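(* Let $n,p$ be positive integers. For $x,y\in\widehat{B}_p$ the polyharmonic Bergman kernel $R_p$ for $\widehat{B}_p$ is given by $$R_p(x,y)=\frac{1}{n\Omega_n}\left( nP_p(x,y)+\frac{d}{dt}P_p(tx,ty)\Big|_{t=1}\right)$$ $$=\frac{(n-4p)|x|^{2p+2}|\overline{y}|^{2p+2}+(8p\,x\overline{y}-n-4p)|x|^{2p}|\overline{y}|^{2p}+n(1-|x|^{2}|\overline{y}|^{2})}{n\Omega_n(1-2x\overline{y}+|x|^2|\overline{y}|^2)^{n/2+1}}.$$
   Context: Notation: for complex vectors $z,w\in\mathbb{C}^n$, $zw=\sum_j z_jw_j$ (bilinear), $\overline{y}$ is the componentwise conjugate, and $|z|=(\sum_j z_j^2)^{1/2}$ is the complex extension of the Euclidean norm (principal square root), so $|x|^{2k}=(\sum_jx_j^2)^k$ and $|\overline{y}|^{2k}=(\sum_j\overline{y_j}^2)^k$. Non-integer powers are principal branches. Sets: $B$ and $S$ are the open unit ball and the unit sphere of $\mathbb{R}^n$ centred at $0$; $\widehat{B}_p=\bigcup_{k=0}^{p-1}e^{k\pi i/p}B$, $\widehat{S}_p=\bigcup_{k=0}^{p-1}e^{k\pi i/p}S$ in $\mathbb{C}^n$. $\Omega_n=\pi^{n/2}/\Gamma(n/2+1)$ is the volume of $B$, and $\sigma$ is the normalized surface measure on $S$. Polyharmonic functions: a complex-valued analytic function $u$ on $B$ is polyharmonic of order $p$ if $\Delta^p u=0$ on $B$; the space of these is $\mathcal{A}_{\Delta^p}(B)$. Each such $u$ has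 an expansion $u=\sum_{m\ge 0} q_m$ into homogeneous polynomials $q_m$ of degree $m$, converging on $B$, and is extended holomorphically to rotated balls by $u(e^{i\psi}x)=\sum_m e^{im\psi}q_m(x)$ ($\psi\in\mathbb{R}$, $x\in B$). In this way $u$ is regarded as a function on $\widehat{B}_p$. Bergman space: $b_p^2(\widehat{B}_p)$ is the space of $u\in\mathcal{A}_{\Delta^p}(B)$ (extended to $\widehat{B}_p$) that are square integrable in the sense that $\langle u,u\rangle_{b_p^2}<\infty$, where $\langle u,v\rangle_{b_p^2}=\frac1p\sum_{k=0}^{p-1}\int_B u(e^{k\pi i/p}y)\overline{v(e^{k\pi i/p}y)}\,dy$. It is a Hilbert space on which point evaluations at points of $\widehat{B}_p$ are bounded. Bergman kernel: $R_p:\widehat{B}_p\times\widehat{B}_p\to\mathbb{C}$ is the unique function such that for every $x\in\widehat{B}_p$ one has $R_p(\cdot,x)\in b_p^2(\widehat{B}_p)$ and $u(x)=\langle u,R_p(\cdot,x)\rangle_{b_p^2}$ for all $u\in b_p^2(\widehat{B}_p)$. Zonal polyharmonics: $\mathcal{H}_m^p(\mathbb{C}^n)$ is the space of polynomials on $\mathbb{C}^n$ homogeneous of degree $m$ and polyharmonic of order $p$, and $\mathcal{H}_m^p(\widehat{S}_p)$ is the space of their restrictions to $\widehat{S}_p$, with inner product $\langle f,g\rangle_{\widehat{S}_p}=\frac1p\int_S\sum_{j=0}^{p-1}f(e^{j\pi i/p}\zeta)\overline{g(e^{j\pi i/p}\zeta)}\,d\sigma(\zeta)$. For $\eta\in\widehat{S}_p$,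 $Z_m^p(\cdot,\eta)$ is the unique element of $\mathcal{H}_m^p(\widehat{S}_p)$ with $q(\eta)=\langle q,Z_m^p(\cdot,\eta)\rangle_{\widehat{S}_p}$ for all $q\in\mathcal{H}_m^p(\widehat{S}_p)$; it is extended to $\widehat{B}_p\times\widehat{B}_p$ by $Z_m^p(r\zeta,s\eta)=r^ms^mZ_m^p(\zeta,\eta)$, $r,s\in[0,1)$, $\zeta,\eta\in\widehat{S}_p$ (with $0^0=1$). The (extended) polyharmonic Poisson kernel is $P_p(x,y)=\sum_{m=0}^\infty Z_m^p(x,y)$ for $x,y\in\widehat{B}_p$; it is known that $P_p(x,y)=\dfrac{1-|x|^{2p}|\overline{y}|^{2p}}{(1-2x\overline{y}+|x|^2|\overline{y}|^2)^{n/2}}$. *)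

theory Defs
  imports "HOL-Analysis.Analysis"
begin

section \<open>Complex vectors and rotated balls\<close>

definition cvec :: "real ^ 'n \<Rightarrow> complex ^ 'n" where
  "cvec x = (\<chi> j. complex_of_real (x $ j))"

definition vcnj :: "complex ^ 'n \<Rightarrow> complex ^ 'n" where
  "vcnj z = (\<chi> j. cnj (z $ j))"

text \<open>The product on \<open>\<complex>\<^sup>n\<close> below is bilinear, not Hermitian; accordingly \<open>cnorm\<close> is the
  complex-valued extension of the Euclidean norm of \<open>\<real>\<^sup>n\<close> and differs from \<^const>\<open>norm\<close>.\<close>

definition bdot :: "complex ^ 'n \<Rightarrow> complex ^ 'n \<Rightarrow> complex" where
  "bdot z w = (\<Sum>j\<in>UNIV. z $ j * w $ j)"

definition cnorm :: "complex ^ 'n \<Rightarrow> complex" where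
  "cnorm z = csqrt (bdot z z)"

definition rot :: "nat \<Rightarrow> nat \<Rightarrow> real ^ 'n \<Rightarrow> complex ^ 'n" where
  "rot p k x = cis (real k * pi / real p) *s cvec x"

definition Bhat :: "nat \<Rightarrow> (complex ^ 'n) set" where
  "Bhat p = (\<Union>k<p. rot p k ` ball 0 1)"

definition Shat :: "nat \<Rightarrow> (complex ^ 'n) set" where
  "Shat p = (\<Union>k<p. rot p k ` sphere 0 1)"

section \<open>Polynomials and polyharmonic functions\<close>

definition monomial :: "('n \<Rightarrow> nat) \<Rightarrow> complex ^ 'n \<Rightarrow> complex" where
  "monomial \<alpha> z = (\<Prod>j\<in>UNIV. z $ j ^ \<alpha> j)"

definition hom_polys :: "nat \<Rightarrow> (complex ^ 'n \<Rightarrow> complex) set" where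
  "hom_polys m = {q. \<exists>c. \<forall>z. q z = (\<Sum>\<alpha> | sum \<alpha> UNIV = m. c \<alpha> * monomial \<alpha> z)}"

definition complex_laplacian :: "(complex ^ 'n \<Rightarrow> complex) \<Rightarrow> complex ^ 'n \<Rightarrow> complex" where
  "complex_laplacian f =
    (let D = (\<lambda>j g z. deriv (\<lambda>t. g (z + t *s axis j 1)) 0)
     in (\<lambda>z. \<Sum>j\<in>UNIV. D j (D j f) z))"

definition real_laplacian :: "(real ^ 'n \<Rightarrow> complex) \<Rightarrow> real ^ 'n \<Rightarrow> complex" where
  "real_laplacian u =
    (let D = (\<lambda>j g x. vector_derivative (\<lambda>t. g (x + t *\<^sub>R axis j 1)) (at 0))
     in (\<lambda>x. \<Sum>j\<in>UNIV. D j (D j u) x))"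

definition real_analytic_on :: "(real ^ 'n \<Rightarrow> complex) \<Rightarrow> (real ^ 'n) set \<Rightarrow> bool" where
  "real_analytic_on u A \<longleftrightarrow> (\<forall>a\<in>A. \<exists>r>0. \<exists>c. \<forall>x\<in>ball a r.
      ((\<lambda>\<alpha>. c \<alpha> * monomial \<alpha> (cvec (x - a))) has_sum u x) UNIV)"

definition polyharmonic_ball :: "nat \<Rightarrow> (real ^ 'n \<Rightarrow> complex) set" where
  "polyharmonic_ball p = {u. real_analytic_on u (ball 0 1) \<and>
      (\<forall>x\<in>ball 0 1. (real_laplacian ^^ p) u x = 0)}"

text \<open>Functions on a subset \<open>A\<close> of \<open>\<complex>\<^sup>n\<close> are represented by members of \<^term>\<open>extensional A\<close>,
  so that equality of representatives is equality on \<open>A\<close>.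

  \<open>polyharmonic_Bhat p\<close> consists of the extensions to \<^term>\<open>Bhat p\<close> of the functions
  \<open>u\<close> in \<^term>\<open>polyharmonic_ball p\<close>. The homogeneous expansion \<open>q\<close> of \<open>u\<close> is determined
  by \<open>u\<close>, since \<open>t \<mapsto> u (t x)\<close> is a power series with coefficients \<open>q m x\<close>.\<close>

definition polyharmonic_Bhat :: "nat \<Rightarrow> (complex ^ 'n \<Rightarrow> complex) set" where
  "polyharmonic_Bhat p = {f \<in> extensional (Bhat p).
      \<exists>u\<in>polyharmonic_ball p. \<exists>q.
        (\<forall>m. q m \<in> hom_polys m) \<and>
        (\<forall>x\<in>ball 0 1. (\<lambda>m. q m (cvec x)) sums u x) \<and>
        (\<forall>\<psi>. \<forall>x\<in>ball 0 1. cis \<psi> *s cvec x \<in> Bhat p \<longrightarrow>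
           (\<lambda>m. cis (real m * \<psi>) * q m (cvec x)) sums f (cis \<psi> *s cvec x))}"

section \<open>The polyharmonic Bergman kernel\<close>

definition bergman_inner ::
    "nat \<Rightarrow> (complex ^ 'n \<Rightarrow> complex) \<Rightarrow> (complex ^ 'n \<Rightarrow> complex) \<Rightarrow> complex" where
  "bergman_inner p u v = 1 / of_nat p *
     (\<Sum>k<p. LINT y:ball 0 1|lborel. u (rot p k y) * cnj (v (rot p k y)))"

text \<open>The Bochner integral of a non-integrable function is \<open>0\<close>, so finiteness of
  \<^term>\<open>bergman_inner p u u\<close> is expressed by integrability.\<close>

definition bergman_space :: "nat \<Rightarrow> (complex ^ 'n \<Rightarrow> complex) set" where
  "bergman_space p = {u \<in> polyharmonic_Bhat p.
      \<forall>k<p. set_integrable lborel (ball 0 1) (\<lambda>y. (cmod (u (rot p k y)))\<^sup>2)}"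

definition bergman_kernel :: "nat \<Rightarrow> complex ^ 'n \<Rightarrow> complex ^ 'n \<Rightarrow> complex" where
  "bergman_kernel p x y =
     (THE f. f \<in> bergman_space p \<and> (\<forall>u\<in>bergman_space p. u y = bergman_inner p u f)) x"

section \<open>Zonal polyharmonics and the Poisson kernel\<close>

text \<open>Normalized surface measure on the unit sphere: by polar coordinates, the measure of a
  Borel set \<open>A\<close> of unit vectors is the proportion of the unit ball lying on rays through \<open>A\<close>.\<close>

definition sphere_measure :: "(real ^ 'n) measure" where
  "sphere_measure = distr (uniform_measure lborel (ball 0 1)) borel sgn"

definition polyharmonic_polys :: "nat \<Rightarrow> nat \<Rightarrow> (complex ^ 'n \<Rightarrow> complex) set" where
  "polyharmonic_polys p m = {q \<in> hom_polys m. \<forall>z. (complex_laplacian ^^ p) q z = 0}"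

definition polyharmonic_Shat :: "nat \<Rightarrow> nat \<Rightarrow> (complex ^ 'n \<Rightarrow> complex) set" where
  "polyharmonic_Shat p m = (\<lambda>q. restrict q (Shat p)) ` polyharmonic_polys p m"

definition sphere_inner ::
    "nat \<Rightarrow> (complex ^ 'n \<Rightarrow> complex) \<Rightarrow> (complex ^ 'n \<Rightarrow> complex) \<Rightarrow> complex" where
  "sphere_inner p f g = 1 / of_nat p *
     (LINT \<zeta>:sphere 0 1|sphere_measure. \<Sum>j<p. f (rot p j \<zeta>) * cnj (g (rot p j \<zeta>)))"

definition zonal_sphere :: "nat \<Rightarrow> nat \<Rightarrow> complex ^ 'n \<Rightarrow> complex ^ 'n \<Rightarrow> complex" where
  "zonal_sphere p m \<zeta> \<eta> =
     (THE f. f \<in> polyharmonic_Shat p m \<and>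
        (\<forall>q\<in>polyharmonic_Shat p m. q \<eta> = sphere_inner p q f)) \<zeta>"

text \<open>A nonzero point of \<^term>\<open>Bhat p\<close> has only one polar form \<open>r \<zeta>\<close>. For the origin \<open>\<zeta>\<close>
  is arbitrary, but the value does not depend on it: it is \<open>0\<close> if \<open>m > 0\<close>, and
  \<open>zonal_sphere p 0\<close> is constant.\<close>

definition zonal :: "nat \<Rightarrow> nat \<Rightarrow> complex ^ 'n \<Rightarrow> complex ^ 'n \<Rightarrow> complex" where
  "zonal p m x y = (THE w. \<exists>r\<in>{0..<1}. \<exists>s\<in>{0..<1}. \<exists>\<zeta>\<in>Shat p. \<exists>\<eta>\<in>Shat p.
      x = r *\<^sub>R \<zeta> \<and> y = s *\<^sub>R \<eta> \<and>
      w = complex_of_real (r ^ m * s ^ m) * zonal_sphere p m \<zeta> \<eta>)"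

definition poisson :: "nat \<Rightarrow> complex ^ 'n \<Rightarrow> complex ^ 'n \<Rightarrow> complex" where
  "poisson p x y = (\<Sum>m. zonal p m x y)"

end

theory Submission
  imports Defs "HOL-Complex_Analysis.Complex_Analysis"
begin

text \<open>
  Write \<open>w\<close> for the conjugate of \<open>y\<close>, \<open>X = |x|\<^sup>2|w|\<^sup>2\<close> and \<open>\<Omega>\<close> for the volume of the
  unit ball of \<open>\<real>\<^sup>n\<close>. The proof rests on the expansion
  \<open>R\<^sub>p(x,y) = \<Sum>\<^sub>m (n + 2m)/(n\<Omega>) Z\<^sub>m(x,w)\<close>, where \<open>Z\<^sub>m\<close> is the zonal polyharmonic of degree \<open>m\<close>,
  an explicit polynomial in both arguments (\<open>zonal_poly\<close>).

  The weight \<open>(n + 2m)/(n\<Omega>)\<close> has a simple origin. By homogeneity the integral over the ball of a product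
  of two polynomials of degree \<open>m\<close> is \<open>n\<Omega>/(n + 2m)\<close> times its mean over the sphere
  (\<open>ball_int_hom_polys\<close>), and \<open>Z\<^sub>m\<close> reproduces polyharmonic polynomials of degree \<open>m\<close> on the
  sphere (\<open>sphere_mean_polyharmonic_zonal_poly\<close>). Pieces of different degree \<open>m\<close>, \<open>m'\<close> do not
  interact: by Almansi's decomposition into harmonic polynomials of distinct degrees they are
  orthogonal on the sphere unless \<open>m - m' = 2d\<close> with \<open>|d| < p\<close>, and in that case the average over the
  \<open>p\<close> rotations is a vanishing sum of powers of a root of unity (\<open>sum_rotations\<close>).

  Both formulas of the theorem are read off from the generating function
  \<open>\<Sum>\<^sub>m Z\<^sub>m(x,w) \<tau>\<^sup>m = (1 - (X\<tau>\<^sup>2)\<^sup>p) (1 - 2xw\<tau> + X\<tau>\<^sup>2) powr (-n/2)\<close>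
  (\<open>zonal_poly_sums\<close>). At \<open>\<tau> = 1\<close> it is the Poisson kernel; since \<open>Z\<^sub>m(tx,tw) = t\<^sup>2\<^sup>m Z\<^sub>m(x,w)\<close>, the
  weight \<open>n + 2m\<close> amounts to adding the derivative in \<open>t\<close> to \<open>n\<close> times the function; and carrying
  out that derivative gives the closed form (\<open>deriv_zonal_gf\<close>).

  Two points need analysis. First, the closed form must belong to the Bergman space. It is real
  analytic because it is built from quadratic polynomials and a power that stays off the cut
  (\<open>kern_closed_real_analytic\<close>), and it is polyharmonic because its homogeneous components are
  (\<open>polyharmonic_expansion_iff\<close>). Secondly, the orthogonality argument integrates the expansion
  \<open>u = \<Sum>\<^sub>m q\<^sub>m\<close> of an arbitrary member of the space term by term, whereas that expansion is only known
  to converge pointwise. The lemma \<open>q_summable_majorant\<close> supplies a uniform majorant on every smaller ball.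
  It bounds the Almansi components of \<open>q\<^sub>m\<close> by integrals of \<open>u\<close> against zonal harmonics over finitely
  many dilated balls; these integrals are polynomials in the dilation factor
  (\<open>ball_int_u_zonal_harmonic\<close>), so their coefficients can be recovered from finitely many values.
\<close>

section \<open>Homogeneous polynomials and their Laplacian\<close>

text \<open>This is the operator iterated in \<^const>\<open>complex_laplacian\<close>.\<close>

definition pd :: "'n::finite \<Rightarrow> (complex ^ 'n \<Rightarrow> complex) \<Rightarrow> complex ^ 'n \<Rightarrow> complex" where
  "pd j f z = deriv (\<lambda>t. f (z + t *s axis j 1)) 0"

lemma complex_laplacian_eq: "complex_laplacian f = (\<lambda>z. \<Sum>j\<in>UNIV. pd j (pd j f) z)"
  by (simp add: complex_laplacian_def pd_def Let_def)

definition pdiff :: "(complex ^ 'n::finite \<Rightarrow> complex) \<Rightarrow> bool" where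
  "pdiff f \<longleftrightarrow> (\<forall>j z. (\<lambda>t. f (z + t *s axis j 1)) field_differentiable at 0)"

lemma has_pd: "pdiff f \<Longrightarrow> ((\<lambda>t. f (z + t *s axis j 1)) has_field_derivative pd j f z) (at 0)"
  by (simp add: pdiff_def pd_def field_differentiable_derivI)

lemma pdI:
  assumes "\<And>j z. ((\<lambda>t. f (z + t *s axis j 1)) has_field_derivative f' j z) (at 0)"
  shows "pdiff f" "pd j f = f' j"
  using assms by (auto simp: pdiff_def pd_def fun_eq_iff DERIV_imp_deriv field_differentiable_def)

lemma
  assumes f: "pdiff f" and g: "pdiff g"
  shows pdiff_add: "pdiff (\<lambda>z. f z + g z)" and pd_add: "pd j (\<lambda>z. f z + g z) = (\<lambda>z. pd j f z + pd j g z)"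
   and pdiff_mult: "pdiff (\<lambda>z. f z * g z)" and pd_mult: "pd j (\<lambda>z. f z * g z) = (\<lambda>z. pd j f z * g z + f z * pd j g z)"
proof -
  have 1: "((\<lambda>t. f (z + t *s axis j 1) + g (z + t *s axis j 1)) has_field_derivative pd j f z + pd j g z) (at 0)" for z j
    by (intro derivative_intros has_pd f g)
  show "pdiff (\<lambda>z. f z + g z)" "pd j (\<lambda>z. f z + g z) = (\<lambda>z. pd j f z + pd j g z)"
    using pdI[OF 1] by blast+
  have 2: "((\<lambda>t. f (z + t *s axis j 1) * g (z + t *s axis j 1)) has_field_derivative pd j f z * g z + f z * pd j g z) (at 0)" for z j
    using DERIV_mult[OF has_pd[OF f, of z j] has_pd[OF g, of z j]] by (simp add: mult.commute add.commute)
  show "pdiff (\<lambda>z. f z * g z)" "pd j (\<lambda>z. f z * g z) = (\<lambda>z. pd j f z * g z + f z * pd j g z)"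
    using pdI[OF 2] by blast+
qed

lemma pdiff_const: "pdiff (\<lambda>z. c)" and pd_const: "pd j (\<lambda>z. c) = (\<lambda>z. 0)"
proof -
  have "((\<lambda>t. c) has_field_derivative 0) (at 0)" by simp
  from pdI[of "\<lambda>z. c" "\<lambda>j z. 0"] show "pdiff (\<lambda>z. c)" "pd j (\<lambda>z. c) = (\<lambda>z. 0)" by auto
qed

lemma pd_cmult: "pdiff f \<Longrightarrow> pd j (\<lambda>z. c * f z) = (\<lambda>z. c * pd j f z)"
  using pd_mult[OF pdiff_const, of f j c] by (simp add: pd_const)

lemma pdiff_cmult: "pdiff f \<Longrightarrow> pdiff (\<lambda>z. c * f z)"
  using pdiff_mult[OF pdiff_const] by auto

lemma
  assumes "finite S" "\<And>i. i \<in> S \<Longrightarrow> pdiff (f i)"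
  shows pdiff_sum: "pdiff (\<lambda>z. \<Sum>i\<in>S. f i z)" and pd_sum: "pd j (\<lambda>z. \<Sum>i\<in>S. f i z) = (\<lambda>z. \<Sum>i\<in>S. pd j (f i) z)"
  using assms by (induction S rule: finite_induct) (auto simp: pdiff_const pd_const pdiff_add pd_add)

lemma monomial_line:
  "monomial \<alpha> (z + t *s axis j 1) = (z $ j + t) ^ \<alpha> j * (\<Prod>i\<in>UNIV - {j}. z $ i ^ \<alpha> i)"
proof -
  have "monomial \<alpha> (z + t *s axis j 1) = ((z + t *s axis j 1) $ j) ^ \<alpha> j * (\<Prod>i\<in>UNIV-{j}. ((z + t *s axis j 1) $ i) ^ \<alpha> i)"
    unfolding monomial_def by (rule prod.remove) auto
  also have "(\<Prod>i\<in>UNIV-{j}. ((z + t *s axis j 1) $ i) ^ \<alpha> i) = (\<Prod>i\<in>UNIV - {j}. z $ i ^ \<alpha> i)"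
    by (intro prod.cong refl) (auto simp: axis_def)
  finally show ?thesis by (simp add: axis_def)
qed

lemma monomial_split: "monomial \<alpha> z = z $ j ^ \<alpha> j * (\<Prod>i\<in>UNIV - {j}. z $ i ^ \<alpha> i)"
  using monomial_line[of \<alpha> z 0 j] by simp

lemma pdiff_monomial: "pdiff (monomial \<alpha>)"
  and pd_monomial: "pd j (monomial \<alpha>) = (\<lambda>z. of_nat (\<alpha> j) * monomial (\<alpha>(j := \<alpha> j - 1)) z)"
proof -
  have 1: "((\<lambda>t. monomial \<alpha> (z + t *s axis j 1)) has_field_derivative of_nat (\<alpha> j) * monomial (\<alpha>(j := \<alpha> j - 1)) z) (at 0)" for j z
  proof -
    have "(\<Prod>i\<in>UNIV - {j}. z $ i ^ (\<alpha>(j := \<alpha> j - 1)) i) = (\<Prod>i\<in>UNIV - {j}. z $ i ^ \<alpha> i)"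
      by (intro prod.cong) auto
    moreover have "((\<lambda>t. (z $ j + t) ^ \<alpha> j * C) has_field_derivative of_nat (\<alpha> j) * (z $ j ^ (\<alpha> j - 1) * C)) (at 0)" for C
      by (auto intro!: derivative_eq_intros)
    ultimately show ?thesis unfolding monomial_line monomial_split[of _ z j] by simp
  qed
  show "pdiff (monomial \<alpha>)" "pd j (monomial \<alpha>) = (\<lambda>z. of_nat (\<alpha> j) * monomial (\<alpha>(j := \<alpha> j - 1)) z)"
    using pdI[OF 1] by blast+
qed

lemma finite_multi_index: "finite {\<alpha> :: 'n::finite \<Rightarrow> nat. sum \<alpha> UNIV = m}"
proof -
  have "{\<alpha> :: 'n \<Rightarrow> nat. sum \<alpha> UNIV = m} \<subseteq> Pi\<^sub>E UNIV (\<lambda>_. {..m})"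
    by (auto simp: PiE_def intro: member_le_sum)
  then show ?thesis
    by (rule finite_subset) (intro finite_PiE, auto)
qed

lemma hom_polys_zero: "(\<lambda>z. 0) \<in> hom_polys m"
  unfolding hom_polys_def by (intro CollectI exI[of _ "\<lambda>_. 0"]) simp

lemma hom_polys_add:
  assumes "f \<in> hom_polys m" "g \<in> hom_polys m" shows "(\<lambda>z. f z + g z) \<in> hom_polys m"
proof -
  from assms obtain c d where "\<And>z. f z = (\<Sum>\<alpha> | sum \<alpha> UNIV = m. c \<alpha> * monomial \<alpha> z)"
    "\<And>z. g z = (\<Sum>\<alpha> | sum \<alpha> UNIV = m. d \<alpha> * monomial \<alpha> z)" unfolding hom_polys_def by auto
  then show ?thesis unfolding hom_polys_def
    by (intro CollectI exI[of _ "\<lambda>\<alpha>. c \<alpha> + d \<alpha>"]) (simp add: sum.distrib algebra_simps)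
qed

lemma hom_polys_cmult:
  assumes "f \<in> hom_polys m" shows "(\<lambda>z. a * f z) \<in> hom_polys m"
proof -
  from assms obtain c where "\<And>z. f z = (\<Sum>\<alpha> | sum \<alpha> UNIV = m. c \<alpha> * monomial \<alpha> z)"
    unfolding hom_polys_def by auto
  then show ?thesis unfolding hom_polys_def
    by (intro CollectI exI[of _ "\<lambda>\<alpha>. a * c \<alpha>"]) (simp add: sum_distrib_left algebra_simps)
qed

lemma hom_polys_monomial: "sum \<alpha> UNIV = m \<Longrightarrow> monomial \<alpha> \<in> hom_polys m"
proof -
  assume m: "sum \<alpha> UNIV = m"
  have "(\<Sum>\<beta> | sum \<beta> UNIV = m. (if \<beta> = \<alpha> then 1 else 0) * monomial \<beta> z) =
      (\<Sum>\<beta> | sum \<beta> UNIV = m. if \<beta> = \<alpha> then monomial \<beta> z else 0)" for z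
    by (intro sum.cong) auto
  then have "(\<Sum>\<beta> | sum \<beta> UNIV = m. (if \<beta> = \<alpha> then 1 else 0) * monomial \<beta> z) = monomial \<alpha> z" for z
    using m by (simp add: sum.delta finite_multi_index)
  then show ?thesis unfolding hom_polys_def by (intro CollectI exI[of _ "\<lambda>\<beta>. if \<beta> = \<alpha> then 1 else 0"]) auto
qed

lemma hom_polys_sum:
  "(\<And>i. i \<in> S \<Longrightarrow> f i \<in> hom_polys m) \<Longrightarrow> (\<lambda>z. \<Sum>i\<in>S. f i z) \<in> hom_polys m"
  by (induction S rule: infinite_finite_induct) (auto simp: hom_polys_zero hom_polys_add)

text \<open>Statements that are linear in the polynomial reduce to monomials by this rule.\<close>

lemma hom_polys_induct [consumes 1, case_names zero monomial add]:
  assumes "q \<in> hom_polys m" and z: "P (\<lambda>z. 0)"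
    and m: "\<And>c \<alpha>. sum \<alpha> UNIV = m \<Longrightarrow> P (\<lambda>z. c * monomial \<alpha> z)"
    and a: "\<And>f g. f \<in> hom_polys m \<Longrightarrow> g \<in> hom_polys m \<Longrightarrow> P f \<Longrightarrow> P g \<Longrightarrow> P (\<lambda>z. f z + g z)"
  shows "P q"
proof -
  obtain c where c: "\<And>z. q z = (\<Sum>\<alpha> | sum \<alpha> UNIV = m. c \<alpha> * monomial \<alpha> z)"
    using assms(1) unfolding hom_polys_def by auto
  have "P (\<lambda>z. \<Sum>\<alpha>\<in>S. c \<alpha> * monomial \<alpha> z)" if "finite S" "S \<subseteq> {\<alpha>. sum \<alpha> UNIV = m}" for S
    using that
  proof (induction S rule: finite_induct)
    case empty then show ?case using z by simp
  next
    case (insert x F)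
    then show ?case
      using a[of "\<lambda>z. c x * monomial x z" "\<lambda>z. \<Sum>\<alpha>\<in>F. c \<alpha> * monomial \<alpha> z"]
        m[of x "c x"] hom_polys_sum[of F "\<lambda>\<alpha> z. c \<alpha> * monomial \<alpha> z" m]
      by (auto intro!: hom_polys_cmult hom_polys_monomial)
  qed
  from this[OF finite_multi_index order.refl] have "P (\<lambda>z. \<Sum>\<alpha> | sum \<alpha> UNIV = m. c \<alpha> * monomial \<alpha> z)" .
  moreover have "q = (\<lambda>z. \<Sum>\<alpha> | sum \<alpha> UNIV = m. c \<alpha> * monomial \<alpha> z)" using c by (intro ext)
  ultimately show ?thesis by simp
qed

lemma hom_polys_mult:
  assumes f: "f \<in> hom_polys k" and g: "g \<in> hom_polys m" shows "(\<lambda>z. f z * g z) \<in> hom_polys (k + m)"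
  using f
proof (induction rule: hom_polys_induct)
  case zero then show ?case by (simp add: hom_polys_zero)
next
  case (monomial c \<alpha>)
  show ?case using g
  proof (induction rule: hom_polys_induct)
    case zero then show ?case by (simp add: hom_polys_zero)
  next
    case (monomial d \<beta>)
    have "(\<lambda>z. c * monomial \<alpha> z * (d * monomial \<beta> z)) = (\<lambda>z. (c * d) * monomial (\<lambda>i. \<alpha> i + \<beta> i) z)"
      by (simp add: monomial_def power_add prod.distrib mult_ac)
    moreover have "(\<lambda>z. (c * d) * monomial (\<lambda>i. \<alpha> i + \<beta> i) z) \<in> hom_polys (k + m)"
      by (intro hom_polys_cmult hom_polys_monomial) (simp add: sum.distrib monomial \<open>sum \<alpha> UNIV = k\<close>)
    ultimately show ?case by simp
  next
    case (add f g)
    then show ?case using hom_polys_add by (fastforce simp: algebra_simps)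
  qed
next
  case (add f g)
  then show ?case using hom_polys_add by (fastforce simp: algebra_simps)
qed

lemma hom_polys_const: "(\<lambda>z. c) \<in> hom_polys 0"
proof -
  have "(\<lambda>z. c * monomial (\<lambda>_. 0) z) \<in> hom_polys 0"
    by (intro hom_polys_cmult hom_polys_monomial) simp
  then show ?thesis by (simp add: monomial_def)
qed

lemma hom_polys_coord: "(\<lambda>z. z $ j) \<in> hom_polys (Suc 0)"
proof -
  have "monomial (\<lambda>i. if i = j then 1 else 0) = (\<lambda>z. z $ j)"
    by (rule ext, subst monomial_split[of _ _ j]) simp
  moreover have "monomial (\<lambda>i. if i = j then 1 else 0) \<in> hom_polys (Suc 0)"
    by (intro hom_polys_monomial) simp
  ultimately show ?thesis by simp
qed

lemma hom_polys_power: "f \<in> hom_polys m \<Longrightarrow> (\<lambda>z. f z ^ k) \<in> hom_polys (k * m)"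
  by (induction k) (auto simp: hom_polys_const intro: hom_polys_mult)

lemma hom_polys_bdot: "(\<lambda>z. bdot z w) \<in> hom_polys (Suc 0)"
  unfolding bdot_def by (intro hom_polys_sum) (subst mult.commute, intro hom_polys_cmult hom_polys_coord)

lemma hom_polys_bdot_self: "(\<lambda>z. bdot z z) \<in> hom_polys 2"
  unfolding bdot_def using hom_polys_mult[OF hom_polys_coord hom_polys_coord]
  by (intro hom_polys_sum) (simp add: numeral_2_eq_2)

lemma pdiff_hom_polys: "q \<in> hom_polys m \<Longrightarrow> pdiff q"
  by (induction rule: hom_polys_induct) (auto simp: pdiff_const pdiff_add pdiff_cmult pdiff_monomial)

lemma sum_update_dec:
  fixes \<alpha> :: "'n::finite \<Rightarrow> nat"
  assumes "\<alpha> j \<noteq> 0" shows "sum (\<alpha>(j := \<alpha> j - 1)) UNIV = sum \<alpha> UNIV - 1"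
proof -
  have "sum \<alpha> UNIV = \<alpha> j + sum \<alpha> (UNIV - {j})" by (rule sum.remove) auto
  moreover have "sum (\<alpha>(j := \<alpha> j - 1)) UNIV = (\<alpha> j - 1) + sum (\<alpha>(j := \<alpha> j - 1)) (UNIV - {j})"
    by (subst sum.remove[of _ j]) auto
  moreover have "sum (\<alpha>(j := \<alpha> j - 1)) (UNIV - {j}) = sum \<alpha> (UNIV - {j})"
    by (intro sum.cong) auto
  ultimately show ?thesis using assms by simp
qed

lemma pd_hom_polys: "q \<in> hom_polys m \<Longrightarrow> pd j q \<in> hom_polys (m - 1)"
proof (induction rule: hom_polys_induct)
  case (monomial c \<alpha>)
  show ?case
  proof (cases "\<alpha> j = 0")
    case True then show ?thesis
      by (simp add: pd_cmult pd_monomial pdiff_monomial hom_polys_zero)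
  next
    case False
    show ?thesis unfolding pd_cmult[OF pdiff_monomial] pd_monomial
      using sum_update_dec[of \<alpha> j] False monomial by (intro hom_polys_cmult hom_polys_monomial) simp
  qed
qed (auto simp: pd_const hom_polys_zero pd_add pdiff_hom_polys hom_polys_add)

lemma pd_hom_polys_0: "q \<in> hom_polys 0 \<Longrightarrow> pd j q = (\<lambda>z. 0)"
  by (induction rule: hom_polys_induct)
     (auto simp: pd_const pd_add pdiff_hom_polys pd_cmult pd_monomial pdiff_monomial)

lemma hom_polys_scale: "q \<in> hom_polys m \<Longrightarrow> q (c *s z) = c ^ m * q z"
proof (induction rule: hom_polys_induct)
  case (monomial d \<alpha>)
  have "monomial \<alpha> (c *s z) = c ^ m * monomial \<alpha> z"
    unfolding monomial_def by (simp add: power_mult_distrib prod.distrib power_sum[symmetric] monomial)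
  then show ?case by simp
qed (auto simp: algebra_simps)

lemma hom_polys_Euler: "q \<in> hom_polys m \<Longrightarrow> (\<Sum>j\<in>UNIV. z $ j * pd j q z) = of_nat m * q z"
proof (induction rule: hom_polys_induct)
  case (monomial c \<alpha>)
  have "z $ j * (of_nat (\<alpha> j) * monomial (\<alpha>(j := \<alpha> j - 1)) z) = of_nat (\<alpha> j) * monomial \<alpha> z" for j
  proof (cases "\<alpha> j = 0")
    case False
    have "(\<Prod>i\<in>UNIV - {j}. z $ i ^ (\<alpha>(j := \<alpha> j - 1)) i) = (\<Prod>i\<in>UNIV - {j}. z $ i ^ \<alpha> i)"
      by (intro prod.cong) auto
    then show ?thesis unfolding monomial_split[of _ _ j] using False
      by (auto simp: power_eq_if)
  qed simp
  then have "z $ j * pd j (\<lambda>z. c * monomial \<alpha> z) z = of_nat (\<alpha> j) * (c * monomial \<alpha> z)" for j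
    unfolding pd_cmult[OF pdiff_monomial] pd_monomial by (simp add: algebra_simps)
  then show ?case by (simp add: sum_distrib_right[symmetric] of_nat_sum[symmetric] monomial del: of_nat_sum)
qed (auto simp: algebra_simps pd_const pd_add pdiff_hom_polys sum.distrib)

lemma pd_commute: "q \<in> hom_polys m \<Longrightarrow> pd i (pd j q) = pd j (pd i q)"
proof (induction rule: hom_polys_induct)
  case (monomial c \<alpha>)
  show ?case
    by (cases "i = j") (auto simp: pd_cmult pd_monomial pdiff_monomial pdiff_cmult fun_upd_twist algebra_simps)
qed (auto simp: pd_const pd_add pdiff_hom_polys[OF pd_hom_polys] pdiff_hom_polys)

abbreviation "lap \<equiv> complex_laplacian"

lemma lap_add: "f \<in> hom_polys m \<Longrightarrow> g \<in> hom_polys k \<Longrightarrow> lap (\<lambda>z. f z + g z) = (\<lambda>z. lap f z + lap g z)"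
  unfolding complex_laplacian_eq by (simp add: pd_add pdiff_hom_polys pdiff_hom_polys[OF pd_hom_polys] sum.distrib)

lemma lap_cmult: "f \<in> hom_polys m \<Longrightarrow> lap (\<lambda>z. c * f z) = (\<lambda>z. c * lap f z)"
  unfolding complex_laplacian_eq by (simp add: pd_cmult pdiff_hom_polys pdiff_hom_polys[OF pd_hom_polys] sum_distrib_left)

lemma lap_const: "lap (\<lambda>z. c) = (\<lambda>z. 0)"
  unfolding complex_laplacian_eq by (simp add: pd_const)

lemma lap_hom_polys: "f \<in> hom_polys m \<Longrightarrow> lap f \<in> hom_polys (m - 2)"
  unfolding complex_laplacian_eq using pd_hom_polys[OF pd_hom_polys]
  by (intro hom_polys_sum) (simp add: numeral_2_eq_2)

lemma lap_hom_polys_low: "f \<in> hom_polys m \<Longrightarrow> m < 2 \<Longrightarrow> lap f = (\<lambda>z. 0)"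
proof -
  assume f: "f \<in> hom_polys m" "m < 2"
  then have "pd j f \<in> hom_polys 0" for j using pd_hom_polys[of f m j] by (cases m) auto
  then show ?thesis unfolding complex_laplacian_eq by (simp add: pd_hom_polys_0)
qed

lemma lap_sum: "finite S \<Longrightarrow> (\<And>i. i \<in> S \<Longrightarrow> f i \<in> hom_polys m) \<Longrightarrow>
    lap (\<lambda>z. \<Sum>i\<in>S. f i z) = (\<lambda>z. \<Sum>i\<in>S. lap (f i) z)"
proof (induction S rule: finite_induct)
  case (insert x F)
  have "lap (\<lambda>z. f x z + (\<Sum>i\<in>F. f i z)) = (\<lambda>z. lap (f x) z + lap (\<lambda>z. \<Sum>i\<in>F. f i z) z)"
    using insert by (intro lap_add hom_polys_sum) auto
  then show ?case using insert by simp
qed (simp add: lap_const)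

lemma lap_mult:
  assumes f: "f \<in> hom_polys m" and g: "g \<in> hom_polys k"
  shows "lap (\<lambda>z. f z * g z) = (\<lambda>z. lap f z * g z + 2 * (\<Sum>j\<in>UNIV. pd j f z * pd j g z) + f z * lap g z)"
proof -
  note [simp] = pdiff_hom_polys[OF f] pdiff_hom_polys[OF g] pdiff_hom_polys[OF pd_hom_polys[OF f]] pdiff_hom_polys[OF pd_hom_polys[OF g]]
  have "pd j (pd j (\<lambda>z. f z * g z)) = (\<lambda>z. pd j (pd j f) z * g z + 2 * (pd j f z * pd j g z) + f z * pd j (pd j g) z)" for j
    by (simp add: pd_mult pd_add pdiff_mult pdiff_add algebra_simps)
  then show ?thesis unfolding complex_laplacian_eq
    by (simp add: sum.distrib sum_distrib_left sum_distrib_right algebra_simps)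
qed

lemma pd_lap: "f \<in> hom_polys m \<Longrightarrow> lap (pd j f) = pd j (lap f)"
proof -
  assume f: "f \<in> hom_polys m"
  have "pd i (pd i (pd j f)) = pd j (pd i (pd i f))" for i
    using pd_commute[OF f, of i j] pd_commute[OF pd_hom_polys[OF f], of i j] by simp
  then show ?thesis unfolding complex_laplacian_eq
    by (subst pd_sum) (auto intro: pdiff_hom_polys[OF pd_hom_polys[OF pd_hom_polys[OF f]]])
qed

section \<open>Harmonic polynomials and Almansi's decomposition\<close>

lemma bdot_comm: "bdot z w = bdot w z"
  by (simp add: bdot_def mult.commute)

lemma pd_coord: "pd j (\<lambda>z. z $ i) = (\<lambda>z. if i = j then 1 else 0)"
proof -
  have "((\<lambda>t. (z + t *s axis j 1) $ i) has_field_derivative (if i = j then 1 else 0)) (at 0)" for z and j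
    by (auto simp: axis_def intro!: derivative_eq_intros)
  then show ?thesis using pdI(2)[of "\<lambda>z. z $ i" "\<lambda>j z. if i = j then 1 else 0"] by blast
qed

lemmas pdiff_coord = pdiff_hom_polys[OF hom_polys_coord]

lemma pd_bdot: "pd j (\<lambda>z. bdot z w) = (\<lambda>z. w $ j)"
proof -
  have "pd j (\<lambda>z. \<Sum>i\<in>UNIV. w $ i * z $ i) = (\<lambda>z. \<Sum>i\<in>UNIV. w $ i * (if i = j then 1 else 0))"
    by (subst pd_sum) (auto simp: pdiff_cmult pdiff_coord pd_cmult pd_coord)
  then show ?thesis by (simp add: bdot_def mult.commute if_distrib cong: if_cong)
qed

lemma pd_bdot_self: "pd j (\<lambda>z. bdot z z) = (\<lambda>z. 2 * z $ j)"
proof -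
  have "pd j (\<lambda>z. \<Sum>i\<in>UNIV. z $ i * z $ i) = (\<lambda>z. \<Sum>i\<in>UNIV. 2 * ((if i = j then 1 else 0) * z $ i))"
    by (subst pd_sum) (auto simp: pdiff_mult pdiff_coord pd_mult pd_coord mult.commute)
  moreover have "(\<Sum>i\<in>UNIV. 2 * ((if i = j then 1 else 0) * z $ i)) = (\<Sum>i\<in>UNIV. if i = j then 2 * z $ i else 0)" for z :: "complex ^ 'a"
    by (intro sum.cong) auto
  ultimately show ?thesis by (simp add: bdot_def)
qed

lemma lap_bdot_self: "lap (\<lambda>z::complex^'n. bdot z z) = (\<lambda>z. 2 * of_nat CARD('n::finite))"
  unfolding complex_laplacian_eq pd_bdot_self pd_cmult[OF pdiff_coord] pd_coord by (simp add: mult.commute)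

text \<open>The product rule and Euler's identity give
  \<open>\<Delta>(|z|\<^sup>2 f) = (2n + 4 deg f) f + |z|\<^sup>2 \<Delta>f\<close>; the general power follows by induction.\<close>

lemma lap_bdot_power_mult:
  fixes g :: "complex ^ 'n \<Rightarrow> complex"
  assumes g: "g \<in> hom_polys d"
  shows "lap (\<lambda>z. bdot z z ^ b * g z) =
     (\<lambda>z. 2 * of_nat b * (2 * of_nat b + of_nat CARD('n) + 2 * of_nat d - 2) * bdot z z ^ (b - 1) * g z + bdot z z ^ b * lap g z)"
proof (induction b)
  case 0 show ?case by simp
next
  case (Suc b)
  define f where "f = (\<lambda>z. bdot z z ^ b * g z)"
  have f: "f \<in> hom_polys (b * 2 + d)" unfolding f_def
    by (intro hom_polys_mult hom_polys_power hom_polys_bdot_self g)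
  have E: "(\<Sum>j\<in>UNIV. 2 * z $ j * pd j f z) = 2 * (of_nat (b * 2 + d) * f z)" for z
    using hom_polys_Euler[OF f, of z] by (simp add: sum_distrib_left[symmetric] mult.assoc)
  have "lap (\<lambda>z. bdot z z * f z) = (\<lambda>z. (2 * of_nat CARD('n) + 4 * of_nat (b * 2 + d)) * f z + bdot z z * lap f z)"
    unfolding lap_mult[OF hom_polys_bdot_self f] lap_bdot_self pd_bdot_self E by (simp add: algebra_simps)
  also have "lap f = (\<lambda>z. 2 * of_nat b * (2 * of_nat b + of_nat CARD('n) + 2 * of_nat d - 2) * bdot z z ^ (b - 1) * g z + bdot z z ^ b * lap g z)"
    unfolding f_def by (rule Suc)
  finally have 1: "lap (\<lambda>z. bdot z z * f z) = (\<lambda>z. (2 * of_nat CARD('n) + 4 * of_nat (b * 2 + d)) * f z + bdot z z *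
    (2 * of_nat b * (2 * of_nat b + of_nat CARD('n) + 2 * of_nat d - 2) * bdot z z ^ (b - 1) * g z + bdot z z ^ b * lap g z))" .
  have bb: "bdot z z * (of_nat b * bdot z z ^ (b - 1)) = of_nat b * bdot z z ^ b" for z :: "complex ^ 'n"
    by (cases b) auto
  then have 2: "bdot z z * (2 * of_nat b * C * bdot z z ^ (b - 1) * g z + bdot z z ^ b * lap g z) =
    2 * C * g z * (of_nat b * bdot z z ^ b) + bdot z z * bdot z z ^ b * lap g z" for z C
  proof -
    have "bdot z z * (2 * of_nat b * C * bdot z z ^ (b - 1) * g z + bdot z z ^ b * lap g z) =
      2 * C * g z * (bdot z z * (of_nat b * bdot z z ^ (b - 1))) + bdot z z * bdot z z ^ b * lap g z"
      by (simp only: algebra_simps)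
    then show ?thesis unfolding bb by simp
  qed
  show ?case using 1 unfolding 2 unfolding f_def by (simp add: algebra_simps)
qed

definition harmonic_polys :: "nat \<Rightarrow> (complex ^ 'n \<Rightarrow> complex) set" where
  "harmonic_polys m = {h \<in> hom_polys m. lap h = (\<lambda>z. 0)}"

lemma harmonic_polys_zero: "(\<lambda>z. 0) \<in> harmonic_polys m"
  by (simp add: harmonic_polys_def hom_polys_zero lap_const)

lemma harmonic_polys_add: "f \<in> harmonic_polys m \<Longrightarrow> g \<in> harmonic_polys m \<Longrightarrow> (\<lambda>z. f z + g z) \<in> harmonic_polys m"
  by (auto simp: harmonic_polys_def hom_polys_add lap_add)

lemma harmonic_polys_cmult: "f \<in> harmonic_polys m \<Longrightarrow> (\<lambda>z. c * f z) \<in> harmonic_polys m"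
  by (auto simp: harmonic_polys_def hom_polys_cmult lap_cmult)

lemma lap_iter_cmult: "f \<in> hom_polys m \<Longrightarrow> (lap ^^ p) (\<lambda>z. c * f z) = (\<lambda>z. c * (lap ^^ p) f z)"
proof (induction p arbitrary: f m)
  case (Suc p)
  then show ?case using lap_hom_polys[of f m]
    unfolding funpow_Suc_right comp_def by (simp add: lap_cmult)
qed auto

lemma lap_iter_add: "f \<in> hom_polys m \<Longrightarrow> g \<in> hom_polys m \<Longrightarrow>
    (lap ^^ p) (\<lambda>z. f z + g z) = (\<lambda>z. (lap ^^ p) f z + (lap ^^ p) g z)"
proof (induction p arbitrary: f g m)
  case (Suc p)
  then show ?case using Suc.IH[OF lap_hom_polys[OF Suc.prems(1)] lap_hom_polys[OF Suc.prems(2)]]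
    unfolding funpow_Suc_right comp_def by (simp add: lap_add)
qed auto

lemma lap_iter_zero: "(lap ^^ p) (\<lambda>z. 0) = (\<lambda>z. 0)"
  by (induction p) (auto simp: lap_const)

lemma lap_iter_hom_polys: "f \<in> hom_polys m \<Longrightarrow> (lap ^^ p) f \<in> hom_polys (m - 2 * p)"
proof (induction p arbitrary: f m)
  case (Suc p)
  then show ?case using Suc.IH[OF lap_hom_polys[OF Suc.prems]]
    unfolding funpow_Suc_right comp_def by simp
qed auto

lemma lap_iter_low: "f \<in> hom_polys m \<Longrightarrow> m < 2 * p \<Longrightarrow> (lap ^^ p) f = (\<lambda>z. 0)"
proof (induction p arbitrary: f m)
  case (Suc p)
  show ?case
  proof (cases "m < 2")
    case True then show ?thesis using lap_hom_polys_low[OF Suc.prems(1)]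
      unfolding funpow_Suc_right comp_def by (simp add: lap_iter_zero)
  next
    case False then show ?thesis using Suc.IH[OF lap_hom_polys[OF Suc.prems(1)]] Suc.prems(2)
      unfolding funpow_Suc_right comp_def by simp
  qed
qed auto

text \<open>Each Laplacian strips one factor \<open>|z|\<^sup>2\<close> and contributes a positive
  integer, so nothing of \<open>g\<close> is lost.\<close>

lemma lap_iter_bdot_power_harm:
  fixes g :: "complex ^ 'n \<Rightarrow> complex"
  assumes g: "g \<in> harmonic_polys d"
  shows "\<exists>c. c \<noteq> 0 \<and> (lap ^^ i) (\<lambda>z. bdot z z ^ i * g z) = (\<lambda>z. c * g z)"
proof (induction i)
  case 0 show ?case by (auto intro!: exI[of _ 1])
next
  case (Suc i)
  then obtain c where c: "c \<noteq> 0" "(lap ^^ i) (\<lambda>z. bdot z z ^ i * g z) = (\<lambda>z. c * g z)" by blast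
  define a :: complex where "a = of_nat (2 * Suc i * (2 * i + CARD('n) + 2 * d))"
  have g': "g \<in> hom_polys d" "lap g = (\<lambda>z. 0)" using g by (auto simp: harmonic_polys_def)
  have "lap (\<lambda>z. bdot z z ^ Suc i * g z) = (\<lambda>z. a * (bdot z z ^ i * g z))"
    unfolding lap_bdot_power_mult[OF g'(1)] g'(2) a_def by (simp add: algebra_simps)
  then have "(lap ^^ Suc i) (\<lambda>z. bdot z z ^ Suc i * g z) = (lap ^^ i) (\<lambda>z. a * (bdot z z ^ i * g z))"
    unfolding funpow_Suc_right comp_def by simp
  also have "\<dots> = (\<lambda>z. a * (lap ^^ i) (\<lambda>z. bdot z z ^ i * g z) z)"
    by (rule lap_iter_cmult[OF hom_polys_mult[OF hom_polys_power[OF hom_polys_bdot_self] g'(1)]])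
  finally have "(lap ^^ Suc i) (\<lambda>z. bdot z z ^ Suc i * g z) = (\<lambda>z. (a * c) * g z)"
    unfolding c(2) by (simp add: mult.assoc)
  moreover have "a * c \<noteq> 0" using c(1) unfolding a_def of_nat_eq_0_iff mult_eq_0_iff by simp
  ultimately show ?case by blast
qed

text \<open>Induction on \<open>p\<close>: if \<open>\<Delta>\<close> to the power \<open>p + 1\<close> kills \<open>q\<close>, then \<open>g = \<Delta>\<^sup>p q\<close> is
  harmonic and a multiple of \<open>|z|\<^sup>2\<^sup>p g\<close> has the same image under \<open>\<Delta>\<^sup>p\<close>; the difference falls under the induction hypothesis.
  The components beyond half the degree are recorded as zero, because \<open>m - 2 * k\<close> is then truncated
  to \<open>0\<close> and constants would otherwise be admitted there.\<close>

lemma Almansi_decomposition: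
  assumes "q \<in> hom_polys m" "(lap ^^ p) q = (\<lambda>z. 0)"
  shows "\<exists>h. (\<forall>k. h k \<in> harmonic_polys (m - 2 * k)) \<and> (\<forall>k. m < 2 * k \<longrightarrow> h k = (\<lambda>z. 0)) \<and>
    (\<forall>z. q z = (\<Sum>k<p. bdot z z ^ k * h k z))"
  using assms
proof (induction p arbitrary: q)
  case 0 then show ?case by (intro exI[of _ "\<lambda>_ _. 0"]) (auto simp: harmonic_polys_zero)
next
  case (Suc p)
  define g where "g = (lap ^^ p) q"
  have g: "g \<in> harmonic_polys (m - 2 * p)" using Suc.prems lap_iter_hom_polys[of q m p] by (simp add: harmonic_polys_def g_def)
  have g0: "m < 2 * p \<Longrightarrow> g = (\<lambda>z. 0)" unfolding g_def using Suc.prems by (intro lap_iter_low)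
  obtain c where c: "c \<noteq> 0" "(lap ^^ p) (\<lambda>z. bdot z z ^ p * g z) = (\<lambda>z. c * g z)"
    using lap_iter_bdot_power_harm[OF g] by blast
  define r where "r = (\<lambda>z. - (1 / c) * (bdot z z ^ p * g z))"
  have Ng: "(\<lambda>z. bdot z z ^ p * g z) \<in> hom_polys m"
  proof (cases "m < 2 * p")
    case True then show ?thesis using g0 hom_polys_zero by simp
  next
    case False
    have "(\<lambda>z. bdot z z ^ p * g z) \<in> hom_polys (p * 2 + (m - 2 * p))"
      using g by (intro hom_polys_mult hom_polys_power hom_polys_bdot_self) (simp add: harmonic_polys_def)
    then show ?thesis using False by simp
  qed
  then have r: "r \<in> hom_polys m" unfolding r_def by (rule hom_polys_cmult)
  have "(lap ^^ p) r = (\<lambda>z. - g z)" unfolding r_def lap_iter_cmult[OF Ng] c(2) using c(1) by simp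
  then have "(lap ^^ p) (\<lambda>z. q z + r z) = (\<lambda>z. 0)"
    unfolding lap_iter_add[OF Suc.prems(1) r] by (simp add: g_def)
  from Suc.IH[OF hom_polys_add[OF Suc.prems(1) r] this] obtain h where
    h: "\<And>k. h k \<in> harmonic_polys (m - 2 * k)" "\<And>k. m < 2 * k \<Longrightarrow> h k = (\<lambda>z. 0)"
       "\<And>z. q z + r z = (\<Sum>k<p. bdot z z ^ k * h k z)" by blast
  define h' where "h' = h(p := \<lambda>z. (1 / c) * g z)"
  have "q z = (\<Sum>k<Suc p. bdot z z ^ k * h' k z)" for z
    using h(3)[of z] by (simp add: h'_def r_def algebra_simps)
  moreover have "h' k \<in> harmonic_polys (m - 2 * k)" for k using h(1)[of k] harmonic_polys_cmult[OF g, of "1/c"] by (simp add: h'_def)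
  moreover have "m < 2 * k \<Longrightarrow> h' k = (\<lambda>z. 0)" for k using h(2)[of k] g0 by (auto simp: h'_def)
  ultimately show ?case by blast
qed

section \<open>Integration over the unit ball\<close>

lemma cvec_add: "cvec (x + y) = cvec x + cvec y"
  and cvec_scaleR: "cvec (t *\<^sub>R x) = complex_of_real t *s cvec x"
  and cvec_axis: "cvec (axis j 1) = axis j 1"
  and cvec_nth: "cvec x $ i = complex_of_real (x $ i)"
  by (auto simp: cvec_def vec_eq_iff axis_def)

lemma bdot_cvec_self: "bdot (cvec x) (cvec x) = of_real ((norm x)\<^sup>2)"
  by (simp add: bdot_def cvec_def power2_norm_eq_inner inner_vec_def)

lemma bdot_cvec: "bdot (cvec x) (cvec y) = of_real (x \<bullet> y)"
  by (simp add: bdot_def cvec_def inner_vec_def)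

lemma continuous_on_cvec [continuous_intros]: "continuous_on S f \<Longrightarrow> continuous_on S (\<lambda>x. cvec (f x))"
  unfolding cvec_def by (intro continuous_intros)

lemma continuous_on_bdot [continuous_intros]:
  "continuous_on S f \<Longrightarrow> continuous_on S g \<Longrightarrow> continuous_on S (\<lambda>x. bdot (f x) (g x))"
  unfolding bdot_def by (intro continuous_intros)

lemma continuous_hom_polys: "q \<in> hom_polys m \<Longrightarrow> continuous_on UNIV q"
proof (induction rule: hom_polys_induct)
  case (monomial c \<alpha>)
  show ?case unfolding monomial_def by (intro continuous_intros)
qed (auto intro: continuous_intros)

lemma continuous_hom_polys' [continuous_intros]:
  "q \<in> hom_polys m \<Longrightarrow> continuous_on S f \<Longrightarrow> continuous_on S (\<lambda>x. q (f x))"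
  using continuous_on_compose2[OF continuous_hom_polys] by blast

lemma has_vector_derivative_line:
  assumes "q \<in> hom_polys m"
  shows "((\<lambda>t. q (cvec (x + t *\<^sub>R axis j 1))) has_vector_derivative pd j q (cvec x)) (at 0)"
  using has_vector_derivative_real_field[of "\<lambda>t. q (cvec x + t *s axis j 1)" "pd j q (cvec x)" 0 UNIV]
    has_pd[OF pdiff_hom_polys[OF assms], of "cvec x" j] by (simp add: cvec_add cvec_scaleR cvec_axis)

abbreviation ball_int :: "(real ^ 'n \<Rightarrow> complex) \<Rightarrow> complex" where
  "ball_int f \<equiv> set_lebesgue_integral lborel (ball 0 1) f"

lemma lborel_integral_scale:
  fixes g :: "real ^ 'n \<Rightarrow> complex"
  assumes [measurable]: "g \<in> borel_measurable borel" and c: "c > 0"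
  shows "integral\<^sup>L lborel g = of_real (c ^ CARD('n)) * integral\<^sup>L lborel (\<lambda>x. g (c *\<^sub>R x))"
proof -
  have "integral\<^sup>L lborel g = integral\<^sup>L (density (distr lborel borel (\<lambda>x::real^'n. 0 + c *\<^sub>R x)) (\<lambda>_. ennreal (\<bar>c\<bar> ^ DIM(real ^ 'n)))) g"
    by (subst lborel_affine[of c "0 :: real ^ 'n"]) (use c in \<open>auto simp: ennreal_power\<close>)
  also have "\<dots> = (\<integral>x. (c ^ CARD('n)) *\<^sub>R g x \<partial>distr lborel borel (\<lambda>x::real^'n. 0 + c *\<^sub>R x))"
    using c by (subst integral_density) auto
  also have "\<dots> = (\<integral>x. (c ^ CARD('n)) *\<^sub>R g (c *\<^sub>R x) \<partial>lborel)"
    by (subst integral_distr) auto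
  finally show ?thesis by (simp add: scaleR_conv_of_real)
qed

lemma set_integrable_bounded:
  fixes f :: "real ^ 'n \<Rightarrow> complex"
  assumes "f \<in> borel_measurable borel" "A \<in> sets borel" "bounded A" "\<And>x. x \<in> A \<Longrightarrow> norm (f x) \<le> B"
  shows "set_integrable lborel A f"
  unfolding set_integrable_def using assms emeasure_bounded_finite[OF \<open>bounded A\<close>]
  by (intro integrableI_bounded_set_indicator[where B=B]) auto

lemma set_integrable_continuous:
  fixes f :: "real ^ 'n \<Rightarrow> complex"
  assumes "continuous_on UNIV f" "A \<in> sets borel" "bounded A"
  shows "set_integrable lborel A f"
proof -
  from \<open>bounded A\<close> obtain R where R: "A \<subseteq> cball 0 R" using bounded_subset_ballD[of A 0] ball_subset_cball by (meson subset_trans)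
  have "bounded (f ` cball 0 R)"
    using assms(1) by (intro compact_imp_bounded compact_continuous_image) (auto intro: continuous_on_subset)
  then obtain B where "\<And>x. x \<in> cball 0 R \<Longrightarrow> norm (f x) \<le> B" unfolding bounded_iff by blast
  then show ?thesis using assms R by (intro set_integrable_bounded[where B=B] borel_measurable_continuous_onI) auto
qed

lemma sgn_scaleR_pos: "t > 0 \<Longrightarrow> sgn (t *\<^sub>R x) = (sgn x :: real ^ 'n)"
  by (simp add: sgn_div_norm)

lemma borel_measurable_sgn_vec [measurable]: "(sgn :: real ^ 'n \<Rightarrow> _) \<in> borel_measurable borel"
  unfolding sgn_div_norm[abs_def] by measurable

lemma set_lebesgue_integral_ball_scale:
  fixes g :: "real ^ 'n \<Rightarrow> complex"
  assumes [measurable]: "g \<in> borel_measurable borel" and c: "c > 0"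
  shows "set_lebesgue_integral lborel (ball 0 c) g = of_real (c ^ CARD('n)) * ball_int (\<lambda>x. g (c *\<^sub>R x))"
proof -
  have "indicator (ball 0 c) (c *\<^sub>R x) = (indicator (ball 0 1) x :: real)" for x :: "real ^ 'n"
    using c by (auto simp: indicator_def)
  moreover have "(\<lambda>x. indicat_real (ball 0 c) x *\<^sub>R g x) \<in> borel_measurable borel"
    using assms(1) by (intro borel_measurable_scaleR borel_measurable_indicator) auto
  ultimately show ?thesis unfolding set_lebesgue_integral_def
    by (subst lborel_integral_scale[OF _ c]) auto
qed

text \<open>Integration in polar coordinates for a homogeneous \<open>f\<close>. Let \<open>J\<close> and \<open>I\<close> be the
  integrals of \<open>f\<close> and of its radially constant version \<open>h\<close>, and let \<open>S\<close> be the shell \<open>r \<le> |x| < 1\<close>.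
  Scaling gives \<open>(1 - r\<^sup>n\<^sup>+\<^sup>m) J\<close> and \<open>(1 - r\<^sup>n) I\<close> as the integrals of \<open>f\<close> and \<open>h\<close> over \<open>S\<close>, which differ by
  \<open>O((1 - r)\<^sup>2)\<close>, since \<open>f - h = O(1 - r)\<close> on \<open>S\<close>. Divide by \<open>1 - r\<close> and let \<open>r\<close> tend to \<open>1\<close>.\<close>

lemma ball_int_homogeneous:
  fixes f :: "real ^ 'n \<Rightarrow> complex"
  assumes f: "continuous_on UNIV f" and hom: "\<And>t x. t > 0 \<Longrightarrow> f (t *\<^sub>R x) = of_real (t ^ m) * f x"
  shows "of_nat (CARD('n) + m) * ball_int f = of_nat CARD('n) * ball_int (\<lambda>x. f (sgn x))"
proof -
  let ?n = "CARD('n)"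
  define h where "h = (\<lambda>x. f (sgn x))"
  have fm [measurable]: "f \<in> borel_measurable borel" using f by (rule borel_measurable_continuous_onI)
  have hm [measurable]: "h \<in> borel_measurable borel" unfolding h_def by measurable
  have "bounded (f ` cball 0 1)"
    using f by (intro compact_imp_bounded compact_continuous_image) (auto intro: continuous_on_subset)
  then obtain C where C: "\<And>x. x \<in> cball 0 1 \<Longrightarrow> norm (f x) \<le> C" unfolding bounded_iff by blast
  have hC: "norm (h x) \<le> C" for x unfolding h_def by (intro C) (auto simp: norm_sgn)
  have C0: "C \<ge> 0" using hC[of 0] norm_ge_zero order_trans by blast
  define J I where "J = ball_int f" and "I = ball_int h"
  have ih: "set_integrable lborel A h" if "A \<in> sets borel" "bounded A" for A
    by (rule set_integrable_bounded[OF hm that hC])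
  have jf: "set_integrable lborel A f" if "A \<in> sets borel" "bounded A" for A
    by (rule set_integrable_continuous[OF f that])
  have key: "norm ((\<Sum>i<?n+m. of_real r ^ i) * J - (\<Sum>i<?n. of_real r ^ i) * I) \<le> C * unit_ball_vol ?n * (1 - r ^ ?n) * (\<Sum>i<m. r ^ i)"
    if r: "0 < r" "r < 1" for r :: real
  proof -
    define S where "S = (ball 0 1 - ball 0 r :: (real ^ 'n) set)"
    have S: "S \<in> sets borel" "bounded S" unfolding S_def by (auto intro: bounded_subset[of "ball 0 1"])
    have Un: "ball 0 1 = ball 0 r \<union> S" "ball 0 r \<inter> S = {}" using r unfolding S_def by auto
    have mS: "measure lborel S = unit_ball_vol ?n * (1 - r ^ ?n)"
      unfolding S_def using r
      by (subst measure_Diff) (auto simp: content_ball emeasure_ball algebra_simps measure_lborel_Icc)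
    have Jr: "set_lebesgue_integral lborel (ball 0 r) f = of_real (r ^ (?n + m)) * J"
      using r by (subst set_lebesgue_integral_ball_scale) (auto simp: hom J_def power_add)
    have Ir: "set_lebesgue_integral lborel (ball 0 r) h = of_real (r ^ ?n) * I"
      using r by (subst set_lebesgue_integral_ball_scale) (auto simp: h_def sgn_scaleR_pos I_def)
    have 1: "J = of_real (r ^ (?n + m)) * J + set_lebesgue_integral lborel S f"
      unfolding Jr[symmetric] unfolding J_def Un(1)
      by (rule set_integral_Un[OF Un(2) jf jf]) (use S in auto)
    have 2: "I = of_real (r ^ ?n) * I + set_lebesgue_integral lborel S h"
      unfolding Ir[symmetric] unfolding I_def Un(1)
      by (rule set_integral_Un[OF Un(2) ih ih]) (use S in auto)
    have 3: "set_lebesgue_integral lborel S f - set_lebesgue_integral lborel S h = set_lebesgue_integral lborel S (\<lambda>x. f x - h x)"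
      using ih[OF S] jf[OF S] by simp
    have "(1 - of_real r ^ (?n + m)) * J = set_lebesgue_integral lborel S f"
      "(1 - of_real r ^ ?n) * I = set_lebesgue_integral lborel S h"
      using 1 2 by (simp_all add: algebra_simps)
    then have eq: "(1 - of_real r ^ (?n + m)) * J - (1 - of_real r ^ ?n) * I = set_lebesgue_integral lborel S (\<lambda>x. f x - h x)"
      using 3 by simp
    have bd: "norm (f x - h x) \<le> C * (1 - r ^ m)" if "x \<in> S" for x
    proof -
      have x: "r \<le> norm x" "norm x < 1" using that by (auto simp: S_def)
      then have x0: "norm x > 0" using r by linarith
      have "f x = f (norm x *\<^sub>R sgn x)" using x0 by (simp add: sgn_div_norm)
      also have "\<dots> = of_real (norm x ^ m) * h x" using hom[OF x0] by (simp add: h_def)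
      finally have "f x - h x = of_real (norm x ^ m - 1) * h x" by (simp add: algebra_simps)
      then have "norm (f x - h x) = \<bar>norm x ^ m - 1\<bar> * norm (h x)" by (simp only: norm_mult norm_of_real)
      also have "\<bar>norm x ^ m - 1\<bar> = 1 - norm x ^ m" using power_le_one[of "norm x" m] x by simp
      also have "\<dots> * norm (h x) \<le> (1 - r ^ m) * C"
        using power_mono[of r "norm x" m] x r hC power_le_one[of "norm x" m] power_le_one[of "r" m] by (intro mult_mono) auto
      finally show ?thesis by (simp add: mult.commute)
    qed
    have "norm (set_lebesgue_integral lborel S (\<lambda>x. f x - h x)) \<le> (LINT x:S|lborel. C * (1 - r ^ m))"
    proof -
      have "norm (set_lebesgue_integral lborel S (\<lambda>x. f x - h x)) \<le> (\<integral>x. indicator S x * (C * (1 - r ^ m)) \<partial>lborel)"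
        unfolding set_lebesgue_integral_def
      proof (rule Bochner_Integration.integral_norm_bound_integral)
        show "integrable lborel (\<lambda>x. indicat_real S x *\<^sub>R (f x - h x))"
          using set_integral_diff(1)[OF jf[OF S] ih[OF S]] by (simp add: set_integrable_def)
        show "integrable lborel (\<lambda>x. indicat_real S x * (C * (1 - r ^ m)))"
          using S emeasure_bounded_finite[OF S(2)] by (intro integrable_mult_left integrable_real_indicator) auto
      qed (use bd in \<open>auto simp: indicator_def\<close>)
      then show ?thesis by (simp add: set_lebesgue_integral_def mult_ac)
    qed
    also have "\<dots> = C * (1 - r ^ m) * (unit_ball_vol ?n * (1 - r ^ ?n))"
      unfolding set_lebesgue_integral_def using S mS by simp
    finally have "norm ((1 - of_real r ^ (?n + m)) * J - (1 - of_real r ^ ?n) * I) \<le> C * (1 - r ^ m) * (unit_ball_vol ?n * (1 - r ^ ?n))"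
      unfolding eq .
    also have "(1 - of_real r ^ (?n + m)) * J - (1 - of_real r ^ ?n) * I = of_real (1 - r) * ((\<Sum>i<?n+m. of_real r ^ i) * J - (\<Sum>i<?n. of_real r ^ i) * I)"
      unfolding one_diff_power_eq by (simp add: algebra_simps)
    also have "C * (1 - r ^ m) * (unit_ball_vol ?n * (1 - r ^ ?n)) = (1 - r) * (C * unit_ball_vol ?n * (1 - r ^ ?n) * (\<Sum>i<m. r ^ i))"
      unfolding one_diff_power_eq[of r m] by (simp add: algebra_simps)
    finally show ?thesis using r unfolding norm_mult norm_of_real by simp
  qed
  have "((\<lambda>r. norm ((\<Sum>i<?n+m. of_real r ^ i) * J - (\<Sum>i<?n. of_real r ^ i) * I)) \<longlongrightarrow>
      norm ((\<Sum>i<?n+m. of_real 1 ^ i) * J - (\<Sum>i<?n. of_real 1 ^ i) * I)) (at_left 1)"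
    by (intro tendsto_intros)
  moreover have "((\<lambda>r. C * unit_ball_vol ?n * (1 - r ^ ?n) * (\<Sum>i<m. r ^ i)) \<longlongrightarrow> C * unit_ball_vol ?n * (1 - 1 ^ ?n) * (\<Sum>i<m. 1 ^ i)) (at_left 1)"
    by (intro tendsto_intros)
  moreover have "eventually (\<lambda>r. norm ((\<Sum>i<?n+m. of_real r ^ i) * J - (\<Sum>i<?n. of_real r ^ i) * I) \<le> C * unit_ball_vol ?n * (1 - r ^ ?n) * (\<Sum>i<m. r ^ i)) (at_left 1)"
    using eventually_at_left_real[of 0 1] by (rule eventually_mono) (use key in auto)
  ultimately have "norm ((\<Sum>i<?n+m. of_real 1 ^ i) * J - (\<Sum>i<?n. of_real 1 ^ i) * I) \<le> C * unit_ball_vol ?n * (1 - 1 ^ ?n) * (\<Sum>i<m. 1 ^ i)"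
    by (intro tendsto_le[OF trivial_limit_at_left_real])
  then show ?thesis by (simp add: J_def I_def h_def)
qed

text \<open>Translation invariance makes every difference quotient integrate to zero,
  and dominated convergence passes this on to the derivative.\<close>

lemma integral_partial_derivative_zero:
  fixes F F' :: "real ^ 'n \<Rightarrow> complex"
  assumes F: "continuous_on UNIV F" and F': "continuous_on UNIV F'"
    and d: "\<And>x. ((\<lambda>t. F (x + t *\<^sub>R axis j 1)) has_vector_derivative F' x) (at 0)"
    and supp: "\<And>x. norm x \<ge> 1 \<Longrightarrow> F x = 0" "\<And>x. norm x \<ge> 1 \<Longrightarrow> F' x = 0"
  shows "integral\<^sup>L lborel F' = 0"
proof -
  let ?e = "axis j 1 :: real ^ 'n"
  have [measurable]: "F \<in> borel_measurable borel" "F' \<in> borel_measurable borel"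
    using F F' by (auto intro: borel_measurable_continuous_onI)
  have "bounded (F' ` cball 0 1)"
    using F' by (intro compact_imp_bounded compact_continuous_image) (auto intro: continuous_on_subset)
  then obtain M where M: "\<And>x. x \<in> cball 0 1 \<Longrightarrow> norm (F' x) \<le> M" unfolding bounded_iff by blast
  have M0: "M \<ge> 0" using M[of 0] norm_ge_zero[of "F' 0"] by (simp add: order_trans[OF norm_ge_zero])
  have M': "norm (F' x) \<le> M" for x using M[of x] supp(2)[of x] M0 by (cases "norm x \<le> 1") auto
  have d': "((\<lambda>t. F (x + t *\<^sub>R ?e)) has_vector_derivative F' (x + s *\<^sub>R ?e)) (at s)" for x s
  proof -
    have "((\<lambda>t. F (x + s *\<^sub>R ?e + t *\<^sub>R ?e)) \<circ> (\<lambda>t. t - s) has_vector_derivative 1 *\<^sub>R F' (x + s *\<^sub>R ?e)) (at s)"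
      by (rule vector_diff_chain_at) (auto intro!: derivative_eq_intros d)
    then show ?thesis by (simp add: comp_def algebra_simps)
  qed
  define h :: "nat \<Rightarrow> real" where "h i = 1 / real (Suc i)" for i
  have h: "0 < h i" "h i \<le> 1" for i by (auto simp: h_def)
  define D where "D i x = (1 / h i) *\<^sub>R (F (x + h i *\<^sub>R ?e) - F x)" for i x
  have Dint: "integral\<^sup>L lborel (D i) = 0" for i
  proof -
    have iF: "integrable lborel F"
    proof -
      have "set_integrable lborel (cball 0 1) F" by (rule set_integrable_continuous[OF F]) auto
      moreover have "(\<lambda>x. indicat_real (cball 0 1) x *\<^sub>R F x) = F" using supp(1) by (auto simp: indicator_def)
      ultimately show ?thesis by (simp add: set_integrable_def)
    qed
    have "integral\<^sup>L lborel F = integral\<^sup>L (distr lborel borel ((+) (h i *\<^sub>R ?e))) F"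
      by (simp add: lborel_distr_plus)
    also have "\<dots> = integral\<^sup>L lborel (\<lambda>x. F (h i *\<^sub>R ?e + x))" by (subst integral_distr) auto
    finally have "integral\<^sup>L lborel F = integral\<^sup>L lborel (\<lambda>x. F (x + h i *\<^sub>R ?e))" by (simp add: add.commute)
    moreover have "integrable lborel (\<lambda>x. F (x + h i *\<^sub>R ?e))"
    proof -
      have "integrable (distr lborel borel ((+) (h i *\<^sub>R ?e))) F" using iF by (simp add: lborel_distr_plus)
      then have "integrable lborel (\<lambda>x. F (h i *\<^sub>R ?e + x))" by (subst (asm) integrable_distr_eq) auto
      then show ?thesis by (simp add: add.commute)
    qed
    ultimately show ?thesis unfolding D_def using iF by simp
  qed
  have bd: "norm (D i x) \<le> indicator (cball 0 2) x * M" for i x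
  proof (cases "norm x \<le> 2")
    case True
    have "\<exists>s\<in>{0<..<h i}. norm (F (x + h i *\<^sub>R ?e) - F (x + 0 *\<^sub>R ?e)) \<le> norm ((h i - 0) *\<^sub>R F' (x + s *\<^sub>R ?e))"
      using h[of i] d'[of x, unfolded has_vector_derivative_def]
      by (intro mvt_general continuous_at_imp_continuous_on ballI has_vector_derivative_continuous[OF d']) auto
    then obtain s where "norm (F (x + h i *\<^sub>R ?e) - F x) \<le> h i * norm (F' (x + s *\<^sub>R ?e))"
      using h[of i] by auto
    also have "\<dots> \<le> h i * M" using h[of i] M' by (intro mult_left_mono) auto
    finally show ?thesis unfolding D_def using h[of i] True by (simp add: divide_simps mult.commute)
  next
    case False
    have "norm x - norm (x + h i *\<^sub>R ?e) \<le> norm (h i *\<^sub>R ?e)"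
      using norm_triangle_ineq2[of x "x + h i *\<^sub>R ?e"] by simp
    also have "\<dots> \<le> 1" using h[of i] by simp
    finally show ?thesis unfolding D_def using supp(1)[of x] supp(1)[of "x + h i *\<^sub>R ?e"] False by simp
  qed
  have lim: "(\<lambda>i. D i x) \<longlonglongrightarrow> F' x" for x
  proof -
    have "((\<lambda>t. (F (x + t *\<^sub>R ?e) - F (x + 0 *\<^sub>R ?e)) /\<^sub>R (t - 0)) \<longlongrightarrow> F' x) (at 0)"
    proof (rule Lim_null[THEN iffD2], rule tendsto_norm_zero_cancel, rule Lim_transform_eventually)
      show "((\<lambda>t. norm (F (x + t *\<^sub>R ?e) - F (x + 0 *\<^sub>R ?e) - (t - 0) *\<^sub>R F' x) / norm (t - 0)) \<longlongrightarrow> 0) (at 0)"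
        using d[of x] unfolding has_vector_derivative_def has_derivative_iff_norm by blast
      show "eventually (\<lambda>t. norm (F (x + t *\<^sub>R ?e) - F (x + 0 *\<^sub>R ?e) - (t - 0) *\<^sub>R F' x) / norm (t - 0) =
         norm ((F (x + t *\<^sub>R ?e) - F (x + 0 *\<^sub>R ?e)) /\<^sub>R (t - 0) - F' x)) (at 0)"
        using eventually_neq_at_within[of 0 0 UNIV]
      proof (rule eventually_mono)
        fix t :: real assume t: "t \<noteq> 0"
        have "(F (x + t *\<^sub>R ?e) - F (x + 0 *\<^sub>R ?e)) /\<^sub>R (t - 0) - F' x = (F (x + t *\<^sub>R ?e) - F (x + 0 *\<^sub>R ?e) - (t - 0) *\<^sub>R F' x) /\<^sub>R t"
          using t by (simp add: scaleR_diff_right)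
        then show "norm (F (x + t *\<^sub>R ?e) - F (x + 0 *\<^sub>R ?e) - (t - 0) *\<^sub>R F' x) / norm (t - 0) =
         norm ((F (x + t *\<^sub>R ?e) - F (x + 0 *\<^sub>R ?e)) /\<^sub>R (t - 0) - F' x)"
          by (simp only: norm_scaleR) (simp add: divide_inverse mult.commute)
      qed
    qed
    moreover have "filterlim h (at 0) sequentially"
      unfolding filterlim_at h_def using LIMSEQ_inverse_real_of_nat by (auto simp: inverse_eq_divide)
    ultimately have "(\<lambda>i. (F (x + h i *\<^sub>R ?e) - F (x + 0 *\<^sub>R ?e)) /\<^sub>R (h i - 0)) \<longlonglongrightarrow> F' x"
      by (rule filterlim_compose)
    then show ?thesis by (simp add: D_def divide_inverse)
  qed
  have [measurable]: "D i \<in> borel_measurable borel" for i unfolding D_def[abs_def] by measurable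
  have "(\<lambda>i. integral\<^sup>L lborel (D i)) \<longlonglongrightarrow> integral\<^sup>L lborel F'"
  proof (rule integral_dominated_convergence[where w="\<lambda>x. indicator (cball 0 2) x * M"])
    show "integrable lborel (\<lambda>x::real^'n. indicat_real (cball 0 2) x * M)"
      using emeasure_bounded_finite[of "cball 0 2 :: (real^'n) set"]
      by (intro integrable_mult_left integrable_real_indicator) auto
  qed (use lim bd in auto)
  then show ?thesis unfolding Dint by (simp add: LIMSEQ_const_iff)
qed

section \<open>Spherical means of harmonic polynomials\<close>

text \<open>The mean over the ball of the radially constant extension: this is integration
  against \<^const>\<open>sphere_measure\<close>, as \<open>lebesgue_integral_sphere_measure\<close> confirms.\<close>

definition sphere_mean :: "(complex ^ 'n \<Rightarrow> complex) \<Rightarrow> complex" where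
  "sphere_mean f = ball_int (\<lambda>x. f (cvec (sgn x))) / of_real (unit_ball_vol (real CARD('n)))"

lemma set_integrable_sgn:
  fixes f :: "complex ^ 'n \<Rightarrow> complex"
  assumes f: "continuous_on UNIV f"
  shows "set_integrable lborel (ball 0 1) (\<lambda>x. f (cvec (sgn x)))"
proof -
  have c: "continuous_on UNIV (\<lambda>x. f (cvec x))"
    by (rule continuous_on_compose2[OF f continuous_on_cvec[OF continuous_on_id]]) auto
  then have "bounded ((\<lambda>x. f (cvec x)) ` cball 0 1)"
    by (intro compact_imp_bounded compact_continuous_image) (auto intro: continuous_on_subset)
  then obtain B where B: "\<And>x. x \<in> cball 0 1 \<Longrightarrow> norm (f (cvec x)) \<le> B" unfolding bounded_iff by blast
  have m: "(\<lambda>x. f (cvec x)) \<in> borel_measurable borel" using c by (rule borel_measurable_continuous_onI)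
  have "(\<lambda>x. f (cvec (sgn x))) \<in> borel_measurable borel"
    using measurable_compose[OF borel_measurable_sgn_vec m] .
  then show ?thesis
    by (intro set_integrable_bounded[where B=B] B) (auto simp: norm_sgn)
qed

lemma sphere_mean_add: "continuous_on UNIV f \<Longrightarrow> continuous_on UNIV g \<Longrightarrow> sphere_mean (\<lambda>z. f z + g z) = sphere_mean f + sphere_mean g"
  unfolding sphere_mean_def by (simp add: set_integrable_sgn add_divide_distrib)

lemma sphere_mean_cmult: "sphere_mean (\<lambda>z. c * f z) = c * sphere_mean f"
  unfolding sphere_mean_def by simp

lemma sphere_mean_zero: "sphere_mean (\<lambda>z. 0) = 0"
  unfolding sphere_mean_def by simp

lemma sphere_mean_sum:
  "finite S \<Longrightarrow> (\<And>i. i \<in> S \<Longrightarrow> continuous_on UNIV (f i)) \<Longrightarrow> sphere_mean (\<lambda>z. \<Sum>i\<in>S. f i z) = (\<Sum>i\<in>S. sphere_mean (f i))"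
proof (induction S rule: finite_induct)
  case (insert x F)
  have "sphere_mean (\<lambda>z. f x z + (\<Sum>i\<in>F. f i z)) = sphere_mean (f x) + sphere_mean (\<lambda>z. \<Sum>i\<in>F. f i z)"
    using insert by (intro sphere_mean_add continuous_on_sum) auto
  then show ?case using insert by simp
qed (simp add: sphere_mean_zero)

lemma sphere_mean_bdot_power: "sphere_mean (\<lambda>z::complex^'n. bdot z z ^ k * f z) = sphere_mean f"
proof -
  have "(\<integral>x. indicator (ball 0 1) x *\<^sub>R (bdot (cvec (sgn x)) (cvec (sgn x)) ^ k * f (cvec (sgn x))) \<partial>lborel)
      = (\<integral>x. indicator (ball 0 1) x *\<^sub>R f (cvec (sgn x :: real^'n)) \<partial>lborel)"
  proof (rule integral_discrete_difference[where X="{0}"])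
    fix x :: "real ^ 'n" assume "x \<notin> {0}"
    then show "indicator (ball 0 1) x *\<^sub>R (bdot (cvec (sgn x)) (cvec (sgn x)) ^ k * f (cvec (sgn x))) = indicator (ball 0 1) x *\<^sub>R f (cvec (sgn x))"
      by (simp add: bdot_cvec_self norm_sgn)
  qed auto
  then show ?thesis unfolding sphere_mean_def set_lebesgue_integral_def by simp
qed

lemma unit_ball_vol_neq_0: "complex_of_real (unit_ball_vol (real n)) \<noteq> 0"
  using unit_ball_vol_pos[of "real n"] by (simp del: unit_ball_vol_pos)

lemma ball_int_hom_polys:
  fixes f :: "complex ^ 'n \<Rightarrow> complex"
  assumes f: "f \<in> hom_polys m"
  shows "ball_int (\<lambda>x. f (cvec x)) = of_nat CARD('n) * of_real (unit_ball_vol (real CARD('n))) / of_nat (CARD('n) + m) * sphere_mean f"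
proof -
  have "of_nat (CARD('n) + m) * ball_int (\<lambda>x. f (cvec x)) = of_nat CARD('n) * ball_int (\<lambda>x. f (cvec (sgn x)))"
    by (rule ball_int_homogeneous)
       (auto intro!: continuous_intros continuous_hom_polys'[OF f] simp: cvec_scaleR hom_polys_scale[OF f])
  moreover have "(of_nat (CARD('n) + m) :: complex) \<noteq> 0" by (simp del: of_nat_add)
  ultimately show ?thesis unfolding sphere_mean_def using unit_ball_vol_neq_0[of "CARD('n)"]
    by (simp add: field_simps del: of_nat_add)
qed

text \<open>Needed for the cut-off \<open>max 0 (1 - |x|\<^sup>2)\<^sup>2\<close>, which is continuously
  differentiable across the unit sphere.\<close>

lemma has_real_derivative_pos_part_square:
  "((\<lambda>s::real. (max 0 s)\<^sup>2) has_real_derivative 2 * max 0 s) (at s)"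
proof -
  consider "s > 0" | "s < 0" | "s = 0" by linarith
  then show ?thesis
  proof cases
    case 1
    have "((\<lambda>s::real. s\<^sup>2) has_real_derivative 2 * s) (at s)" by (auto intro!: derivative_eq_intros)
    moreover have ev: "eventually (\<lambda>u::real. (max 0 u)\<^sup>2 = u\<^sup>2) (nhds s)"
      using eventually_nhds_in_open[of "{0<..}" s] 1 by (auto elim!: eventually_mono)
    ultimately show ?thesis using 1 unfolding DERIV_cong_ev[OF refl ev refl] by simp
  next
    case 2
    have "((\<lambda>s::real. 0) has_real_derivative 0) (at s)" by simp
    moreover have ev: "eventually (\<lambda>u::real. (max 0 u)\<^sup>2 = 0) (nhds s)"
      using eventually_nhds_in_open[of "{..<0}" s] 2 by (auto elim!: eventually_mono)
    ultimately show ?thesis using 2 unfolding DERIV_cong_ev[OF refl ev refl] by simp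
  next
    case 3
    have "((\<lambda>h. (max 0 (0 + h))\<^sup>2 / h) \<longlongrightarrow> 0) (at (0::real))"
    proof (rule Lim_null_comparison)
      show "\<forall>\<^sub>F x in at (0::real). norm ((max 0 (0 + x))\<^sup>2 / x) \<le> \<bar>x\<bar>"
        by (rule always_eventually) (auto simp: power2_eq_square max_def divide_simps)
      show "((\<lambda>x::real. \<bar>x\<bar>) \<longlongrightarrow> 0) (at 0)" by (auto intro!: tendsto_eq_intros)
    qed
    then show ?thesis using 3 by (simp add: DERIV_def)
  qed
qed

text \<open>Integrate the divergence of \<open>max 0 (1 - |x|\<^sup>2)\<^sup>2\<close> times the gradient of \<open>f\<close> over the whole
  space. The weight vanishes to second order on the sphere, so there is no boundary term, and Euler's identity
  evaluates the radial derivative of \<open>f\<close>.\<close>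

lemma ball_int_lap:
  fixes f :: "complex ^ 'n \<Rightarrow> complex"
  assumes f: "f \<in> hom_polys m"
  shows "ball_int (\<lambda>x. (1 - bdot (cvec x) (cvec x))\<^sup>2 * lap f (cvec x)) =
    4 * of_nat m * ball_int (\<lambda>x. (1 - bdot (cvec x) (cvec x)) * f (cvec x))"
proof -
  define \<phi> where "\<phi> x = max 0 (1 - x \<bullet> x)" for x :: "real ^ 'n"
  define F' where "F' j x = of_real (- 4 * \<phi> x * x $ j) * pd j f (cvec x) + of_real ((\<phi> x)\<^sup>2) * pd j (pd j f) (cvec x)" for j x
  have F': "continuous_on UNIV (F' j)" for j
    unfolding F'_def \<phi>_def
    by (intro continuous_intros continuous_hom_polys'[OF pd_hom_polys[OF f]] continuous_hom_polys'[OF pd_hom_polys[OF pd_hom_polys[OF f]]])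
  have 0: "\<phi> x = 0" if "norm x \<ge> 1" for x
    using one_le_power[OF that, of 2] by (simp add: \<phi>_def dot_square_norm max_def)
  have Z: "integral\<^sup>L lborel (F' j) = 0" for j
  proof (rule integral_partial_derivative_zero)
    show "continuous_on UNIV (\<lambda>x. of_real ((\<phi> x)\<^sup>2) * pd j f (cvec x))"
      unfolding \<phi>_def by (intro continuous_intros continuous_hom_polys'[OF pd_hom_polys[OF f]])
    show "((\<lambda>t. of_real ((\<phi> (x + t *\<^sub>R axis j 1))\<^sup>2) * pd j f (cvec (x + t *\<^sub>R axis j 1))) has_vector_derivative F' j x) (at 0)" for x
    proof -
      have "((\<lambda>t. 1 - (x + t *\<^sub>R axis j 1) \<bullet> (x + t *\<^sub>R axis j 1)) has_real_derivative - 2 * x $ j) (at 0)"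
        by (simp add: inner_add_left inner_add_right inner_axis inner_axis' algebra_simps)
           (auto intro!: derivative_eq_intros)
      from DERIV_chain2[OF has_real_derivative_pos_part_square this]
      have "((\<lambda>t. (\<phi> (x + t *\<^sub>R axis j 1))\<^sup>2) has_real_derivative - 4 * \<phi> x * x $ j) (at 0)"
        by (simp add: \<phi>_def mult_ac)
      then have "((\<lambda>t. complex_of_real ((\<phi> (x + t *\<^sub>R axis j 1))\<^sup>2)) has_vector_derivative of_real (- 4 * \<phi> x * x $ j)) (at 0)"
        by (intro has_vector_derivative_of_real) (simp add: has_real_derivative_iff_has_vector_derivative)
      from has_vector_derivative_mult[OF this has_vector_derivative_line[OF pd_hom_polys[OF f], where x=x and j=j]]
      show ?thesis by (simp add: F'_def add.commute)
    qed
    show "continuous_on UNIV (F' j)" by (rule F')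
  qed (use 0 in \<open>auto simp: F'_def\<close>)
  have iF': "integrable lborel (F' j)" for j
  proof -
    have "set_integrable lborel (ball 0 1) (F' j)" by (rule set_integrable_continuous[OF F']) auto
    moreover have "(\<lambda>x. indicat_real (ball 0 1) x *\<^sub>R F' j x) = F' j" using 0 by (auto simp: indicator_def F'_def fun_eq_iff)
    ultimately show ?thesis by (simp add: set_integrable_def)
  qed
  have "0 = integral\<^sup>L lborel (\<lambda>x. \<Sum>j\<in>UNIV. F' j x)"
    using iF' Z by (subst Bochner_Integration.integral_sum) auto
  also have "(\<lambda>x. \<Sum>j\<in>UNIV. F' j x) = (\<lambda>x. indicator (ball 0 1) x *\<^sub>R ((1 - bdot (cvec x) (cvec x))\<^sup>2 * lap f (cvec x) -
      4 * of_nat m * ((1 - bdot (cvec x) (cvec x)) * f (cvec x))))"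
  proof
    fix x :: "real ^ 'n"
    have "(\<Sum>j\<in>UNIV. F' j x) = - 4 * of_real (\<phi> x) * (\<Sum>j\<in>UNIV. cvec x $ j * pd j f (cvec x)) + (of_real (\<phi> x))\<^sup>2 * lap f (cvec x)"
    proof -
      have "F' j x = - 4 * of_real (\<phi> x) * (cvec x $ j * pd j f (cvec x)) + (of_real (\<phi> x))\<^sup>2 * pd j (pd j f) (cvec x)" for j
        unfolding F'_def by (simp add: cvec_nth)
      then show ?thesis unfolding complex_laplacian_eq by (simp only: sum.distrib sum_distrib_left)
    qed
    also have "\<dots> = (of_real (\<phi> x))\<^sup>2 * lap f (cvec x) - 4 * of_nat m * (of_real (\<phi> x) * f (cvec x))"
      unfolding hom_polys_Euler[OF f] by simp
    finally have e: "(\<Sum>j\<in>UNIV. F' j x) = (of_real (\<phi> x))\<^sup>2 * lap f (cvec x) - 4 * of_nat m * (of_real (\<phi> x) * f (cvec x))" .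
    have "norm x < 1 \<Longrightarrow> of_real (\<phi> x) = 1 - bdot (cvec x) (cvec x)"
      unfolding bdot_cvec_self \<phi>_def dot_square_norm using power_le_one[of "norm x" 2] by (simp add: max_def)
    then show "(\<Sum>j\<in>UNIV. F' j x) = indicator (ball 0 1) x *\<^sub>R ((1 - bdot (cvec x) (cvec x))\<^sup>2 * lap f (cvec x) -
      4 * of_nat m * ((1 - bdot (cvec x) (cvec x)) * f (cvec x)))"
      unfolding e using 0[of x] by (cases "norm x < 1") auto
  qed
  also have "integral\<^sup>L lborel \<dots> = ball_int (\<lambda>x. (1 - bdot (cvec x) (cvec x))\<^sup>2 * lap f (cvec x)) -
     ball_int (\<lambda>x. 4 * of_nat m * ((1 - bdot (cvec x) (cvec x)) * f (cvec x)))"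
  proof -
    have a: "set_integrable lborel (ball 0 1) (\<lambda>x. (1 - bdot (cvec x) (cvec x))\<^sup>2 * lap f (cvec x))"
      "set_integrable lborel (ball 0 1) (\<lambda>x. 4 * of_nat m * ((1 - bdot (cvec x) (cvec x)) * f (cvec x)))"
      by (intro set_integrable_continuous continuous_intros continuous_hom_polys'[OF f] continuous_hom_polys'[OF lap_hom_polys[OF f]]; simp)+
    show ?thesis unfolding set_lebesgue_integral_def[symmetric] by (rule set_integral_diff(2)[OF a])
  qed
  finally show ?thesis by simp
qed

text \<open>Green's formula on the sphere. All integrals in \<open>ball_int_lap\<close> are known multiples of
  the means of \<open>f\<close> and \<open>\<Delta>f\<close>, by \<open>ball_int_hom_polys\<close>. The second part is implied by the first unless
  \<open>m = n = 1\<close>, where the factor \<open>m + n - 2\<close> vanishes.\<close>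

lemma sphere_mean_lap:
  fixes f :: "complex ^ 'n \<Rightarrow> complex"
  assumes f: "f \<in> hom_polys m"
  shows "of_nat m * (of_nat m + of_nat CARD('n) - 2) * sphere_mean f = sphere_mean (lap f)"
    and "m > 0 \<Longrightarrow> lap f = (\<lambda>z. 0) \<Longrightarrow> sphere_mean f = 0"
proof -
  let ?V = "of_nat CARD('n) * complex_of_real (unit_ball_vol (real CARD('n)))"
  have V: "?V \<noteq> 0" using unit_ball_vol_neq_0[of "CARD('n)"] by simp
  define A :: complex where "A = of_nat (CARD('n) + m)"
  have A: "A \<noteq> 0" "A + 2 \<noteq> 0" unfolding A_def by (simp del: of_nat_add, metis of_nat_eq_0_iff of_nat_add of_nat_numeral add_is_0 zero_neq_numeral)
  have Nf: "(\<lambda>z. bdot z z ^ 1 * f z) \<in> hom_polys (2 + m)"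
    using hom_polys_mult[OF hom_polys_bdot_self f] by simp
  have "ball_int (\<lambda>x. (1 - bdot (cvec x) (cvec x)) * f (cvec x)) = ball_int (\<lambda>x. f (cvec x)) - ball_int (\<lambda>x. bdot (cvec x) (cvec x) ^ 1 * f (cvec x))"
  proof -
    have a: "set_integrable lborel (ball 0 1) (\<lambda>x. f (cvec x))"
        "set_integrable lborel (ball 0 1) (\<lambda>x. bdot (cvec x) (cvec x) ^ 1 * f (cvec x))"
      by (intro set_integrable_continuous continuous_intros continuous_hom_polys'[OF f]; simp)+
    show ?thesis unfolding set_integral_diff(2)[OF a, symmetric] by (simp add: algebra_simps)
  qed
  also have "\<dots> = ?V / A * sphere_mean f - ?V / (A + 2) * sphere_mean f"
    unfolding ball_int_hom_polys[OF f] ball_int_hom_polys[OF Nf] sphere_mean_bdot_power A_def by (simp add: algebra_simps)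
  also have "\<dots> = 2 * ?V / (A * (A + 2)) * sphere_mean f" using A by (simp add: divide_simps) (simp add: algebra_simps)
  finally have 1: "ball_int (\<lambda>x. (1 - bdot (cvec x) (cvec x)) * f (cvec x)) = 2 * ?V / (A * (A + 2)) * sphere_mean f" .
  have zero: "sphere_mean f = 0" if "m > 0" "lap f = (\<lambda>z. 0)"
    using ball_int_lap[OF f] that A V unfolding 1 by simp
  then show "m > 0 \<Longrightarrow> lap f = (\<lambda>z. 0) \<Longrightarrow> sphere_mean f = 0" .
  show "of_nat m * (of_nat m + of_nat CARD('n) - 2) * sphere_mean f = sphere_mean (lap f)"
  proof (cases "m < 2")
    case True
    then show ?thesis using lap_hom_polys_low[OF f] zero by (cases "m = 0") (auto simp: sphere_mean_zero)
  next
    case False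
    let ?g = "lap f"
    note g = lap_hom_polys[OF f]
    have A2: "A - 2 = of_nat (CARD('n) + (m - 2))" unfolding A_def using False by (simp add: of_nat_diff)
    have A2': "A - 2 \<noteq> 0" unfolding A2 by (simp del: of_nat_add)
    have N1: "(\<lambda>z. bdot z z ^ 1 * ?g z) \<in> hom_polys (2 + (m - 2))"
      using hom_polys_mult[OF hom_polys_bdot_self g] by simp
    have N2: "(\<lambda>z. bdot z z ^ 2 * ?g z) \<in> hom_polys (2 * 2 + (m - 2))"
      by (rule hom_polys_mult[OF hom_polys_power[OF hom_polys_bdot_self] g])
    have "ball_int (\<lambda>x. (1 - bdot (cvec x) (cvec x))\<^sup>2 * ?g (cvec x)) =
       ball_int (\<lambda>x. (?g (cvec x) - 2 * (bdot (cvec x) (cvec x) ^ 1 * ?g (cvec x))) + bdot (cvec x) (cvec x) ^ 2 * ?g (cvec x))"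
      by (simp add: power2_eq_square algebra_simps)
    also have "\<dots> = ball_int (\<lambda>x. ?g (cvec x)) - 2 * ball_int (\<lambda>x. bdot (cvec x) (cvec x) ^ 1 * ?g (cvec x))
       + ball_int (\<lambda>x. bdot (cvec x) (cvec x) ^ 2 * ?g (cvec x))"
    proof -
      have a: "set_integrable lborel (ball 0 1) (\<lambda>x. ?g (cvec x))"
        "set_integrable lborel (ball 0 1) (\<lambda>x. 2 * (bdot (cvec x) (cvec x) ^ 1 * ?g (cvec x)))"
        "set_integrable lborel (ball 0 1) (\<lambda>x. bdot (cvec x) (cvec x) ^ 2 * ?g (cvec x))"
        by (intro set_integrable_continuous continuous_intros continuous_hom_polys'[OF g]; simp)+
      show ?thesis unfolding set_integral_add(2)[OF set_integral_diff(1)[OF a(1,2)] a(3)] set_integral_diff(2)[OF a(1,2)]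
        set_integral_mult_right ..
    qed
    also have "\<dots> = (?V / (A - 2) - 2 * (?V / A) + ?V / (A + 2)) * sphere_mean ?g"
      unfolding ball_int_hom_polys[OF g] ball_int_hom_polys[OF N1] ball_int_hom_polys[OF N2] sphere_mean_bdot_power A2
      using False by (simp add: A_def algebra_simps of_nat_diff)
    also have "?V / (A - 2) - 2 * (?V / A) + ?V / (A + 2) = 8 * ?V / ((A - 2) * A * (A + 2))"
      using A A2' by (simp add: divide_simps) (simp add: algebra_simps)
    finally have "8 * ?V / ((A - 2) * A * (A + 2)) * sphere_mean ?g = 4 * of_nat m * (2 * ?V / (A * (A + 2)) * sphere_mean f)"
      using ball_int_lap[OF f] 1 by simp
    then have "sphere_mean ?g = of_nat m * (A - 2) * sphere_mean f"
      using A A2' V by (simp add: divide_simps)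
    then show ?thesis by (simp add: A_def algebra_simps)
  qed
qed

lemma pd_harmonic_polys: "h \<in> harmonic_polys m \<Longrightarrow> pd j h \<in> harmonic_polys (m - 1)"
  using pd_hom_polys[of h m j] by (auto simp: harmonic_polys_def pd_lap pd_const)

lemma harm_hom_polys: "h \<in> harmonic_polys m \<Longrightarrow> h \<in> hom_polys m"
  by (simp add: harmonic_polys_def)

lemma lap_mult_harm:
  assumes "h \<in> harmonic_polys a" "g \<in> harmonic_polys b"
  shows "lap (\<lambda>z. h z * g z) = (\<lambda>z. 2 * (\<Sum>j\<in>UNIV. pd j h z * pd j g z))"
  using assms by (subst lap_mult[of _ a _ b]) (auto simp: harmonic_polys_def)

text \<open>The Laplacian of a product of harmonic polynomials is twice the product of
  their gradients, whose components are harmonic of one degree less. Green's formula thus lowers both degrees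
  until one factor is constant.\<close>

lemma sphere_mean_harm_orthogonal:
  fixes h g :: "complex ^ 'n \<Rightarrow> complex"
  assumes "h \<in> harmonic_polys a" "g \<in> harmonic_polys b" "a \<noteq> b"
  shows "sphere_mean (\<lambda>z. h z * g z) = 0"
  using assms
proof (induction a arbitrary: b h g)
  case 0
  then have h: "pd j h = (\<lambda>z. 0)" for j using pd_hom_polys_0 harm_hom_polys by blast
  have "(\<lambda>z. h z * g z) \<in> hom_polys (0 + b)" using 0 by (intro hom_polys_mult harm_hom_polys)
  then show ?case using lap_mult_harm[OF 0(1,2)] 0(3) unfolding h by (intro sphere_mean_lap(2)) auto
next
  case (Suc a)
  note hg = hom_polys_mult[OF harm_hom_polys[OF Suc.prems(1)] harm_hom_polys[OF Suc.prems(2)]]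
  show ?case
  proof (cases b)
    case 0
    then have g: "pd j g = (\<lambda>z. 0)" for j using Suc.prems pd_hom_polys_0 harm_hom_polys by blast
    show ?thesis using lap_mult_harm[OF Suc.prems(1,2)] unfolding g by (intro sphere_mean_lap(2)[OF hg]) auto
  next
    case (Suc b')
    have "sphere_mean (\<lambda>z. pd j h z * pd j g z) = 0" for j
      using pd_harmonic_polys[OF Suc.prems(1), of j] pd_harmonic_polys[OF Suc.prems(2), of j] Suc.prems(3) Suc
      by (intro Suc.IH[where b=b']) auto
    then have "sphere_mean (lap (\<lambda>z. h z * g z)) = 0"
      unfolding lap_mult_harm[OF Suc.prems(1,2)] sphere_mean_cmult
      using continuous_hom_polys[OF pd_hom_polys[OF harm_hom_polys[OF Suc.prems(1)]]]
        continuous_hom_polys[OF pd_hom_polys[OF harm_hom_polys[OF Suc.prems(2)]]]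
      by (subst sphere_mean_sum) (auto intro!: continuous_on_mult)
    then have "of_nat (Suc a + b) * (of_nat (Suc a + b) + of_nat CARD('n) - 2) * sphere_mean (\<lambda>z. h z * g z) = 0"
      using sphere_mean_lap(1)[OF hg] by simp
    moreover have nz: "(of_nat (Suc a + b) + of_nat CARD('n) - 2 :: complex) = of_nat (a + b' + CARD('n))"
      using Suc by simp
    ultimately show ?thesis unfolding nz mult_eq_0_iff of_nat_eq_0_iff by simp
  qed
qed

lemma pd_bdot_power: "pd j (\<lambda>z. bdot z w ^ k) = (\<lambda>z. of_nat k * bdot z w ^ (k - 1) * w $ j)"
proof (induction k)
  case (Suc k)
  have "pd j (\<lambda>z. bdot z w * bdot z w ^ k) = (\<lambda>z. w $ j * bdot z w ^ k + bdot z w * (of_nat k * bdot z w ^ (k - 1) * w $ j))"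
    unfolding pd_mult[OF pdiff_hom_polys[OF hom_polys_bdot] pdiff_hom_polys[OF hom_polys_power[OF hom_polys_bdot]]] Suc pd_bdot ..
  then show ?case by (cases k) (auto simp: fun_eq_iff algebra_simps)
qed (simp add: pd_const)

lemma lap_bdot_power: "lap (\<lambda>z. bdot z w ^ k) = (\<lambda>z. of_nat k * of_nat (k - 1) * bdot z w ^ (k - 2) * bdot w w)"
proof -
  have "pd j (pd j (\<lambda>z. bdot z w ^ k)) = (\<lambda>z. (of_nat k * w $ j) * (of_nat (k - 1) * bdot z w ^ (k - 1 - 1) * w $ j))" for j
  proof -
    have "pd j (\<lambda>z. bdot z w ^ k) = (\<lambda>z. (of_nat k * w $ j) * bdot z w ^ (k - 1))"
      unfolding pd_bdot_power by (simp add: algebra_simps)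
    then show ?thesis
      using pd_cmult[OF pdiff_hom_polys[OF hom_polys_power[OF hom_polys_bdot]], of j "of_nat k * w $ j" w "k - 1"]
      unfolding pd_bdot_power by simp
  qed
  then show ?thesis unfolding complex_laplacian_eq bdot_def[of w w]
    by (simp add: sum_distrib_left algebra_simps numeral_2_eq_2)
qed

lemma sphere_mean_const: "sphere_mean (\<lambda>z::complex^'n. c) = c"
  using unit_ball_vol_neq_0[of "CARD('n)"]
  by (simp add: sphere_mean_def set_lebesgue_integral_def content_ball scaleR_conv_of_real emeasure_ball)

text \<open>Induction on \<open>k\<close> by Green's formula. In the Laplacian of \<open>h(z) (zw)\<^sup>k\<close> the term with
  \<open>(zw)\<^sup>k\<^sup>-\<^sup>2\<close> has mean zero, and the other one pairs the derivative of \<open>h\<close> in direction \<open>w\<close> with \<open>(zw)\<^sup>k\<^sup>-\<^sup>1\<close>.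
  At \<open>k = m\<close> Euler's identity turns that derivative, evaluated at \<open>w\<close>, into \<open>m h(w)\<close>.\<close>

lemma sphere_mean_harm_bdot_power:
  fixes h :: "complex ^ 'n \<Rightarrow> complex" and w
  assumes "h \<in> harmonic_polys m" "k \<le> m"
  shows "sphere_mean (\<lambda>z. h z * bdot z w ^ k) = (if k = m then fact m / (2 ^ m * pochhammer (of_nat CARD('n) / 2) m) * h w else 0)"
  using assms
proof (induction k arbitrary: m h rule: less_induct)
  case (less k)
  note h = harm_hom_polys[OF less.prems(1)]
  show ?case
  proof (cases "k = 0")
    case True
    show ?thesis
    proof (cases "m = 0")
      case m: True
      have "h z = h 0" for z using hom_polys_scale[OF h, of 0 z] m by simp
      then have "h = (\<lambda>z. h w)" by metis
      then have "sphere_mean h = h w" using sphere_mean_const[of "h w"] by metis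
      then show ?thesis using m True by simp
    next
      case False
      then show ?thesis using True sphere_mean_lap(2)[OF h] less.prems by (simp add: harmonic_polys_def)
    qed
  next
    case False
    define D where "D = (\<lambda>z. \<Sum>j\<in>UNIV. w $ j * pd j h z)"
    have "D \<in> harmonic_polys (m - 1)"
    proof -
      have "(\<lambda>z. \<Sum>j\<in>S. w $ j * pd j h z) \<in> harmonic_polys (m - 1)" if "finite S" for S
        using that
      proof (induction S rule: finite_induct)
        case (insert x F)
        show ?case unfolding sum.insert[OF insert(1,2)] by (intro harmonic_polys_add harmonic_polys_cmult pd_harmonic_polys less.prems(1) insert.IH)
      qed (simp add: harmonic_polys_zero)
      from this[OF finite] show ?thesis unfolding D_def .
    qed
    define c where "c = (\<lambda>m. fact m / (2 ^ m * pochhammer (of_nat CARD('n) / 2) m) :: complex)"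
    have sD: "sphere_mean (\<lambda>z. D z * bdot z w ^ (k - 1)) = (if k = m then c (m - 1) * D w else 0)"
    proof -
      have "sphere_mean (\<lambda>z. D z * bdot z w ^ (k - 1)) = (if k - 1 = m - 1 then c (m - 1) * D w else 0)"
      proof -
        have k: "k - 1 < k" "k - 1 \<le> m - 1" using False less.prems(2) by auto
        show ?thesis unfolding c_def by (rule less.IH[OF k(1) \<open>D \<in> harmonic_polys (m - 1)\<close> k(2)])
      qed
      moreover have "k - 1 = m - 1 \<longleftrightarrow> k = m" using False less.prems(2) by auto
      ultimately show ?thesis by simp
    qed
    have sh: "of_nat (k - 1) * sphere_mean (\<lambda>z. h z * bdot z w ^ (k - 2)) = 0"
    proof (cases "k = 1")
      case k1: False
      have "sphere_mean (\<lambda>z. h z * bdot z w ^ (k - 2)) = (if k - 2 = m then fact m / (2 ^ m * pochhammer (of_nat CARD('n) / 2) m) * h w else 0)"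
      proof -
        have k: "k - 2 < k" "k - 2 \<le> m" using False less.prems(2) by auto
        show ?thesis by (rule less.IH[OF k(1) less.prems(1) k(2)])
      qed
      moreover have "k - 2 \<noteq> m" using False less.prems(2) by auto
      ultimately show ?thesis by simp
    qed simp
    have q: "(\<lambda>z. h z * bdot z w ^ k) \<in> hom_polys (m + k)"
      using hom_polys_mult[OF h hom_polys_power[OF hom_polys_bdot, of w k]] by simp
    have "lap (\<lambda>z. h z * bdot z w ^ k) = (\<lambda>z. 2 * (\<Sum>j\<in>UNIV. pd j h z * (of_nat k * bdot z w ^ (k - 1) * w $ j)) +
       h z * (of_nat k * of_nat (k - 1) * bdot z w ^ (k - 2) * bdot w w))"
      using less.prems unfolding lap_mult[OF h hom_polys_power[OF hom_polys_bdot]] lap_bdot_power pd_bdot_power by (simp add: harmonic_polys_def)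
    also have "\<dots> = (\<lambda>z. (2 * of_nat k) * (D z * bdot z w ^ (k - 1)) + (of_nat k * bdot w w) * (of_nat (k - 1) * (h z * bdot z w ^ (k - 2))))"
      unfolding D_def by (simp add: sum_distrib_left sum_distrib_right algebra_simps)
    finally have L: "lap (\<lambda>z. h z * bdot z w ^ k) = (\<lambda>z. (2 * of_nat k) * (D z * bdot z w ^ (k - 1)) + (of_nat k * bdot w w) * (of_nat (k - 1) * (h z * bdot z w ^ (k - 2))))" .
    then have "sphere_mean (lap (\<lambda>z. h z * bdot z w ^ k)) = (2 * of_nat k) * sphere_mean (\<lambda>z. D z * bdot z w ^ (k - 1))
       + (of_nat k * bdot w w) * (of_nat (k - 1) * sphere_mean (\<lambda>z. h z * bdot z w ^ (k - 2)))"
    proof -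
      have "sphere_mean (\<lambda>z. (2 * of_nat k) * (D z * bdot z w ^ (k - 1)) + (of_nat k * bdot w w) * (of_nat (k - 1) * (h z * bdot z w ^ (k - 2)))) =
        sphere_mean (\<lambda>z. (2 * of_nat k) * (D z * bdot z w ^ (k - 1))) + sphere_mean (\<lambda>z. (of_nat k * bdot w w) * (of_nat (k - 1) * (h z * bdot z w ^ (k - 2))))"
      proof (rule sphere_mean_add)
        have c: "continuous_on UNIV (\<lambda>z. bdot z w ^ i)" for i by (intro continuous_intros)
        show "continuous_on UNIV (\<lambda>z. (2 * of_nat k) * (D z * bdot z w ^ (k - 1)))"
          by (intro continuous_on_mult continuous_on_const c continuous_hom_polys[OF harm_hom_polys[OF \<open>D \<in> harmonic_polys (m - 1)\<close>]])
        show "continuous_on UNIV (\<lambda>z. (of_nat k * bdot w w) * (of_nat (k - 1) * (h z * bdot z w ^ (k - 2))))"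
          by (intro continuous_on_mult continuous_on_const c continuous_hom_polys[OF h])
      qed
      then show ?thesis using L by (simp only: sphere_mean_cmult)
    qed
    then have E: "of_nat (m + k) * (of_nat (m + k) + of_nat CARD('n) - 2) * sphere_mean (\<lambda>z. h z * bdot z w ^ k) =
       (2 * of_nat k) * (if k = m then c (m - 1) * D w else 0)"
      unfolding sphere_mean_lap(1)[OF q] sD sh by simp
    have nz: "(of_nat (m + k) + of_nat CARD('n) - 2 :: complex) = of_nat (m + k + CARD('n) - 2)"
      using False less.prems by (simp add: of_nat_diff)
    have nz': "m + k \<noteq> 0" "m + k + CARD('n) - 2 \<noteq> 0"
    proof -
      have "0 < CARD('n)" by simp
      then show "m + k \<noteq> 0" "m + k + CARD('n) - 2 \<noteq> 0" using False less.prems(2) by linarith+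
    qed
    show ?thesis
    proof (cases "k = m")
      case False
      then have "of_nat (m + k) * of_nat (m + k + CARD('n) - 2) * sphere_mean (\<lambda>z. h z * bdot z w ^ k) = 0"
        using E unfolding nz by simp
      then show ?thesis using nz' False by (simp only: mult_eq_0_iff of_nat_eq_0_iff) simp
    next
      case True
      obtain m' where m': "m = Suc m'" using True \<open>k \<noteq> 0\<close> by (cases m) auto
      define \<mu> :: complex where "\<mu> = of_nat CARD('n) / 2"
      have muk: "\<mu> + of_nat m' \<noteq> 0"
      proof -
        have "\<mu> + of_nat m' = of_nat (CARD('n) + 2 * m') / 2" by (simp add: \<mu>_def)
        moreover have "(of_nat (CARD('n) + 2 * m') :: complex) \<noteq> 0" unfolding of_nat_eq_0_iff by simp
        ultimately show ?thesis by (simp only: divide_eq_0_iff) simp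
      qed
      have ph: "pochhammer \<mu> m' \<noteq> 0"
        unfolding pochhammer_eq_0_iff
      proof
        assume "\<exists>k<m'. \<mu> = - of_nat k"
        then obtain k where "\<mu> = - of_nat k" by blast
        then have "of_nat (CARD('n) + 2 * k) = (0::complex)" by (simp add: \<mu>_def field_simps)
        then show False by (simp only: of_nat_eq_0_iff) simp
      qed
      have Dw: "D w = of_nat m * h w" unfolding D_def by (rule hom_polys_Euler[OF h])
      have "of_nat (m + m) * (2 * (\<mu> + of_nat m')) * sphere_mean (\<lambda>z. h z * bdot z w ^ k) = 2 * of_nat m * (c m' * (of_nat m * h w))"
        using E True Dw m' by (simp add: \<mu>_def algebra_simps)
      then have "(2 * of_nat m) * (2 * (\<mu> + of_nat m') * sphere_mean (\<lambda>z. h z * bdot z w ^ k)) = (2 * of_nat m) * (c m' * (of_nat m * h w))"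
        by (simp add: algebra_simps)
      then have "2 * (\<mu> + of_nat m') * sphere_mean (\<lambda>z. h z * bdot z w ^ k) = c m' * (of_nat m * h w)"
        using m' by (subst (asm) mult_cancel_left) (auto simp del: of_nat_Suc)
      then have "sphere_mean (\<lambda>z. h z * bdot z w ^ k) = c m' * (of_nat m * h w) / (2 * (\<mu> + of_nat m'))"
      proof (intro eq_divide_imp)
        show "2 * (\<mu> + of_nat m') \<noteq> 0" using muk by (simp only: mult_eq_0_iff) simp
      qed (simp only: mult.commute)
      then show ?thesis using muk ph True unfolding m' c_def \<mu>_def[symmetric]
        by (simp add: pochhammer_Suc field_simps)
    qed
  qed
qed

section \<open>Zonal polyharmonics as explicit polynomials\<close>

text \<open>With \<open>\<mu> = n/2\<close> these are the coefficients of \<open>C\<^sub>m - C\<^sub>m\<^sub>-\<^sub>2\<close> for the Gegenbauer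
  polynomials \<open>C\<close> of index \<open>\<mu>\<close>; see \<open>zonal_coeff_eq_gegenbauer_coeff\<close>. Where \<open>a + b - 1\<close> is truncated, the term
  carries the factor \<open>b = 0\<close>.\<close>

definition zonal_coeff :: "complex \<Rightarrow> nat \<Rightarrow> nat \<Rightarrow> complex" where
  "zonal_coeff \<mu> a b = (-1) ^ b * 2 ^ a / (fact a * fact b) * (pochhammer \<mu> (a + b) + of_nat b * pochhammer \<mu> (a + b - 1))"

text \<open>The homogeneous form of the classical zonal harmonic, a polynomial in \<open>zw\<close> and
  \<open>|z|\<^sup>2|w|\<^sup>2\<close> and therefore meaningful for complex \<open>z\<close> and \<open>w\<close>.\<close>

definition zonal_harmonic :: "nat \<Rightarrow> complex ^ 'n \<Rightarrow> complex ^ 'n \<Rightarrow> complex" where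
  "zonal_harmonic m z w = (\<Sum>b\<le>m div 2. zonal_coeff (of_nat CARD('n) / 2) (m - 2 * b) b * bdot w w ^ b * (bdot z z ^ b * bdot z w ^ (m - 2 * b)))"

text \<open>By Almansi's decomposition the polyharmonic polynomials of degree \<open>m\<close> restrict to the
  sphere as an orthogonal sum of harmonic ones of degrees \<open>m - 2k\<close>, and reproducing kernels of orthogonal
  summands add up.\<close>

definition zonal_poly :: "nat \<Rightarrow> nat \<Rightarrow> complex ^ 'n \<Rightarrow> complex ^ 'n \<Rightarrow> complex" where
  "zonal_poly p m z w = (\<Sum>k | k < p \<and> 2 * k \<le> m. bdot w w ^ k * (bdot z z ^ k * zonal_harmonic (m - 2 * k) z w))"

text \<open>The condition for neighbouring terms of \<open>\<Delta>\<close> of the zonal sum to cancel.\<close>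

lemma zonal_coeff_recurrence:
  "zonal_coeff \<mu> (a + 2) b * (of_nat (a + 2) * of_nat (a + 1)) +
   zonal_coeff \<mu> a (b + 1) * (2 * of_nat (b + 1) * (2 * of_nat (b + 1) + 2 * \<mu> + 2 * of_nat a - 2)) = 0"
proof -
  define P where "P = pochhammer \<mu> (a + b)"
  define C :: complex where "C = (-1) ^ b * 2 ^ a / (fact a * fact b)"
  have P1: "pochhammer \<mu> (a + b + 1) = (\<mu> + of_nat (a + b)) * P" by (simp add: P_def pochhammer_Suc algebra_simps)
  have P2: "pochhammer \<mu> (a + 2 + b) = (\<mu> + of_nat (a + b) + 1) * ((\<mu> + of_nat (a + b)) * P)"
    by (simp add: P_def pochhammer_Suc algebra_simps)
  have 1: "zonal_coeff \<mu> (a + 2) b * (of_nat (a + 2) * of_nat (a + 1)) =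
    C * 4 * (((\<mu> + of_nat (a + b)) * P) * (\<mu> + of_nat (a + 2 * b + 1)))"
  proof -
    have "fact (a + 2) = (of_nat (a + 2) * of_nat (a + 1)) * (fact a :: complex)" by (simp add: algebra_simps)
    moreover have "(of_nat (a + 2) * of_nat (a + 1) :: complex) \<noteq> 0" unfolding mult_eq_0_iff of_nat_eq_0_iff by simp
    moreover have "a + 2 + b - 1 = a + b + 1" by simp
    ultimately have "zonal_coeff \<mu> (a + 2) b * (of_nat (a + 2) * of_nat (a + 1)) = (-1) ^ b * 2 ^ (a + 2) / (fact a * fact b) * (pochhammer \<mu> (a + 2 + b) + of_nat b * pochhammer \<mu> (a + b + 1))"
      unfolding zonal_coeff_def by (simp del: of_nat_add fact_Suc add: divide_simps)
    moreover have "(-1) ^ b * 2 ^ (a + 2) / (fact a * fact b) = C * 4" by (simp add: C_def)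
    ultimately have "zonal_coeff \<mu> (a + 2) b * (of_nat (a + 2) * of_nat (a + 1)) = C * 4 * (pochhammer \<mu> (a + 2 + b) + of_nat b * pochhammer \<mu> (a + b + 1))"
      by (simp only:)
    then show ?thesis unfolding P1 P2 by (simp add: algebra_simps)
  qed
  have 2: "zonal_coeff \<mu> a (b + 1) * (2 * of_nat (b + 1) * (2 * of_nat (b + 1) + 2 * \<mu> + 2 * of_nat a - 2)) =
    - (C * 4 * ((\<mu> + of_nat (a + 2 * b + 1)) * P * (\<mu> + of_nat (a + b))))"
  proof -
    have f: "fact (b + 1) = of_nat (b + 1) * (fact b :: complex)" by simp
    have nz: "(of_nat (b + 1) :: complex) \<noteq> 0" unfolding of_nat_eq_0_iff by simp
    have "zonal_coeff \<mu> a (b + 1) = - ((-1) ^ b) * 2 ^ a / (fact a * (of_nat (b + 1) * fact b)) * ((\<mu> + of_nat (a + 2 * b + 1)) * P)"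
      unfolding zonal_coeff_def f using P1 by (simp add: P_def[symmetric] algebra_simps)
    then have "zonal_coeff \<mu> a (b + 1) * of_nat (b + 1) = - C * ((\<mu> + of_nat (a + 2 * b + 1)) * P)"
      using nz by (simp del: of_nat_add add: divide_simps C_def mult_ac)
    then have "zonal_coeff \<mu> a (b + 1) * of_nat (b + 1) * (2 * (2 * of_nat (b + 1) + 2 * \<mu> + 2 * of_nat a - 2)) =
       - C * ((\<mu> + of_nat (a + 2 * b + 1)) * P) * (2 * (2 * of_nat (b + 1) + 2 * \<mu> + 2 * of_nat a - 2))"
      by simp
    then show ?thesis by (simp add: algebra_simps)
  qed
  show ?thesis unfolding 1 2 by (simp add: algebra_simps)
qed

lemma zonal_harmonic_hom_polys: "(\<lambda>z. zonal_harmonic m z w) \<in> hom_polys m"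
  unfolding zonal_harmonic_def
proof (intro hom_polys_sum hom_polys_cmult)
  fix b assume "b \<in> {..m div 2}"
  then have "b * 2 + (m - 2 * b) = m" by auto
  then show "(\<lambda>z. bdot z z ^ b * bdot z w ^ (m - 2 * b)) \<in> hom_polys m"
    using hom_polys_mult[OF hom_polys_power[OF hom_polys_bdot_self, of b] hom_polys_power[OF hom_polys_bdot, of w "m - 2 * b"]] by simp
qed

text \<open>The Laplacian sends the term of index \<open>b\<close> to two terms, \<open>g\<close> and \<open>f\<close>, and \<open>f\<close> cancels the \<open>g\<close>
  of the next index.\<close>

lemma zonal_harmonic_harm:
  fixes w :: "complex ^ 'n"
  shows "(\<lambda>z. zonal_harmonic m z w) \<in> harmonic_polys m"
proof -
  let ?M = "m div 2"
  define \<mu> :: complex where "\<mu> = of_nat CARD('n) / 2"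
  define f where "f z b = zonal_coeff \<mu> (m - 2 * b) b * bdot w w ^ b * (bdot z z ^ b * (of_nat (m - 2 * b) * of_nat (m - 2 * b - 1) * bdot z w ^ (m - 2 * b - 2) * bdot w w))" for z b
  define g where "g z b = zonal_coeff \<mu> (m - 2 * b) b * bdot w w ^ b * (2 * of_nat b * (2 * of_nat b + of_nat CARD('n) + 2 * of_nat (m - 2 * b) - 2) * bdot z z ^ (b - 1) * bdot z w ^ (m - 2 * b))" for z b
  have "lap (\<lambda>z. zonal_harmonic m z w) = (\<lambda>z. \<Sum>b\<le>?M. lap (\<lambda>z. zonal_coeff \<mu> (m - 2 * b) b * bdot w w ^ b * (bdot z z ^ b * bdot z w ^ (m - 2 * b))) z)"
    unfolding zonal_harmonic_def \<mu>_def
  proof (intro lap_sum hom_polys_cmult)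
    fix b assume "b \<in> {..m div 2}"
    then have "b * 2 + (m - 2 * b) = m" by auto
    then show "(\<lambda>z. bdot z z ^ b * bdot z w ^ (m - 2 * b)) \<in> hom_polys m"
      using hom_polys_mult[OF hom_polys_power[OF hom_polys_bdot_self, of b] hom_polys_power[OF hom_polys_bdot, of w "m - 2 * b"]] by simp
  qed auto
  also have "\<dots> = (\<lambda>z. \<Sum>b\<le>?M. g z b + f z b)"
  proof (intro ext sum.cong refl)
    fix z b
    have s: "(\<lambda>z. bdot z w ^ (m - 2 * b)) \<in> hom_polys (m - 2 * b)"
      using hom_polys_power[OF hom_polys_bdot, of w "m - 2 * b"] by simp
    show "lap (\<lambda>z. zonal_coeff \<mu> (m - 2 * b) b * bdot w w ^ b * (bdot z z ^ b * bdot z w ^ (m - 2 * b))) z = g z b + f z b"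
      unfolding lap_cmult[OF hom_polys_mult[OF hom_polys_power[OF hom_polys_bdot_self] s]]
        lap_bdot_power_mult[OF s] lap_bdot_power f_def g_def by (simp only: distrib_left)
  qed
  also have "\<dots> = (\<lambda>z. 0)"
  proof
    fix z
    have fM: "f z ?M = 0"
    proof -
      have "m - 2 * ?M = 0 \<or> m - 2 * ?M - 1 = 0" by presburger
      then show ?thesis unfolding f_def by (elim disjE; simp only: of_nat_0 mult_zero_left mult_zero_right)
    qed
    have g0: "g z 0 = 0" by (simp add: g_def)
    have fg: "f z b + g z (Suc b) = 0" if "b < ?M" for b
    proof -
      define a where "a = m - 2 * b - 2"
      have a: "m - 2 * b = a + 2" "m - 2 * Suc b = a" using that by (auto simp: a_def)
      have n: "of_nat CARD('n) = 2 * \<mu>" by (simp add: \<mu>_def)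
      have "f z b + g z (Suc b) = bdot w w ^ (b + 1) * bdot z z ^ b * bdot z w ^ a *
        (zonal_coeff \<mu> (a + 2) b * (of_nat (a + 2) * of_nat (a + 1)) +
         zonal_coeff \<mu> a (b + 1) * (2 * of_nat (b + 1) * (2 * of_nat (b + 1) + 2 * \<mu> + 2 * of_nat a - 2)))"
        unfolding f_def g_def a n by (simp add: algebra_simps)
      then show ?thesis unfolding zonal_coeff_recurrence by simp
    qed
    have "(\<Sum>b\<le>?M. g z b + f z b) = (\<Sum>b\<le>?M. g z b) + (\<Sum>b\<le>?M. f z b)" by (rule sum.distrib)
    also have "(\<Sum>b\<le>?M. g z b) = (\<Sum>b<?M. g z (Suc b))" by (simp add: sum.atMost_shift g0)
    also have "(\<Sum>b\<le>?M. f z b) = (\<Sum>b<?M. f z b)" by (simp add: lessThan_Suc_atMost[symmetric] fM)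
    also have "(\<Sum>b<?M. g z (Suc b)) + (\<Sum>b<?M. f z b) = (\<Sum>b<?M. f z b + g z (Suc b))" by (simp add: sum.distrib)
    also have "\<dots> = 0" using fg by simp
    finally show "(\<Sum>b\<le>?M. g z b + f z b) = 0" .
  qed
  finally show ?thesis using zonal_harmonic_hom_polys by (simp add: harmonic_polys_def)
qed

lemma pochhammer_half_neq_0: "n > 0 \<Longrightarrow> pochhammer (of_nat n / 2 :: complex) m \<noteq> 0"
proof
  assume n: "n > 0" and "pochhammer (of_nat n / 2 :: complex) m = 0"
  then obtain k where "(of_nat n / 2 :: complex) = - of_nat k" unfolding pochhammer_eq_0_iff by blast
  then have "(of_nat (n + 2 * k) :: complex) = 0" by (simp add: field_simps)
  then show False using n unfolding of_nat_eq_0_iff by simp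
qed

text \<open>In equal degrees only the term \<open>b = 0\<close> of the zonal sum pairs nontrivially with \<open>h\<close>,
  because the others contain lower powers of \<open>zw\<close>. So the harmonicity of \<open>zonal_harmonic\<close> serves
  unequal degrees, and its leading coefficient fixes the normalisation.\<close>

lemma sphere_mean_harm_zonal_harmonic:
  fixes h :: "complex ^ 'n \<Rightarrow> complex"
  assumes h: "h \<in> harmonic_polys l"
  shows "sphere_mean (\<lambda>z. h z * zonal_harmonic m z w) = (if m = l then h w else 0)"
proof (cases "m = l")
  case False
  then show ?thesis using sphere_mean_harm_orthogonal[OF h zonal_harmonic_harm] by auto
next
  case True
  have c: "continuous_on UNIV (\<lambda>z. C * (bdot z z ^ b * (h z * bdot z w ^ a)))" for C b a
    by (intro continuous_on_mult continuous_on_const continuous_on_power continuous_on_bdot continuous_on_id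
        continuous_hom_polys[OF harm_hom_polys[OF h]])
  let ?\<mu> = "of_nat CARD('n) / 2 :: complex"
  have "(\<lambda>z. h z * zonal_harmonic m z w) = (\<lambda>z. \<Sum>b\<le>m div 2. (zonal_coeff ?\<mu> (m - 2 * b) b * bdot w w ^ b) * (bdot z z ^ b * (h z * bdot z w ^ (m - 2 * b))))"
    unfolding zonal_harmonic_def by (simp add: sum_distrib_left algebra_simps)
  then have "sphere_mean (\<lambda>z. h z * zonal_harmonic m z w) = (\<Sum>b\<le>m div 2. (zonal_coeff ?\<mu> (m - 2 * b) b * bdot w w ^ b) * sphere_mean (\<lambda>z. h z * bdot z w ^ (m - 2 * b)))"
    using sphere_mean_sum[of "{..m div 2}" "\<lambda>b z. (zonal_coeff ?\<mu> (m - 2 * b) b * bdot w w ^ b) * (bdot z z ^ b * (h z * bdot z w ^ (m - 2 * b)))"] c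
    by (simp add: sphere_mean_cmult sphere_mean_bdot_power)
  also have "\<dots> = (\<Sum>b\<in>{0}. (zonal_coeff ?\<mu> (m - 2 * b) b * bdot w w ^ b) * sphere_mean (\<lambda>z. h z * bdot z w ^ (m - 2 * b)))"
  proof (rule sum.mono_neutral_right)
    show "\<forall>b\<in>{..m div 2} - {0}. (zonal_coeff ?\<mu> (m - 2 * b) b * bdot w w ^ b) * sphere_mean (\<lambda>z. h z * bdot z w ^ (m - 2 * b)) = 0"
    proof
      fix b assume b: "b \<in> {..m div 2} - {0}"
      then have "m - 2 * b \<le> l" "m - 2 * b \<noteq> l" using True by auto
      then show "(zonal_coeff ?\<mu> (m - 2 * b) b * bdot w w ^ b) * sphere_mean (\<lambda>z. h z * bdot z w ^ (m - 2 * b)) = 0"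
        using sphere_mean_harm_bdot_power[OF h, of "m - 2 * b" w] by simp
    qed
  qed auto
  also have "\<dots> = zonal_coeff ?\<mu> l 0 * (fact l / (2 ^ l * pochhammer ?\<mu> l) * h w)"
    using sphere_mean_harm_bdot_power[OF h, of l w] True by simp
  also have "\<dots> = h w"
    unfolding zonal_coeff_def using pochhammer_half_neq_0[of "CARD('n)" l] by (simp add: divide_simps)
  finally show ?thesis using True by simp
qed

lemma zonal_poly_hom_polys: "(\<lambda>z. zonal_poly p m z w) \<in> hom_polys m"
  unfolding zonal_poly_def
proof (intro hom_polys_sum hom_polys_cmult)
  fix k assume "k \<in> {k. k < p \<and> 2 * k \<le> m}"
  then have "k * 2 + (m - 2 * k) = m" by auto
  then show "(\<lambda>z. bdot z z ^ k * zonal_harmonic (m - 2 * k) z w) \<in> hom_polys m"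
    using hom_polys_mult[OF hom_polys_power[OF hom_polys_bdot_self, of k] zonal_harmonic_hom_polys[of "m - 2 * k" w]] by simp
qed

lemma lap_iter_bdot_power_harm_zero:
  assumes g: "g \<in> harmonic_polys d" and "k < p"
  shows "(lap ^^ p) (\<lambda>z. bdot z z ^ k * g z) = (\<lambda>z. 0)"
proof -
  obtain c where c: "(lap ^^ k) (\<lambda>z. bdot z z ^ k * g z) = (\<lambda>z. c * g z)"
    using lap_iter_bdot_power_harm[OF g] by blast
  have "(p - Suc k) + Suc k = p" using assms by simp
  then have pk: "lap ^^ p = lap ^^ (p - Suc k) \<circ> lap ^^ Suc k" by (simp only: funpow_add[symmetric])
  have "(lap ^^ p) (\<lambda>z. bdot z z ^ k * g z) = (lap ^^ (p - Suc k)) (lap ((lap ^^ k) (\<lambda>z. bdot z z ^ k * g z)))"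
    unfolding pk by (simp only: comp_apply funpow.simps(2))
  also have "lap ((lap ^^ k) (\<lambda>z. bdot z z ^ k * g z)) = (\<lambda>z. 0)"
    unfolding c using harmonic_polys_cmult[OF g, of c] by (simp add: harmonic_polys_def)
  finally show ?thesis by (simp add: lap_iter_zero)
qed

lemma lap_iter_sum:
  "finite S \<Longrightarrow> (\<And>i. i \<in> S \<Longrightarrow> f i \<in> hom_polys m) \<Longrightarrow> (lap ^^ p) (\<lambda>z. \<Sum>i\<in>S. f i z) = (\<lambda>z. \<Sum>i\<in>S. (lap ^^ p) (f i) z)"
proof (induction S rule: finite_induct)
  case (insert x F)
  have "(lap ^^ p) (\<lambda>z. f x z + (\<Sum>i\<in>F. f i z)) = (\<lambda>z. (lap ^^ p) (f x) z + (lap ^^ p) (\<lambda>z. \<Sum>i\<in>F. f i z) z)"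
    using insert by (intro lap_iter_add hom_polys_sum) auto
  then show ?case using insert by simp
qed (simp add: lap_iter_zero)

lemma zonal_poly_polyharmonic: "(\<lambda>z. zonal_poly p m z w) \<in> polyharmonic_polys p m"
proof -
  have h: "(\<lambda>z. bdot z z ^ k * zonal_harmonic (m - 2 * k) z w) \<in> hom_polys m" if "2 * k \<le> m" for k
  proof -
    have "k * 2 + (m - 2 * k) = m" using that by auto
    then show "(\<lambda>z. bdot z z ^ k * zonal_harmonic (m - 2 * k) z w) \<in> hom_polys m"
      using hom_polys_mult[OF hom_polys_power[OF hom_polys_bdot_self, of k] zonal_harmonic_hom_polys[of "m - 2 * k" w]] by simp
  qed
  have "(lap ^^ p) (\<lambda>z. zonal_poly p m z w) = (\<lambda>z. \<Sum>k | k < p \<and> 2 * k \<le> m. (lap ^^ p) (\<lambda>z. bdot w w ^ k * (bdot z z ^ k * zonal_harmonic (m - 2 * k) z w)) z)"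
    unfolding zonal_poly_def using h by (intro lap_iter_sum hom_polys_cmult) auto
  also have "\<dots> = (\<lambda>z. 0)"
    using h by (simp add: lap_iter_cmult[where m=m] lap_iter_bdot_power_harm_zero[OF zonal_harmonic_harm])
  finally show ?thesis using zonal_poly_hom_polys by (simp add: polyharmonic_polys_def)
qed

lemma continuous_zonal_harmonic: "continuous_on UNIV (\<lambda>z. zonal_harmonic m z w)"
  using continuous_hom_polys[OF zonal_harmonic_hom_polys] .

text \<open>Pair the Almansi components of \<open>q\<close> with the summands of \<open>zonal_poly\<close>: on the sphere
  only harmonic pieces of equal degree interact. The second part isolates the degrees that this alone
  separates; the rotations take care of the remaining ones.\<close>

lemma sphere_mean_polyharmonic_zonal_poly:
  fixes q :: "complex ^ 'n \<Rightarrow> complex"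
  assumes q: "q \<in> polyharmonic_polys p m"
  shows "sphere_mean (\<lambda>z. q z * zonal_poly p m z w) = q w"
    and "(\<And>i j. i < p \<Longrightarrow> j < p \<Longrightarrow> m + 2 * j \<noteq> m' + 2 * i) \<Longrightarrow> sphere_mean (\<lambda>z. q z * zonal_poly p m' z w) = 0"
proof -
  have "q \<in> hom_polys m" "(lap ^^ p) q = (\<lambda>z. 0)" using q by (auto simp: polyharmonic_polys_def)
  from Almansi_decomposition[OF this] obtain h where h: "\<And>k. h k \<in> harmonic_polys (m - 2 * k)"
    "\<And>k. m < 2 * k \<Longrightarrow> h k = (\<lambda>z. 0)" "\<And>z. q z = (\<Sum>k<p. bdot z z ^ k * h k z)" by blast
  have E: "sphere_mean (\<lambda>z. q z * zonal_poly p M z w) = (\<Sum>i<p. \<Sum>k | k < p \<and> 2 * k \<le> M. bdot w w ^ k * (if M - 2 * k = m - 2 * i then h i w else 0))" for M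
  proof -
    let ?F = "\<lambda>i k z. bdot w w ^ k * (bdot z z ^ (i + k) * (h i z * zonal_harmonic (M - 2 * k) z w))"
    have c: "continuous_on UNIV (?F i k)" for i k
      by (intro continuous_on_mult continuous_on_const continuous_on_power continuous_on_bdot continuous_on_id
          continuous_zonal_harmonic continuous_hom_polys[OF harm_hom_polys[OF h(1)]])
    have "(\<lambda>z. q z * zonal_poly p M z w) = (\<lambda>z. \<Sum>i<p. \<Sum>k | k < p \<and> 2 * k \<le> M. ?F i k z)"
      unfolding h(3) zonal_poly_def sum_product by (intro ext sum.cong refl) (simp add: power_add mult_ac)
    then have "sphere_mean (\<lambda>z. q z * zonal_poly p M z w) = sphere_mean (\<lambda>z. \<Sum>i<p. \<Sum>k | k < p \<and> 2 * k \<le> M. ?F i k z)" by simp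
    also have "\<dots> = (\<Sum>i<p. sphere_mean (\<lambda>z. \<Sum>k | k < p \<and> 2 * k \<le> M. ?F i k z))"
      by (rule sphere_mean_sum) (use c in \<open>auto intro!: continuous_on_sum\<close>)
    also have "\<dots> = (\<Sum>i<p. \<Sum>k | k < p \<and> 2 * k \<le> M. sphere_mean (?F i k))"
      by (intro sum.cong refl sphere_mean_sum) (use c in auto)
    also have "\<dots> = (\<Sum>i<p. \<Sum>k | k < p \<and> 2 * k \<le> M. bdot w w ^ k * (if M - 2 * k = m - 2 * i then h i w else 0))"
      by (intro sum.cong refl) (simp add: sphere_mean_cmult sphere_mean_bdot_power sphere_mean_harm_zonal_harmonic[OF h(1)])
    finally show ?thesis .
  qed
  show "sphere_mean (\<lambda>z. q z * zonal_poly p m z w) = q w"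
  proof -
    have "(\<Sum>k | k < p \<and> 2 * k \<le> m. bdot w w ^ k * (if m - 2 * k = m - 2 * i then h i w else 0)) = bdot w w ^ i * h i w" if "i < p" for i
    proof (cases "2 * i \<le> m")
      case True
      have "(\<Sum>k | k < p \<and> 2 * k \<le> m. bdot w w ^ k * (if m - 2 * k = m - 2 * i then h i w else 0)) =
        (\<Sum>k | k < p \<and> 2 * k \<le> m. if k = i then bdot w w ^ i * h i w else 0)"
        by (intro sum.cong refl) (use True in auto)
      then show ?thesis using True that by (simp add: sum.delta)
    next
      case False
      then show ?thesis using h(2)[of i] by (simp cong: if_cong)
    qed
    then show ?thesis unfolding E unfolding h(3) by simp
  qed
  show "sphere_mean (\<lambda>z. q z * zonal_poly p m' z w) = 0" if "\<And>i j. i < p \<Longrightarrow> j < p \<Longrightarrow> m + 2 * j \<noteq> m' + 2 * i"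
    unfolding E
  proof (intro sum.neutral ballI)
    fix i k assume ik: "i \<in> {..<p}" "k \<in> {k. k < p \<and> 2 * k \<le> m'}"
    show "bdot w w ^ k * (if m' - 2 * k = m - 2 * i then h i w else 0) = 0"
    proof (cases "m < 2 * i")
      case False
      then have "m' - 2 * k \<noteq> m - 2 * i" using that[of i k] ik by auto
      then show ?thesis by simp
    qed (simp add: h(2))
  qed
qed

lemma vcnj_vcnj [simp]: "vcnj (vcnj z) = z" by (simp add: vcnj_def vec_eq_iff)
lemma vcnj_cvec [simp]: "vcnj (cvec x) = cvec x" by (simp add: vcnj_def cvec_def vec_eq_iff)
lemma vcnj_smult: "vcnj (c *s z) = cnj c *s vcnj z" by (simp add: vcnj_def vec_eq_iff)
lemma cnj_bdot: "cnj (bdot z w) = bdot (vcnj z) (vcnj w)" by (simp add: bdot_def vcnj_def)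

lemma cnj_zonal_coeff: "cnj (zonal_coeff (of_nat n / 2) a b) = zonal_coeff (of_nat n / 2) a b"
proof -
  have "cnj (pochhammer (of_nat n / 2) k) = pochhammer (of_nat n / 2) k" for k
    by (simp add: pochhammer_prod)
  then show ?thesis by (simp add: zonal_coeff_def)
qed

lemma cnj_zonal_poly: "cnj (zonal_poly p m z w) = zonal_poly p m (vcnj z) (vcnj w)"
  unfolding zonal_poly_def zonal_harmonic_def by (simp add: cnj_zonal_coeff cnj_bdot)

lemma zonal_poly_commute: "zonal_poly p m z w = zonal_poly p m w z"
proof -
  have "zonal_harmonic m z w = zonal_harmonic m w z" for m unfolding zonal_harmonic_def by (simp add: bdot_comm[of z w] mult_ac)
  then show ?thesis unfolding zonal_poly_def by (simp add: mult_ac)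
qed

lemma zonal_poly_scale: "zonal_poly p m (c *s z) w = c ^ m * zonal_poly p m z w"
  using hom_polys_scale[OF zonal_poly_hom_polys] .

lemma zonal_poly_scale_right: "zonal_poly p m z (c *s w) = c ^ m * zonal_poly p m z w"
  using zonal_poly_scale[of p m c w z] by (simp add: zonal_poly_commute)

lemma lebesgue_integral_sphere_measure:
  fixes f :: "complex ^ 'n \<Rightarrow> complex"
  assumes f: "continuous_on UNIV f"
  shows "(LINT \<zeta>:sphere 0 1|sphere_measure. f (cvec \<zeta>)) = sphere_mean f"
proof -
  let ?V = "unit_ball_vol (real CARD('n))"
  have V: "?V > 0" by simp
  have c: "continuous_on UNIV (\<lambda>x. f (cvec x))"
    by (rule continuous_on_compose2[OF f continuous_on_cvec[OF continuous_on_id]]) auto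
  have m [measurable]: "(\<lambda>x. f (cvec x)) \<in> borel_measurable borel" using c by (rule borel_measurable_continuous_onI)
  have m2: "(\<lambda>x. indicat_real (sphere 0 1) x *\<^sub>R f (cvec x)) \<in> borel_measurable borel"
    by (intro borel_measurable_scaleR borel_measurable_indicator m) auto
  have m3: "(\<lambda>x::real^'n. indicat_real (sphere 0 1) (sgn x) *\<^sub>R f (cvec (sgn x))) \<in> borel_measurable borel"
    using measurable_compose[OF borel_measurable_sgn_vec m2] .
  have u: "uniform_measure lborel (ball 0 1 :: (real^'n) set) = density lborel (\<lambda>x. ennreal (indicator (ball 0 1) x / ?V))"
    unfolding uniform_measure_def
    by (intro arg_cong2[where f=density] refl ext) (use V in \<open>auto simp: emeasure_ball divide_ennreal[symmetric] indicator_def\<close>)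
  have "(LINT \<zeta>:sphere 0 1|sphere_measure. f (cvec \<zeta>)) =
     (\<integral>x. indicat_real (sphere 0 1) (sgn x) *\<^sub>R f (cvec (sgn x)) \<partial>uniform_measure lborel (ball 0 1 :: (real^'n) set))"
    unfolding set_lebesgue_integral_def sphere_measure_def
    by (rule integral_distr) (use m2 in auto)
  also have "\<dots> = (\<integral>x. (indicator (ball 0 1) x / ?V) *\<^sub>R (indicat_real (sphere 0 1) (sgn x) *\<^sub>R f (cvec (sgn x))) \<partial>lborel)"
    unfolding u using m3 V by (subst integral_density) (auto intro!: borel_measurable_divide borel_measurable_indicator)
  also have "\<dots> = (\<integral>x. (1 / ?V) *\<^sub>R (indicator (ball 0 1) x *\<^sub>R f (cvec (sgn (x :: real^'n)))) \<partial>lborel)"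
  proof (rule integral_discrete_difference[where X="{0}"])
    fix x :: "real ^ 'n" assume "x \<notin> {0}"
    then have "sgn x \<in> sphere 0 1" by (simp add: norm_sgn)
    then show "(indicator (ball 0 1) x / ?V) *\<^sub>R (indicat_real (sphere 0 1) (sgn x) *\<^sub>R f (cvec (sgn x))) = (1 / ?V) *\<^sub>R (indicator (ball 0 1) x *\<^sub>R f (cvec (sgn x)))"
      by (simp add: indicator_def)
  qed auto
  also have "\<dots> = sphere_mean f"
    unfolding sphere_mean_def set_lebesgue_integral_def using V by (simp add: scaleR_conv_of_real divide_inverse)
  finally show ?thesis .
qed

lemma cis_power_cnj: "cis t ^ m * cnj (cis t ^ m) = 1"
  by (simp add: cis_cnj cis_mult flip: power_mult_distrib)

text \<open>All \<open>p\<close> rotated spheres contribute equally, since in equal degrees the unimodular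
  factors cancel.\<close>

lemma sphere_inner_polys:
  fixes q r :: "complex ^ 'n \<Rightarrow> complex"
  assumes p: "p > 0" and q: "q \<in> hom_polys m" and r: "r \<in> hom_polys m" and s: "s \<in> hom_polys m"
    and sr: "\<And>x. cnj (r (cvec x)) = s (cvec x)"
  shows "sphere_inner p (restrict q (Shat p)) (restrict r (Shat p)) = sphere_mean (\<lambda>z. q z * s z)"
proof -
  have "(LINT \<zeta>:sphere 0 1|sphere_measure. \<Sum>j<p. restrict q (Shat p) (rot p j \<zeta>) * cnj (restrict r (Shat p) (rot p j \<zeta>)))
     = (LINT \<zeta>:sphere 0 1|sphere_measure. of_nat p * (q (cvec \<zeta>) * s (cvec \<zeta>)))"
  proof (rule set_lebesgue_integral_cong)
    show "sphere 0 1 \<in> sets sphere_measure" unfolding sphere_measure_def by simp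
    show "\<forall>\<zeta>. \<zeta> \<in> sphere 0 1 \<longrightarrow> (\<Sum>j<p. restrict q (Shat p) (rot p j \<zeta>) * cnj (restrict r (Shat p) (rot p j \<zeta>))) = of_nat p * (q (cvec \<zeta>) * s (cvec \<zeta>))"
    proof (intro allI impI)
      fix \<zeta> :: "real ^ 'n" assume z: "\<zeta> \<in> sphere 0 1"
      have "restrict q (Shat p) (rot p j \<zeta>) * cnj (restrict r (Shat p) (rot p j \<zeta>)) = q (cvec \<zeta>) * s (cvec \<zeta>)" if "j < p" for j
      proof -
        have "rot p j \<zeta> \<in> Shat p" unfolding Shat_def using z that by blast
        then have "restrict q (Shat p) (rot p j \<zeta>) * cnj (restrict r (Shat p) (rot p j \<zeta>)) =
          (cis (real j * pi / real p) ^ m * cnj (cis (real j * pi / real p) ^ m)) * (q (cvec \<zeta>) * cnj (r (cvec \<zeta>)))"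
          by (simp add: rot_def hom_polys_scale[OF q] hom_polys_scale[OF r] mult_ac)
        then show ?thesis unfolding cis_power_cnj sr by simp
      qed
      then show "(\<Sum>j<p. restrict q (Shat p) (rot p j \<zeta>) * cnj (restrict r (Shat p) (rot p j \<zeta>))) = of_nat p * (q (cvec \<zeta>) * s (cvec \<zeta>))"
        by simp
    qed
  qed
  also have "\<dots> = sphere_mean (\<lambda>z. of_nat p * (q z * s z))"
    using lebesgue_integral_sphere_measure[of "\<lambda>z. of_nat p * (q z * s z)"]
    by (simp only: continuous_on_mult continuous_on_const continuous_hom_polys[OF q] continuous_hom_polys[OF s])
  finally show ?thesis unfolding sphere_inner_def using p by (simp add: sphere_mean_cmult)
qed

lemma sphere_inner_commute: "sphere_inner p f g = cnj (sphere_inner p g f)"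
proof -
  have "(LINT \<zeta>:sphere 0 1|sphere_measure. \<Sum>j<p. f (rot p j \<zeta>) * cnj (g (rot p j \<zeta>))) =
    cnj (LINT \<zeta>:sphere 0 1|sphere_measure. \<Sum>j<p. g (rot p j \<zeta>) * cnj (f (rot p j \<zeta>)))"
    unfolding set_lebesgue_integral_def Bochner_Integration.integral_cnj[symmetric]
    by (intro Bochner_Integration.integral_cong refl) (simp add: mult.commute)
  then show ?thesis by (simp add: sphere_inner_def)
qed

text \<open>The explicit polynomial represents evaluation; any other representing function agrees
  with it pointwise by Hermitian symmetry.\<close>

lemma zonal_sphere_eq:
  fixes \<zeta> \<eta> :: "complex ^ 'n"
  assumes p: "p > 0" and "\<zeta> \<in> Shat p" and \<eta>: "\<eta> \<in> Shat p"
  shows "zonal_sphere p m \<zeta> \<eta> = zonal_poly p m \<zeta> (vcnj \<eta>)"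
proof -
  define K where "K \<eta> = restrict (\<lambda>z. zonal_poly p m z (vcnj \<eta>)) (Shat p)" for \<eta> :: "complex ^ 'n"
  have K: "K \<eta> \<in> polyharmonic_Shat p m" for \<eta>
    unfolding K_def polyharmonic_Shat_def using zonal_poly_polyharmonic by blast
  have rep: "f \<eta> = sphere_inner p f (K \<eta>)" if "\<eta> \<in> Shat p" "f \<in> polyharmonic_Shat p m" for f \<eta>
  proof -
    obtain q where q: "q \<in> polyharmonic_polys p m" "f = restrict q (Shat p)"
      using \<open>f \<in> _\<close> by (auto simp: polyharmonic_Shat_def)
    have "sphere_inner p f (K \<eta>) = sphere_mean (\<lambda>z. q z * zonal_poly p m z \<eta>)"
      unfolding q(2) K_def using q(1)
      by (intro sphere_inner_polys[OF p _ zonal_poly_hom_polys zonal_poly_hom_polys]) (auto simp: polyharmonic_polys_def cnj_zonal_poly)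
    also have "\<dots> = q \<eta>" using q(1) by (rule sphere_mean_polyharmonic_zonal_poly)
    finally show ?thesis using q(2) that(1) by simp
  qed
  have "(THE f. f \<in> polyharmonic_Shat p m \<and> (\<forall>q\<in>polyharmonic_Shat p m. q \<eta> = sphere_inner p q f)) = K \<eta>"
  proof (rule the_equality)
    show "K \<eta> \<in> polyharmonic_Shat p m \<and> (\<forall>q\<in>polyharmonic_Shat p m. q \<eta> = sphere_inner p q (K \<eta>))"
      using K rep[OF \<eta>] by blast
  next
    fix f assume f: "f \<in> polyharmonic_Shat p m \<and> (\<forall>q\<in>polyharmonic_Shat p m. q \<eta> = sphere_inner p q f)"
    show "f = K \<eta>"
    proof (rule extensionalityI)
      show "f \<in> extensional (Shat p)" "K \<eta> \<in> extensional (Shat p)" using f by (auto simp: polyharmonic_Shat_def K_def)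
      fix z :: "complex ^ 'n" assume z: "z \<in> Shat p"
      have "f z = sphere_inner p f (K z)" using f z by (intro rep) auto
      also have "\<dots> = cnj (sphere_inner p (K z) f)" by (rule sphere_inner_commute)
      also have "\<dots> = cnj (K z \<eta>)" using f K by simp
      also have "K z \<eta> = sphere_inner p (K z) (K \<eta>)" by (rule rep[OF \<eta> K])
      also have "cnj \<dots> = sphere_inner p (K \<eta>) (K z)" by (rule sphere_inner_commute[symmetric])
      also have "\<dots> = K \<eta> z" by (rule rep[OF z K, symmetric])
      finally show "f z = K \<eta> z" .
    qed
  qed
  then show ?thesis using assms unfolding zonal_sphere_def K_def by simp
qed

lemma scaleR_eq_smult: "r *\<^sub>R (z :: complex ^ 'n) = of_real r *s z"
  unfolding vec_eq_iff vector_scaleR_component vector_smult_component by (simp add: scaleR_conv_of_real)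

lemma Bhat_polar:
  fixes x :: "complex ^ 'n"
  assumes p: "p > 0" and x: "x \<in> Bhat p"
  obtains r \<zeta> where "r \<in> {0..<1}" "\<zeta> \<in> Shat p" "x = r *\<^sub>R \<zeta>"
proof -
  from x obtain k a where k: "k < p" and a: "a \<in> ball 0 1" "x = rot p k a" unfolding Bhat_def by blast
  define e :: "real ^ 'n" where "e = (if a = 0 then axis undefined 1 else sgn a)"
  have e: "e \<in> sphere 0 1" by (simp add: e_def norm_sgn)
  have "a = norm a *\<^sub>R e" by (simp add: e_def sgn_div_norm)
  then have "x = norm a *\<^sub>R rot p k e"
    unfolding a(2) rot_def scaleR_eq_smult by (metis cvec_scaleR mult.commute vector_smult_assoc)
  moreover have "rot p k e \<in> Shat p" using k e unfolding Shat_def by blast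
  ultimately show ?thesis using a(1) that[of "norm a" "rot p k e"] by simp
qed

text \<open>Homogeneity of \<open>zonal_poly\<close> in both arguments makes the value independent of the polar forms,
  in particular at the origin.\<close>

lemma zonal_eq:
  fixes x y :: "complex ^ 'n"
  assumes p: "p > 0" and "x \<in> Bhat p" "y \<in> Bhat p"
  shows "zonal p m x y = zonal_poly p m x (vcnj y)"
proof -
  have val: "of_real (r ^ m * s ^ m) * zonal_sphere p m \<zeta> \<eta> = zonal_poly p m (r *\<^sub>R \<zeta>) (vcnj (s *\<^sub>R \<eta>))"
    if "\<zeta> \<in> Shat p" "\<eta> \<in> Shat p" for r s and \<zeta> \<eta> :: "complex ^ 'n"
    unfolding zonal_sphere_eq[OF p that] scaleR_eq_smult vcnj_smult zonal_poly_scale zonal_poly_scale_right by simp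
  obtain r \<zeta> where r: "r \<in> {0..<1}" "\<zeta> \<in> Shat p" "x = r *\<^sub>R \<zeta>" by (rule Bhat_polar[OF assms(1,2)])
  obtain s \<eta> where s: "s \<in> {0..<1}" "\<eta> \<in> Shat p" "y = s *\<^sub>R \<eta>" by (rule Bhat_polar[OF assms(1,3)])
  show ?thesis unfolding zonal_def
  proof (rule the_equality)
    show "\<exists>r\<in>{0..<1}. \<exists>s\<in>{0..<1}. \<exists>\<zeta>\<in>Shat p. \<exists>\<eta>\<in>Shat p. x = r *\<^sub>R \<zeta> \<and> y = s *\<^sub>R \<eta> \<and>
        zonal_poly p m x (vcnj y) = of_real (r ^ m * s ^ m) * zonal_sphere p m \<zeta> \<eta>"
      using r s val[OF r(2) s(2)] by metis
  next
    fix w assume "\<exists>r\<in>{0..<1}. \<exists>s\<in>{0..<1}. \<exists>\<zeta>\<in>Shat p. \<exists>\<eta>\<in>Shat p. x = r *\<^sub>R \<zeta> \<and> y = s *\<^sub>R \<eta> \<and>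
        w = of_real (r ^ m * s ^ m) * zonal_sphere p m \<zeta> \<eta>"
    then show "w = zonal_poly p m x (vcnj y)" using val by metis
  qed
qed

section \<open>The generating function of the zonal polyharmonics\<close>

text \<open>Two arguments of modulus below \<open>\<pi>/2\<close> add up to less than \<open>\<pi>\<close>, so the product
  stays off the cut of the principal power.\<close>

lemma mult_Re_pos_notin_nonpos_Reals:
  assumes "Re u > 0" "Re v > 0" shows "u * v \<notin> \<real>\<^sub>\<le>\<^sub>0"
proof
  assume "u * v \<in> \<real>\<^sub>\<le>\<^sub>0"
  then obtain t where t: "t \<le> 0" "u * v = of_real t" by (auto elim: nonpos_Reals_cases)
  have u: "u \<noteq> 0" using assms by auto
  then have "v = of_real t / u" using t by (simp add: field_simps)
  also have "\<dots> = of_real (t / (norm u)\<^sup>2) * cnj u"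
    using u by (simp add: complex_div_cnj[of "of_real t" u] mult.commute)
  finally have "Re v = t / (norm u)\<^sup>2 * Re u" by simp
  also have "\<dots> \<le> 0" using t assms by (intro mult_nonpos_nonneg divide_nonpos_nonneg) auto
  finally show False using assms by simp
qed

lemma Re_one_minus_pos: "norm z < 1 \<Longrightarrow> Re (1 - z) > 0"
  using complex_Re_le_cmod[of z] by simp

text \<open>The formal series of \<open>(1 - 2s\<tau> + A\<tau>\<^sup>2) powr (-\<mu>)\<close>, the generating function of
  the Gegenbauer polynomials in homogeneous form.\<close>

definition gegenbauer_fps :: "complex \<Rightarrow> complex \<Rightarrow> complex \<Rightarrow> complex fps" where
  "gegenbauer_fps \<mu> s A = fps_binomial (- \<mu>) oo (fps_X * (fps_const (- 2 * s) + fps_const A * fps_X))"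

lemma fps_linear_power_nth:
  "((fps_const c + fps_const A * fps_X) ^ k) $ j = of_nat (k choose j) * c ^ (k - j) * (A::complex) ^ j"
proof (induction k arbitrary: j)
  case (Suc k)
  show ?case
  proof (cases j)
    case 0
    then show ?thesis using Suc[of 0] by (simp add: algebra_simps)
  next
    case j: (Suc i)
    have "((fps_const c + fps_const A * fps_X) ^ Suc k) $ j =
      c * ((fps_const c + fps_const A * fps_X) ^ k) $ Suc i + A * ((fps_const c + fps_const A * fps_X) ^ k) $ i"
      by (simp add: distrib_right mult.assoc j)
    also have "\<dots> = of_nat (k choose Suc i) * (c * c ^ (k - Suc i)) * A ^ Suc i + of_nat (k choose i) * c ^ (k - i) * A ^ Suc i"
      unfolding Suc by (simp add: algebra_simps)
    also have "of_nat (k choose Suc i) * (c * c ^ (k - Suc i)) = of_nat (k choose Suc i) * c ^ (k - i)"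
      by (cases "Suc i \<le> k") (simp_all add: Suc_diff_Suc flip: power_Suc)
    finally show ?thesis by (simp add: j algebra_simps)
  qed
qed (simp add: fps_one_nth)

definition gegenbauer_coeff :: "complex \<Rightarrow> nat \<Rightarrow> nat \<Rightarrow> complex" where
  "gegenbauer_coeff \<mu> a b = (-1) ^ b * 2 ^ a * pochhammer \<mu> (a + b) / (fact a * fact b)"

lemma gegenbauer_fps_nth: "gegenbauer_fps \<mu> s A $ m = (\<Sum>b\<le>m div 2. gegenbauer_coeff \<mu> (m - 2 * b) b * s ^ (m - 2 * b) * A ^ b)"
proof -
  define t where "t b = ((- \<mu>) gchoose (m - b)) * (of_nat ((m - b) choose b) * (- 2 * s) ^ (m - b - b) * A ^ b)" for b
  have "gegenbauer_fps \<mu> s A $ m = (\<Sum>k=0..m. ((- \<mu>) gchoose k) * ((fps_const (- 2 * s) + fps_const A * fps_X) ^ k $ (m - k)))"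
    unfolding gegenbauer_fps_def fps_compose_nth
    by (intro sum.cong refl) (simp add: power_mult_distrib fps_X_power_mult_nth)
  also have "\<dots> = (\<Sum>b=0..m. ((- \<mu>) gchoose (m - b)) * ((fps_const (- 2 * s) + fps_const A * fps_X) ^ (m - b) $ (m - (m - b))))"
    by (subst sum.atLeastAtMost_rev) simp
  also have "\<dots> = (\<Sum>b=0..m. t b)"
    unfolding t_def fps_linear_power_nth by (intro sum.cong refl) auto
  also have "\<dots> = (\<Sum>b\<le>m div 2. t b)"
  proof (rule sum.mono_neutral_right)
    show "\<forall>i\<in>{0..m} - {..m div 2}. t i = 0"
    proof
      fix i assume "i \<in> {0..m} - {..m div 2}"
      then have "m - i < i" by auto
      then show "t i = 0" by (simp add: t_def binomial_eq_0)
    qed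
  qed auto
  also have "\<dots> = (\<Sum>b\<le>m div 2. gegenbauer_coeff \<mu> (m - 2 * b) b * s ^ (m - 2 * b) * A ^ b)"
  proof (intro sum.cong refl)
    fix b assume "b \<in> {..m div 2}"
    then obtain a where a: "m = a + 2 * b" by (metis add.commute atMost_iff le_add_diff_inverse2 less_eq_div_iff_mult_less_eq mult.commute pos2)
    have "of_nat ((a + b) choose b) = (fact (a + b) / (fact a * fact b) :: complex)"
      using binomial_fact[of b "a + b", where 'a=complex] by (simp add: mult.commute)
    moreover have "m - b = a + b" "m - b - b = a" "m - 2 * b = a" using a by auto
    moreover have "(- 1 :: complex) ^ (a + b) * (- 2 * s) ^ a = (- 1) ^ b * 2 ^ a * s ^ a"
    proof -
      have "(- 2 * s) ^ a = (- 1) ^ a * (2 ^ a * s ^ a)"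
      proof -
        have "- 2 * s = (- 1) * (2 * s)" by simp
        then show ?thesis by (simp only: power_mult_distrib)
      qed
      moreover have "(- 1 :: complex) ^ a * (- 1) ^ a = 1" by simp
      ultimately show ?thesis by (simp add: power_add mult_ac)
    qed
    ultimately show "t b = gegenbauer_coeff \<mu> (m - 2 * b) b * s ^ (m - 2 * b) * A ^ b"
      unfolding t_def gegenbauer_coeff_def gbinomial_pochhammer by (simp add: field_simps)
  qed
  finally show ?thesis .
qed

lemma zonal_coeff_eq_gegenbauer_coeff: "zonal_coeff \<mu> a b = gegenbauer_coeff \<mu> a b - (if b = 0 then 0 else gegenbauer_coeff \<mu> a (b - 1))"
proof (cases b)
  case (Suc c)
  have "zonal_coeff \<mu> a b = gegenbauer_coeff \<mu> a b + (-1) ^ b * 2 ^ a / (fact a * fact b) * (of_nat b * pochhammer \<mu> (a + b - 1))"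
    unfolding zonal_coeff_def gegenbauer_coeff_def by (simp add: algebra_simps add_divide_distrib)
  also have "(-1) ^ b * 2 ^ a / (fact a * fact b) * (of_nat b * pochhammer \<mu> (a + b - 1)) = - gegenbauer_coeff \<mu> a (b - 1)"
  proof -
    have "fact b = of_nat b * (fact c :: complex)" by (simp add: Suc)
    moreover have "(of_nat b :: complex) \<noteq> 0" unfolding of_nat_eq_0_iff by (simp add: Suc)
    ultimately show ?thesis unfolding gegenbauer_coeff_def Suc by (simp add: divide_simps del: of_nat_Suc)
  qed
  finally show ?thesis by (simp add: Suc)
qed (simp add: zonal_coeff_def gegenbauer_coeff_def)

definition zonal_fps :: "nat \<Rightarrow> complex ^ 'n \<Rightarrow> complex ^ 'n \<Rightarrow> complex fps" where
  "zonal_fps p z w = (1 - (fps_const (bdot z z * bdot w w) * fps_X ^ 2) ^ p) * gegenbauer_fps (of_nat CARD('n) / 2) (bdot z w) (bdot z z * bdot w w)"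

text \<open>The factor \<open>1 - A\<tau>\<^sup>2\<close> turns \<open>C\<^sub>m\<close> into \<open>C\<^sub>m - A C\<^sub>m\<^sub>-\<^sub>2\<close>.\<close>

lemma zonal_harmonic_eq_gegenbauer_fps:
  fixes z w :: "complex ^ 'n"
  defines "A \<equiv> bdot z z * bdot w w"
  shows "((1 - fps_const A * fps_X ^ 2) * gegenbauer_fps (of_nat CARD('n) / 2) (bdot z w) A) $ m = zonal_harmonic m z w"
proof -
  define \<mu> :: complex where "\<mu> = of_nat CARD('n) / 2"
  define s where "s = bdot z w"
  have 1: "((1 - fps_const A * fps_X ^ 2) * gegenbauer_fps \<mu> s A) $ m = gegenbauer_fps \<mu> s A $ m - (if m < 2 then 0 else A * gegenbauer_fps \<mu> s A $ (m - 2))"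
  proof -
    have "(1 - fps_const A * fps_X ^ 2) * gegenbauer_fps \<mu> s A = gegenbauer_fps \<mu> s A - fps_const A * (fps_X ^ 2 * gegenbauer_fps \<mu> s A)"
      by (simp add: algebra_simps)
    then show ?thesis by (simp add: fps_X_power_mult_nth)
  qed
  define T where "T b = (if b = 0 then 0 else gegenbauer_coeff \<mu> (m - 2 * b) (b - 1)) * s ^ (m - 2 * b) * A ^ b" for b
  have 2: "(if m < 2 then 0 else A * gegenbauer_fps \<mu> s A $ (m - 2)) = (\<Sum>b\<le>m div 2. T b)"
  proof (cases "m < 2")
    case True
    then have "m div 2 = 0" by auto
    then show ?thesis using True by (simp add: T_def)
  next
    case False
    have "(\<Sum>b\<le>m div 2. T b) = (\<Sum>b<m div 2. T (Suc b))" by (simp add: sum.atMost_shift T_def)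
    also have "\<dots> = (\<Sum>b\<le>(m - 2) div 2. T (Suc b))"
    proof -
      have "m div 2 = Suc ((m - 2) div 2)" using False by presburger
      then show ?thesis by (simp only: lessThan_Suc_atMost)
    qed
    also have "\<dots> = (\<Sum>b\<le>(m - 2) div 2. A * (gegenbauer_coeff \<mu> (m - 2 - 2 * b) b * s ^ (m - 2 - 2 * b) * A ^ b))"
      by (intro sum.cong refl) (simp add: T_def)
    finally show ?thesis using False unfolding gegenbauer_fps_nth by (simp add: sum_distrib_left)
  qed
  have "zonal_harmonic m z w = (\<Sum>b\<le>m div 2. gegenbauer_coeff \<mu> (m - 2 * b) b * s ^ (m - 2 * b) * A ^ b - T b)"
    unfolding zonal_harmonic_def zonal_coeff_eq_gegenbauer_coeff T_def A_def \<mu>_def s_def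
    by (intro sum.cong refl) (simp add: power_mult_distrib algebra_simps)
  also have "\<dots> = gegenbauer_fps \<mu> s A $ m - (\<Sum>b\<le>m div 2. T b)" unfolding gegenbauer_fps_nth by (rule sum_subtractf)
  finally show ?thesis using 1 2 unfolding \<mu>_def s_def by simp
qed

text \<open>Since \<open>1 - (A\<tau>\<^sup>2)\<^sup>p\<close> is \<open>1 - A\<tau>\<^sup>2\<close> times a geometric sum, the series is a sum of \<open>p\<close> copies of the one
  for zonal harmonics, the \<open>k\<close>-th one shifted by \<open>2k\<close> degrees, which is how \<open>zonal_poly\<close> is defined.\<close>

lemma zonal_fps_nth: "zonal_fps p z w $ m = zonal_poly p m z w"
proof -
  define A where "A = bdot z z * bdot w w"
  define G where "G = (1 - fps_const A * fps_X ^ 2) * gegenbauer_fps (of_nat CARD('a) / 2) (bdot z w) A"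
  have G: "G $ m = zonal_harmonic m z w" for m unfolding G_def A_def by (rule zonal_harmonic_eq_gegenbauer_fps)
  have "zonal_fps p z w = (\<Sum>k<p. (fps_const A * fps_X ^ 2) ^ k) * G"
    unfolding zonal_fps_def G_def A_def one_diff_power_eq by (simp only: mult_ac)
  also have "\<dots> = (\<Sum>k<p. fps_const (A ^ k) * (fps_X ^ (2 * k) * G))"
    by (simp add: sum_distrib_right power_mult_distrib fps_const_power power_mult mult.assoc)
  finally have "zonal_fps p z w $ m = (\<Sum>k<p. A ^ k * (if m < 2 * k then 0 else zonal_harmonic (m - 2 * k) z w))"
    by (simp add: fps_sum_nth fps_X_power_mult_nth G cong: if_cong)
  also have "\<dots> = (\<Sum>k | k < p \<and> 2 * k \<le> m. A ^ k * (if m < 2 * k then 0 else zonal_harmonic (m - 2 * k) z w))"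
    by (rule sum.mono_neutral_right) auto
  also have "\<dots> = zonal_poly p m z w"
    unfolding zonal_poly_def A_def by (intro sum.cong refl) (auto simp: power_mult_distrib)
  finally show ?thesis .
qed

text \<open>The reciprocals of the zeros of \<open>1 - 2zw\<tau> + |z|\<^sup>2|w|\<^sup>2\<tau>\<^sup>2\<close>; for real unit
  vectors at angle \<open>\<theta>\<close> they are \<open>exp(\<plusminus>i\<theta>)\<close>. Their moduli decide where the generating function is holomorphic.\<close>

definition lie_roots :: "complex ^ 'n \<Rightarrow> complex ^ 'n \<Rightarrow> complex \<Rightarrow> complex \<Rightarrow> bool" where
  "lie_roots z w e1 e2 \<longleftrightarrow> 2 * bdot z w = e1 + e2 \<and> bdot z z * bdot w w = e1 * e2"

definition zonal_gf :: "nat \<Rightarrow> complex ^ 'n \<Rightarrow> complex ^ 'n \<Rightarrow> complex \<Rightarrow> complex" where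
  "zonal_gf p z w \<tau> = (1 - (bdot z z * bdot w w * \<tau>\<^sup>2) ^ p) *
     (1 - 2 * bdot z w * \<tau> + bdot z z * bdot w w * \<tau>\<^sup>2) powr (- (of_nat CARD('n) / 2))"

lemma lie_roots_factor:
  assumes "lie_roots z w e1 e2"
  shows "1 - 2 * bdot z w * \<tau> + bdot z z * bdot w w * \<tau>\<^sup>2 = (1 - e1 * \<tau>) * (1 - e2 * \<tau>)"
  using assms unfolding lie_roots_def by (simp add: algebra_simps power2_eq_square)

lemma quad_notin_nonpos_Reals:
  assumes "lie_roots z w e1 e2" "norm (e1 * \<tau>) < 1" "norm (e2 * \<tau>) < 1"
  shows "1 - 2 * bdot z w * \<tau> + bdot z z * bdot w w * \<tau>\<^sup>2 \<notin> \<real>\<^sub>\<le>\<^sub>0"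
  unfolding lie_roots_factor[OF assms(1)] using assms by (intro mult_Re_pos_notin_nonpos_Reals Re_one_minus_pos)

lemma zonal_gf_holomorphic:
  assumes r: "lie_roots z w e1 e2" and R: "norm e1 * R \<le> 1" "norm e2 * R \<le> 1" "R > 0"
  shows "zonal_gf p z w holomorphic_on ball 0 R"
proof -
  have "norm (e * \<tau>) < 1" if "\<tau> \<in> ball 0 R" "norm e * R \<le> 1" for e \<tau> :: complex
  proof (cases "e = 0")
    case False
    then have "norm e * norm \<tau> < norm e * R" using that by (intro mult_strict_left_mono) auto
    then show ?thesis using that by (simp add: norm_mult)
  qed simp
  then show ?thesis unfolding zonal_gf_def
    by (intro holomorphic_intros) (use quad_notin_nonpos_Reals[OF r] R in auto)
qed

lemma zonal_gf_has_fps_expansion: "zonal_gf p z w has_fps_expansion zonal_fps p z w"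
proof -
  let ?A = "bdot z z * bdot w w" and ?s = "bdot z w"
  have "((\<lambda>x. (1 + x) powr (- (of_nat CARD('a) / 2))) \<circ> (\<lambda>\<tau>. \<tau> * (- 2 * ?s + ?A * \<tau>))) has_fps_expansion gegenbauer_fps (of_nat CARD('a) / 2) ?s ?A"
    unfolding gegenbauer_fps_def
  proof (rule has_fps_expansion_compose[OF has_fps_expansion_binomial_complex])
    show "(\<lambda>\<tau>. \<tau> * (- 2 * ?s + ?A * \<tau>)) has_fps_expansion fps_X * (fps_const (- 2 * ?s) + fps_const ?A * fps_X)"
      by (intro fps_expansion_intros)
  qed simp
  moreover have "((\<lambda>x. (1 + x) powr (- (of_nat CARD('a) / 2))) \<circ> (\<lambda>\<tau>. \<tau> * (- 2 * ?s + ?A * \<tau>))) =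
     (\<lambda>\<tau>. (1 - 2 * ?s * \<tau> + ?A * \<tau>\<^sup>2) powr (- (of_nat CARD('a) / 2)))"
    by (auto simp: fun_eq_iff power2_eq_square algebra_simps intro!: arg_cong2[where f="(powr)"])
  ultimately have g: "(\<lambda>\<tau>. (1 - 2 * ?s * \<tau> + ?A * \<tau>\<^sup>2) powr (- (of_nat CARD('a) / 2))) has_fps_expansion gegenbauer_fps (of_nat CARD('a) / 2) ?s ?A"
    by simp
  have "(\<lambda>\<tau>. (1 - (?A * \<tau>\<^sup>2) ^ p) * (1 - 2 * ?s * \<tau> + ?A * \<tau>\<^sup>2) powr (- (of_nat CARD('a) / 2))) has_fps_expansion
     (1 - (fps_const ?A * fps_X ^ 2) ^ p) * gegenbauer_fps (of_nat CARD('a) / 2) ?s ?A"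
    by (intro fps_expansion_intros g)
  then show ?thesis unfolding zonal_gf_def[abs_def] zonal_fps_def .
qed

lemma zonal_poly_sums:
  assumes r: "lie_roots z w e1 e2" and R: "norm e1 * R \<le> 1" "norm e2 * R \<le> 1" "R > 0" and \<tau>: "norm \<tau> < R"
  shows "(\<lambda>m. zonal_poly p m z w * \<tau> ^ m) sums zonal_gf p z w \<tau>"
    and "(\<lambda>m. of_nat m * zonal_poly p m z w * \<tau> ^ m) sums (\<tau> * deriv (zonal_gf p z w) \<tau>)"
proof -
  have h: "zonal_gf p z w holomorphic_on eball 0 (ereal R)" using zonal_gf_holomorphic[OF r R] by simp
  show "(\<lambda>m. zonal_poly p m z w * \<tau> ^ m) sums zonal_gf p z w \<tau>"
    using has_fps_expansion_imp_sums_complex[OF zonal_gf_has_fps_expansion h] \<tau> by (simp add: zonal_fps_nth)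
  have "deriv (zonal_gf p z w) has_fps_expansion fps_deriv (zonal_fps p z w)"
    by (intro has_fps_expansion_deriv zonal_gf_has_fps_expansion)
  moreover have "deriv (zonal_gf p z w) holomorphic_on eball 0 (ereal R)" using h by (intro holomorphic_deriv) auto
  ultimately have "(\<lambda>m. fps_nth (fps_deriv (zonal_fps p z w)) m * \<tau> ^ m) sums deriv (zonal_gf p z w) \<tau>"
    using \<tau> by (intro has_fps_expansion_imp_sums_complex[where r="ereal R"]) auto
  then have "(\<lambda>m. \<tau> * (of_nat (Suc m) * zonal_poly p (Suc m) z w * \<tau> ^ m)) sums (\<tau> * deriv (zonal_gf p z w) \<tau>)"
    by (intro sums_mult) (simp add: zonal_fps_nth fps_deriv_nth)
  then have "(\<lambda>m. of_nat (Suc m) * zonal_poly p (Suc m) z w * \<tau> ^ Suc m) sums (\<tau> * deriv (zonal_gf p z w) \<tau>)"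
    by (simp add: mult_ac)
  then show "(\<lambda>m. of_nat m * zonal_poly p m z w * \<tau> ^ m) sums (\<tau> * deriv (zonal_gf p z w) \<tau>)"
    by (subst (asm) sums_Suc_iff) simp
qed

text \<open>In the theorem the dilation enters as \<open>\<tau> = t\<^sup>2\<close>, whence the factor \<open>2\<close>. The fractional power is
  brought to the exponent \<open>-n/2 - 1\<close> at the price of a factor \<open>Q\<close>.\<close>

lemma deriv_zonal_gf:
  fixes z w :: "complex ^ 'n"
  assumes r: "lie_roots z w e1 e2" and e: "norm e1 < 1" "norm e2 < 1" and p: "p > 0"
  defines "X \<equiv> bdot z z * bdot w w" and "Q \<equiv> 1 - 2 * bdot z w + bdot z z * bdot w w"
  shows "of_nat CARD('n) * zonal_gf p z w 1 + 2 * deriv (zonal_gf p z w) 1 =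
    (of_nat CARD('n) * (1 - X ^ p) * (1 - X) - 4 * of_nat p * X ^ p * Q) / Q powr (of_nat CARD('n) / 2 + 1)"
proof -
  define \<mu> :: complex where "\<mu> = of_nat CARD('n) / 2"
  have Q: "Q \<notin> \<real>\<^sub>\<le>\<^sub>0" using quad_notin_nonpos_Reals[OF r, of 1] e by (simp add: Q_def)
  then have Q0: "Q \<noteq> 0" by auto
  define D where "D = (- (of_nat p * X ^ (p - 1) * (X * 2))) * Q powr (- \<mu>) + (1 - X ^ p) * (- \<mu> * Q powr (- \<mu> - 1) * (- (2 * bdot z w) + X * 2))"
  have d: "((\<lambda>\<tau>. (1 - (X * \<tau>\<^sup>2) ^ p) * (1 - 2 * bdot z w * \<tau> + X * \<tau>\<^sup>2) powr (- \<mu>)) has_field_derivative D) (at 1)"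
  proof -
    have Q1: "1 - 2 * bdot z w * 1 + X * 1\<^sup>2 \<notin> \<real>\<^sub>\<le>\<^sub>0" using Q by (simp add: Q_def X_def)
    have a: "((\<lambda>\<tau>. 1 - 2 * bdot z w * \<tau> + X * \<tau>\<^sup>2) has_field_derivative (- (2 * bdot z w) + X * 2)) (at 1)"
      by (auto intro!: derivative_eq_intros)
    have b: "((\<lambda>\<tau>. 1 - (X * \<tau>\<^sup>2) ^ p) has_field_derivative (- (of_nat p * X ^ (p - 1) * (X * 2)))) (at 1)"
      by (auto intro!: derivative_eq_intros)
    have c: "((\<lambda>\<tau>. (1 - 2 * bdot z w * \<tau> + X * \<tau>\<^sup>2) powr (- \<mu>)) has_field_derivative (- \<mu> * Q powr (- \<mu> - 1) * (- (2 * bdot z w) + X * 2))) (at 1)"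
      using DERIV_chain2[OF has_field_derivative_powr[OF Q1] a, of "- \<mu>"] by (simp add: Q_def X_def)
    show ?thesis using DERIV_mult[OF b c] by (simp add: D_def Q_def X_def algebra_simps)
  qed
  have "zonal_gf p z w = (\<lambda>\<tau>. (1 - (X * \<tau>\<^sup>2) ^ p) * (1 - 2 * bdot z w * \<tau> + X * \<tau>\<^sup>2) powr (- \<mu>))"
    by (simp add: fun_eq_iff zonal_gf_def X_def \<mu>_def)
  then have dz: "deriv (zonal_gf p z w) 1 = D" using d by (simp add: DERIV_imp_deriv)
  have z1: "zonal_gf p z w 1 = (1 - X ^ p) * Q powr (- \<mu>)" by (simp add: zonal_gf_def X_def Q_def \<mu>_def)
  have pw: "Q powr (- \<mu> - 1) = 1 / Q powr (\<mu> + 1)" "Q powr (- \<mu>) = Q / Q powr (\<mu> + 1)"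
  proof -
    have "- \<mu> - 1 = - (\<mu> + 1)" by simp
    then show 1: "Q powr (- \<mu> - 1) = 1 / Q powr (\<mu> + 1)" by (simp only: powr_minus inverse_eq_divide)
    have "Q powr (- \<mu>) = Q * Q powr (- \<mu> - 1)" using Q0 powr_add[of Q "- \<mu> - 1" 1] by (simp add: mult.commute)
    then show "Q powr (- \<mu>) = Q / Q powr (\<mu> + 1)" unfolding 1 by simp
  qed
  have XX: "X ^ (p - 1) * X = X ^ p" using p by (cases p) auto
  have n: "of_nat CARD('n) = 2 * \<mu>" by (simp add: \<mu>_def)
  have "2 * \<mu> * zonal_gf p z w 1 + 2 * D =
     (2 * \<mu> * ((1 - X ^ p) * Q) - 4 * of_nat p * (X ^ (p - 1) * X) * Q + 2 * \<mu> * ((1 - X ^ p) * (2 * bdot z w - X * 2))) / Q powr (\<mu> + 1)"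
    unfolding z1 D_def pw by (simp add: add_divide_distrib diff_divide_distrib algebra_simps)
  also have "2 * \<mu> * ((1 - X ^ p) * Q) - 4 * of_nat p * (X ^ (p - 1) * X) * Q + 2 * \<mu> * ((1 - X ^ p) * (2 * bdot z w - X * 2)) =
     2 * \<mu> * (1 - X ^ p) * (1 - X) - 4 * of_nat p * X ^ p * Q"
    unfolding XX unfolding Q_def X_def by (simp add: algebra_simps)
  finally show ?thesis unfolding dz n by simp
qed

text \<open>A bound for the generating function on the circle of radius \<open>r\<close> when both roots lie in
  the closed unit disc: there \<open>|Q| \<ge> (1 - r)\<^sup>2\<close>.\<close>

definition zonal_bound :: "nat \<Rightarrow> real \<Rightarrow> real" where
  "zonal_bound n r = 2 * exp (- (real n / 2 * ln ((1 - r)\<^sup>2)))"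

text \<open>Cauchy's estimate for the generating function on the circle of radius \<open>r\<close>.\<close>

lemma zonal_poly_bound:
  fixes z w :: "complex ^ 'n"
  assumes L: "lie_roots z w e1 e2" and e: "norm e1 \<le> 1" "norm e2 \<le> 1" and r: "0 < r" "r < 1"
  shows "norm (zonal_poly p m z w) \<le> zonal_bound CARD('n) r / r ^ m"
proof -
  have h: "zonal_gf p z w holomorphic_on ball 0 1" using zonal_gf_holomorphic[OF L, of 1] e by simp
  have "norm (zonal_gf p z w \<tau>) \<le> zonal_bound CARD('n) r" if t: "norm \<tau> = r" for \<tau>
  proof -
    define Q where "Q = 1 - 2 * bdot z w * \<tau> + bdot z z * bdot w w * \<tau>\<^sup>2"
    have Q: "Q = (1 - e1 * \<tau>) * (1 - e2 * \<tau>)" unfolding Q_def by (rule lie_roots_factor[OF L])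
    have a: "1 - r \<le> norm (1 - e * \<tau>)" if "norm e \<le> 1" for e
    proof -
      have "norm e * r \<le> 1 * r" using that r by (intro mult_right_mono) auto
      then show ?thesis using norm_triangle_ineq2[of 1 "e * \<tau>"] t by (simp add: norm_mult)
    qed
    have nQ: "(1 - r)\<^sup>2 \<le> norm Q" unfolding Q norm_mult power2_eq_square using a e r by (intro mult_mono) auto
    then have nQ0: "norm Q > 0" using r by (smt (verit) zero_less_power2)
    have "norm (Q powr (- (of_nat CARD('n) / 2))) = exp (- (real CARD('n) / 2 * ln (norm Q)))"
      using nQ0 by (simp add: powr_def)
    also have "\<dots> \<le> exp (- (real CARD('n) / 2 * ln ((1 - r)\<^sup>2)))"
    proof -
      have "ln ((1 - r)\<^sup>2) \<le> ln (norm Q)" using nQ nQ0 r by (subst ln_le_cancel_iff) auto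
      then have "real CARD('n) / 2 * ln ((1 - r)\<^sup>2) \<le> real CARD('n) / 2 * ln (norm Q)" by (intro mult_left_mono) auto
      then show ?thesis by simp
    qed
    finally have 1: "norm (Q powr (- (of_nat CARD('n) / 2))) \<le> exp (- (real CARD('n) / 2 * ln ((1 - r)\<^sup>2)))" .
    have "norm (bdot z z * bdot w w * \<tau>\<^sup>2) \<le> 1"
    proof -
      have "bdot z z * bdot w w = e1 * e2" using L by (simp add: lie_roots_def)
      then have "norm (bdot z z * bdot w w * \<tau>\<^sup>2) = norm e1 * norm e2 * r\<^sup>2" by (simp add: norm_mult norm_power t)
      also have "\<dots> \<le> 1 * 1 * 1" using e r by (intro mult_mono) (auto simp: power_le_one)
      finally show ?thesis by simp
    qed
    then have "norm ((bdot z z * bdot w w * \<tau>\<^sup>2) ^ p) \<le> 1" unfolding norm_power by (simp add: power_le_one)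
    then have 2: "norm (1 - (bdot z z * bdot w w * \<tau>\<^sup>2) ^ p) \<le> 2"
      using norm_triangle_ineq4[of 1 "(bdot z z * bdot w w * \<tau>\<^sup>2) ^ p"] by simp
    show ?thesis unfolding zonal_gf_def Q_def[symmetric] norm_mult zonal_bound_def using 1 2 by (intro mult_mono) auto
  qed
  then have "norm ((deriv ^^ m) (zonal_gf p z w) 0) \<le> fact m * zonal_bound CARD('n) r / r ^ m"
    using r h by (intro Cauchy_inequality holomorphic_on_imp_continuous_on) (auto elim: holomorphic_on_subset)
  moreover have "zonal_poly p m z w = (deriv ^^ m) (zonal_gf p z w) 0 / fact m"
    using fps_nth_fps_expansion[OF zonal_gf_has_fps_expansion[of p z w], of m] by (simp add: zonal_fps_nth)
  ultimately have "norm (zonal_poly p m z w) \<le> (fact m * zonal_bound CARD('n) r / r ^ m) / fact m"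
    unfolding \<open>zonal_poly p m z w = _\<close> norm_divide by (simp del: times_divide_eq_right divide_divide_eq_left add: divide_right_mono)
  then show ?thesis by simp
qed

lemma zonal_poly_1: "zonal_poly 1 m z w = zonal_harmonic m z w"
proof -
  have "{k. k < 1 \<and> 2 * k \<le> m} = {0::nat}" by auto
  then show ?thesis by (simp add: zonal_poly_def)
qed

text \<open>Up to the factor \<open>\<alpha>\<beta>\<close> the roots are \<open>ab \<plusminus> i sqrt (|a|\<^sup>2|b|\<^sup>2 - (ab)\<^sup>2)\<close>, with a real square root by the
  Cauchy-Schwarz inequality.\<close>

lemma lie_roots_exist:
  fixes a b :: "real ^ 'n"
  assumes "norm \<alpha> = 1" "norm \<beta> = 1"
  obtains e1 e2 where "lie_roots (\<alpha> *s cvec a) (\<beta> *s cvec b) e1 e2" "norm e1 = norm a * norm b" "norm e2 = norm a * norm b"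
proof -
  define c where "c = a \<bullet> b"
  define d where "d = sqrt ((norm a * norm b)\<^sup>2 - c\<^sup>2)"
  have "c\<^sup>2 \<le> (norm a * norm b)\<^sup>2" unfolding c_def
    using Cauchy_Schwarz_ineq2[of a b] by (metis abs_ge_zero power2_abs power_mono)
  then have d: "d\<^sup>2 = (norm a * norm b)\<^sup>2 - c\<^sup>2" unfolding d_def by simp
  define e1 where "e1 = (\<alpha> * \<beta>) * Complex c d"
  define e2 where "e2 = (\<alpha> * \<beta>) * Complex c (- d)"
  have sm: "bdot (\<alpha> *s z) (\<beta> *s w) = \<alpha> * \<beta> * bdot z w" for \<alpha> \<beta> and z w :: "complex ^ 'n"
    by (simp add: bdot_def sum_distrib_left mult_ac)
  have cc: "Complex c d * Complex c (- d) = of_real ((norm a * norm b)\<^sup>2)"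
    using d by (simp add: complex_eq_iff power2_eq_square algebra_simps)
  have "lie_roots (\<alpha> *s cvec a) (\<beta> *s cvec b) e1 e2"
    unfolding lie_roots_def
  proof
    show "2 * bdot (\<alpha> *s cvec a) (\<beta> *s cvec b) = e1 + e2"
      unfolding sm bdot_cvec e1_def e2_def c_def[symmetric] distrib_left[symmetric] by (simp add: complex_eq_iff)
    have "e1 * e2 = (\<alpha> * \<beta>)\<^sup>2 * (Complex c d * Complex c (- d))" by (simp add: e1_def e2_def power2_eq_square mult_ac)
    then show "bdot (\<alpha> *s cvec a) (\<alpha> *s cvec a) * bdot (\<beta> *s cvec b) (\<beta> *s cvec b) = e1 * e2"
      unfolding sm bdot_cvec_self cc by (simp add: power2_eq_square mult_ac)
  qed
  moreover have "norm e1 = norm a * norm b" "norm e2 = norm a * norm b"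
    using assms d unfolding e1_def e2_def norm_mult by (simp_all add: cmod_def)
  ultimately show ?thesis using that by blast
qed

section \<open>Power series in several real variables\<close>

text \<open>The form of local expansion that \<^const>\<open>real_analytic_on\<close> asks for at each point.\<close>

definition power_series_at :: "(('n \<Rightarrow> nat) \<Rightarrow> complex) \<Rightarrow> real ^ 'n \<Rightarrow> real \<Rightarrow> (real ^ 'n \<Rightarrow> complex) \<Rightarrow> bool" where
  "power_series_at c a r u \<longleftrightarrow> (\<forall>x\<in>ball a r. ((\<lambda>\<alpha>. c \<alpha> * monomial \<alpha> (cvec (x - a))) has_sum u x) UNIV)"

lemma norm_monomial_le:
  fixes v :: "complex ^ 'n" and V :: "real ^ 'n"
  assumes "\<And>i. cmod (v $ i) \<le> V $ i"
  shows "cmod (monomial \<alpha> v) \<le> cmod (monomial \<alpha> (cvec V))"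
  unfolding monomial_def prod_norm[symmetric]
proof (intro prod_mono conjI)
  fix i
  have "0 \<le> V $ i" using assms[of i] norm_ge_zero order_trans by blast
  then show "cmod (v $ i ^ \<alpha> i) \<le> cmod (cvec V $ i ^ \<alpha> i)"
    unfolding norm_power cvec_nth norm_of_real using assms[of i] by (intro power_mono) auto
qed auto

lemma power_series_at_majorant:
  assumes "power_series_at c a r u" "norm V < r"
  shows "(\<lambda>\<alpha>. cmod (c \<alpha> * monomial \<alpha> (cvec V))) summable_on UNIV"
proof -
  have "a + V \<in> ball a r" using assms(2) by (simp add: dist_norm)
  then have "((\<lambda>\<alpha>. c \<alpha> * monomial \<alpha> (cvec (a + V - a))) has_sum u (a + V)) UNIV"
    using assms(1) unfolding power_series_at_def by blast
  then have "(\<lambda>\<alpha>. c \<alpha> * monomial \<alpha> (cvec V)) summable_on UNIV" by (simp add: summable_on_def exI)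
  then show ?thesis by (simp only: summable_on_iff_abs_summable_on_complex)
qed

text \<open>Convergence at one real point \<open>V\<close> is absolute and hence normal on the
  complex polydisc below \<open>V\<close>. This provides all complex extensions of real power series used here.\<close>

lemma power_series_at_uniform_limit:
  fixes v :: "'b \<Rightarrow> complex ^ 'n" and V :: "real ^ 'n"
  assumes "power_series_at c a r u" "norm V < r" and v: "\<And>t i. t \<in> K \<Longrightarrow> cmod (v t $ i) \<le> V $ i"
  shows "uniform_limit K (\<lambda>S t. \<Sum>\<alpha>\<in>S. c \<alpha> * monomial \<alpha> (v t)) (\<lambda>t. \<Sum>\<^sub>\<infinity>\<alpha>. c \<alpha> * monomial \<alpha> (v t)) (finite_subsets_at_top UNIV)"
    and "t \<in> K \<Longrightarrow> cmod (\<Sum>\<^sub>\<infinity>\<alpha>. c \<alpha> * monomial \<alpha> (v t)) \<le> (\<Sum>\<^sub>\<infinity>\<alpha>. cmod (c \<alpha> * monomial \<alpha> (cvec V)))"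
proof -
  have le: "cmod (c \<alpha> * monomial \<alpha> (v t)) \<le> cmod (c \<alpha> * monomial \<alpha> (cvec V))" if "t \<in> K" for t \<alpha>
    unfolding norm_mult using v[OF that] by (intro mult_left_mono norm_monomial_le) auto
  show "uniform_limit K (\<lambda>S t. \<Sum>\<alpha>\<in>S. c \<alpha> * monomial \<alpha> (v t)) (\<lambda>t. \<Sum>\<^sub>\<infinity>\<alpha>. c \<alpha> * monomial \<alpha> (v t)) (finite_subsets_at_top UNIV)"
    using le power_series_at_majorant[OF assms(1,2)] by (intro Weierstrass_m_test_general[where M="\<lambda>\<alpha>. cmod (c \<alpha> * monomial \<alpha> (cvec V))"]) auto
  assume t: "t \<in> K"
  have s: "(\<lambda>\<alpha>. cmod (c \<alpha> * monomial \<alpha> (v t))) summable_on UNIV"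
    using power_series_at_majorant[OF assms(1,2)] le[OF t] by (rule Infinite_Sum.abs_summable_on_comparison_test')
  have "cmod (\<Sum>\<^sub>\<infinity>\<alpha>. c \<alpha> * monomial \<alpha> (v t)) \<le> (\<Sum>\<^sub>\<infinity>\<alpha>. cmod (c \<alpha> * monomial \<alpha> (v t)))"
    using s by (rule norm_infsum_bound)
  also have "\<dots> \<le> (\<Sum>\<^sub>\<infinity>\<alpha>. cmod (c \<alpha> * monomial \<alpha> (cvec V)))"
    using s power_series_at_majorant[OF assms(1,2)] le[OF t] by (intro infsum_mono) auto
  finally show "cmod (\<Sum>\<^sub>\<infinity>\<alpha>. c \<alpha> * monomial \<alpha> (v t)) \<le> (\<Sum>\<^sub>\<infinity>\<alpha>. cmod (c \<alpha> * monomial \<alpha> (cvec V)))" .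
qed

definition real_pd :: "'n::finite \<Rightarrow> (real ^ 'n \<Rightarrow> complex) \<Rightarrow> real ^ 'n \<Rightarrow> complex" where
  "real_pd j u x = vector_derivative (\<lambda>t. u (x + t *\<^sub>R axis j 1)) (at 0)"

lemma real_laplacian_eq: "real_laplacian u = (\<lambda>x. \<Sum>j\<in>UNIV. real_pd j (real_pd j u) x)"
  by (simp add: real_laplacian_def real_pd_def Let_def)

definition deriv_coeffs :: "'n \<Rightarrow> (('n \<Rightarrow> nat) \<Rightarrow> complex) \<Rightarrow> ('n \<Rightarrow> nat) \<Rightarrow> complex" where
  "deriv_coeffs j c \<beta> = of_nat (Suc (\<beta> j)) * c (\<beta>(j := Suc (\<beta> j)))"

text \<open>Complexify the coordinate line through \<open>x\<close>. The partial sums are holomorphic and converge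
  uniformly, so the series may be differentiated term by term.\<close>

lemma power_series_at_deriv_ex:
  fixes u :: "real ^ 'n \<Rightarrow> complex"
  assumes m: "power_series_at c a r u" and x: "x \<in> ball a r"
  shows "\<exists>D. ((\<lambda>t. u (x + t *\<^sub>R axis j 1)) has_vector_derivative D) (at 0) \<and>
     ((\<lambda>\<beta>. deriv_coeffs j c \<beta> * monomial \<beta> (cvec (x - a))) has_sum D) UNIV"
proof -
  let ?e = "axis j 1 :: real ^ 'n"
  define \<delta> where "\<delta> = (r - norm (x - a)) / 2"
  have xa: "norm (x - a) < r" using x by (simp add: dist_norm norm_minus_commute)
  then have \<delta>: "\<delta> > 0" by (simp add: \<delta>_def)
  define V :: "real ^ 'n" where "V = (\<chi> i. \<bar>(x - a) $ i\<bar>) + \<delta> *\<^sub>R ?e"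
  have "norm V \<le> norm (\<chi> i. \<bar>(x - a) $ i\<bar>) + \<delta>" unfolding V_def
    using norm_triangle_ineq[of "\<chi> i. \<bar>(x - a) $ i\<bar>" "\<delta> *\<^sub>R ?e"] \<delta> by simp
  also have "norm (\<chi> i. \<bar>(x - a) $ i\<bar>) = norm (x - a)" by (simp add: norm_vec_def)
  finally have V: "norm V < r" using \<delta> by (simp add: \<delta>_def field_simps)
  define v where "v t = cvec (x - a) + t *s axis j 1" for t :: complex
  have v: "cmod (v t $ i) \<le> V $ i" if "t \<in> cball 0 \<delta>" for t i
  proof -
    have "cmod (v t $ i) \<le> \<bar>(x - a) $ i\<bar> + (if i = j then cmod t else 0)"
      unfolding v_def using norm_triangle_ineq[of "complex_of_real ((x - a) $ i)" "t * axis j 1 $ i"]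
      by (auto simp: cvec_nth axis_def norm_mult simp del: of_real_diff)
    also have "\<dots> \<le> V $ i" using that by (auto simp: V_def axis_def)
    finally show ?thesis .
  qed
  define \<Phi> where "\<Phi> t = (\<Sum>\<^sub>\<infinity>\<alpha>. c \<alpha> * monomial \<alpha> (v t))" for t
  have ul: "uniform_limit (cball 0 \<delta>) (\<lambda>S t. \<Sum>\<alpha>\<in>S. c \<alpha> * monomial \<alpha> (v t)) \<Phi> (finite_subsets_at_top UNIV)"
    unfolding \<Phi>_def using v by (rule power_series_at_uniform_limit[OF m V])
  have d: "((\<lambda>t. monomial \<alpha> (v t)) has_field_derivative pd j (monomial \<alpha>) (v w)) (at w)" for \<alpha> w
  proof -
    have "((\<lambda>t. monomial \<alpha> (v w + t *s axis j 1)) has_field_derivative pd j (monomial \<alpha>) (v w)) (at (w - w))"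
      using has_pd[OF pdiff_monomial, of \<alpha> "v w" j] by simp
    moreover have "((\<lambda>t. t - w) has_field_derivative 1) (at w)" by (auto intro!: derivative_eq_intros)
    ultimately have "((\<lambda>t. monomial \<alpha> (v w + (t - w) *s axis j 1)) has_field_derivative pd j (monomial \<alpha>) (v w) * 1) (at w)"
      by (rule DERIV_chain2[where f="\<lambda>t. monomial \<alpha> (v w + t *s axis j 1)" and g="\<lambda>t. t - w"])
    moreover have "v w + (t - w) *s axis j 1 = v t" for t by (simp add: v_def vector_sub_rdistrib)
    ultimately show ?thesis by simp
  qed
  have "\<forall>\<^sub>F S in finite_subsets_at_top UNIV. continuous_on (cball 0 \<delta>) (\<lambda>t. \<Sum>\<alpha>\<in>S. c \<alpha> * monomial \<alpha> (v t)) \<and>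
      (\<forall>w\<in>ball 0 \<delta>. ((\<lambda>t. \<Sum>\<alpha>\<in>S. c \<alpha> * monomial \<alpha> (v t)) has_field_derivative (\<Sum>\<alpha>\<in>S. c \<alpha> * pd j (monomial \<alpha>) (v w))) (at w))"
  proof (intro always_eventually allI conjI ballI)
    fix S :: "('n \<Rightarrow> nat) set"
    have dd: "((\<lambda>t. \<Sum>\<alpha>\<in>S. c \<alpha> * monomial \<alpha> (v t)) has_field_derivative (\<Sum>\<alpha>\<in>S. c \<alpha> * pd j (monomial \<alpha>) (v w))) (at w)" for w
      by (intro DERIV_sum DERIV_cmult d)
    then show "((\<lambda>t. \<Sum>\<alpha>\<in>S. c \<alpha> * monomial \<alpha> (v t)) has_field_derivative (\<Sum>\<alpha>\<in>S. c \<alpha> * pd j (monomial \<alpha>) (v w))) (at w)" for w .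
    show "continuous_on (cball 0 \<delta>) (\<lambda>t. \<Sum>\<alpha>\<in>S. c \<alpha> * monomial \<alpha> (v t))"
      using DERIV_isCont[OF dd] by (intro continuous_at_imp_continuous_on) auto
  qed
  from has_complex_derivative_uniform_limit[OF this ul finite_subsets_at_top_neq_bot \<delta>] obtain g' where
    g': "\<And>w. w \<in> ball 0 \<delta> \<Longrightarrow> (\<Phi> has_field_derivative g' w) (at w) \<and> ((\<lambda>S. \<Sum>\<alpha>\<in>S. c \<alpha> * pd j (monomial \<alpha>) (v w)) \<longlongrightarrow> g' w) (finite_subsets_at_top UNIV)"
    by blast
  have "((\<lambda>\<alpha>. c \<alpha> * pd j (monomial \<alpha>) (cvec (x - a))) has_sum g' 0) UNIV"
    unfolding has_sum_def using g'[of 0] \<delta> by (simp add: v_def)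
  then have hs: "((\<lambda>\<alpha>. c \<alpha> * (of_nat (\<alpha> j) * monomial (\<alpha>(j := \<alpha> j - 1)) (cvec (x - a)))) has_sum g' 0) UNIV"
    unfolding pd_monomial .
  have "((\<lambda>\<beta>. deriv_coeffs j c \<beta> * monomial \<beta> (cvec (x - a))) has_sum g' 0) UNIV"
  proof -
    have bij: "bij_betw (\<lambda>\<beta>. \<beta>(j := Suc (\<beta> j))) UNIV {\<alpha>. \<alpha> j \<noteq> 0}"
      by (rule bij_betwI[where g="\<lambda>\<alpha>. \<alpha>(j := \<alpha> j - 1)"]) auto
    have "((\<lambda>\<alpha>. c \<alpha> * (of_nat (\<alpha> j) * monomial (\<alpha>(j := \<alpha> j - 1)) (cvec (x - a)))) has_sum g' 0) {\<alpha>. \<alpha> j \<noteq> 0}"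
      using hs by (subst has_sum_cong_neutral[where T=UNIV]) auto
    from this[folded has_sum_reindex_bij_betw[OF bij]] show ?thesis
      by (simp add: deriv_coeffs_def mult_ac)
  qed
  moreover have "((\<lambda>t. u (x + t *\<^sub>R ?e)) has_vector_derivative g' 0) (at 0)"
  proof -
    have "(\<Phi> has_field_derivative g' 0) (at (of_real 0))" using g'[of 0] \<delta> by simp
    from has_vector_derivative_real_field[OF this] have "((\<lambda>t. \<Phi> (of_real t)) has_vector_derivative g' 0) (at 0)" .
    then show ?thesis
    proof (rule has_vector_derivative_transform_within_open[where S="ball 0 \<delta>"])
      fix t :: real assume t: "t \<in> ball 0 \<delta>"
      have "norm (x + t *\<^sub>R ?e - a) \<le> norm (x - a) + norm (t *\<^sub>R ?e)"
        using norm_triangle_ineq[of "x - a" "t *\<^sub>R ?e"] by (simp add: algebra_simps)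
      also have "\<dots> < r" using t xa \<delta> by (simp add: \<delta>_def)
      finally have "x + t *\<^sub>R ?e \<in> ball a r" by (simp add: dist_norm norm_minus_commute)
      then have "((\<lambda>\<alpha>. c \<alpha> * monomial \<alpha> (cvec (x + t *\<^sub>R ?e - a))) has_sum u (x + t *\<^sub>R ?e)) UNIV"
        using m unfolding power_series_at_def by blast
      moreover have "cvec (x + t *\<^sub>R ?e - a) = v (of_real t)"
        unfolding v_def by (simp add: cvec_scaleR[symmetric] cvec_axis[symmetric] cvec_add[symmetric] algebra_simps del: cvec_axis)
      ultimately show "\<Phi> (of_real t) = u (x + t *\<^sub>R ?e)" unfolding \<Phi>_def by (simp add: infsumI)
    qed (use \<delta> in auto)
  qed
  ultimately show ?thesis by blast
qed

lemma power_series_at_deriv: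
  assumes "power_series_at c a r u" shows "power_series_at (deriv_coeffs j c) a r (real_pd j u)"
  unfolding power_series_at_def real_pd_def
proof
  fix x assume x: "x \<in> ball a r"
  from power_series_at_deriv_ex[OF assms x, of j] obtain D where
    D: "((\<lambda>t. u (x + t *\<^sub>R axis j 1)) has_vector_derivative D) (at 0)"
     "((\<lambda>\<beta>. deriv_coeffs j c \<beta> * monomial \<beta> (cvec (x - a))) has_sum D) UNIV" by blast
  show "((\<lambda>\<beta>. deriv_coeffs j c \<beta> * monomial \<beta> (cvec (x - a))) has_sum vector_derivative (\<lambda>t. u (x + t *\<^sub>R axis j 1)) (at 0)) UNIV"
    using D by (simp add: vector_derivative_at)
qed

definition lap_coeffs :: "(('n::finite \<Rightarrow> nat) \<Rightarrow> complex) \<Rightarrow> ('n \<Rightarrow> nat) \<Rightarrow> complex" where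
  "lap_coeffs c \<beta> = (\<Sum>j\<in>UNIV. deriv_coeffs j (deriv_coeffs j c) \<beta>)"

lemma has_sum_finite_sum:
  fixes f :: "'i \<Rightarrow> 'a \<Rightarrow> complex"
  assumes "finite J" "\<And>j. j \<in> J \<Longrightarrow> (f j has_sum s j) A"
  shows "((\<lambda>x. \<Sum>j\<in>J. f j x) has_sum (\<Sum>j\<in>J. s j)) A"
  using assms by (induction J rule: finite_induct) (auto intro: has_sum_add)

lemma power_series_at_real_laplacian:
  assumes "power_series_at c a r u" shows "power_series_at (lap_coeffs c) a r (real_laplacian u)"
  unfolding power_series_at_def real_laplacian_eq lap_coeffs_def sum_distrib_right
proof (intro ballI has_sum_finite_sum)
  fix x and j :: 'a assume "x \<in> ball a r"
  then show "((\<lambda>\<alpha>. deriv_coeffs j (deriv_coeffs j c) \<alpha> * monomial \<alpha> (cvec (x - a))) has_sum real_pd j (real_pd j u) x) UNIV"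
    using power_series_at_deriv[OF power_series_at_deriv[OF assms]] unfolding power_series_at_def by blast
qed simp

lemma power_series_at_real_laplacian_iter:
  assumes "power_series_at c a r u" shows "power_series_at ((lap_coeffs ^^ p) c) a r ((real_laplacian ^^ p) u)"
  by (induction p) (auto intro: power_series_at_real_laplacian assms)

lemma power_series_at_cong: "power_series_at c a r u \<Longrightarrow> (\<And>x. x \<in> ball a r \<Longrightarrow> u x = u' x) \<Longrightarrow> power_series_at c a r u'"
  unfolding power_series_at_def by auto

text \<open>Induction on the degree of \<open>\<beta>\<close>: the constant coefficient is the value at the centre,
  and any other one is, up to a factor, a coefficient of lower degree of a derivative.\<close>

lemma power_series_at_zero_unique:
  fixes c :: "('n::finite \<Rightarrow> nat) \<Rightarrow> complex"
  assumes "power_series_at c a r (\<lambda>x. 0)" "r > 0"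
  shows "c \<beta> = 0"
  using assms
proof (induction "sum \<beta> UNIV" arbitrary: \<beta> c)
  case 0
  then have b: "\<beta> = (\<lambda>_. 0)" by auto
  have "((\<lambda>\<alpha>. c \<alpha> * monomial \<alpha> (cvec (a - a))) has_sum 0) UNIV"
  proof -
    have "a \<in> ball a r" using \<open>r > 0\<close> by simp
    then show ?thesis using 0(2) unfolding power_series_at_def by blast
  qed
  moreover have "monomial \<alpha> (cvec (a - a)) = (if \<alpha> = (\<lambda>_. 0) then 1 else 0)" for \<alpha>
  proof (cases "\<alpha> = (\<lambda>_. 0)")
    case False
    then obtain i where "\<alpha> i \<noteq> 0" by auto
    then show ?thesis using False by (simp add: monomial_split[of \<alpha> _ i] cvec_nth)
  qed (simp add: monomial_def)
  ultimately have "((\<lambda>\<alpha>. c \<alpha> * (if \<alpha> = (\<lambda>_. 0) then 1 else 0)) has_sum 0) UNIV" by simp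
  then have "((\<lambda>\<alpha>. c \<alpha> * (if \<alpha> = (\<lambda>_. 0) then 1 else 0)) has_sum 0) {\<lambda>_. 0}"
    by (subst has_sum_cong_neutral[where T=UNIV]) auto
  then have "(\<Sum>\<alpha>\<in>{\<lambda>_. 0}. c \<alpha> * (if \<alpha> = (\<lambda>_. 0) then 1 else 0)) = 0"
    using has_sum_unique has_sum_finite by blast
  then show ?case using b by simp
next
  case (Suc m)
  then obtain j where j: "\<beta> j \<noteq> 0" by (metis sum.neutral nat.distinct(1) UNIV_I)
  define \<gamma> where "\<gamma> = \<beta>(j := \<beta> j - 1)"
  have g: "\<gamma>(j := Suc (\<gamma> j)) = \<beta>" using j by (auto simp: \<gamma>_def)
  have "power_series_at (deriv_coeffs j c) a r (real_pd j (\<lambda>x. 0))" using Suc.prems by (intro power_series_at_deriv)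
  moreover have "real_pd j (\<lambda>x. 0 :: complex) = (\<lambda>x. 0)" by (simp add: real_pd_def fun_eq_iff vector_derivative_at[OF has_vector_derivative_const])
  ultimately have "power_series_at (deriv_coeffs j c) a r (\<lambda>x. 0)" by simp
  moreover have m: "m = sum \<gamma> UNIV" using sum_update_dec[of \<beta> j] j Suc(2) by (simp add: \<gamma>_def)
  ultimately have "deriv_coeffs j c \<gamma> = 0" using Suc(1)[OF m] Suc.prems(2) by simp
  then have "of_nat (Suc (\<gamma> j)) * c \<beta> = 0" by (simp only: deriv_coeffs_def g)
  then show ?case by (simp del: of_nat_Suc)
qed

lemma power_series_at_zero_unique': "power_series_at c a r u \<Longrightarrow> r > 0 \<Longrightarrow> (\<And>x. x \<in> ball a r \<Longrightarrow> u x = 0) \<Longrightarrow> c = (\<lambda>_. 0)"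
  using power_series_at_zero_unique[OF power_series_at_cong[of c a r u "\<lambda>x. 0"]] by (auto simp: fun_eq_iff)

definition degree_part :: "nat \<Rightarrow> (('n::finite \<Rightarrow> nat) \<Rightarrow> complex) \<Rightarrow> ('n \<Rightarrow> nat) \<Rightarrow> complex" where
  "degree_part m c \<alpha> = (if sum \<alpha> UNIV = m then c \<alpha> else 0)"

lemma power_series_at_degree_part:
  assumes "\<And>x. u x = (\<Sum>\<alpha> | sum \<alpha> UNIV = m. c \<alpha> * monomial \<alpha> (cvec x))"
  shows "power_series_at (degree_part m c) 0 r u"
  unfolding power_series_at_def
proof
  fix x :: "real ^ 'a"
  have "((\<lambda>\<alpha>. degree_part m c \<alpha> * monomial \<alpha> (cvec (x - 0))) has_sum u x) {\<alpha>. sum \<alpha> UNIV = m}"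
    unfolding assms by (rule has_sum_finiteI[OF finite_multi_index]) (simp add: degree_part_def)
  then show "((\<lambda>\<alpha>. degree_part m c \<alpha> * monomial \<alpha> (cvec (x - 0))) has_sum u x) UNIV"
    by (subst (asm) has_sum_cong_neutral[where T=UNIV]) (auto simp: degree_part_def)
qed

text \<open>The Laplacian lowers degrees by exactly two, so it commutes with splitting a
  coefficient family by degree.\<close>

lemma lap_coeffs_degree_part: "lap_coeffs (degree_part (m + 2) c) = degree_part m (lap_coeffs c)" "m < 2 \<Longrightarrow> lap_coeffs (degree_part m c) = (\<lambda>_. 0)"
proof -
  have s: "sum (\<beta>(j := Suc (\<beta> j))) UNIV = Suc (sum \<beta> UNIV)" for \<beta> :: "'a \<Rightarrow> nat" and j
  proof -
    have "sum \<beta> UNIV = \<beta> j + sum \<beta> (UNIV - {j})" by (rule sum.remove) auto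
    moreover have "sum (\<beta>(j := Suc (\<beta> j))) UNIV = Suc (\<beta> j) + sum (\<beta>(j := Suc (\<beta> j))) (UNIV - {j})"
      by (subst sum.remove[of _ j]) auto
    moreover have "sum (\<beta>(j := Suc (\<beta> j))) (UNIV - {j}) = sum \<beta> (UNIV - {j})"
      by (intro sum.cong) auto
    ultimately show ?thesis by simp
  qed
  have d: "deriv_coeffs j (degree_part (Suc k) c) = degree_part k (deriv_coeffs j c)" "deriv_coeffs j (degree_part 0 c) = (\<lambda>_. 0)" for j :: 'a and k c
    by (auto simp: fun_eq_iff deriv_coeffs_def degree_part_def s simp del: fun_upd_apply)
  show "lap_coeffs (degree_part (m + 2) c) = degree_part m (lap_coeffs c)"
  proof
    fix \<beta>
    have "lap_coeffs (degree_part (m + 2) c) \<beta> = (\<Sum>j\<in>UNIV. degree_part m (deriv_coeffs j (deriv_coeffs j c)) \<beta>)"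
      by (simp add: lap_coeffs_def d)
    then show "lap_coeffs (degree_part (m + 2) c) \<beta> = degree_part m (lap_coeffs c) \<beta>" by (simp add: degree_part_def lap_coeffs_def)
  qed
  have z: "deriv_coeffs j (\<lambda>_. 0) = (\<lambda>_. 0)" for j :: 'a by (simp add: fun_eq_iff deriv_coeffs_def)
  show "lap_coeffs (degree_part m c) = (\<lambda>_. 0)" if "m < 2"
  proof -
    have "m = 0 \<or> m = Suc 0" using that by auto
    then show ?thesis by (auto simp: fun_eq_iff lap_coeffs_def d z)
  qed
qed

lemma lap_coeffs_iter_degree_part: "(lap_coeffs ^^ p) (degree_part (m + 2 * p) c) = degree_part m ((lap_coeffs ^^ p) c)"
proof (induction p arbitrary: c)
  case (Suc p)
  have "(lap_coeffs ^^ Suc p) (degree_part (m + 2 * Suc p) c) = (lap_coeffs ^^ p) (lap_coeffs (degree_part ((m + 2 * p) + 2) c))"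
    unfolding funpow_Suc_right comp_def by (simp add: algebra_simps)
  also have "\<dots> = degree_part m ((lap_coeffs ^^ p) (lap_coeffs c))" unfolding lap_coeffs_degree_part(1) by (rule Suc)
  finally show ?case unfolding funpow_Suc_right comp_def .
qed simp

lemma real_laplacian_hom_polys:
  assumes q: "q \<in> hom_polys m"
  shows "real_laplacian (\<lambda>x. q (cvec x)) = (\<lambda>x. lap q (cvec x))"
proof -
  have 1: "real_pd j (\<lambda>x. q (cvec x)) = (\<lambda>x. pd j q (cvec x))" if "q \<in> hom_polys m" for j q and m
    unfolding real_pd_def using vector_derivative_at[OF has_vector_derivative_line[OF that]] by (intro ext)
  have "real_pd j (real_pd j (\<lambda>x. q (cvec x))) = (\<lambda>x. pd j (pd j q) (cvec x))" for j
    unfolding 1[OF q] by (rule 1[OF pd_hom_polys[OF q]])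
  then show ?thesis unfolding real_laplacian_eq complex_laplacian_eq by simp
qed

lemma real_laplacian_iter_hom_polys:
  "q \<in> hom_polys m \<Longrightarrow> (real_laplacian ^^ p) (\<lambda>x. q (cvec x)) = (\<lambda>x. (lap ^^ p) q (cvec x))"
proof (induction p arbitrary: q m)
  case (Suc p)
  show ?case using Suc.IH[OF lap_hom_polys[OF Suc.prems]] real_laplacian_hom_polys[OF Suc.prems]
    unfolding funpow_Suc_right comp_def by simp
qed simp

text \<open>A polynomial is determined by its values at real points, where it is a finite power series.\<close>

lemma hom_polys_eq_0I:
  assumes q: "q \<in> hom_polys m" and r: "r > 0" and z: "\<And>x. x \<in> ball 0 r \<Longrightarrow> q (cvec x) = 0"
  shows "q = (\<lambda>z. 0)"
proof -
  obtain c where c: "\<And>z. q z = (\<Sum>\<alpha> | sum \<alpha> UNIV = m. c \<alpha> * monomial \<alpha> z)"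
    using q unfolding hom_polys_def by auto
  have "power_series_at (degree_part m c) 0 r (\<lambda>x. q (cvec x))" by (rule power_series_at_degree_part) (rule c)
  from power_series_at_zero_unique'[OF this r z] have "degree_part m c = (\<lambda>_. 0)" .
  then have "c \<alpha> = 0" if "sum \<alpha> UNIV = m" for \<alpha> using that by (auto simp: degree_part_def fun_eq_iff split: if_splits)
  then show ?thesis by (simp add: c fun_eq_iff)
qed

section \<open>Homogeneous expansions of real analytic functions\<close>

text \<open>The positive reals accumulate at \<open>0\<close>, so analytic continuation applies.\<close>

lemma powser_zero_unique:
  fixes d :: "nat \<Rightarrow> complex"
  assumes d: "\<And>t::real. 0 < t \<Longrightarrow> t < 1 \<Longrightarrow> (\<lambda>m. d m * of_real t ^ m) sums 0"
  shows "d m = 0"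
proof -
  define F where "F = Abs_fps d"
  have "summable (\<lambda>m. d m * of_real (1/2) ^ m)" using sums_summable[OF d[of "1/2"]] by simp
  then have r: "fps_conv_radius F \<ge> ereal (1/2)"
    using conv_radius_geI[of d "of_real (1/2)"] by (simp add: fps_conv_radius_def F_def)
  have hol: "eval_fps F holomorphic_on ball 0 (1/2)"
  proof (rule holomorphic_on_eval_fps, rule subsetI)
    fix z :: complex assume "z \<in> ball 0 (1/2)"
    then have "ereal (norm z) < ereal (1/2)" by simp
    also note r
    finally show "z \<in> eball 0 (fps_conv_radius F)" by simp
  qed
  have zero: "eval_fps F w = 0" if "w \<in> ball 0 (1/2)" for w
  proof (rule analytic_continuation[OF hol])
    show "of_real ` {0<..<1/2} \<subseteq> ball (0::complex) (1/2)" by auto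
    show "0 islimpt (complex_of_real ` {0<..<1/2})"
      unfolding islimpt_approachable
    proof (intro allI impI)
      fix e :: real assume "e > 0"
      then show "\<exists>x'\<in>complex_of_real ` {0<..<1/2}. x' \<noteq> 0 \<and> dist x' 0 < e"
        by (intro bexI[of _ "of_real (min (e/2) (1/4))"]) auto
    qed
    fix z assume "z \<in> complex_of_real ` {0<..<1/2}"
    then obtain t where "z = of_real t" "0 < t" "t < 1" by auto
    then show "eval_fps F z = 0" using d[of t] by (simp add: eval_fps_def F_def sums_iff)
  qed (use that in auto)
  have "F = 0"
  proof (rule eval_fps_eqD)
    show "fps_conv_radius F > 0" using r by (rule less_le_trans[rotated]) simp
    have "eventually (\<lambda>z. z \<in> ball (0::complex) (1/2)) (nhds 0)" by (intro eventually_nhds_in_open) auto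
    then show "eventually (\<lambda>z. eval_fps F z = eval_fps 0 z) (nhds 0)"
      by (rule eventually_mono) (simp add: zero)
  qed auto
  then have "fps_nth F m = 0" by simp
  then show ?thesis by (simp add: F_def)
qed

lemma has_sum_by_degree:
  fixes c :: "('n::finite \<Rightarrow> nat) \<Rightarrow> complex"
  assumes "(c has_sum s) UNIV"
  shows "(\<lambda>m. \<Sum>\<alpha> | sum \<alpha> UNIV = m. c \<alpha>) sums s"
proof -
  let ?S = "Sigma UNIV (\<lambda>m. {\<alpha> :: 'n \<Rightarrow> nat. sum \<alpha> UNIV = m})"
  have bij: "bij_betw snd ?S UNIV" by (rule bij_betwI[where g="\<lambda>\<alpha>. (sum \<alpha> UNIV, \<alpha>)"]) auto
  have "((\<lambda>x. c (snd x)) has_sum s) ?S" unfolding has_sum_reindex_bij_betw[OF bij] by (rule assms)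
  then have "((\<lambda>m. \<Sum>\<alpha> | sum \<alpha> UNIV = m. c \<alpha>) has_sum s) UNIV"
    by (rule has_sum_SigmaD) (simp add: has_sum_finite[OF finite_multi_index])
  then show ?thesis by (rule has_sum_imp_sums)
qed

text \<open>Along each ray both the homogeneous expansion and the power series sorted by degree
  are power series in the radius, so they agree term by term.\<close>

lemma expansion_coeffs:
  fixes q :: "nat \<Rightarrow> complex ^ 'n \<Rightarrow> complex"
  assumes c: "power_series_at c 0 r u" and r: "r > 0" and q: "\<And>m. q m \<in> hom_polys m"
    and s: "\<And>x. x \<in> ball 0 1 \<Longrightarrow> (\<lambda>m. q m (cvec x)) sums u x"
  shows "q m = (\<lambda>z. \<Sum>\<alpha> | sum \<alpha> UNIV = m. c \<alpha> * monomial \<alpha> z)"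
proof -
  define p where "p m = (\<lambda>z :: complex ^ 'n. \<Sum>\<alpha> | sum \<alpha> UNIV = m. c \<alpha> * monomial \<alpha> z)" for m
  have p: "p m \<in> hom_polys m" for m unfolding p_def hom_polys_def by blast
  have d: "(\<lambda>z. q m z + (- 1) * p m z) \<in> hom_polys m" by (intro hom_polys_add hom_polys_cmult p q)
  have "(\<lambda>z. q m z + (- 1) * p m z) = (\<lambda>z. 0)"
  proof (rule hom_polys_eq_0I[OF d, of "min r 1"])
    fix x :: "real ^ 'n" assume x: "x \<in> ball 0 (min r 1)"
    have "q m (cvec x) - p m (cvec x) = 0" for m
    proof (rule powser_zero_unique)
      fix t :: real assume t: "0 < t" "t < 1"
      have tx: "norm (t *\<^sub>R x) \<le> norm x" using t by (simp add: mult_left_le_one_le)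
      have hs: "f (cvec (t *\<^sub>R x)) = f (cvec x) * of_real t ^ m" if "f \<in> hom_polys m" for f :: "complex ^ 'n \<Rightarrow> complex" and m
        using hom_polys_scale[OF that, of "of_real t" "cvec x"] by (simp add: cvec_scaleR)
      have "(\<lambda>m. q m (cvec (t *\<^sub>R x))) sums u (t *\<^sub>R x)" using tx x by (intro s) simp
      moreover have "((\<lambda>\<alpha>. c \<alpha> * monomial \<alpha> (cvec (t *\<^sub>R x - 0))) has_sum u (t *\<^sub>R x)) UNIV"
        using c tx x unfolding power_series_at_def by (auto simp del: norm_scaleR)
      then have "(\<lambda>m. p m (cvec (t *\<^sub>R x))) sums u (t *\<^sub>R x)" unfolding p_def using has_sum_by_degree by fastforce
      ultimately have "(\<lambda>m. q m (cvec (t *\<^sub>R x)) - p m (cvec (t *\<^sub>R x))) sums (u (t *\<^sub>R x) - u (t *\<^sub>R x))" by (rule sums_diff)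
      then show "(\<lambda>m. (q m (cvec x) - p m (cvec x)) * of_real t ^ m) sums 0"
        unfolding hs[OF p] hs[OF q] by (simp add: algebra_simps)
    qed
    then show "q m (cvec x) + (- 1) * p m (cvec x) = 0" by simp
  qed (use r in auto)
  then show ?thesis by (simp add: p_def fun_eq_iff)
qed

text \<open>The part of degree \<open>m\<close> of the power series of \<open>\<Delta>\<^sup>p u\<close> is \<open>\<Delta>\<^sup>p\<close> of the component of degree \<open>m + 2p\<close>.
  From right to left this makes the closed form of the kernel polyharmonic near \<open>0\<close>; from left to right it applies to arbitrary
  members of the Bergman space.\<close>

lemma polyharmonic_expansion_iff:
  fixes q :: "nat \<Rightarrow> complex ^ 'n \<Rightarrow> complex"
  assumes c: "power_series_at c 0 r u" and r: "r > 0" and q: "\<And>m. q m \<in> hom_polys m"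
    and s: "\<And>x. x \<in> ball 0 1 \<Longrightarrow> (\<lambda>m. q m (cvec x)) sums u x"
  shows "(\<forall>x\<in>ball 0 r. (real_laplacian ^^ p) u x = 0) \<longleftrightarrow> (\<forall>m. q m \<in> polyharmonic_polys p m)"
proof -
  have mq: "power_series_at (degree_part m c) 0 r' (\<lambda>x. q m (cvec x))" for m r'
    by (rule power_series_at_degree_part) (use expansion_coeffs[OF c r q s] in metis)
  have L: "power_series_at ((lap_coeffs ^^ p) (degree_part m c)) 0 r' (\<lambda>x. (lap ^^ p) (q m) (cvec x))" for m r'
    using power_series_at_real_laplacian_iter[OF mq, of p] unfolding real_laplacian_iter_hom_polys[OF q] .
  have Lu: "power_series_at ((lap_coeffs ^^ p) c) 0 r ((real_laplacian ^^ p) u)" by (rule power_series_at_real_laplacian_iter[OF c])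
  show ?thesis
  proof
    assume "\<forall>x\<in>ball 0 r. (real_laplacian ^^ p) u x = 0"
    then have z: "(lap_coeffs ^^ p) c = (\<lambda>_. 0)" using power_series_at_zero_unique'[OF Lu r] by blast
    show "\<forall>m. q m \<in> polyharmonic_polys p m"
    proof
      fix m
      have "(lap ^^ p) (q m) = (\<lambda>z. 0)"
      proof (cases "m < 2 * p")
        case True then show ?thesis using lap_iter_low[OF q] by blast
      next
        case False
        then have "m = (m - 2 * p) + 2 * p" by simp
        then have "(lap_coeffs ^^ p) (degree_part m c) = degree_part (m - 2 * p) ((lap_coeffs ^^ p) c)" by (metis lap_coeffs_iter_degree_part)
        then have "(lap_coeffs ^^ p) (degree_part m c) = (\<lambda>_. 0)" unfolding z by (simp add: degree_part_def fun_eq_iff)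
        then have "power_series_at (\<lambda>_. 0) 0 1 (\<lambda>x. (lap ^^ p) (q m) (cvec x))" using L[of m 1] by simp
        then have "(lap ^^ p) (q m) (cvec x) = 0" if "x \<in> ball 0 1" for x
          using that unfolding power_series_at_def using has_sum_unique[OF _ has_sum_0] by fastforce
        then show ?thesis by (intro hom_polys_eq_0I[OF lap_iter_hom_polys[OF q], of 1]) auto
      qed
      then show "q m \<in> polyharmonic_polys p m" using q by (simp add: polyharmonic_polys_def)
    qed
  next
    assume h: "\<forall>m. q m \<in> polyharmonic_polys p m"
    have "(lap_coeffs ^^ p) c \<beta> = 0" for \<beta>
    proof -
      have "(lap ^^ p) (q (sum \<beta> UNIV + 2 * p)) = (\<lambda>z. 0)" using h by (auto simp: polyharmonic_polys_def fun_eq_iff)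
      then have "(lap_coeffs ^^ p) (degree_part (sum \<beta> UNIV + 2 * p) c) = (\<lambda>_. 0)"
        using power_series_at_zero_unique'[OF L[of "sum \<beta> UNIV + 2 * p" 1]] by simp
      then have "degree_part (sum \<beta> UNIV) ((lap_coeffs ^^ p) c) \<beta> = 0" unfolding lap_coeffs_iter_degree_part by simp
      then show ?thesis by (simp add: degree_part_def)
    qed
    then have "power_series_at (\<lambda>_. 0) 0 r ((real_laplacian ^^ p) u)" using Lu by (metis ext)
    then show "\<forall>x\<in>ball 0 r. (real_laplacian ^^ p) u x = 0"
      unfolding power_series_at_def using has_sum_unique[OF _ has_sum_0] by fastforce
  qed
qed

lemma power_series_at_line_holomorphic:
  fixes u :: "real ^ 'n \<Rightarrow> complex"
  assumes m: "power_series_at c (t0 *\<^sub>R x) r u" and r: "r > 0" and x: "norm x < 1"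
  obtains \<Phi> where "\<Phi> holomorphic_on ball (of_real t0) (r / 2)"
    "\<And>t::real. \<bar>t - t0\<bar> < r / 2 \<Longrightarrow> u (t *\<^sub>R x) = \<Phi> (of_real t)"
proof -
  define V :: "real ^ 'n" where "V = (r / 2) *\<^sub>R (\<chi> i. \<bar>x $ i\<bar>)"
  have "norm (\<chi> i. \<bar>x $ i\<bar>) = norm x" by (simp add: norm_vec_def)
  then have "norm V = (r / 2) * norm x" using r by (simp add: V_def)
  also have "\<dots> \<le> (r / 2) * 1" using x r by (intro mult_left_mono) auto
  finally have V: "norm V < r" using r by simp
  define v where "v z = (z - of_real t0) *s cvec x" for z :: complex
  have v: "cmod (v z $ i) \<le> V $ i" if "z \<in> cball (of_real t0) (r / 2)" for z i
  proof -
    have "cmod (v z $ i) = cmod (z - of_real t0) * \<bar>x $ i\<bar>"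
      unfolding v_def vector_smult_component cvec_nth norm_mult norm_of_real ..
    also have "\<dots> \<le> (r / 2) * \<bar>x $ i\<bar>"
      using that by (intro mult_right_mono) (auto simp: dist_norm norm_minus_commute)
    finally show ?thesis by (simp add: V_def)
  qed
  define \<Phi> where "\<Phi> z = (\<Sum>\<^sub>\<infinity>\<alpha>. c \<alpha> * monomial \<alpha> (v z))" for z
  have ul: "uniform_limit (cball (of_real t0) (r / 2)) (\<lambda>S z. \<Sum>\<alpha>\<in>S. c \<alpha> * monomial \<alpha> (v z)) \<Phi> (finite_subsets_at_top UNIV)"
    unfolding \<Phi>_def using v by (rule power_series_at_uniform_limit[OF m V])
  have hol: "(\<lambda>z. \<Sum>\<alpha>\<in>S. c \<alpha> * monomial \<alpha> (v z)) holomorphic_on A" for S A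
    unfolding v_def monomial_def by (simp, intro holomorphic_intros)
  have "\<Phi> holomorphic_on ball (of_real t0) (r / 2)"
  proof (rule holomorphic_uniform_limit[OF _ ul finite_subsets_at_top_neq_bot])
    show "\<forall>\<^sub>F S in finite_subsets_at_top UNIV. continuous_on (cball (complex_of_real t0) (r / 2)) (\<lambda>z. \<Sum>\<alpha>\<in>S. c \<alpha> * monomial \<alpha> (v z)) \<and>
       (\<lambda>z. \<Sum>\<alpha>\<in>S. c \<alpha> * monomial \<alpha> (v z)) holomorphic_on ball (complex_of_real t0) (r / 2)"
      by (intro always_eventually allI conjI hol holomorphic_on_imp_continuous_on)
  qed
  moreover have "u (t *\<^sub>R x) = \<Phi> (of_real t)" if t: "\<bar>t - t0\<bar> < r / 2" for t :: real
  proof -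
    have d: "t *\<^sub>R x - t0 *\<^sub>R x = (t - t0) *\<^sub>R x" by (simp add: algebra_simps)
    have "norm (t *\<^sub>R x - t0 *\<^sub>R x) \<le> \<bar>t - t0\<bar> * 1" unfolding d norm_scaleR using x by (intro mult_left_mono) auto
    then have "t *\<^sub>R x \<in> ball (t0 *\<^sub>R x) r" using t r by (simp add: dist_norm norm_minus_commute)
    then have "((\<lambda>\<alpha>. c \<alpha> * monomial \<alpha> (cvec (t *\<^sub>R x - t0 *\<^sub>R x))) has_sum u (t *\<^sub>R x)) UNIV"
      using m unfolding power_series_at_def by blast
    moreover have "cvec (t *\<^sub>R x - t0 *\<^sub>R x) = v (of_real t)" unfolding d cvec_scaleR v_def by simp
    ultimately show ?thesis unfolding \<Phi>_def by (simp add: infsumI)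
  qed
  ultimately show ?thesis using that by blast
qed

lemma real_analytic_on_power_series_at: "real_analytic_on u A \<longleftrightarrow> (\<forall>a\<in>A. \<exists>r>0. \<exists>c. power_series_at c a r u)"
  by (simp add: real_analytic_on_def power_series_at_def)

text \<open>The points near which \<open>\<phi>\<close> vanishes form an open and closed subset of \<open>I\<close>. The
  holomorphic extension may differ from point to point, which allows functions known to be analytic only
  locally.\<close>

lemma locally_holomorphic_identity:
  fixes \<phi> :: "real \<Rightarrow> complex"
  assumes I: "convex I" "0 \<in> I" "t \<in> I"
    and loc: "\<And>t0. t0 \<in> I \<Longrightarrow> \<exists>r>0. \<exists>\<Phi>. \<Phi> holomorphic_on ball (of_real t0) r \<and> (\<forall>t. \<bar>t - t0\<bar> < r \<longrightarrow> \<phi> t = \<Phi> (of_real t))"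
    and ev: "eventually (\<lambda>s. \<phi> s = 0) (nhds 0)"
  shows "\<phi> t = 0"
proof -
  define P where "P t \<longleftrightarrow> eventually (\<lambda>s. \<phi> s = 0) (nhds t)" for t :: real
  have "P t"
  proof (rule connected_induction_simple[OF convex_connected[OF I(1)], of 0 t P])
    show "0 \<in> I" "t \<in> I" "P 0" using I ev by (auto simp: P_def)
    fix t0 assume t0: "t0 \<in> I"
    from loc[OF t0] obtain r \<Phi> where r: "r > 0" and \<Phi>: "\<Phi> holomorphic_on ball (of_real t0) r"
      "\<And>t::real. \<bar>t - t0\<bar> < r \<Longrightarrow> \<phi> t = \<Phi> (of_real t)" by blast
    have step: "P t2" if t: "t1 \<in> ball t0 r" "t2 \<in> ball t0 r" and P: "P t1" for t1 t2
    proof -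
      obtain d where d: "d > 0" "\<And>s. dist s t1 < d \<Longrightarrow> \<phi> s = 0"
        using P unfolding P_def eventually_nhds_metric by blast
      define U where "U = complex_of_real ` (ball t1 d \<inter> ball t0 r)"
      have z0: "\<Phi> w = 0" if "w \<in> ball (of_real t0) r" for w
      proof (rule analytic_continuation[OF \<Phi>(1)])
        show "U \<subseteq> ball (of_real t0) r" unfolding U_def by (auto simp: dist_of_real)
        show "of_real t1 \<in> ball (complex_of_real t0) r" using t(1) by (simp add: dist_of_real)
        show "of_real t1 islimpt U"
          unfolding islimpt_approachable
        proof (intro allI impI)
          fix e :: real assume e: "e > 0"
          have "open (ball t1 d \<inter> ball t0 r \<inter> ball t1 e)" by (intro open_Int open_ball)
          moreover have "t1 \<in> ball t1 d \<inter> ball t0 r \<inter> ball t1 e" using t(1) d e by simp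
          ultimately obtain \<eta> where \<eta>: "\<eta> > 0" "ball t1 \<eta> \<subseteq> ball t1 d \<inter> ball t0 r \<inter> ball t1 e"
            unfolding open_contains_ball by blast
          have "t1 + \<eta> / 2 \<in> ball t1 \<eta>" using \<eta>(1) by (simp add: dist_real_def)
          then have in_int: "t1 + \<eta> / 2 \<in> ball t1 d \<inter> ball t0 r" "t1 + \<eta> / 2 \<in> ball t1 e" using \<eta>(2) by auto
          show "\<exists>x'\<in>U. x' \<noteq> of_real t1 \<and> dist x' (of_real t1) < e"
          proof (intro bexI[of _ "of_real (t1 + \<eta> / 2)"] conjI)
            show "complex_of_real (t1 + \<eta> / 2) \<in> U" unfolding U_def using in_int(1) by (rule imageI)
            show "dist (complex_of_real (t1 + \<eta> / 2)) (of_real t1) < e" using in_int(2) unfolding dist_of_real by (simp add: dist_commute)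
          qed (use \<eta> in \<open>simp del: of_real_add\<close>)
        qed
        show "\<Phi> w = 0" if "w \<in> U" for w
        proof -
          from that obtain s where s: "w = of_real s" "s \<in> ball t1 d" "s \<in> ball t0 r" unfolding U_def by blast
          then have "\<phi> s = 0" "\<phi> s = \<Phi> (of_real s)" using d(2)[of s] \<Phi>(2)[of s] by (auto simp: dist_commute dist_real_def abs_minus_commute)
          then show ?thesis using s by simp
        qed
      qed (use that in auto)
      have "eventually (\<lambda>s. s \<in> ball t0 r) (nhds t2)" using t(2) by (intro eventually_nhds_in_open) auto
      then show "P t2" unfolding P_def
      proof (rule eventually_mono)
        fix s assume s: "s \<in> ball t0 r"
        then have "\<phi> s = \<Phi> (of_real s)" by (intro \<Phi>(2)) (simp add: dist_real_def abs_minus_commute)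
        moreover have "complex_of_real s \<in> ball (of_real t0) r" using s by (simp add: dist_of_real)
        ultimately show "\<phi> s = 0" using z0 by simp
      qed
    qed
    show "\<exists>T. openin (top_of_set I) T \<and> t0 \<in> T \<and> (\<forall>x\<in>T. \<forall>y\<in>T. P x \<longrightarrow> P y)"
    proof (intro exI[of _ "I \<inter> ball t0 r"] conjI ballI impI)
      show "openin (top_of_set I) (I \<inter> ball t0 r)" by (rule openin_open_Int) simp
      show "t0 \<in> I \<inter> ball t0 r" using t0 r by simp
      show "P b" if "a \<in> I \<inter> ball t0 r" "b \<in> I \<inter> ball t0 r" "P a" for a b
        by (rule step[of a b]) (use that in auto)
    qed
  qed
  then show ?thesis unfolding P_def by (rule eventually_nhds_x_imp_x)
qed

lemma real_analytic_identity:
  fixes u :: "real ^ 'n \<Rightarrow> complex"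
  assumes an: "real_analytic_on u (ball 0 1)" and e: "e > 0" and z: "\<And>x. x \<in> ball 0 e \<Longrightarrow> u x = 0"
    and x: "x \<in> ball 0 1"
  shows "u x = 0"
proof -
  define I where "I = {t::real. norm (t *\<^sub>R x) < 1}"
  have "u (1 *\<^sub>R x) = 0"
  proof (rule locally_holomorphic_identity[of I])
    show "convex I"
    proof (rule convexI)
      fix s t a b :: real assume H: "s \<in> I" "t \<in> I" "0 \<le> a" "0 \<le> b" "a + b = 1"
      have "a *\<^sub>R (s *\<^sub>R x) + b *\<^sub>R (t *\<^sub>R x) \<in> ball 0 1"
        by (rule convexD[OF convex_ball]) (use H in \<open>auto simp: I_def\<close>)
      moreover have "a *\<^sub>R (s *\<^sub>R x) + b *\<^sub>R (t *\<^sub>R x) = (a *\<^sub>R s + b *\<^sub>R t) *\<^sub>R x" by (simp add: algebra_simps)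
      ultimately show "a *\<^sub>R s + b *\<^sub>R t \<in> I" by (simp add: I_def del: norm_scaleR)
    qed
    show "0 \<in> I" "1 \<in> I" using x by (auto simp: I_def)
    have "((\<lambda>s. s *\<^sub>R x) \<longlongrightarrow> 0 *\<^sub>R x) (nhds 0)" by (intro tendsto_intros filterlim_ident)
    then have "eventually (\<lambda>s. s *\<^sub>R x \<in> ball 0 e) (nhds 0)" by (rule topological_tendstoD) (use e in auto)
    then show "eventually (\<lambda>s. u (s *\<^sub>R x) = 0) (nhds 0)" by (rule eventually_mono) (rule z)
    fix t0 assume "t0 \<in> I"
    then have "t0 *\<^sub>R x \<in> ball 0 1" by (simp add: I_def)
    then obtain r c where r: "r > 0" and m: "power_series_at c (t0 *\<^sub>R x) r u" using an unfolding real_analytic_on_power_series_at by blast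
    obtain \<Phi> where "\<Phi> holomorphic_on ball (of_real t0) (r / 2)"
      "\<And>t::real. \<bar>t - t0\<bar> < r / 2 \<Longrightarrow> u (t *\<^sub>R x) = \<Phi> (of_real t)"
      using power_series_at_line_holomorphic[OF m r] x by auto
    then show "\<exists>r>0. \<exists>\<Phi>. \<Phi> holomorphic_on ball (of_real t0) r \<and> (\<forall>t. \<bar>t - t0\<bar> < r \<longrightarrow> u (t *\<^sub>R x) = \<Phi> (of_real t))"
      using r by (intro exI[of _ "r / 2"] conjI exI[of _ \<Phi>]) auto
  qed
  then show ?thesis by simp
qed

lemma real_analytic_real_laplacian_iter: "real_analytic_on u A \<Longrightarrow> real_analytic_on ((real_laplacian ^^ p) u) A"
  unfolding real_analytic_on_power_series_at using power_series_at_real_laplacian_iter by blast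

section \<open>Real analyticity of the closed form\<close>

text \<open>A norm bound in the Banach algebra of power series that converge absolutely on the polydisc of
  radius \<open>\<delta>\<close>. Holomorphic functions operate on this algebra, which is how
  fractional powers of polynomials are seen to be real analytic.\<close>

definition wiener :: "real \<Rightarrow> (complex ^ 'n \<Rightarrow> complex) \<Rightarrow> real \<Rightarrow> bool" where
  "wiener \<delta> f M \<longleftrightarrow> \<delta> > 0 \<and> (\<exists>c. (\<exists>S\<le>M. ((\<lambda>\<alpha>. norm (c \<alpha>) * \<delta> ^ sum \<alpha> UNIV) has_sum S) UNIV) \<and>
     (\<forall>h::complex ^ 'n. (\<forall>i. cmod (h $ i) \<le> \<delta>) \<longrightarrow> ((\<lambda>\<alpha>. c \<alpha> * monomial \<alpha> h) has_sum f h) UNIV))"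

lemma norm_monomial_le_power:
  fixes h :: "complex ^ 'n"
  assumes "\<And>i. cmod (h $ i) \<le> \<delta>"
  shows "cmod (monomial \<alpha> h) \<le> \<delta> ^ sum \<alpha> UNIV"
proof -
  have "cmod (monomial \<alpha> h) \<le> (\<Prod>i\<in>UNIV. \<delta> ^ \<alpha> i)"
    unfolding monomial_def prod_norm[symmetric] norm_power using assms by (intro prod_mono conjI power_mono) auto
  then show ?thesis by (simp add: power_sum)
qed

lemma wiener_norm_le:
  fixes h :: "complex ^ 'n"
  assumes "wiener \<delta> f M" "\<And>i. cmod (h $ i) \<le> \<delta>" shows "cmod (f h) \<le> M"
proof -
  from assms(1) obtain c S where c: "S \<le> M" "((\<lambda>\<alpha>. norm (c \<alpha>) * \<delta> ^ sum \<alpha> UNIV) has_sum S) UNIV"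
    "((\<lambda>\<alpha>. c \<alpha> * monomial \<alpha> h) has_sum f h) UNIV" unfolding wiener_def using assms(2) by blast
  have le: "norm (c \<alpha> * monomial \<alpha> h) \<le> norm (c \<alpha>) * \<delta> ^ sum \<alpha> UNIV" for \<alpha>
    unfolding norm_mult by (intro mult_left_mono norm_monomial_le_power assms(2)) auto
  have s: "(\<lambda>\<alpha>. norm (c \<alpha> * monomial \<alpha> h)) summable_on UNIV"
    using c(2) le by (intro Infinite_Sum.abs_summable_on_comparison_test'[where g="\<lambda>\<alpha>. norm (c \<alpha>) * \<delta> ^ sum \<alpha> UNIV"]) (auto simp: summable_on_def)
  have "cmod (f h) \<le> (\<Sum>\<^sub>\<infinity>\<alpha>. norm (c \<alpha> * monomial \<alpha> h))"
    using norm_infsum_bound[OF s] infsumI[OF c(3)] by simp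
  also have "\<dots> \<le> S" using has_sum_mono[OF has_sum_infsum[OF s] c(2)] le by simp
  finally show ?thesis using c(1) by simp
qed

lemma wiener_mono: "wiener \<delta> f M \<Longrightarrow> M \<le> M' \<Longrightarrow> wiener \<delta> f M'"
  unfolding wiener_def by (meson order_trans)

lemma wiener_cong: "wiener \<delta> f M \<Longrightarrow> (\<And>h. (\<forall>i. cmod (h $ i) \<le> \<delta>) \<Longrightarrow> f h = g h) \<Longrightarrow> wiener \<delta> g M"
  unfolding wiener_def by auto

lemma wiener_const: "\<delta> > 0 \<Longrightarrow> wiener \<delta> (\<lambda>h. \<kappa>) (cmod \<kappa>)"
proof -
  have 1: "((\<lambda>\<alpha>. norm (if \<alpha> = (\<lambda>_. 0) then \<kappa> else 0) * \<delta> ^ sum \<alpha> UNIV) has_sum cmod \<kappa>) UNIV"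
  proof -
    have "((\<lambda>\<alpha>. norm (if \<alpha> = (\<lambda>_. 0) then \<kappa> else 0) * \<delta> ^ sum \<alpha> UNIV) has_sum cmod \<kappa>) {\<lambda>_. 0}" by (rule has_sum_finiteI) auto
    then show ?thesis by (subst (asm) has_sum_cong_neutral[where T=UNIV]) auto
  qed
  have 2: "((\<lambda>\<alpha>. (if \<alpha> = (\<lambda>_. 0) then \<kappa> else 0) * monomial \<alpha> h) has_sum \<kappa>) UNIV" for h :: "complex ^ 'n"
  proof -
    have "((\<lambda>\<alpha>. (if \<alpha> = (\<lambda>_. 0) then \<kappa> else 0) * monomial \<alpha> h) has_sum \<kappa>) {\<lambda>_. 0}"
      by (rule has_sum_finiteI) (auto simp: monomial_def)
    then show ?thesis by (subst (asm) has_sum_cong_neutral[where T=UNIV]) auto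
  qed
  assume "\<delta> > 0"
  then show ?thesis unfolding wiener_def using 1 2 by (intro conjI exI[of _ "\<lambda>\<alpha>. if \<alpha> = (\<lambda>_. 0) then \<kappa> else 0"]) auto
qed

lemma wiener_cmult:
  fixes f :: "complex ^ 'n \<Rightarrow> complex"
  assumes "wiener \<delta> f M" shows "wiener \<delta> (\<lambda>h. \<kappa> * f h) (cmod \<kappa> * M)"
proof -
  from assms obtain c S where d: "\<delta> > 0" and c: "S \<le> M" "((\<lambda>\<alpha>. norm (c \<alpha>) * \<delta> ^ sum \<alpha> UNIV) has_sum S) UNIV"
    "\<And>h. (\<forall>i. cmod (h $ i) \<le> \<delta>) \<Longrightarrow> ((\<lambda>\<alpha>. c \<alpha> * monomial \<alpha> h) has_sum f h) UNIV" unfolding wiener_def by blast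
  show ?thesis unfolding wiener_def
  proof (intro conjI d exI[of _ "\<lambda>\<alpha>. \<kappa> * c \<alpha>"] exI[of _ "cmod \<kappa> * S"] allI impI)
    show "((\<lambda>\<alpha>. norm (\<kappa> * c \<alpha>) * \<delta> ^ sum \<alpha> UNIV) has_sum cmod \<kappa> * S) UNIV"
      using has_sum_cmult_right[OF c(2), of "cmod \<kappa>"] by (simp add: norm_mult mult.assoc)
    show "((\<lambda>\<alpha>. \<kappa> * c \<alpha> * monomial \<alpha> h) has_sum \<kappa> * f h) UNIV" if "\<forall>i. cmod (h $ i) \<le> \<delta>" for h :: "complex ^ 'n"
      using has_sum_cmult_right[OF c(3)[OF that], of \<kappa>] by (simp add: mult.assoc)
  qed (use c(1) in \<open>auto intro: mult_left_mono\<close>)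
qed

text \<open>Completeness of the algebra: the coefficients are summed over \<open>k\<close>, and the double family \<open>G\<close> is
  summable, so the order of summation may be exchanged.\<close>

lemma wiener_suminf:
  fixes f :: "nat \<Rightarrow> complex ^ 'n \<Rightarrow> complex"
  assumes f: "\<And>k. wiener \<delta> (f k) (M k)" and M: "summable M"
  shows "wiener \<delta> (\<lambda>h. \<Sum>k. f k h) (\<Sum>k. M k)"
proof -
  have d0: "\<delta> > 0" using f unfolding wiener_def by blast
  then have d: "\<delta> \<ge> 0" by simp
  define P where "P k c S \<longleftrightarrow> S \<le> M k \<and> ((\<lambda>\<alpha>. norm (c \<alpha>) * \<delta> ^ sum \<alpha> UNIV) has_sum S) UNIV \<and>
    (\<forall>h. (\<forall>i. cmod (h $ i) \<le> \<delta>) \<longrightarrow> ((\<lambda>\<alpha>. c \<alpha> * monomial \<alpha> h) has_sum f k h) UNIV)" for k c S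
  have "\<forall>k. \<exists>c S. P k c S"
    using f unfolding wiener_def P_def by blast
  from choice[OF this] obtain c where "\<forall>k. \<exists>S. P k (c k) S" by (rule exE)
  from choice[OF this] obtain S where PS: "\<forall>k. P k (c k) (S k)" by (rule exE)
  have c: "\<And>k. S k \<le> M k" "\<And>k. ((\<lambda>\<alpha>. norm (c k \<alpha>) * \<delta> ^ sum \<alpha> UNIV) has_sum S k) UNIV"
    "\<And>k h. (\<forall>i. cmod (h $ i) \<le> \<delta>) \<Longrightarrow> ((\<lambda>\<alpha>. c k \<alpha> * monomial \<alpha> h) has_sum f k h) UNIV"
    using PS unfolding P_def by simp_all
  have S0: "S k \<ge> 0" for k using has_sum_nonneg[OF c(2)] d by simp
  have M0: "M k \<ge> 0" for k using S0[of k] c(1)[of k] by linarith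
  have "summable S" using c(1) S0 by (intro summable_comparison_test'[OF M, of 0]) auto
  then have So: "S summable_on UNIV" using S0 by (intro summable_nonneg_imp_summable_on)
  define G where "G = (\<lambda>(k, \<alpha>). norm (c k \<alpha>) * \<delta> ^ sum \<alpha> UNIV)"
  have sG: "G summable_on (UNIV \<times> UNIV)"
    by (rule summable_on_SigmaI[OF _ So]) (use c(2) d in \<open>auto simp: G_def\<close>)
  have fib: "(\<lambda>k. G (k, \<alpha>)) summable_on UNIV" for \<alpha>
  proof -
    have "G summable_on (UNIV \<times> {\<alpha>})" by (rule summable_on_subset_banach[OF sG]) auto
    moreover have "bij_betw (\<lambda>k. (k, \<alpha>)) UNIV (UNIV \<times> {\<alpha>})" by (auto simp: bij_betw_def inj_on_def)
    ultimately show ?thesis using summable_on_reindex_bij_betw by fastforce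
  qed
  show ?thesis
  proof -
    define C where "C \<alpha> = (\<Sum>\<^sub>\<infinity>k. c k \<alpha>)" for \<alpha>
    have sc: "(\<lambda>k. norm (c k \<alpha>)) summable_on UNIV" for \<alpha>
    proof -
      have "(\<lambda>k. G (k, \<alpha>) * (1 / \<delta> ^ sum \<alpha> UNIV)) summable_on UNIV" by (rule summable_on_cmult_left[OF fib])
      then show ?thesis using d0 by (simp add: G_def)
    qed
    have hc: "((\<lambda>k. c k \<alpha>) has_sum C \<alpha>) UNIV" for \<alpha> unfolding C_def by (rule has_sum_infsum[OF abs_summable_summable[OF sc]])
    have A: "((\<lambda>\<alpha>. C \<alpha> * monomial \<alpha> h) has_sum (\<Sum>k. f k h)) UNIV" if h: "\<forall>i. cmod (h $ i) \<le> \<delta>" for h :: "complex ^ 'n"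
    proof -
      have le: "norm (c k \<alpha> * monomial \<alpha> h) \<le> G (k, \<alpha>)" for k \<alpha>
        unfolding norm_mult G_def prod.case using h by (intro mult_left_mono norm_monomial_le_power) auto
      have "(\<lambda>x. norm (case x of (k, \<alpha>) \<Rightarrow> c k \<alpha> * monomial \<alpha> h)) summable_on (UNIV \<times> UNIV)"
        using le by (intro Infinite_Sum.abs_summable_on_comparison_test'[OF sG]) auto
      then have s: "(\<lambda>(k, \<alpha>). c k \<alpha> * monomial \<alpha> h) summable_on (UNIV \<times> UNIV)" by (rule abs_summable_summable)
      define T where "T = infsum (\<lambda>(k, \<alpha>). c k \<alpha> * monomial \<alpha> h) (UNIV \<times> UNIV)"
      have hT: "((\<lambda>(k, \<alpha>). c k \<alpha> * monomial \<alpha> h) has_sum T) (UNIV \<times> UNIV)" unfolding T_def by (rule has_sum_infsum[OF s])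
      then have "((\<lambda>k. f k h) has_sum T) UNIV" by (rule has_sum_SigmaD) (use c(3)[OF h] in auto)
      then have "(\<lambda>k. f k h) sums T" by (rule has_sum_imp_sums)
      then have T: "T = (\<Sum>k. f k h)" by (rule sums_unique)
      have "((\<lambda>(\<alpha>, k). c k \<alpha> * monomial \<alpha> h) has_sum T) (UNIV \<times> UNIV)"
        using hT by (subst (asm) has_sum_swap) (simp add: case_prod_unfold)
      then show ?thesis unfolding T[symmetric]
        by (rule has_sum_SigmaD) (use has_sum_cmult_left[OF hc] in auto)
    qed
    have Cle: "norm (C \<alpha>) * \<delta> ^ sum \<alpha> UNIV \<le> (\<Sum>\<^sub>\<infinity>k. G (k, \<alpha>))" for \<alpha>
    proof -
      have "norm (C \<alpha>) \<le> (\<Sum>\<^sub>\<infinity>k. norm (c k \<alpha>))" unfolding C_def by (rule norm_infsum_bound[OF sc])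
      then have "norm (C \<alpha>) * \<delta> ^ sum \<alpha> UNIV \<le> (\<Sum>\<^sub>\<infinity>k. norm (c k \<alpha>)) * \<delta> ^ sum \<alpha> UNIV" using d by (intro mult_right_mono) auto
      also have "\<dots> = (\<Sum>\<^sub>\<infinity>k. G (k, \<alpha>))" unfolding G_def prod.case by (rule infsum_cmult_left[symmetric]) (use sc in auto)
      finally show ?thesis .
    qed
    have hG: "(G has_sum infsum G (UNIV \<times> UNIV)) (UNIV \<times> UNIV)" by (rule has_sum_infsum[OF sG])
    have g1: "(S has_sum infsum G (UNIV \<times> UNIV)) UNIV"
      using hG by (rule has_sum_SigmaD) (use c(2) in \<open>auto simp: G_def\<close>)
    have g2: "((\<lambda>\<alpha>. \<Sum>\<^sub>\<infinity>k. G (k, \<alpha>)) has_sum infsum G (UNIV \<times> UNIV)) UNIV"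
    proof -
      have "((\<lambda>(\<alpha>, k). G (k, \<alpha>)) has_sum infsum G (UNIV \<times> UNIV)) (UNIV \<times> UNIV)"
        using hG by (subst (asm) has_sum_swap)
      then show ?thesis by (rule has_sum_SigmaD) (use has_sum_infsum[OF fib] in auto)
    qed
    have sC: "(\<lambda>\<alpha>. norm (C \<alpha>) * \<delta> ^ sum \<alpha> UNIV) summable_on UNIV"
    proof -
      have "(\<lambda>\<alpha>. \<Sum>\<^sub>\<infinity>k. G (k, \<alpha>)) summable_on UNIV" using g2 by (auto simp: summable_on_def)
      then show ?thesis by (rule summable_on_comparison_test) (use Cle d in auto)
    qed
    have "infsum (\<lambda>\<alpha>. norm (C \<alpha>) * \<delta> ^ sum \<alpha> UNIV) UNIV \<le> infsum G (UNIV \<times> UNIV)"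
      using has_sum_mono[OF has_sum_infsum[OF sC] g2] Cle by simp
    also have "\<dots> = (\<Sum>k. S k)" using has_sum_imp_sums[OF g1] by (rule sums_unique)
    also have "\<dots> \<le> (\<Sum>k. M k)" by (intro suminf_le c(1) \<open>summable S\<close> M)
    finally show ?thesis unfolding wiener_def using A d0 has_sum_infsum[OF sC] by blast
  qed
qed

lemma wiener_add:
  assumes "wiener \<delta> f M" "wiener \<delta> g N" shows "wiener \<delta> (\<lambda>h. f h + g h) (M + N)"
proof -
  from assms(1) obtain c S where d0: "\<delta> > 0" and c: "S \<le> M" "((\<lambda>\<alpha>. norm (c \<alpha>) * \<delta> ^ sum \<alpha> UNIV) has_sum S) UNIV"
    "\<And>h. (\<forall>i. cmod (h $ i) \<le> \<delta>) \<Longrightarrow> ((\<lambda>\<alpha>. c \<alpha> * monomial \<alpha> h) has_sum f h) UNIV" unfolding wiener_def by blast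
  from assms(2) obtain d T where d: "T \<le> N" "((\<lambda>\<alpha>. norm (d \<alpha>) * \<delta> ^ sum \<alpha> UNIV) has_sum T) UNIV"
    "\<And>h. (\<forall>i. cmod (h $ i) \<le> \<delta>) \<Longrightarrow> ((\<lambda>\<alpha>. d \<alpha> * monomial \<alpha> h) has_sum g h) UNIV" unfolding wiener_def by blast
  have st: "((\<lambda>\<alpha>. norm (c \<alpha>) * \<delta> ^ sum \<alpha> UNIV + norm (d \<alpha>) * \<delta> ^ sum \<alpha> UNIV) has_sum S + T) UNIV"
    by (rule has_sum_add[OF c(2) d(2)])
  have le: "norm (c \<alpha> + d \<alpha>) * \<delta> ^ sum \<alpha> UNIV \<le> norm (c \<alpha>) * \<delta> ^ sum \<alpha> UNIV + norm (d \<alpha>) * \<delta> ^ sum \<alpha> UNIV" for \<alpha>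
    using mult_right_mono[OF norm_triangle_ineq[of "c \<alpha>" "d \<alpha>"], of "\<delta> ^ sum \<alpha> UNIV"] d0 by (simp add: algebra_simps)
  have s: "(\<lambda>\<alpha>. norm (c \<alpha> + d \<alpha>) * \<delta> ^ sum \<alpha> UNIV) summable_on UNIV"
    by (rule summable_on_comparison_test[where f="\<lambda>\<alpha>. norm (c \<alpha>) * \<delta> ^ sum \<alpha> UNIV + norm (d \<alpha>) * \<delta> ^ sum \<alpha> UNIV"])
       (use st le d0 in \<open>auto simp: summable_on_def\<close>)
  have "infsum (\<lambda>\<alpha>. norm (c \<alpha> + d \<alpha>) * \<delta> ^ sum \<alpha> UNIV) UNIV \<le> S + T"
    using has_sum_mono[OF has_sum_infsum[OF s] st] le by simp
  then show ?thesis unfolding wiener_def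
    using has_sum_infsum[OF s] has_sum_add[OF c(3) d(3)] c(1) d(1) d0
    by (intro conjI exI[of _ "\<lambda>\<alpha>. c \<alpha> + d \<alpha>"] exI[of _ "infsum (\<lambda>\<alpha>. norm (c \<alpha> + d \<alpha>) * \<delta> ^ sum \<alpha> UNIV) UNIV"]) (auto simp: distrib_right)
qed

lemma wiener_coord:
  fixes f :: "complex ^ 'n \<Rightarrow> complex"
  assumes "wiener \<delta> f M" shows "wiener \<delta> (\<lambda>h. h $ i * f h) (\<delta> * M)"
proof -
  from assms obtain c S where d0: "\<delta> > 0" and c: "S \<le> M" "((\<lambda>\<alpha>. norm (c \<alpha>) * \<delta> ^ sum \<alpha> UNIV) has_sum S) UNIV"
    "\<And>h. (\<forall>i. cmod (h $ i) \<le> \<delta>) \<Longrightarrow> ((\<lambda>\<alpha>. c \<alpha> * monomial \<alpha> h) has_sum f h) UNIV" unfolding wiener_def by blast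
  define c' where "c' \<beta> = (if \<beta> i = 0 then 0 else c (\<beta>(i := \<beta> i - 1)))" for \<beta> :: "'n \<Rightarrow> nat"
  let ?g = "\<lambda>\<beta> :: 'n \<Rightarrow> nat. \<beta>(i := Suc (\<beta> i))"
  have bij: "bij_betw ?g UNIV {\<alpha>. \<alpha> i \<noteq> 0}"
    by (rule bij_betwI[where g="\<lambda>\<alpha>. \<alpha>(i := \<alpha> i - 1)"]) auto
  have cg: "c' (?g \<alpha>) = c \<alpha>" for \<alpha> by (simp add: c'_def)
  have sg: "sum (?g \<alpha>) UNIV = Suc (sum \<alpha> UNIV)" for \<alpha>
  proof -
    have "?g \<alpha> i \<noteq> 0" by simp
    moreover have "(?g \<alpha>)(i := ?g \<alpha> i - 1) = \<alpha>" by simp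
    moreover have "sum (?g \<alpha>) UNIV > 0" using member_le_sum[of i UNIV "?g \<alpha>"] by simp
    ultimately show ?thesis using sum_update_dec[of "?g \<alpha>" i] by (simp del: fun_upd_apply)
  qed
  have mg: "monomial (?g \<alpha>) h = h $ i * monomial \<alpha> h" for \<alpha> h
  proof -
    have "(\<Prod>k\<in>UNIV - {i}. h $ k ^ ?g \<alpha> k) = (\<Prod>k\<in>UNIV - {i}. h $ k ^ \<alpha> k)" by (intro prod.cong) auto
    then show ?thesis unfolding monomial_split[of _ h i] by (simp add: mult.assoc)
  qed
  have 1: "((\<lambda>\<beta>. norm (c' \<beta>) * \<delta> ^ sum \<beta> UNIV) has_sum \<delta> * S) UNIV"
  proof -
    have "((\<lambda>\<alpha>. norm (c' (?g \<alpha>)) * \<delta> ^ sum (?g \<alpha>) UNIV) has_sum \<delta> * S) UNIV"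
      unfolding cg sg using has_sum_cmult_right[OF c(2), of \<delta>] by (simp add: mult_ac)
    then have "((\<lambda>\<beta>. norm (c' \<beta>) * \<delta> ^ sum \<beta> UNIV) has_sum \<delta> * S) {\<alpha>. \<alpha> i \<noteq> 0}"
      by (rule iffD1[OF has_sum_reindex_bij_betw[OF bij, where f="\<lambda>\<beta>. norm (c' \<beta>) * \<delta> ^ sum \<beta> UNIV"]])
    then show ?thesis by (subst (asm) has_sum_cong_neutral[where T=UNIV]) (auto simp: c'_def)
  qed
  have 2: "((\<lambda>\<beta>. c' \<beta> * monomial \<beta> h) has_sum h $ i * f h) UNIV" if "\<forall>i. cmod (h $ i) \<le> \<delta>" for h :: "complex ^ 'n"
  proof -
    have "((\<lambda>\<alpha>. c' (?g \<alpha>) * monomial (?g \<alpha>) h) has_sum h $ i * f h) UNIV"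
      unfolding cg mg using has_sum_cmult_right[OF c(3)[OF that], of "h $ i"] by (simp add: mult_ac)
    then have "((\<lambda>\<beta>. c' \<beta> * monomial \<beta> h) has_sum h $ i * f h) {\<alpha>. \<alpha> i \<noteq> 0}"
      by (rule iffD1[OF has_sum_reindex_bij_betw[OF bij, where f="\<lambda>\<beta>. c' \<beta> * monomial \<beta> h"]])
    then show ?thesis by (subst (asm) has_sum_cong_neutral[where T=UNIV]) (auto simp: c'_def)
  qed
  show ?thesis unfolding wiener_def using 1 2 d0 c(1)
    by (intro conjI exI[of _ c'] exI[of _ "\<delta> * S"]) (auto intro: mult_left_mono)
qed

lemma wiener_sum:
  "finite J \<Longrightarrow> \<delta> > 0 \<Longrightarrow> (\<And>j. j \<in> J \<Longrightarrow> wiener \<delta> (f j) (M j)) \<Longrightarrow> wiener \<delta> (\<lambda>h. \<Sum>j\<in>J. f j h) (\<Sum>j\<in>J. M j)"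
proof (induction J rule: finite_induct)
  case empty then show ?case using wiener_const[of \<delta> 0] by simp
next
  case (insert x F)
  then show ?case using wiener_add[of \<delta> "f x" "M x"] by simp
qed

text \<open>The form that \<open>|x|\<^sup>2|w|\<^sup>2\<close> and \<open>1 - 2xw + |x|\<^sup>2|w|\<^sup>2\<close> take in the variable \<open>h = x - a\<close>.\<close>

definition quad :: "complex \<Rightarrow> complex ^ 'n \<Rightarrow> complex \<Rightarrow> complex ^ 'n \<Rightarrow> complex" where
  "quad \<kappa> l v h = \<kappa> + bdot h l + v * bdot h h"

definition quad_wiener :: "real \<Rightarrow> complex \<Rightarrow> complex ^ 'n \<Rightarrow> complex \<Rightarrow> real" where
  "quad_wiener \<delta> \<kappa> l v = cmod \<kappa> + (\<Sum>i\<in>UNIV. cmod (l $ i)) * \<delta> + cmod v * (real CARD('n) * \<delta>\<^sup>2)"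

lemma wiener_quad:
  fixes f :: "complex ^ 'n \<Rightarrow> complex"
  assumes f: "wiener \<delta> f M" shows "wiener \<delta> (\<lambda>h. quad \<kappa> l v h * f h) (quad_wiener \<delta> \<kappa> l v * M)"
proof -
  have d: "\<delta> > 0" using f by (simp add: wiener_def)
  have "wiener \<delta> (\<lambda>h. (\<kappa> * f h + (\<Sum>i\<in>UNIV. l $ i * (h $ i * f h))) + v * (\<Sum>i\<in>UNIV. h $ i * (h $ i * f h)))
     ((cmod \<kappa> * M + (\<Sum>i\<in>UNIV. cmod (l $ i) * (\<delta> * M))) + cmod v * (\<Sum>i\<in>(UNIV::'n set). \<delta> * (\<delta> * M)))"
    by (intro wiener_add wiener_cmult wiener_sum wiener_coord f d finite)
  then show ?thesis
    by (rule wiener_cong[OF wiener_mono])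
       (simp_all add: quad_wiener_def quad_def bdot_def sum_distrib_left sum_distrib_right algebra_simps power2_eq_square)
qed

definition in_wiener :: "(complex ^ 'n \<Rightarrow> complex) \<Rightarrow> real \<Rightarrow> bool" where "in_wiener f \<delta> \<longleftrightarrow> (\<exists>M. wiener \<delta> f M)"

lemma in_wiener_quad_power: "in_wiener f \<delta> \<Longrightarrow> in_wiener (\<lambda>h. quad \<kappa> l v h ^ k * f h) \<delta>"
proof (induction k)
  case (Suc k)
  then show ?case using wiener_quad unfolding in_wiener_def by (fastforce simp: mult.assoc)
qed simp

text \<open>Substitute the quadratic into the Taylor series of \<open>\<phi>\<close> at its constant term. For small
  \<open>\<delta>\<close> the norm of the remaining part is at most \<open>\<rho>/2\<close>, well inside the disc of convergence.\<close>

lemma holomorphic_quad_wiener: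
  fixes l :: "complex ^ 'n"
  assumes hol: "\<phi> holomorphic_on ball Q0 \<rho>" and \<rho>: "\<rho> > 0"
  obtains \<delta> where "\<delta> > 0" "in_wiener (\<lambda>h. \<phi> (quad Q0 l v h)) \<delta>"
proof -
  define C where "C = (\<Sum>i\<in>UNIV. cmod (l $ i)) + cmod v * real CARD('n)"
  have C: "C \<ge> 0" unfolding C_def by (intro add_nonneg_nonneg sum_nonneg mult_nonneg_nonneg) auto
  define \<delta> where "\<delta> = min 1 (\<rho> / (2 * (C + 1)))"
  have \<delta>: "\<delta> > 0" "\<delta> \<le> 1" "\<delta> * C \<le> \<rho> / 2"
  proof -
    show "\<delta> > 0" "\<delta> \<le> 1" using C \<rho> by (auto simp: \<delta>_def)
    have "\<delta> * C \<le> \<rho> / (2 * (C + 1)) * (C + 1)" using C \<rho> \<open>\<delta> > 0\<close> by (intro mult_mono) (auto simp: \<delta>_def)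
    also have "\<dots> = \<rho> / 2" using C by (simp add: field_simps)
    finally show "\<delta> * C \<le> \<rho> / 2" .
  qed
  define q where "q = quad_wiener \<delta> 0 l v"
  have q: "q \<le> \<rho> / 2" "q \<ge> 0"
  proof -
    have "cmod v * (real CARD('n) * \<delta>\<^sup>2) \<le> cmod v * (real CARD('n) * \<delta>)"
      using \<delta> by (intro mult_left_mono) (auto simp: power2_eq_square mult_left_le_one_le)
    then have "q \<le> \<delta> * C" by (simp add: q_def quad_wiener_def C_def algebra_simps)
    then show "q \<le> \<rho> / 2" using \<delta> by simp
    show "q \<ge> 0" using \<delta> unfolding q_def quad_wiener_def by (intro add_nonneg_nonneg mult_nonneg_nonneg sum_nonneg) auto
  qed
  define b where "b k = (deriv ^^ k) \<phi> Q0 / fact k" for k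
  have sb: "(\<lambda>k. b k * (z - Q0) ^ k) sums \<phi> z" if "z \<in> ball Q0 \<rho>" for z
    using holomorphic_power_series[OF hol that] unfolding b_def .
  have sn: "summable (\<lambda>k. cmod (b k) * q ^ k)"
  proof -
    \<comment> \<open>Convergence at a point of distance \<open>3\<rho>/4 > q\<close> is absolute at distance \<open>q\<close>.\<close>
    have "Q0 + of_real (3 / 4 * \<rho>) \<in> ball Q0 \<rho>" using \<rho> by (simp add: dist_norm)
    from sums_summable[OF sb[OF this]] have "summable (\<lambda>k. b k * of_real (3 / 4 * \<rho>) ^ k)" by simp
    then have "summable (\<lambda>k. norm (b k * of_real q ^ k))"
      by (rule powser_insidea) (use q \<rho> in simp)
    then show ?thesis using q by (simp add: norm_mult norm_power)
  qed
  have pw: "wiener \<delta> (\<lambda>h. quad 0 l v h ^ k) (q ^ k)" for k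
  proof (induction k)
    case 0 show ?case using wiener_const[OF \<delta>(1), of 1] by simp
  next
    case (Suc k) show ?case using wiener_quad[OF Suc, of 0 l v] by (simp add: q_def)
  qed
  have "wiener \<delta> (\<lambda>h. \<Sum>k. b k * quad 0 l v h ^ k) (\<Sum>k. cmod (b k) * q ^ k)"
    by (intro wiener_suminf wiener_cmult pw sn)
  then have "wiener \<delta> (\<lambda>h. \<phi> (quad Q0 l v h)) (\<Sum>k. cmod (b k) * q ^ k)"
  proof (rule wiener_cong)
    fix h :: "complex ^ 'n" assume h: "\<forall>i. cmod (h $ i) \<le> \<delta>"
    have "cmod (quad 0 l v h ^ 1) \<le> q ^ 1" by (rule wiener_norm_le[OF pw]) (use h in auto)
    moreover have e: "quad Q0 l v h - Q0 = quad 0 l v h" by (simp add: quad_def)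
    moreover have "dist Q0 (quad Q0 l v h) = cmod (quad 0 l v h)" by (simp only: dist_norm norm_minus_commute[of Q0] e)
    ultimately have "quad Q0 l v h \<in> ball Q0 \<rho>" using q \<rho> by simp
    from sb[OF this] show "(\<Sum>k. b k * quad 0 l v h ^ k) = \<phi> (quad Q0 l v h)" unfolding e by (simp add: sums_iff)
  qed
  then show ?thesis using that \<delta>(1) unfolding in_wiener_def by blast
qed

lemma in_wiener_power_series_at:
  fixes u :: "real ^ 'n \<Rightarrow> complex"
  assumes "in_wiener f \<delta>" and u: "\<And>x. u x = f (cvec (x - a))"
  shows "\<delta> > 0 \<and> (\<exists>c. power_series_at c a \<delta> u)"
proof -
  from assms(1) obtain c where d: "\<delta> > 0" and c: "\<And>h. (\<forall>i. cmod (h $ i) \<le> \<delta>) \<Longrightarrow> ((\<lambda>\<alpha>. c \<alpha> * monomial \<alpha> h) has_sum f h) UNIV"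
    unfolding in_wiener_def wiener_def by blast
  have "power_series_at c a \<delta> u" unfolding power_series_at_def u
  proof
    fix x assume "x \<in> ball a \<delta>"
    then have "norm (x - a) \<le> \<delta>" by (simp add: dist_norm norm_minus_commute)
    then have "cmod (cvec (x - a) $ i) \<le> \<delta>" for i
      unfolding cvec_nth norm_of_real using component_le_norm_cart[of "x - a" i] by linarith
    then show "((\<lambda>\<alpha>. c \<alpha> * monomial \<alpha> (cvec (x - a))) has_sum f (cvec (x - a))) UNIV"
      by (intro c) auto
  qed
  then show ?thesis using d by blast
qed

lemma in_wiener_add: "in_wiener f \<delta> \<Longrightarrow> in_wiener g \<delta> \<Longrightarrow> in_wiener (\<lambda>h. f h + g h) \<delta>"
  unfolding in_wiener_def using wiener_add by blast

lemma in_wiener_cmult: "in_wiener f \<delta> \<Longrightarrow> in_wiener (\<lambda>h. \<kappa> * f h) \<delta>"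
  unfolding in_wiener_def using wiener_cmult by blast

text \<open>\<open>n\<Omega>\<close> times the kernel, in the form delivered by \<open>deriv_zonal_gf\<close>; \<open>w\<close> is the conjugate of the
  second argument.\<close>

definition kern_closed :: "nat \<Rightarrow> complex ^ 'n \<Rightarrow> complex ^ 'n \<Rightarrow> complex" where
  "kern_closed p z w = (of_nat CARD('n) * (1 - (bdot z z * bdot w w) ^ p) * (1 - bdot z z * bdot w w)
      - 4 * of_nat p * (bdot z z * bdot w w) ^ p * (1 - 2 * bdot z w + bdot z z * bdot w w)) /
     (1 - 2 * bdot z w + bdot z z * bdot w w) powr (of_nat CARD('n) / 2 + 1)"

text \<open>After expanding the numerator, each summand is a product of powers of the quadratics
  \<open>X\<close> and \<open>Q\<close> with one fractional power of \<open>Q\<close>, and \<open>Q\<close> avoids the cut.\<close>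

lemma kern_closed_real_analytic:
  fixes w :: "complex ^ 'n"
  assumes slit: "\<And>x. x \<in> ball 0 1 \<Longrightarrow> 1 - 2 * bdot (cvec x) w + bdot (cvec x) (cvec x) * bdot w w \<notin> \<real>\<^sub>\<le>\<^sub>0"
  shows "real_analytic_on (\<lambda>x. kern_closed p (cvec x) w) (ball 0 1)"
  unfolding real_analytic_on_power_series_at
proof
  fix a :: "real ^ 'n" assume a: "a \<in> ball 0 1"
  let ?a = "cvec a" and ?W = "bdot w w"
  define \<nu> :: complex where "\<nu> = of_nat CARD('n) / 2 + 1"
  define Q0 where "Q0 = 1 - 2 * bdot ?a w + bdot ?a ?a * ?W"
  define l1 where "l1 = (2 * ?W) *s ?a"
  define l2 where "l2 = (2 * ?W) *s ?a - 2 *s w"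
  define X where "X = quad (bdot ?a ?a * ?W) l1 ?W"
  define Q where "Q = quad Q0 l2 ?W"
  have "open (- \<real>\<^sub>\<le>\<^sub>0 :: complex set)" by (simp add: open_Compl)
  moreover have "Q0 \<in> - \<real>\<^sub>\<le>\<^sub>0" using slit[OF a] by (simp add: Q0_def)
  ultimately obtain \<rho> where \<rho>: "\<rho> > 0" "ball Q0 \<rho> \<subseteq> - \<real>\<^sub>\<le>\<^sub>0" unfolding open_contains_ball by blast
  have "(\<lambda>q. q powr (- \<nu>)) holomorphic_on ball Q0 \<rho>" using \<rho>(2) by (intro holomorphic_intros) auto
  from holomorphic_quad_wiener[OF this \<rho>(1)] obtain \<delta> where g: "in_wiener (\<lambda>h. Q h powr (- \<nu>)) \<delta>"
    unfolding Q_def by blast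
  define f where "f h = (of_nat CARD('n) * (Q h powr (- \<nu>)) + (- of_nat CARD('n)) * (X h ^ 1 * Q h powr (- \<nu>)) +
     (- of_nat CARD('n)) * (X h ^ p * Q h powr (- \<nu>)) + of_nat CARD('n) * (X h ^ Suc p * Q h powr (- \<nu>))) +
     (- 4 * of_nat p) * (Q h ^ 1 * (X h ^ p * Q h powr (- \<nu>)))" for h
  have "in_wiener f \<delta>" unfolding f_def[abs_def] X_def
    using in_wiener_quad_power[OF in_wiener_quad_power[OF g], of Q0 l2 ?W 1, folded Q_def]
    by (intro in_wiener_add in_wiener_cmult in_wiener_quad_power g) blast
  moreover have "kern_closed p (cvec x) w = f (cvec (x - a))" for x
  proof -
    define h where "h = cvec (x - a)"
    have x: "cvec x = ?a + h" unfolding h_def cvec_add[symmetric] by simp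
    have bx: "bdot (?a + h) (?a + h) = bdot ?a ?a + 2 * bdot ?a h + bdot h h"
      by (simp add: bdot_def algebra_simps sum.distrib sum_distrib_left)
    have bl: "bdot h (c *s ?a) = c * bdot ?a h" for c
      by (simp add: bdot_def algebra_simps sum_distrib_left)
    have "bdot h (y - z) = bdot h y - bdot h z" "bdot h (c *s y) = c * bdot h y" for y z c
      by (simp_all add: bdot_def algebra_simps sum_distrib_left sum_subtractf)
    then have bl2: "bdot h l2 = 2 * ?W * bdot ?a h - 2 * bdot h w"
      by (simp add: l2_def bdot_comm[of h ?a])
    have Xh: "bdot (cvec x) (cvec x) * ?W = X h"
      unfolding x bx X_def quad_def l1_def bl by (simp add: algebra_simps)
    have bw: "bdot (?a + h) w = bdot ?a w + bdot h w"
      by (simp add: bdot_def algebra_simps sum.distrib)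
    have Qh: "1 - 2 * bdot (cvec x) w + X h = Q h"
      unfolding Xh[symmetric] unfolding x bx Q_def quad_def bl2 Q0_def bw by (simp add: algebra_simps)
    have pd: "y / Q h powr \<nu> = y * Q h powr (- \<nu>)" for y by (simp add: powr_minus divide_inverse)
    show ?thesis unfolding kern_closed_def Xh Qh \<nu>_def[symmetric] pd f_def h_def[symmetric]
      by (simp add: algebra_simps)
  qed
  ultimately have "\<delta> > 0 \<and> (\<exists>c. power_series_at c a \<delta> (\<lambda>x. kern_closed p (cvec x) w))" by (rule in_wiener_power_series_at)
  then show "\<exists>r>0. \<exists>c. power_series_at c a r (\<lambda>x. kern_closed p (cvec x) w)" by blast
qed

section \<open>A majorant for the expansion of a polyharmonic function\<close>

text \<open>Cauchy's inequality turns the majorant of the integrand into one of its difference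
  quotients, so dominated convergence applies.\<close>

lemma holomorphic_on_integral:
  fixes f :: "complex \<Rightarrow> 'a \<Rightarrow> complex"
  assumes hol: "\<And>x. x \<in> space M \<Longrightarrow> (\<lambda>z. f z x) holomorphic_on ball z0 R"
    and meas: "\<And>z. z \<in> ball z0 R \<Longrightarrow> f z \<in> borel_measurable M"
    and bnd: "\<And>z x. z \<in> ball z0 R \<Longrightarrow> x \<in> space M \<Longrightarrow> cmod (f z x) \<le> B x"
    and B: "integrable M B"
  shows "(\<lambda>z. integral\<^sup>L M (f z)) holomorphic_on ball z0 R"
  unfolding holomorphic_on_open[OF open_ball]
proof
  fix z assume z: "z \<in> ball z0 R"
  define d where "d = (R - dist z0 z) / 4"
  have d: "d > 0" using z by (simp add: d_def)
  have sub: "cball w d \<subseteq> ball z0 R" if "w \<in> ball z (2 * d)" for w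
  proof
    fix v assume "v \<in> cball w d"
    then have "dist z0 v \<le> dist z0 z + dist z w + dist w v" using dist_triangle[of z0 v z] dist_triangle[of z v w] by linarith
    also have "\<dots> < dist z0 z + 2 * d + d + d" using that \<open>v \<in> cball w d\<close> d by simp
    also have "\<dots> = R"
    proof -
      have "4 * d = R - dist z0 z" by (simp add: d_def)
      then show ?thesis by linarith
    qed
    finally show "v \<in> ball z0 R" by simp
  qed
  have inb: "w \<in> ball z0 R" if "w \<in> ball z (2 * d)" for w using sub[OF that] d by force
  define g where "g x = deriv (\<lambda>z. f z x) z" for x
  have int: "integrable M (f w)" if "w \<in> ball z0 R" for w
    by (rule Bochner_Integration.integrable_bound[OF B meas[OF that]])
       (use bnd[OF that] in \<open>auto intro!: AE_I2 intro: order_trans[OF _ abs_ge_self]\<close>)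
  have db: "cmod (deriv (\<lambda>z. f z x) w) \<le> B x / d" if "x \<in> space M" "w \<in> ball z (2 * d)" for x w
  proof -
    have "cmod ((deriv ^^ 1) (\<lambda>z. f z x) w) \<le> fact 1 * B x / d ^ 1"
    proof (rule Cauchy_inequality)
      have "ball w d \<subseteq> cball w d" by auto
      then show "(\<lambda>z. f z x) holomorphic_on ball w d" "continuous_on (cball w d) (\<lambda>z. f z x)"
        using holomorphic_on_subset[OF hol[OF that(1)]] sub[OF that(2)]
        by (blast intro: holomorphic_on_imp_continuous_on)+
      show "cmod (f y x) \<le> B x" if "cmod (w - y) = d" for y
      proof -
        have "y \<in> cball w d" using that by (simp add: dist_norm)
        then show ?thesis using sub[OF \<open>w \<in> ball z (2 * d)\<close>] by (intro bnd \<open>x \<in> space M\<close>) auto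
      qed
    qed (rule d)
    then show ?thesis by simp
  qed
  have lip: "cmod (f w x - f z x) \<le> B x / d * cmod (w - z)" if x: "x \<in> space M" and w: "w \<in> ball z (2 * d)" for x w
  proof (rule field_differentiable_bound[where S="ball z (2 * d)" and f'="deriv (\<lambda>z. f z x)"])
    fix v assume v: "v \<in> ball z (2 * d)"
    have "((\<lambda>z. f z x) has_field_derivative deriv (\<lambda>z. f z x) v) (at v)"
      using holomorphic_derivI[OF hol[OF x] open_ball inb[OF v]] .
    then show "((\<lambda>z. f z x) has_field_derivative deriv (\<lambda>z. f z x) v) (at v within ball z (2 * d))"
      by (rule has_field_derivative_at_within)
  qed (use x w d db in auto)
  have "((\<lambda>w. (integral\<^sup>L M (f w) - integral\<^sup>L M (f z)) / (w - z)) \<longlongrightarrow> integral\<^sup>L M g) (at z within ball z (2 * d))"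
    unfolding tendsto_at_iff_sequentially
  proof (intro allI impI)
    fix X assume X: "\<forall>i. X i \<in> ball z (2 * d) - {z}" "X \<longlonglongrightarrow> z"
    define s where "s i x = (f (X i) x - f z x) / (X i - z)" for i x
    have Xb: "X i \<in> ball z (2 * d)" "X i \<noteq> z" for i using X by auto
    have ms: "s i \<in> borel_measurable M" for i
      unfolding s_def[abs_def] using meas[OF inb[OF Xb(1)]] meas[OF z] by (intro borel_measurable_divide borel_measurable_diff) auto
    have ls: "(\<lambda>i. s i x) \<longlonglongrightarrow> g x" if x: "x \<in> space M" for x
    proof -
      have "((\<lambda>z. f z x) has_field_derivative g x) (at z)" unfolding g_def
        using holomorphic_derivI[OF hol[OF x] open_ball z] .
      then have "((\<lambda>w. (f w x - f z x) / (w - z)) \<longlongrightarrow> g x) (at z)" by (simp add: has_field_derivative_iff)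
      then have "((\<lambda>w. (f w x - f z x) / (w - z)) \<circ> X) \<longlonglongrightarrow> g x" unfolding tendsto_at_iff_sequentially using X by auto
      then show ?thesis by (simp add: s_def comp_def)
    qed
    have mg: "g \<in> borel_measurable M" by (rule borel_measurable_LIMSEQ_metric[OF ms ls])
    have "(\<lambda>i. integral\<^sup>L M (s i)) \<longlonglongrightarrow> integral\<^sup>L M g"
    proof (rule integral_dominated_convergence[where w="\<lambda>x. B x / d"])
      show "AE x in M. cmod (s i x) \<le> B x / d" for i
      proof (rule AE_I2)
        fix x assume x: "x \<in> space M"
        have "cmod (X i - z) > 0" using Xb(2)[of i] by simp
        then show "cmod (s i x) \<le> B x / d" using lip[OF x Xb(1)[of i]] unfolding s_def norm_divide
          by (simp add: pos_divide_le_eq)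
      qed
    qed (use ms mg ls B in auto)
    moreover have "integral\<^sup>L M (s i) = (integral\<^sup>L M (f (X i)) - integral\<^sup>L M (f z)) / (X i - z)" for i
      unfolding s_def using int[OF inb[OF Xb(1)]] int[OF z] by simp
    ultimately show "((\<lambda>w. (integral\<^sup>L M (f w) - integral\<^sup>L M (f z)) / (w - z)) \<circ> X) \<longlonglongrightarrow> integral\<^sup>L M g"
      by (simp add: comp_def)
  qed
  then have "((\<lambda>z. integral\<^sup>L M (f z)) has_field_derivative integral\<^sup>L M g) (at z within ball z (2 * d))"
    by (simp add: has_field_derivative_iff)
  moreover have "at z within ball z (2 * d) = at z" using d by (intro at_within_open) auto
  ultimately show "\<exists>f'. ((\<lambda>z. integral\<^sup>L M (f z)) has_field_derivative f') (at z)" by auto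
qed

text \<open>For each \<open>j \<in> J\<close> the combination \<open>f(sr) - r\<^sup>j f(s)\<close> removes the power \<open>s\<^sup>j\<close> from the polynomial \<open>f\<close> and at most
  doubles the bound.\<close>

lemma dilation_extract:
  fixes c :: "nat \<Rightarrow> complex" and s r :: real
  assumes "finite J" "0 \<le> r" "r \<le> 1" "\<And>i. i \<le> card J \<Longrightarrow> cmod (\<Sum>k<p. c k * of_real (s * r ^ i) ^ k) \<le> K"
  shows "cmod (\<Sum>k<p. c k * (\<Prod>j\<in>J. of_real (r ^ k - r ^ j)) * of_real s ^ k) \<le> 2 ^ card J * K"
  using assms
proof (induction J arbitrary: s rule: finite_induct)
  case empty
  then show ?case using empty(3)[of 0] by simp
next
  case (insert j J)
  let ?R = "\<lambda>s. \<Sum>k<p. c k * (\<Prod>j\<in>J. of_real (r ^ k - r ^ j)) * of_real s ^ k"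
  have 1: "cmod (?R s) \<le> 2 ^ card J * K" by (rule insert.IH) (use insert in auto)
  have 2: "cmod (?R (s * r)) \<le> 2 ^ card J * K"
  proof (rule insert.IH)
    fix i assume "i \<le> card J"
    then show "cmod (\<Sum>k<p. c k * of_real (s * r * r ^ i) ^ k) \<le> K"
      using insert.prems(3)[of "Suc i"] insert(1,2) by (simp add: mult.assoc)
  qed (use insert in auto)
  have "(\<Sum>k<p. c k * (\<Prod>j\<in>insert j J. of_real (r ^ k - r ^ j)) * of_real s ^ k) = ?R (s * r) - of_real (r ^ j) * ?R s"
    unfolding prod.insert[OF insert(1,2)] sum_distrib_left sum_subtractf[symmetric]
    by (intro sum.cong refl) (simp add: algebra_simps power_mult_distrib flip: power_mult power_add)
  also have "cmod \<dots> \<le> cmod (?R (s * r)) + r ^ j * cmod (?R s)"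
    using norm_triangle_ineq4[of "?R (s * r)" "of_real (r ^ j) * ?R s"] insert.prems(1) by (simp add: norm_mult norm_power)
  also have "\<dots> \<le> 2 ^ card J * K + 1 * (2 ^ card J * K)"
    using 1 2 insert.prems power_le_one[of r j] by (intro add_mono mult_mono) auto
  finally show ?case using insert(1,2) by (simp add: mult_ac)
qed

text \<open>Removing all powers but one bounds the coefficient of that power, with a constant
  depending only on \<open>p\<close>, \<open>s\<close> and \<open>r\<close>.\<close>

lemma dilation_coeff_bound:
  fixes s r :: real
  assumes s: "s > 0" and r: "0 < r" "r < 1"
  obtains C where "C \<ge> 0" "\<And>c K k. k < p \<Longrightarrow> (\<And>i. i < p \<Longrightarrow> cmod (\<Sum>k<p. c k * of_real (s * r ^ i) ^ k) \<le> K) \<Longrightarrow> cmod (c k) \<le> C * K"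
proof -
  define d where "d k = (\<Prod>j\<in>{..<p} - {k}. \<bar>r ^ k - r ^ j\<bar>) * s ^ k" for k
  have d: "d k > 0" for k
    unfolding d_def using s r by (intro mult_pos_pos prod_pos) (auto simp: power_inject_exp')
  define C where "C = (\<Sum>k<p. 2 ^ (p - 1) / d k)"
  have C: "C \<ge> 0" unfolding C_def using d by (intro sum_nonneg) (simp add: less_imp_le)
  moreover have "cmod (c k) \<le> C * K" if k: "k < p" and K: "\<And>i. i < p \<Longrightarrow> cmod (\<Sum>k<p. c k * of_real (s * r ^ i) ^ k) \<le> K" for c :: "nat \<Rightarrow> complex" and K k
  proof -
    let ?J = "{..<p} - {k}"
    have cJ: "card ?J = p - 1" using k by simp
    have K0: "K \<ge> 0" using order_trans[OF norm_ge_zero K[of 0]] k by simp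
    have "cmod (\<Sum>i<p. c i * (\<Prod>j\<in>?J. of_real (r ^ i - r ^ j)) * of_real s ^ i) \<le> 2 ^ card ?J * K"
      by (rule dilation_extract) (use r K k cJ in auto)
    also have "(\<Sum>i<p. c i * (\<Prod>j\<in>?J. complex_of_real (r ^ i - r ^ j)) * of_real s ^ i) =
        (\<Sum>i\<in>{k}. c i * (\<Prod>j\<in>?J. of_real (r ^ i - r ^ j)) * of_real s ^ i)"
    proof (rule sum.mono_neutral_right)
      show "\<forall>i\<in>{..<p} - {k}. c i * (\<Prod>j\<in>?J. complex_of_real (r ^ i - r ^ j)) * of_real s ^ i = 0"
      proof
        fix i assume i: "i \<in> {..<p} - {k}"
        have "(\<Prod>j\<in>?J. complex_of_real (r ^ i - r ^ j)) = 0" by (rule prod_zero) (use i in \<open>auto intro!: bexI[of _ i]\<close>)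
        then show "c i * (\<Prod>j\<in>?J. complex_of_real (r ^ i - r ^ j)) * of_real s ^ i = 0" by simp
      qed
    qed (use k in auto)
    also have "cmod (\<Sum>i\<in>{k}. c i * (\<Prod>j\<in>?J. of_real (r ^ i - r ^ j)) * of_real s ^ i) = cmod (c k) * d k"
      using s by (simp add: norm_mult norm_power d_def prod_norm[symmetric] del: of_real_diff of_real_power)
    finally have "cmod (c k) * d k \<le> 2 ^ (p - 1) * K" unfolding cJ .
    then have "cmod (c k) \<le> 2 ^ (p - 1) / d k * K" using d[of k] by (simp add: field_simps)
    also have "\<dots> \<le> C * K"
    proof (rule mult_right_mono[OF _ K0])
      show "2 ^ (p - 1) / d k \<le> C" unfolding C_def using k d by (intro member_le_sum) (auto simp: less_imp_le)
    qed
    finally show ?thesis .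
  qed
  ultimately show ?thesis using that by blast
qed

lemma ball_int_norm_le:
  fixes f :: "real ^ 'n \<Rightarrow> complex"
  assumes "\<And>x. x \<in> ball 0 1 \<Longrightarrow> cmod (f x) \<le> B" "B \<ge> 0"
  shows "cmod (ball_int f) \<le> B * unit_ball_vol (real CARD('n))"
proof (cases "set_integrable lborel (ball 0 1) f")
  case True
  have "cmod (ball_int f) \<le> (\<integral>x. indicator (ball 0 1 :: (real ^ 'n) set) x * B \<partial>lborel)"
    unfolding set_lebesgue_integral_def
  proof (rule Bochner_Integration.integral_norm_bound_integral)
    show "integrable lborel (\<lambda>x::real^'n. indicat_real (ball 0 1) x * B)"
      using emeasure_bounded_finite[of "ball 0 1 :: (real^'n) set"]
      by (intro integrable_mult_left integrable_real_indicator) auto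
  qed (use True assms in \<open>auto simp: set_integrable_def indicator_def\<close>)
  then show ?thesis by (simp add: content_ball mult.commute)
next
  case False
  then have "ball_int f = 0" unfolding set_lebesgue_integral_def set_integrable_def by (rule not_integrable_integral_eq)
  then show ?thesis using assms(2) by simp
qed

lemma zonal_poly_bound_real:
  fixes a b :: "real ^ 'n"
  assumes "cmod \<alpha> = 1" "cmod \<beta> = 1" "norm a * norm b \<le> 1" "0 < r" "r < 1"
  shows "cmod (zonal_poly p m (\<alpha> *s cvec a) (\<beta> *s cvec b)) \<le> zonal_bound CARD('n) r / r ^ m"
proof -
  obtain e1 e2 where "lie_roots (\<alpha> *s cvec a) (\<beta> *s cvec b) e1 e2" "norm e1 = norm a * norm b" "norm e2 = norm a * norm b"
    using lie_roots_exist[OF assms(1,2)] by blast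
  then show ?thesis using assms(3-5) by (intro zonal_poly_bound) auto
qed

text \<open>A real analytic \<open>u\<close> on the ball with polyharmonic homogeneous components \<open>q m\<close>. The
  convergence assumed is pointwise; the goal is the uniform majorant \<open>q_summable_majorant\<close>.\<close>

locale polyharmonic_expansion =
  fixes u :: "real ^ 'n \<Rightarrow> complex" and q :: "nat \<Rightarrow> complex ^ 'n \<Rightarrow> complex" and p :: nat
  assumes an: "real_analytic_on u (ball 0 1)"
    and q: "\<And>m. q m \<in> polyharmonic_polys p m"
    and qs: "\<And>x. x \<in> ball 0 1 \<Longrightarrow> (\<lambda>m. q m (cvec x)) sums u x"
begin

lemma qh: "q m \<in> hom_polys m" using q by (simp add: polyharmonic_polys_def)

lemma q_scale: "q m (cvec (t *\<^sub>R x)) = q m (cvec x) * of_real t ^ m"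
  using hom_polys_scale[OF qh, of m "of_real t" "cvec x"] by (simp add: cvec_scaleR)

text \<open>Complex dilations of \<open>u\<close>: for real \<open>t\<close> one has \<open>F t x = u (t x)\<close>, and for \<open>z\<close> on the unit circle
  \<open>F z\<close> is the value of \<open>u\<close> on a rotated ball.\<close>

definition F :: "complex \<Rightarrow> real ^ 'n \<Rightarrow> complex" where "F z x = (\<Sum>m. q m (cvec x) * z ^ m)"

lemma F_sums:
  assumes x: "x \<in> cball 0 1" and z: "cmod z < 1"
  shows "(\<lambda>m. q m (cvec x) * z ^ m) sums F z x"
proof -
  obtain s where s: "cmod z < s" "s < 1" using z dense by blast
  have "norm (s *\<^sub>R x) < 1"
  proof -
    have "s \<ge> 0" using s norm_ge_zero[of z] by linarith
    then have "norm (s *\<^sub>R x) \<le> s * 1" using x unfolding norm_scaleR by (intro mult_mono) auto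
    then show ?thesis using s by simp
  qed
  then have "(\<lambda>m. q m (cvec (s *\<^sub>R x))) sums u (s *\<^sub>R x)" by (intro qs) simp
  then have "summable (\<lambda>m. q m (cvec x) * of_real s ^ m)" unfolding q_scale by (rule sums_summable)
  moreover have "norm z < norm (complex_of_real s)" using s norm_ge_zero[of z] by simp
  ultimately have "summable (\<lambda>m. q m (cvec x) * z ^ m)" by (rule powser_inside)
  then show ?thesis unfolding F_def by (rule summable_sums)
qed

lemma F_holomorphic: "x \<in> cball 0 1 \<Longrightarrow> (\<lambda>z. F z x) holomorphic_on ball 0 1"
  by (rule power_series_holomorphic[where a="\<lambda>m. q m (cvec x)"]) (simp add: F_sums)

lemma F_of_real:
  assumes x: "x \<in> cball 0 1" and t: "\<bar>t\<bar> < 1"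
  shows "F (of_real t) x = u (t *\<^sub>R x)"
proof -
  have "norm (t *\<^sub>R x) \<le> \<bar>t\<bar> * 1" using x unfolding norm_scaleR by (intro mult_left_mono) auto
  then have "(\<lambda>m. q m (cvec (t *\<^sub>R x))) sums u (t *\<^sub>R x)" using t by (intro qs) simp
  moreover have "(\<lambda>m. q m (cvec (t *\<^sub>R x))) sums F (of_real t) x" unfolding q_scale using t by (intro F_sums[OF x]) simp
  ultimately show ?thesis by (rule sums_unique2[symmetric])
qed

lemma F_measurable: "F z \<in> borel_measurable borel"
  unfolding F_def[abs_def]
  by (intro borel_measurable_suminf borel_measurable_times borel_measurable_const borel_measurable_continuous_onI
       continuous_hom_polys'[OF qh] continuous_on_cvec continuous_on_id)

text \<open>The local power series of \<open>u\<close> at \<open>t0 x0\<close> has a bounded complex extension along the rays near \<open>x0\<close>, and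
  it coincides with \<open>F\<close> because it does so for real \<open>t\<close>.\<close>

lemma F_locally_bounded:
  assumes t0: "\<bar>t0\<bar> < 1" and x0: "x0 \<in> cball 0 1"
  shows "\<exists>\<kappa>>0. \<exists>M. \<forall>x\<in>cball 0 1. dist x0 x < \<kappa> \<longrightarrow> (\<forall>z\<in>ball (of_real t0) \<kappa>. cmod z < 1 \<and> cmod (F z x) \<le> M)"
proof -
  define a where "a = t0 *\<^sub>R x0"
  have "norm a \<le> \<bar>t0\<bar> * 1" unfolding a_def norm_scaleR using x0 by (intro mult_left_mono) auto
  then have "a \<in> ball 0 1" using t0 by simp
  then obtain r c where r: "r > 0" and m: "power_series_at c a r u" using an unfolding real_analytic_on_power_series_at by blast
  define \<kappa>' where "\<kappa>' = r / (2 * real CARD('n))"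
  have k': "\<kappa>' > 0" "real CARD('n) * \<kappa>' = r / 2" "\<kappa>' \<le> r / 2"
  proof -
    have "real CARD('n) \<ge> 1" using zero_less_card_finite[where 'a='n] by (simp add: Suc_leI)
    then show "\<kappa>' \<le> r / 2" unfolding \<kappa>'_def using r by (intro divide_left_mono) auto
  qed (use r in \<open>auto simp: \<kappa>'_def\<close>)
  define V :: "real ^ 'n" where "V = (\<chi> i. \<kappa>')"
  have "norm V \<le> (\<Sum>i\<in>UNIV. \<bar>V $ i\<bar>)" by (rule norm_le_l1_cart)
  also have "\<dots> = r / 2" using k' by (simp add: V_def)
  finally have V: "norm V < r" using r by simp
  \<comment> \<open>Small enough for \<open>z x - a\<close> to stay below \<open>V\<close> componentwise and for \<open>|z| < 1\<close>.\<close>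
  define \<kappa> where "\<kappa> = min (\<kappa>' / 2) (1 - \<bar>t0\<bar>)"
  have k: "\<kappa> > 0" "\<kappa> \<le> \<kappa>' / 2" "\<kappa> \<le> 1 - \<bar>t0\<bar>"
  proof -
    show "\<kappa> > 0" using k' t0 by (simp add: \<kappa>_def)
    show "\<kappa> \<le> \<kappa>' / 2" "\<kappa> \<le> 1 - \<bar>t0\<bar>" by (simp_all only: \<kappa>_def min.cobounded1 min.cobounded2)
  qed
  define MM where "MM = (\<Sum>\<^sub>\<infinity>\<alpha>. cmod (c \<alpha> * monomial \<alpha> (cvec V)))"
  have zb: "cmod z < 1" if "z \<in> ball (of_real t0) \<kappa>" for z
  proof -
    have "cmod z \<le> cmod (of_real t0) + cmod (z - of_real t0)" using norm_triangle_ineq[of "of_real t0" "z - of_real t0"] by simp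
    also have "cmod (z - of_real t0) < \<kappa>" using that by (simp add: dist_norm norm_minus_commute)
    finally show ?thesis using k(3) by simp
  qed
  have main: "cmod (F z x) \<le> MM" if x: "x \<in> cball 0 1" "dist x0 x < \<kappa>" and z: "z \<in> ball (of_real t0) \<kappa>" for x z
  proof -
    define v where "v z = z *s cvec x - cvec a" for z :: complex
    have v: "cmod (v z $ i) \<le> V $ i" if "z \<in> cball (of_real t0) \<kappa>" for z i
    proof -
      have "v z $ i = (z - of_real t0) * of_real (x $ i) + of_real (t0 * (x - x0) $ i)"
        by (simp add: v_def a_def cvec_nth algebra_simps)
      then have "cmod (v z $ i) \<le> cmod (z - of_real t0) * \<bar>x $ i\<bar> + \<bar>t0\<bar> * \<bar>(x - x0) $ i\<bar>"
        using norm_triangle_ineq[of "(z - of_real t0) * of_real (x $ i)" "of_real (t0 * (x - x0) $ i)"]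
        unfolding norm_mult norm_of_real abs_mult by simp
      also have "\<dots> \<le> \<kappa> * 1 + 1 * \<kappa>"
      proof (intro add_mono mult_mono)
        show "cmod (z - of_real t0) \<le> \<kappa>" using that by (simp add: dist_norm norm_minus_commute)
        show "\<bar>x $ i\<bar> \<le> 1" using component_le_norm_cart[of x i] x(1) by simp
        show "\<bar>(x - x0) $ i\<bar> \<le> \<kappa>" using component_le_norm_cart[of "x - x0" i] x(2) by (simp add: dist_norm norm_minus_commute)
      qed (use t0 k in auto)
      also have "\<dots> \<le> \<kappa>'" using k by simp
      finally show ?thesis by (simp add: V_def)
    qed
    define \<Phi> where "\<Phi> z = (\<Sum>\<^sub>\<infinity>\<alpha>. c \<alpha> * monomial \<alpha> (v z))" for z
    have ul: "uniform_limit (cball (of_real t0) \<kappa>) (\<lambda>S z. \<Sum>\<alpha>\<in>S. c \<alpha> * monomial \<alpha> (v z)) \<Phi> (finite_subsets_at_top UNIV)"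
      unfolding \<Phi>_def using v by (rule power_series_at_uniform_limit(1)[OF m V])
    have \<Phi>M: "cmod (\<Phi> z) \<le> MM" if "z \<in> cball (of_real t0) \<kappa>" for z
      unfolding \<Phi>_def MM_def by (rule power_series_at_uniform_limit(2)[OF m V v that])
    have hol: "(\<lambda>z. \<Sum>\<alpha>\<in>S. c \<alpha> * monomial \<alpha> (v z)) holomorphic_on A" for S A
      unfolding v_def monomial_def by (simp, intro holomorphic_intros)
    have \<Phi>h: "\<Phi> holomorphic_on ball (of_real t0) \<kappa>"
    proof (rule holomorphic_uniform_limit[OF _ ul finite_subsets_at_top_neq_bot])
      show "\<forall>\<^sub>F S in finite_subsets_at_top UNIV. continuous_on (cball (complex_of_real t0) \<kappa>) (\<lambda>z. \<Sum>\<alpha>\<in>S. c \<alpha> * monomial \<alpha> (v z)) \<and>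
         (\<lambda>z. \<Sum>\<alpha>\<in>S. c \<alpha> * monomial \<alpha> (v z)) holomorphic_on ball (complex_of_real t0) \<kappa>"
        by (intro always_eventually allI conjI hol holomorphic_on_imp_continuous_on)
    qed
    have Fh: "(\<lambda>z. F z x) holomorphic_on ball (of_real t0) \<kappa>"
      using F_holomorphic[OF x(1)] by (rule holomorphic_on_subset) (use zb in auto)
    have eq: "F (of_real t) x = \<Phi> (of_real t)" if t: "\<bar>t - t0\<bar> < \<kappa>" for t :: real
    proof -
      have t1: "\<bar>t\<bar> < 1" using t k(3) by linarith
      have d: "t *\<^sub>R x - a = (t - t0) *\<^sub>R x + t0 *\<^sub>R (x - x0)" by (simp add: a_def algebra_simps)
      have "norm (t *\<^sub>R x - a) \<le> norm ((t - t0) *\<^sub>R x) + norm (t0 *\<^sub>R (x - x0))" unfolding d by (rule norm_triangle_ineq)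
      also have "\<dots> \<le> \<kappa> * 1 + 1 * \<kappa>" unfolding norm_scaleR using t x t0 k
        by (intro add_mono mult_mono) (auto simp: dist_norm norm_minus_commute)
      also have "\<dots> < r" using k k' r by simp
      finally have "t *\<^sub>R x \<in> ball a r" by (simp add: dist_norm norm_minus_commute)
      then have "((\<lambda>\<alpha>. c \<alpha> * monomial \<alpha> (cvec (t *\<^sub>R x - a))) has_sum u (t *\<^sub>R x)) UNIV"
        using m unfolding power_series_at_def by blast
      moreover have "cvec (t *\<^sub>R x - a) = v (of_real t)"
        by (simp add: v_def vec_eq_iff cvec_nth)
      ultimately show ?thesis unfolding \<Phi>_def F_of_real[OF x(1) t1] by (simp add: infsumI)
    qed
    have "F z x - \<Phi> z = 0"
    proof (rule analytic_continuation[OF holomorphic_on_diff[OF Fh \<Phi>h]])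
      show "complex_of_real ` ball t0 \<kappa> \<subseteq> ball (of_real t0) \<kappa>" by (auto simp: dist_of_real)
      show "complex_of_real t0 \<in> ball (of_real t0) \<kappa>" using k by simp
      show "complex_of_real t0 islimpt complex_of_real ` ball t0 \<kappa>"
        unfolding islimpt_approachable
      proof (intro allI impI)
        fix e :: real assume e: "e > 0"
        define \<eta> where "\<eta> = min \<kappa> e / 2"
        have \<eta>: "\<eta> > 0" "\<eta> < \<kappa>" "\<eta> < e" using e k by (auto simp: \<eta>_def)
        show "\<exists>x'\<in>complex_of_real ` ball t0 \<kappa>. x' \<noteq> of_real t0 \<and> dist x' (of_real t0) < e"
          by (intro bexI[of _ "of_real (t0 + \<eta>)"] conjI imageI) (use \<eta> in \<open>simp_all add: dist_of_real dist_real_def del: of_real_add\<close>)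
      qed
      show "F w x - \<Phi> w = 0" if "w \<in> complex_of_real ` ball t0 \<kappa>" for w
        using that eq by (auto simp: dist_real_def abs_minus_commute)
    qed (use z in auto)
    then show ?thesis using \<Phi>M[of z] z by simp
  qed
  show ?thesis
    by (rule exI[of _ \<kappa>], rule conjI[OF k(1)], rule exI[of _ MM]) (use main zb in blast)
qed

lemma F_bounded_near_real:
  assumes t0: "\<bar>t0\<bar> < 1"
  obtains \<kappa> M where "\<kappa> > 0" "\<And>x z. x \<in> cball 0 1 \<Longrightarrow> z \<in> ball (of_real t0) \<kappa> \<Longrightarrow> cmod z < 1 \<and> cmod (F z x) \<le> M"
proof -
  define P where "P x0 \<kappa> M \<longleftrightarrow> \<kappa> > 0 \<and> (\<forall>x\<in>cball 0 1. dist x0 x < \<kappa> \<longrightarrow> (\<forall>z\<in>ball (of_real t0) \<kappa>. cmod z < 1 \<and> cmod (F z x) \<le> M))" for x0 \<kappa> M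
  have "\<forall>x0\<in>cball 0 1. \<exists>\<kappa>. \<exists>M. P x0 \<kappa> M" using F_locally_bounded[OF t0] unfolding P_def by blast
  from bchoice[OF this] obtain \<kappa> where "\<forall>x0\<in>cball 0 1. \<exists>M. P x0 (\<kappa> x0) M" by (rule exE)
  from bchoice[OF this] obtain M where P: "\<forall>x0\<in>cball 0 1. P x0 (\<kappa> x0) (M x0)" by (rule exE)
  have "cball (0 :: real ^ 'n) 1 \<subseteq> (\<Union>x0\<in>cball 0 1. ball x0 (\<kappa> x0))" using P unfolding P_def by force
  then obtain D where D: "D \<subseteq> cball 0 1" "finite D" "cball 0 1 \<subseteq> (\<Union>x0\<in>D. ball x0 (\<kappa> x0))"
    using compactE_image[OF compact_cball, of "cball 0 1" "\<lambda>x0. ball x0 (\<kappa> x0)" 0 1] open_ball by metis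
  have D0: "D \<noteq> {}" using D(3) by force
  define k where "k = Min (\<kappa> ` D)"
  define N where "N = Max (M ` D)"
  have "k > 0" unfolding k_def using D D0 P unfolding P_def by (subst Min_gr_iff) auto
  moreover have "cmod z < 1 \<and> cmod (F z x) \<le> N" if x: "x \<in> cball 0 1" and z: "z \<in> ball (of_real t0) k" for x z
  proof -
    obtain x0 where x0: "x0 \<in> D" "dist x0 x < \<kappa> x0" using D(3) x by (auto simp: subset_iff)
    have "k \<le> \<kappa> x0" unfolding k_def using D x0 by (intro Min_le) auto
    then have "z \<in> ball (of_real t0) (\<kappa> x0)" using z by auto
    then have "cmod z < 1 \<and> cmod (F z x) \<le> M x0" using P x0 D(1) x unfolding P_def by blast
    moreover have "M x0 \<le> N" unfolding N_def using D x0 by (intro Max_ge) auto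
    ultimately show ?thesis by linarith
  qed
  ultimately show ?thesis using that by blast
qed

definition almansi :: "nat \<Rightarrow> nat \<Rightarrow> complex ^ 'n \<Rightarrow> complex" where
  "almansi m = (SOME h. (\<forall>k. h k \<in> harmonic_polys (m - 2 * k)) \<and> (\<forall>k. m < 2 * k \<longrightarrow> h k = (\<lambda>z. 0)) \<and>
    (\<forall>z. q m z = (\<Sum>k<p. bdot z z ^ k * h k z)))"

lemma almansi: "almansi m k \<in> harmonic_polys (m - 2 * k)" "m < 2 * k \<Longrightarrow> almansi m k = (\<lambda>z. 0)"
  "q m z = (\<Sum>k<p. bdot z z ^ k * almansi m k z)"
proof -
  have "(lap ^^ p) (q m) = (\<lambda>z. 0)" using q[of m] by (auto simp: polyharmonic_polys_def)
  from someI_ex[OF Almansi_decomposition[OF qh this], folded almansi_def]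
  show "almansi m k \<in> harmonic_polys (m - 2 * k)" "m < 2 * k \<Longrightarrow> almansi m k = (\<lambda>z. 0)"
    "q m z = (\<Sum>k<p. bdot z z ^ k * almansi m k z)" by blast+
qed

lemma sphere_mean_q_zonal_harmonic:
  "sphere_mean (\<lambda>z. q m z * zonal_harmonic l z w) = (\<Sum>k<p. if m = l + 2 * k then almansi m k w else 0)"
proof -
  let ?f = "\<lambda>k z. bdot z z ^ k * (almansi m k z * zonal_harmonic l z w)"
  have c: "continuous_on UNIV (?f k)" for k
    by (intro continuous_on_mult continuous_on_power continuous_on_bdot continuous_on_id continuous_zonal_harmonic
        continuous_hom_polys[OF harm_hom_polys[OF almansi(1)]])
  have "(\<lambda>z. q m z * zonal_harmonic l z w) = (\<lambda>z. \<Sum>k<p. ?f k z)"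
  proof
    fix z
    show "q m z * zonal_harmonic l z w = (\<Sum>k<p. ?f k z)" unfolding almansi(3)[of m z] sum_distrib_right by (simp only: mult.assoc)
  qed
  then have "sphere_mean (\<lambda>z. q m z * zonal_harmonic l z w) = sphere_mean (\<lambda>z. \<Sum>k<p. ?f k z)" by simp
  also have "\<dots> = (\<Sum>k<p. sphere_mean (?f k))" by (rule sphere_mean_sum) (use c in auto)
  also have "\<dots> = (\<Sum>k<p. if m = l + 2 * k then almansi m k w else 0)"
  proof (intro sum.cong refl)
    fix k
    show "sphere_mean (?f k) = (if m = l + 2 * k then almansi m k w else 0)"
      unfolding sphere_mean_bdot_power sphere_mean_harm_zonal_harmonic[OF almansi(1)] using almansi(2)[of m k] by (cases "m < 2 * k") auto
  qed
  finally show ?thesis .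
qed

text \<open>The ratio between the integral over the ball and the spherical mean in degree \<open>k\<close>.\<close>

definition ball_factor :: "nat \<Rightarrow> complex" where
  "ball_factor k = of_nat CARD('n) * of_real (unit_ball_vol (real CARD('n))) / of_nat (CARD('n) + k)"

lemma ball_int_F_times:
  fixes H :: "real ^ 'n \<Rightarrow> complex"
  assumes z: "cmod z < 1" and a: "summable a" "\<And>m x. x \<in> cball 0 1 \<Longrightarrow> cmod (q m (cvec x)) * cmod z ^ m \<le> a m"
    and Hc: "continuous_on UNIV H"
  shows "(\<lambda>m. z ^ m * ball_int (\<lambda>x. q m (cvec x) * H x)) sums ball_int (\<lambda>x. F z x * H x)"
proof -
  have "bounded (H ` cball 0 1)"
    using Hc by (intro compact_imp_bounded compact_continuous_image) (auto intro: continuous_on_subset)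
  then obtain B where B: "\<And>x. x \<in> cball 0 1 \<Longrightarrow> cmod (H x) \<le> B" unfolding bounded_iff by blast
  define f where "f m x = indicat_real (ball 0 1) x *\<^sub>R (q m (cvec x) * z ^ m * H x)" for m x
  have fi: "integrable lborel (f m)" for m
    unfolding f_def[abs_def] set_integrable_def[symmetric]
    by (intro set_integrable_continuous continuous_on_mult continuous_on_const Hc continuous_hom_polys'[OF qh] continuous_on_cvec continuous_on_id) auto
  have fb: "cmod (f m x) \<le> indicator (ball 0 1) x * (a m * B)" for m x
  proof (cases "x \<in> ball 0 1")
    case True
    then have "cmod (q m (cvec x)) * cmod z ^ m * cmod (H x) \<le> a m * B"
      using a(2)[of x m] B[of x] by (intro mult_mono') auto
    then show ?thesis using True by (simp add: f_def norm_mult norm_power)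
  qed (simp add: f_def)
  have sa: "summable (\<lambda>m. C * (a m * B))" for C
    using a(1) by (intro summable_mult summable_mult2)
  have "(\<lambda>m. integral\<^sup>L lborel (f m)) sums integral\<^sup>L lborel (\<lambda>x. \<Sum>m. f m x)"
  proof (rule sums_integral)
    show "AE x in lborel. summable (\<lambda>m. cmod (f m x))"
    proof (rule AE_I2)
      fix x
      show "summable (\<lambda>m. cmod (f m x))"
        by (rule summable_comparison_test'[OF sa[of "indicator (ball 0 1) x"], of 0]) (use fb in simp)
    qed
    show "summable (\<lambda>m. \<integral>x. cmod (f m x) \<partial>lborel)"
    proof (rule summable_comparison_test'[OF sa[of "measure lborel (ball 0 1 :: (real ^ 'n) set)"], of 0])
      fix m
      have "(\<integral>x. cmod (f m x) \<partial>lborel) \<le> (\<integral>x. indicator (ball 0 1 :: (real ^ 'n) set) x * (a m * B) \<partial>lborel)"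
      proof (rule Bochner_Integration.integral_mono[OF integrable_norm[OF fi] _ fb])
        show "integrable lborel (\<lambda>x::real^'n. indicat_real (ball 0 1) x * (a m * B))"
          using emeasure_bounded_finite[of "ball 0 1 :: (real^'n) set"] by (intro integrable_mult_left integrable_real_indicator) auto
      qed
      then show "norm (\<integral>x. cmod (f m x) \<partial>lborel) \<le> measure lborel (ball 0 1 :: (real ^ 'n) set) * (a m * B)" by simp
    qed
  qed (rule fi)
  moreover have "(\<Sum>m. f m x) = indicat_real (ball 0 1) x *\<^sub>R (F z x * H x)" for x
  proof (cases "x \<in> ball 0 1")
    case True
    then have "(\<lambda>m. q m (cvec x) * z ^ m * H x) sums (F z x * H x)" by (intro sums_mult2 F_sums z) auto
    then show ?thesis using True by (simp add: f_def sums_iff)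
  qed (simp add: f_def)
  moreover have "integral\<^sup>L lborel (f m) = z ^ m * ball_int (\<lambda>x. q m (cvec x) * H x)" for m
  proof -
    have "integral\<^sup>L lborel (f m) = ball_int (\<lambda>x. z ^ m * (q m (cvec x) * H x))"
      unfolding f_def set_lebesgue_integral_def by (simp add: mult_ac)
    then show ?thesis by simp
  qed
  ultimately show ?thesis by (simp add: set_lebesgue_integral_def)
qed

text \<open>For small \<open>t\<close> the expansion of \<open>u\<close> converges uniformly, the integral may be computed term by
  term, and orthogonality leaves only the degrees \<open>l + 2k\<close> with \<open>k < p\<close>. Both sides are analytic in \<open>t\<close>, so the identity
  extends to dilations for which termwise integration is not yet justified.\<close>

lemma ball_int_u_zonal_harmonic:
  assumes t: "\<bar>t\<bar> < 1"
  shows "ball_int (\<lambda>x. u (t *\<^sub>R x) * zonal_harmonic l (cvec x) w) = (\<Sum>k<p. ball_factor (2 * l + 2 * k) * almansi (l + 2 * k) k w * of_real t ^ (l + 2 * k))"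
proof -
  define H where "H x = zonal_harmonic l (cvec x) w" for x
  have Hc: "continuous_on UNIV H" unfolding H_def by (intro continuous_hom_polys'[OF zonal_harmonic_hom_polys] continuous_on_cvec continuous_on_id)
  have "bounded (H ` cball 0 1)"
    using Hc by (intro compact_imp_bounded compact_continuous_image) (auto intro: continuous_on_subset)
  then obtain B where B: "\<And>x. x \<in> cball 0 1 \<Longrightarrow> cmod (H x) \<le> B" unfolding bounded_iff by blast
  have B0: "B \<ge> 0" using B[of 0] norm_ge_zero order_trans by (metis centre_in_cball zero_le_one)
  define G where "G z = ball_int (\<lambda>x. F z x * H x)" for z
  define pl where "pl z = (\<Sum>k<p. ball_factor (2 * l + 2 * k) * almansi (l + 2 * k) k w * z ^ (l + 2 * k))" for z
  have meas: "(\<lambda>x. indicat_real (ball 0 1) x *\<^sub>R (F z x * H x)) \<in> borel_measurable lborel" for z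
  proof -
    have "(\<lambda>x. indicat_real (ball 0 1) x *\<^sub>R (F z x * H x)) \<in> borel_measurable borel"
      by (intro borel_measurable_scaleR borel_measurable_indicator borel_measurable_times F_measurable borel_measurable_continuous_onI[OF Hc]) auto
    then show ?thesis by simp
  qed
  have Gh: "\<exists>r>0. G holomorphic_on ball (of_real t0) r" if t0: "\<bar>t0\<bar> < 1" for t0
  proof -
    obtain \<kappa> M where k: "\<kappa> > 0" "\<And>x z. x \<in> cball 0 1 \<Longrightarrow> z \<in> ball (of_real t0) \<kappa> \<Longrightarrow> cmod z < 1 \<and> cmod (F z x) \<le> M"
      using F_bounded_near_real[OF t0] by blast
    have "(\<lambda>z. integral\<^sup>L lborel (\<lambda>x. indicat_real (ball 0 1) x *\<^sub>R (F z x * H x))) holomorphic_on ball (of_real t0) \<kappa>"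
    proof (rule holomorphic_on_integral[where B="\<lambda>x. indicator (ball 0 1) x * (M * B)"])
      fix x :: "real ^ 'n"
      show "(\<lambda>z. indicat_real (ball 0 1) x *\<^sub>R (F z x * H x)) holomorphic_on ball (of_real t0) \<kappa>"
      proof (cases "x \<in> ball 0 1")
        case True
        then have "(\<lambda>z. F z x) holomorphic_on ball (of_real t0) \<kappa>"
          by (intro holomorphic_on_subset[OF F_holomorphic]) (use k(2)[of x] in auto)
        then show ?thesis using True by (auto intro!: holomorphic_intros)
      qed auto
      fix z assume z: "z \<in> ball (complex_of_real t0) \<kappa>"
      show "cmod (indicat_real (ball 0 1) x *\<^sub>R (F z x * H x)) \<le> indicator (ball 0 1) x * (M * B)"
      proof (cases "x \<in> ball 0 1")
        case True
        then have "cmod (F z x) * cmod (H x) \<le> M * B" using k(2)[OF _ z, of x] B[of x] by (intro mult_mono') auto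
        then show ?thesis using True by (simp add: norm_mult)
      qed auto
    next
      show "integrable lborel (\<lambda>x::real^'n. indicat_real (ball 0 1) x * (M * B))"
        using emeasure_bounded_finite[of "ball 0 1 :: (real^'n) set"]
        by (intro integrable_mult_left integrable_real_indicator) auto
    qed (rule meas)
    then show ?thesis unfolding G_def set_lebesgue_integral_def using k(1) by blast
  qed
  have plh: "pl holomorphic_on A" for A unfolding pl_def by (intro holomorphic_intros)
  have near0: "eventually (\<lambda>s. G (of_real s) - pl (of_real s) = 0) (nhds (0::real))"
  proof -
    obtain \<kappa> M where k: "\<kappa> > 0" "\<And>x z. x \<in> cball 0 1 \<Longrightarrow> z \<in> ball 0 \<kappa> \<Longrightarrow> cmod z < 1 \<and> cmod (F z x) \<le> M"
      using F_bounded_near_real[of 0] by auto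
    define r where "r = \<kappa> / 2"
    have r: "r > 0" "r < \<kappa>" using k(1) by (auto simp: r_def)
    have qb: "cmod (q m (cvec x)) \<le> M / r ^ m" if x: "x \<in> cball 0 1" for x m
    proof -
      have sub: "ball 0 \<kappa> \<subseteq> ball (0::complex) 1"
      proof
        fix y :: complex assume "y \<in> ball 0 \<kappa>"
        then have "cmod y < 1" using k(2)[OF x] by blast
        then show "y \<in> ball 0 1" by simp
      qed
      have h: "(\<lambda>z. F z x) holomorphic_on ball 0 \<kappa>" by (rule holomorphic_on_subset[OF F_holomorphic[OF x] sub])
      have "q m (cvec x) = (deriv ^^ m) (\<lambda>z. F z x) 0 / fact m"
      proof -
        have f: "(\<lambda>z. F z x) has_fps_expansion fps_expansion (\<lambda>z. F z x) 0"
          by (rule has_fps_expansion_fps_expansion[of "ball 0 1"]) (use F_holomorphic[OF x] in auto)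
        have "q m (cvec x) - (deriv ^^ m) (\<lambda>z. F z x) 0 / fact m = 0" for m
        proof (rule powser_zero_unique)
          fix t :: real assume t: "0 < t" "t < 1"
          have "(\<lambda>m. (deriv ^^ m) (\<lambda>z. F z x) 0 / fact m * (of_real t - 0) ^ m) sums F (of_real t) x"
            by (rule holomorphic_power_series[OF F_holomorphic[OF x]]) (use t in simp)
          from sums_diff[OF F_sums[OF x, of "of_real t"] this]
          show "(\<lambda>m. (q m (cvec x) - (deriv ^^ m) (\<lambda>z. F z x) 0 / fact m) * of_real t ^ m) sums 0"
            using t by (simp add: algebra_simps)
        qed
        then show ?thesis by simp
      qed
      moreover have "cmod ((deriv ^^ m) (\<lambda>z. F z x) 0) \<le> fact m * M / r ^ m"
      proof (rule Cauchy_inequality)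
        show "(\<lambda>z. F z x) holomorphic_on ball 0 r" "continuous_on (cball 0 r) (\<lambda>z. F z x)"
          using h r by (auto intro!: holomorphic_on_imp_continuous_on intro: holomorphic_on_subset)
        show "cmod (F z x) \<le> M" if "cmod (0 - z) = r" for z using k(2)[OF x, of z] that r by simp
      qed (rule r)
      then have "cmod ((deriv ^^ m) (\<lambda>z. F z x) 0) / fact m \<le> (fact m * M / r ^ m) / fact m" by (rule divide_right_mono) simp
      ultimately show ?thesis by (simp add: norm_divide)
    qed
    have M0: "M \<ge> 0" using qb[of 0 0] norm_ge_zero[of "q 0 (cvec 0)"] by (simp add: order_trans[OF norm_ge_zero])
    have eq: "G z = pl z" if z: "cmod z < r" for z
    proof -
      have z1: "cmod z < 1" using k(2)[of 0 z] z r by simp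
      have qa: "cmod (q m (cvec x)) * cmod z ^ m \<le> M * (cmod z / r) ^ m" if "x \<in> cball 0 1" for x m
        using mult_right_mono[OF qb[OF that, of m], of "cmod z ^ m"] by (simp add: power_divide)
      have "(\<lambda>m. z ^ m * ball_int (\<lambda>x. q m (cvec x) * H x)) sums G z"
        unfolding G_def using z r by (intro ball_int_F_times[OF z1 _ qa Hc] summable_mult summable_geometric) auto
      moreover have "z ^ m * ball_int (\<lambda>x. q m (cvec x) * H x) =
          (\<Sum>k<p. if m = l + 2 * k then ball_factor (2 * l + 2 * k) * almansi (l + 2 * k) k w * z ^ (l + 2 * k) else 0)" for m
      proof -
        have "ball_int (\<lambda>x. q m (cvec x) * H x) = ball_factor (m + l) * sphere_mean (\<lambda>z. q m z * zonal_harmonic l z w)"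
          unfolding H_def using ball_int_hom_polys[OF hom_polys_mult[OF qh zonal_harmonic_hom_polys], of m l w] by (simp add: ball_factor_def)
        then show ?thesis by (auto simp: sphere_mean_q_zonal_harmonic sum_distrib_left mult_ac mult_2 intro!: sum.cong)
      qed
      ultimately have "(\<lambda>m. \<Sum>k<p. if m = l + 2 * k then ball_factor (2 * l + 2 * k) * almansi (l + 2 * k) k w * z ^ (l + 2 * k) else 0) sums G z"
        by simp
      moreover have "(\<lambda>m. \<Sum>k<p. if m = l + 2 * k then ball_factor (2 * l + 2 * k) * almansi (l + 2 * k) k w * z ^ (l + 2 * k) else 0) sums pl z"
        unfolding pl_def
      proof (rule sums_sum)
        fix k
        show "(\<lambda>m. if m = l + 2 * k then ball_factor (2 * l + 2 * k) * almansi (l + 2 * k) k w * z ^ (l + 2 * k) else 0) sums (ball_factor (2 * l + 2 * k) * almansi (l + 2 * k) k w * z ^ (l + 2 * k))"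
          using sums_single[of "l + 2 * k" "\<lambda>_. ball_factor (2 * l + 2 * k) * almansi (l + 2 * k) k w * z ^ (l + 2 * k)"] by simp
      qed
      ultimately show ?thesis by (rule sums_unique2)
    qed
    have "eventually (\<lambda>s. s \<in> ball (0::real) r) (nhds 0)" using r by (intro eventually_nhds_in_open) auto
    then show ?thesis by (rule eventually_mono) (simp add: eq)
  qed
  have "G (of_real t) - pl (of_real t) = 0"
  proof (rule locally_holomorphic_identity[of "{-1<..<1}" t "\<lambda>t. G (of_real t) - pl (of_real t)"])
    show "convex {-1<..<1::real}" by (rule convex_real_interval)
    show "t \<in> {-1<..<1}" using t by auto
    fix t0 :: real assume "t0 \<in> {-1<..<1}"
    then have "\<bar>t0\<bar> < 1" by auto
    then obtain r where "r > 0" "G holomorphic_on ball (of_real t0) r" using Gh[of t0] by blast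
    then show "\<exists>r>0. \<exists>\<Phi>. \<Phi> holomorphic_on ball (of_real t0) r \<and> (\<forall>t. \<bar>t - t0\<bar> < r \<longrightarrow> G (of_real t) - pl (of_real t) = \<Phi> (of_real t))"
      using plh by (intro exI[of _ r] conjI exI[of _ "\<lambda>z. G z - pl z"] holomorphic_on_diff) auto
  qed (use near0 in auto)
  moreover have "G (of_real t) = ball_int (\<lambda>x. u (t *\<^sub>R x) * zonal_harmonic l (cvec x) w)"
    unfolding G_def H_def by (intro set_lebesgue_integral_cong) (auto simp: F_of_real[OF _ t])
  ultimately show ?thesis by (simp add: pl_def)
qed

text \<open>Bound the integrals of \<open>ball_int_u_zonal_harmonic\<close> at the \<open>p\<close> dilations \<open>\<eta>\<^sup>i\<^sup>+\<^sup>1\<close> by the supremum of \<open>u\<close>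
  and \<open>zonal_poly_bound\<close>, and extract the coefficients by \<open>dilation_coeff_bound\<close>. The choice \<open>\<eta>\<^sup>p = \<rho>\<close>
  keeps every dilation above \<open>\<rho>\<close>, so that removing the common factor \<open>t\<^sup>l\<close> costs at most \<open>\<rho>\<close> to the power
  \<open>-l\<close>; the zonal bound costs the same.\<close>

lemma almansi_bound:
  assumes \<rho>: "0 < \<rho>" "\<rho> < 1" and p: "p > 0"
  obtains C where "C \<ge> 0" "\<And>l k b. k < p \<Longrightarrow> norm b \<le> 1 \<Longrightarrow> cmod (almansi (l + 2 * k) k (cvec b)) \<le> C * real (CARD('n) + (2 * l + 2 * k)) / \<rho> ^ (2 * l)"
proof -
  let ?n = "CARD('n)"
  let ?V = "unit_ball_vol (real ?n)"
  define \<eta> where "\<eta> = root p \<rho>"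
  have \<eta>: "0 < \<eta>" "\<eta> < 1" "\<eta> ^ p = \<rho>" using \<rho> p by (auto simp: \<eta>_def)
  have t: "0 < \<eta> ^ Suc i" "\<eta> ^ Suc i < 1" for i using \<eta> by (auto simp: power_Suc_less_one simp del: power_Suc)
  have t\<rho>: "\<rho> \<le> \<eta> ^ Suc i" if "i < p" for i
    unfolding \<eta>(3)[symmetric] using that \<eta> by (intro power_decreasing) auto
  have "\<exists>M. \<forall>x\<in>cball 0 1. cmod (u (\<eta> ^ Suc i *\<^sub>R x)) \<le> M" for i
  proof -
    have a: "\<bar>\<eta> ^ Suc i\<bar> < 1" using t[of i] by simp
    obtain \<kappa> M where "\<kappa> > 0" "\<And>x z. x \<in> cball 0 1 \<Longrightarrow> z \<in> ball (of_real (\<eta> ^ Suc i)) \<kappa> \<Longrightarrow> cmod z < 1 \<and> cmod (F z x) \<le> M"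
      using F_bounded_near_real[OF a] by blast
    then have "\<forall>x\<in>cball 0 1. cmod (F (of_real (\<eta> ^ Suc i)) x) \<le> M" by (metis centre_in_ball)
    then show ?thesis using F_of_real[OF _ a] by metis
  qed
  then obtain M where M: "\<And>i x. x \<in> cball 0 1 \<Longrightarrow> cmod (u (\<eta> ^ Suc i *\<^sub>R x)) \<le> M i" by metis
  define K0 where "K0 = (\<Sum>i<p. \<bar>M i\<bar>)"
  have K0: "K0 \<ge> 0" unfolding K0_def by (intro sum_nonneg) auto
  have MK: "cmod (u (\<eta> ^ Suc i *\<^sub>R x)) \<le> K0" if "i < p" "x \<in> cball 0 1" for i x
  proof -
    have "\<bar>M i\<bar> \<le> K0" unfolding K0_def using that by (intro member_le_sum) auto
    then show ?thesis using M[OF that(2), of i] by linarith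
  qed
  define Z where "Z = zonal_bound ?n \<rho>"
  have Z: "Z \<ge> 0" by (simp add: Z_def zonal_bound_def)
  obtain C0 where C0: "C0 \<ge> 0" "\<And>c K k. k < p \<Longrightarrow> (\<And>i. i < p \<Longrightarrow> cmod (\<Sum>k<p. c k * of_real (\<eta>\<^sup>2 * (\<eta>\<^sup>2) ^ i) ^ k) \<le> K) \<Longrightarrow> cmod (c k) \<le> C0 * K"
    using dilation_coeff_bound[of "\<eta>\<^sup>2" "\<eta>\<^sup>2" p] \<eta> by (auto simp: power_less_one_iff)
  define C where "C = C0 * (K0 * Z * ?V) / (real ?n * ?V)"
  have V: "?V > 0" by simp
  have "C \<ge> 0" unfolding C_def using C0(1) K0 Z V by (intro divide_nonneg_nonneg mult_nonneg_nonneg) auto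
  moreover have "cmod (almansi (l + 2 * k) k (cvec b)) \<le> C * real (?n + (2 * l + 2 * k)) / \<rho> ^ (2 * l)" if k: "k < p" and b: "norm b \<le> 1" for l k b
  proof -
    let ?c = "\<lambda>k. ball_factor (2 * l + 2 * k) * almansi (l + 2 * k) k (cvec b)"
    have "cmod (?c k) \<le> C0 * (K0 * Z * ?V / \<rho> ^ (2 * l))"
    proof (rule C0(2)[OF k])
      fix i assume i: "i < p"
      let ?t = "\<eta> ^ Suc i"
      have "cmod (zonal_harmonic l (cvec x) (cvec b)) \<le> Z / \<rho> ^ l" if "x \<in> ball 0 1" for x
      proof -
        have "norm x * norm b \<le> 1 * 1" using that b by (intro mult_mono) auto
        then show ?thesis using zonal_poly_bound_real[of 1 1 x b \<rho> 1 l] \<rho> by (simp add: zonal_poly_1[unfolded One_nat_def] zonal_poly_1 Z_def)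
      qed
      then have "cmod (ball_int (\<lambda>x. u (?t *\<^sub>R x) * zonal_harmonic l (cvec x) (cvec b))) \<le> (K0 * (Z / \<rho> ^ l)) * ?V"
        using MK[OF i] K0 unfolding norm_mult by (intro ball_int_norm_le) (simp only: norm_mult, intro mult_mono', use Z \<rho> in auto)
      also have "ball_int (\<lambda>x. u (?t *\<^sub>R x) * zonal_harmonic l (cvec x) (cvec b)) = (\<Sum>k<p. ?c k * of_real ?t ^ (l + 2 * k))"
        by (rule ball_int_u_zonal_harmonic) (use t[of i] in simp)
      also have "\<dots> = of_real ?t ^ l * (\<Sum>k<p. ?c k * of_real (\<eta>\<^sup>2 * (\<eta>\<^sup>2) ^ i) ^ k)"
      proof -
        have "of_real (\<eta>\<^sup>2 * (\<eta>\<^sup>2) ^ i) ^ k = (of_real ?t ^ (2 * k) :: complex)" for k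
        proof -
          have "\<eta>\<^sup>2 * (\<eta>\<^sup>2) ^ i = ?t ^ 2" by (simp add: power_mult_distrib power_mult[symmetric] mult.commute)
          then show ?thesis by (simp only: of_real_power power_mult)
        qed
        then show ?thesis by (simp add: sum_distrib_left power_add mult_ac)
      qed
      finally have "?t ^ l * cmod (\<Sum>k<p. ?c k * of_real (\<eta>\<^sup>2 * (\<eta>\<^sup>2) ^ i) ^ k) \<le> (K0 * (Z / \<rho> ^ l)) * ?V"
        using t[of i] by (simp add: norm_mult norm_power del: power_Suc of_real_power)
      moreover have "\<rho> ^ l * cmod (\<Sum>k<p. ?c k * of_real (\<eta>\<^sup>2 * (\<eta>\<^sup>2) ^ i) ^ k) \<le> ?t ^ l * cmod (\<Sum>k<p. ?c k * of_real (\<eta>\<^sup>2 * (\<eta>\<^sup>2) ^ i) ^ k)"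
        using t\<rho>[OF i] \<rho> by (intro mult_right_mono power_mono) auto
      ultimately have "\<rho> ^ l * cmod (\<Sum>k<p. ?c k * of_real (\<eta>\<^sup>2 * (\<eta>\<^sup>2) ^ i) ^ k) \<le> (K0 * (Z / \<rho> ^ l)) * ?V" by linarith
      then have "cmod (\<Sum>k<p. ?c k * of_real (\<eta>\<^sup>2 * (\<eta>\<^sup>2) ^ i) ^ k) \<le> ((K0 * (Z / \<rho> ^ l)) * ?V) / \<rho> ^ l"
        using \<rho> by (simp add: pos_le_divide_eq mult.commute)
      also have "\<dots> = K0 * Z * ?V / \<rho> ^ (2 * l)" by (simp add: mult_2 power_add)
      finally show "cmod (\<Sum>k<p. ?c k * of_real (\<eta>\<^sup>2 * (\<eta>\<^sup>2) ^ i) ^ k) \<le> K0 * Z * ?V / \<rho> ^ (2 * l)" .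
    qed
    moreover have "cmod (ball_factor (2 * l + 2 * k)) = real ?n * ?V / real (?n + (2 * l + 2 * k))"
      using V by (simp add: ball_factor_def norm_mult norm_divide del: of_nat_add)
    ultimately have "(real ?n * ?V / real (?n + (2 * l + 2 * k))) * cmod (almansi (l + 2 * k) k (cvec b)) \<le> C0 * (K0 * Z * ?V / \<rho> ^ (2 * l))"
      by (simp add: norm_mult)
    then have "cmod (almansi (l + 2 * k) k (cvec b)) \<le> C0 * (K0 * Z * ?V / \<rho> ^ (2 * l)) / (real ?n * ?V / real (?n + (2 * l + 2 * k)))"
    proof -
      have pos: "0 < real ?n * ?V / real (?n + (2 * l + 2 * k))"
        by (intro divide_pos_pos mult_pos_pos V) (auto simp del: of_nat_add)
      show "(real ?n * ?V / real (?n + (2 * l + 2 * k))) * cmod (almansi (l + 2 * k) k (cvec b)) \<le> C0 * (K0 * Z * ?V / \<rho> ^ (2 * l)) \<Longrightarrow>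
        cmod (almansi (l + 2 * k) k (cvec b)) \<le> C0 * (K0 * Z * ?V / \<rho> ^ (2 * l)) / (real ?n * ?V / real (?n + (2 * l + 2 * k)))"
        unfolding pos_le_divide_eq[OF pos] by (simp only: mult.commute)
    qed
    also have "\<dots> = C * real (?n + (2 * l + 2 * k)) / \<rho> ^ (2 * l)" by (simp add: C_def mult_ac)
    finally show ?thesis .
  qed
  ultimately show ?thesis using that by blast
qed

text \<open>By \<open>almansi_bound\<close>, \<open>q m\<close> grows at most like \<open>m\<close> times the \<open>2m\<close>-th power of \<open>1/\<rho>\<close>, and \<open>\<rho> < 1\<close> is
  arbitrary; the choice below puts \<open>\<rho>\<^sup>2\<close> halfway between \<open>R\<close> and \<open>1\<close>.\<close>

lemma q_summable_majorant:
  assumes R: "0 \<le> R" "R < 1" and p: "p > 0"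
  obtains a where "summable a" "\<And>m x. x \<in> cball 0 1 \<Longrightarrow> cmod (q m (cvec x)) * R ^ m \<le> a m"
proof -
  define \<rho> where "\<rho> = sqrt ((1 + R) / 2)"
  have \<rho>2: "\<rho>\<^sup>2 = (1 + R) / 2" using R by (simp add: \<rho>_def)
  have \<rho>: "0 < \<rho>" "\<rho> < 1" using R by (auto simp: \<rho>_def)
  obtain C where C: "C \<ge> 0" "\<And>l k b. k < p \<Longrightarrow> norm b \<le> 1 \<Longrightarrow> cmod (almansi (l + 2 * k) k (cvec b)) \<le> C * real (CARD('n) + (2 * l + 2 * k)) / \<rho> ^ (2 * l)"
    using almansi_bound[OF \<rho> p] by blast
  define y where "y = R / \<rho>\<^sup>2"
  have y: "0 \<le> y" "y < 1" using R unfolding y_def \<rho>2 by (auto simp: divide_less_eq)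
  define a where "a m = (real p * C * real (CARD('n) + 2)) * (real (Suc m) * y ^ m)" for m
  have "summable (\<lambda>m. of_nat (Suc m) * y ^ m)" using geometric_deriv_sums[of y] y by (auto simp: sums_iff)
  then have "summable a" unfolding a_def by (intro summable_mult) simp
  moreover have "cmod (q m (cvec x)) * R ^ m \<le> a m" if x: "x \<in> cball 0 1" for m x
  proof -
    have hb: "cmod (bdot (cvec x) (cvec x) ^ k * almansi m k (cvec x)) \<le> C * real ((CARD('n) + 2) * Suc m) / \<rho> ^ (2 * m)" if k: "k < p" for k
    proof (cases "m < 2 * k")
      case True
      then show ?thesis using almansi(2)[OF True] C(1) \<rho> by (simp add: zero_le_mult_iff)
    next
      case False
      then obtain l where l: "m = l + 2 * k" by (metis le_add_diff_inverse2 not_le)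
      have "cmod (almansi m k (cvec x)) \<le> C * real (CARD('n) + (2 * l + 2 * k)) / \<rho> ^ (2 * l)"
        unfolding l by (rule C(2)[OF k]) (use x in simp)
      also have "\<dots> \<le> C * real ((CARD('n) + 2) * Suc m) / \<rho> ^ (2 * m)"
        using C(1) \<rho> l by (intro frac_le mult_left_mono power_decreasing) (auto simp: algebra_simps)
      finally have "cmod (almansi m k (cvec x)) \<le> C * real ((CARD('n) + 2) * Suc m) / \<rho> ^ (2 * m)" .
      moreover have "cmod (bdot (cvec x) (cvec x) ^ k) \<le> 1"
        unfolding bdot_cvec_self norm_power norm_of_real using x by (intro power_le_one) (auto simp: power_le_one)
      ultimately have "cmod (bdot (cvec x) (cvec x) ^ k) * cmod (almansi m k (cvec x)) \<le> 1 * (C * real ((CARD('n) + 2) * Suc m) / \<rho> ^ (2 * m))"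
        by (intro mult_mono) auto
      then show ?thesis by (simp add: norm_mult)
    qed
    have "cmod (q m (cvec x)) \<le> (\<Sum>k<p. C * real ((CARD('n) + 2) * Suc m) / \<rho> ^ (2 * m))"
      unfolding almansi(3)[of m] by (rule order_trans[OF norm_sum sum_mono]) (use hb in auto)
    then have "cmod (q m (cvec x)) * R ^ m \<le> (\<Sum>k<p. C * real ((CARD('n) + 2) * Suc m) / \<rho> ^ (2 * m)) * R ^ m"
      using R by (intro mult_right_mono) auto
    also have "\<dots> = real p * C * real (CARD('n) + 2) * (real (Suc m) * (R ^ m / (\<rho>\<^sup>2) ^ m))"
      unfolding of_nat_mult power_mult by (simp del: of_nat_Suc of_nat_add)
    also have "\<dots> = a m" by (simp only: a_def y_def power_divide)
    finally show ?thesis .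
  qed
  ultimately show ?thesis using that by blast
qed

end

section \<open>The closed form as an element of the Bergman space\<close>

text \<open>Both roots have modulus \<open>|a||b| < 1\<close>, which leaves room to evaluate and differentiate the
  generating function at \<open>1\<close>.\<close>

lemma zonal_series:
  fixes a b :: "real ^ 'n"
  assumes \<alpha>: "cmod \<alpha> = 1" "cmod \<beta> = 1" and ab: "norm a * norm b < 1" and p: "p > 0"
  defines "z \<equiv> \<alpha> *s cvec a" and "w \<equiv> \<beta> *s cvec b"
  obtains R where "R > 1" "zonal_gf p z w holomorphic_on ball 0 R"
    "\<And>\<tau>. cmod \<tau> < R \<Longrightarrow> (\<lambda>m. zonal_poly p m z w * \<tau> ^ m) sums zonal_gf p z w \<tau>"
    "of_nat CARD('n) * zonal_gf p z w 1 + 2 * deriv (zonal_gf p z w) 1 = kern_closed p z w"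
    "(\<lambda>m. (of_nat CARD('n) + 2 * of_nat m) * zonal_poly p m z w) sums kern_closed p z w"
    "1 - 2 * bdot z w + bdot z z * bdot w w \<notin> \<real>\<^sub>\<le>\<^sub>0"
proof -
  obtain e1 e2 where e: "lie_roots z w e1 e2" "norm e1 = norm a * norm b" "norm e2 = norm a * norm b"
    using lie_roots_exist[OF \<alpha>] unfolding z_def w_def by blast
  \<comment> \<open>Chosen to satisfy \<open>1 < R\<close> and \<open>R |a||b| \<le> 1\<close>, also when \<open>|a||b| = 0\<close>.\<close>
  define R where "R = 2 / (1 + norm a * norm b)"
  have ab0: "0 < 1 + norm a * norm b" by (intro add_pos_nonneg) auto
  have R: "R > 1" "norm e1 * R \<le> 1" "norm e2 * R \<le> 1"
    using ab unfolding e R_def times_divide_eq_right pos_less_divide_eq[OF ab0] pos_divide_le_eq[OF ab0] by simp_all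
  have R0: "R > 0" using R by simp
  have hol: "zonal_gf p z w holomorphic_on ball 0 R" by (rule zonal_gf_holomorphic[OF e(1) R(2,3) R0])
  have s: "(\<lambda>m. zonal_poly p m z w * \<tau> ^ m) sums zonal_gf p z w \<tau>" if "cmod \<tau> < R" for \<tau>
    by (rule zonal_poly_sums(1)[OF e(1) R(2,3) R0 that])
  have d: "of_nat CARD('n) * zonal_gf p z w 1 + 2 * deriv (zonal_gf p z w) 1 = kern_closed p z w"
    unfolding kern_closed_def using deriv_zonal_gf[OF e(1)] ab p e(2,3) by simp
  have "(\<lambda>m. of_nat CARD('n) * (zonal_poly p m z w * 1 ^ m) + 2 * (of_nat m * zonal_poly p m z w * 1 ^ m)) sums
    (of_nat CARD('n) * zonal_gf p z w 1 + 2 * (1 * deriv (zonal_gf p z w) 1))"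
    by (intro sums_add sums_mult s zonal_poly_sums(2)[OF e(1) R(2,3) R0]) (use R in auto)
  then have k: "(\<lambda>m. (of_nat CARD('n) + 2 * of_nat m) * zonal_poly p m z w) sums kern_closed p z w"
    unfolding d[symmetric] by (simp add: algebra_simps)
  have "1 - 2 * bdot z w + bdot z z * bdot w w \<notin> \<real>\<^sub>\<le>\<^sub>0"
    using quad_notin_nonpos_Reals[OF e(1), of 1] e ab by simp
  with R(1) hol s d k show ?thesis using that by blast
qed

text \<open>The summands of the kernel; the weight inverts the factor by which integrals over the ball
  differ from spherical means.\<close>

definition kernel_term :: "nat \<Rightarrow> complex ^ 'n \<Rightarrow> nat \<Rightarrow> complex ^ 'n \<Rightarrow> complex" where
  "kernel_term p w m z = (of_nat CARD('n) + 2 * of_nat m) / (of_nat CARD('n) * of_real (unit_ball_vol (real CARD('n)))) * zonal_poly p m z w"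

definition kernel_fun :: "nat \<Rightarrow> complex ^ 'n \<Rightarrow> complex ^ 'n \<Rightarrow> complex" where
  "kernel_fun p w z = kern_closed p z w / (of_nat CARD('n) * of_real (unit_ball_vol (real CARD('n))))"

lemma kernel_term_sums:
  fixes a b :: "real ^ 'n"
  assumes "cmod \<alpha> = 1" "cmod \<beta> = 1" "norm a * norm b < 1" "p > 0"
  shows "(\<lambda>m. kernel_term p (\<beta> *s cvec b) m (\<alpha> *s cvec a)) sums kernel_fun p (\<beta> *s cvec b) (\<alpha> *s cvec a)"
proof -
  have "(\<lambda>m. (of_nat CARD('n) + 2 * of_nat m) * zonal_poly p m (\<alpha> *s cvec a) (\<beta> *s cvec b)) sums kern_closed p (\<alpha> *s cvec a) (\<beta> *s cvec b)"
    by (rule zonal_series[OF assms])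
  from sums_divide[OF this] show ?thesis unfolding kernel_term_def kernel_fun_def by simp
qed

lemma kernel_term_polyharmonic: "kernel_term p w m \<in> polyharmonic_polys p m"
proof -
  have z: "(\<lambda>z. zonal_poly p m z w) \<in> hom_polys m" "\<And>z. (lap ^^ p) (\<lambda>z. zonal_poly p m z w) z = 0"
    using zonal_poly_polyharmonic[of p m w] by (auto simp: polyharmonic_polys_def)
  have "(\<lambda>z. c * zonal_poly p m z w) \<in> polyharmonic_polys p m" for c
    using z hom_polys_cmult[OF z(1), of c] by (simp add: polyharmonic_polys_def lap_iter_cmult[OF z(1)])
  then show ?thesis unfolding kernel_term_def[abs_def] .
qed

text \<open>Real analyticity is that of the closed form. Its homogeneous expansion shows that
  \<open>\<Delta>\<^sup>p\<close> vanishes near \<open>0\<close>, and the identity theorem carries this to the whole ball.\<close>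

lemma kernel_fun_polyharmonic_ball:
  fixes b :: "real ^ 'n"
  assumes \<beta>: "cmod \<beta> = 1" and b: "norm b < 1" and p: "p > 0"
  shows "(\<lambda>x. kernel_fun p (\<beta> *s cvec b) (cvec x)) \<in> polyharmonic_ball p"
proof -
  let ?w = "\<beta> *s cvec b" and ?u = "\<lambda>x. kernel_fun p (\<beta> *s cvec b) (cvec x)"
  have xb: "norm x * norm b < 1" if "x \<in> ball 0 1" for x :: "real ^ 'n"
  proof -
    have "norm x * norm b \<le> 1 * norm b" using that by (intro mult_right_mono) auto
    then show ?thesis using b by simp
  qed
  have slit: "1 - 2 * bdot (cvec x) ?w + bdot (cvec x) (cvec x) * bdot ?w ?w \<notin> \<real>\<^sub>\<le>\<^sub>0" if "x \<in> ball 0 1" for x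
    using zonal_series[of 1 \<beta> x b p thesis for thesis, OF _ \<beta> xb[OF that] p] by simp
  have s: "(\<lambda>m. kernel_term p ?w m (cvec x)) sums ?u x" if "x \<in> ball 0 1" for x
    using kernel_term_sums[of 1 \<beta> x b p] \<beta> xb[OF that] p by simp
  have an: "real_analytic_on ?u (ball 0 1)"
  proof -
    have "real_analytic_on (\<lambda>x. kern_closed p (cvec x) ?w) (ball 0 1)" using slit by (rule kern_closed_real_analytic)
    then show ?thesis unfolding real_analytic_on_power_series_at
    proof (intro ballI, drule_tac bspec)
      fix a assume "\<exists>r>0. \<exists>c. power_series_at c a r (\<lambda>x. kern_closed p (cvec x) ?w)"
      then obtain r c where r: "r > 0" and m: "power_series_at c a r (\<lambda>x. kern_closed p (cvec x) ?w)" by blast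
      define d :: complex where "d = 1 / (of_nat CARD('n) * of_real (unit_ball_vol (real CARD('n))))"
      have "power_series_at (\<lambda>\<alpha>. d * c \<alpha>) a r ?u"
        unfolding power_series_at_def
      proof
        fix x assume "x \<in> ball a r"
        then have "((\<lambda>\<alpha>. d * (c \<alpha> * monomial \<alpha> (cvec (x - a)))) has_sum d * kern_closed p (cvec x) ?w) UNIV"
          using m by (intro has_sum_cmult_right) (auto simp: power_series_at_def)
        then show "((\<lambda>\<alpha>. d * c \<alpha> * monomial \<alpha> (cvec (x - a))) has_sum kernel_fun p ?w (cvec x)) UNIV"
          by (simp add: kernel_fun_def d_def mult.assoc)
      qed
      then show "\<exists>r>0. \<exists>c. power_series_at c a r ?u" using r by blast
    qed
  qed
  moreover have "(real_laplacian ^^ p) ?u x = 0" if "x \<in> ball 0 1" for x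
  proof -
    obtain r c where r: "r > 0" and m: "power_series_at c 0 r ?u"
      using an[unfolded real_analytic_on_power_series_at, rule_format, of 0] by auto
    have "\<forall>x\<in>ball 0 r. (real_laplacian ^^ p) ?u x = 0"
    proof (subst polyharmonic_expansion_iff[OF m r _ s])
      show "kernel_term p ?w m \<in> hom_polys m" for m using kernel_term_polyharmonic[of p ?w m] by (simp add: polyharmonic_polys_def)
    qed (use kernel_term_polyharmonic in auto)
    then show ?thesis using real_analytic_identity[OF real_analytic_real_laplacian_iter[OF an] r _ that] by blast
  qed
  ultimately show ?thesis by (simp add: polyharmonic_ball_def)
qed

lemma Bhat_rot: "k < p \<Longrightarrow> norm x < 1 \<Longrightarrow> rot p k x \<in> Bhat p"
  unfolding Bhat_def by (auto intro!: bexI[of _ k])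

lemma BhatE:
  assumes "y \<in> Bhat p"
  obtains k b where "k < p" "norm b < 1" "y = rot p k b"
  using assms unfolding Bhat_def by auto

lemma vcnj_rot: "vcnj (rot p k b) = cis (- (real k * pi / real p)) *s cvec b"
  by (simp add: rot_def vcnj_smult cis_cnj)

lemma continuous_rot: "continuous_on A (\<lambda>x. rot p k x)"
  unfolding rot_def vector_scalar_mult_def by (intro continuous_on_vec_lambda continuous_intros)

lemma continuous_kernel_fun_rot:
  fixes b :: "real ^ 'n"
  assumes \<beta>: "cmod \<beta> = 1" and b: "norm b < 1" and p: "p > 0"
  shows "continuous_on (cball 0 1) (\<lambda>x. kernel_fun p (\<beta> *s cvec b) (rot p k x))"
proof -
  let ?w = "\<beta> *s cvec b"
  have slit: "1 - 2 * bdot (rot p k x) ?w + bdot (rot p k x) (rot p k x) * bdot ?w ?w \<notin> \<real>\<^sub>\<le>\<^sub>0" if "x \<in> cball 0 1" for x :: "real ^ 'n"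
  proof -
    have "norm x * norm b \<le> 1 * norm b" using that by (intro mult_right_mono) auto
    then have "norm x * norm b < 1" using b by simp
    from zonal_series[of "cis (real k * pi / real p)" \<beta> x b p thesis for thesis, OF _ \<beta> this p] show ?thesis by (simp add: rot_def)
  qed
  have pw: "continuous_on (- \<real>\<^sub>\<le>\<^sub>0) (\<lambda>q::complex. q powr \<nu>)" for \<nu>
    by (intro holomorphic_on_imp_continuous_on holomorphic_intros) auto
  have "continuous_on (cball 0 1) (\<lambda>x. (1 - 2 * bdot (rot p k x) ?w + bdot (rot p k x) (rot p k x) * bdot ?w ?w) powr \<nu>)" for \<nu>
  proof (rule continuous_on_compose2[OF pw])
    show "continuous_on (cball 0 1) (\<lambda>x. 1 - 2 * bdot (rot p k x) ?w + bdot (rot p k x) (rot p k x) * bdot ?w ?w)"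
      by (intro continuous_on_diff continuous_on_mult continuous_on_const continuous_on_add continuous_on_bdot continuous_rot)
  qed (use slit in auto)
  moreover have "(1 - 2 * bdot (rot p k x) ?w + bdot (rot p k x) (rot p k x) * bdot ?w ?w) powr \<nu> \<noteq> 0" if "x \<in> cball 0 1" for x \<nu>
    using slit[OF that] by (auto simp: powr_def)
  ultimately show ?thesis unfolding kernel_fun_def kern_closed_def using unit_ball_vol_neq_0[of "CARD('n)"]
    by (intro continuous_on_divide continuous_on_diff continuous_on_mult continuous_on_power continuous_on_const
         continuous_on_add continuous_on_bdot continuous_rot) auto
qed

definition kernel_at :: "nat \<Rightarrow> complex ^ 'n \<Rightarrow> complex ^ 'n \<Rightarrow> complex" where
  "kernel_at p y = restrict (kernel_fun p (vcnj y)) (Bhat p)"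

text \<open>The closed form is continuous on the closed rotated balls, because \<open>|x||b| < 1\<close> even for \<open>|x| = 1\<close>;
  so it is square integrable.\<close>

lemma kernel_at_in_bergman_space:
  fixes y :: "complex ^ 'n"
  assumes p: "p > 0" and y: "y \<in> Bhat p"
  shows "kernel_at p y \<in> bergman_space p"
proof -
  obtain l b where b: "norm b < 1" and yb: "y = rot p l b" using y by (rule BhatE)
  define \<beta> where "\<beta> = cis (- (real l * pi / real p))"
  have \<beta>: "cmod \<beta> = 1" and w: "vcnj y = \<beta> *s cvec b" by (simp_all add: \<beta>_def yb vcnj_rot)
  have hom: "kernel_term p w m \<in> hom_polys m" for m and w :: "complex ^ 'n"
    using kernel_term_polyharmonic[of p w m] by (simp add: polyharmonic_polys_def)
  have xb: "norm x * norm b < 1" if "x \<in> ball 0 1" for x :: "real ^ 'n"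
  proof -
    have "norm x * norm b \<le> 1 * norm b" using that by (intro mult_right_mono) auto
    then show ?thesis using b by simp
  qed
  have s: "(\<lambda>m. cis (real m * \<psi>) * kernel_term p (vcnj y) m (cvec x)) sums kernel_fun p (vcnj y) (cis \<psi> *s cvec x)" if "x \<in> ball 0 1" for x \<psi>
  proof -
    have "(\<lambda>m. kernel_term p (vcnj y) m (cis \<psi> *s cvec x)) sums kernel_fun p (vcnj y) (cis \<psi> *s cvec x)"
      unfolding w by (rule kernel_term_sums[OF _ \<beta> xb[OF that] p]) simp
    then show ?thesis by (simp add: hom_polys_scale[OF hom] Complex.DeMoivre)
  qed
  have "kernel_at p y \<in> polyharmonic_Bhat p"
    unfolding polyharmonic_Bhat_def
  proof (intro CollectI conjI bexI exI allI ballI impI)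
    show "kernel_at p y \<in> extensional (Bhat p)" by (simp add: kernel_at_def)
    show "(\<lambda>x. kernel_fun p (vcnj y) (cvec x)) \<in> polyharmonic_ball p"
      unfolding w by (rule kernel_fun_polyharmonic_ball[OF \<beta> b p])
    show "kernel_term p (vcnj y) m \<in> hom_polys m" for m by (rule hom)
    show "(\<lambda>m. kernel_term p (vcnj y) m (cvec x)) sums kernel_fun p (vcnj y) (cvec x)" if "x \<in> ball 0 1" for x
      using s[OF that, of 0] by simp
    show "(\<lambda>m. cis (real m * \<psi>) * kernel_term p (vcnj y) m (cvec x)) sums kernel_at p y (cis \<psi> *s cvec x)"
      if "x \<in> ball 0 1" "cis \<psi> *s cvec x \<in> Bhat p" for x \<psi>
      using s[OF that(1)] that(2) by (simp add: kernel_at_def)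
  qed
  moreover have "set_integrable lborel (ball 0 1) (\<lambda>x. (cmod (kernel_at p y (rot p k x)))\<^sup>2)" if k: "k < p" for k
  proof -
    have "set_integrable lborel (cball 0 1) (\<lambda>x::real^'n. (cmod (kernel_fun p (vcnj y) (rot p k x)))\<^sup>2)"
      unfolding set_integrable_def w
      by (intro borel_integrable_compact continuous_on_power continuous_on_norm continuous_kernel_fun_rot[OF \<beta> b p]) auto
    then have "set_integrable lborel (ball 0 1) (\<lambda>x::real^'n. (cmod (kernel_fun p (vcnj y) (rot p k x)))\<^sup>2)"
      by (rule set_integrable_subset) auto
    also have "?this \<longleftrightarrow> ?thesis"
      by (rule set_integrable_cong) (use Bhat_rot[OF k] in \<open>auto simp: kernel_at_def\<close>)
    finally show ?thesis .
  qed
  ultimately show ?thesis unfolding bergman_space_def by blast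
qed

section \<open>Orthogonality of degrees on the rotated balls\<close>

text \<open>Here \<open>m - m' = 2(i - j)\<close> with \<open>0 < |i - j| < p\<close>, so the summands are the powers of a \<open>p\<close>-th root of unity other
  than \<open>1\<close>.\<close>

lemma sum_rotations:
  assumes p: "p > 0" and ij: "i < p" "j < p" and m: "m + 2 * j = m' + 2 * i" "m \<noteq> m'"
  shows "(\<Sum>k<p. cis (real k * pi / real p) ^ m * cnj (cis (real k * pi / real p) ^ m')) = 0"
proof -
  define \<phi> where "\<phi> = 2 * pi * (real i - real j) / real p"
  have mm: "real m - real m' = 2 * (real i - real j)"
    using arg_cong[OF m(1), of real] by simp
  have eq: "cis (real k * pi / real p) ^ m * cnj (cis (real k * pi / real p) ^ m') = cis \<phi> ^ k" for k
  proof -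
    have "cis (real k * pi / real p) ^ m * cnj (cis (real k * pi / real p) ^ m') =
        cis ((real m - real m') * (real k * pi / real p))"
      unfolding Complex.DeMoivre cis_cnj cis_mult by (simp add: left_diff_distrib diff_divide_distrib)
    also have "\<dots> = cis (real k * \<phi>)" unfolding mm \<phi>_def by (simp add: mult_ac)
    finally show ?thesis by (simp add: Complex.DeMoivre)
  qed
  have ne: "cis \<phi> \<noteq> 1"
  proof
    assume "cis \<phi> = 1"
    then have "cos \<phi> = 1" by (simp add: complex_eq_iff)
    then obtain N :: int where "\<phi> = real_of_int N * 2 * pi" unfolding cos_one_2pi_int by blast
    then have "(2 * pi) * ((real i - real j) / real p) = (2 * pi) * real_of_int N"
      unfolding \<phi>_def by (simp only: times_divide_eq_right mult_ac)
    then have "(real i - real j) / real p = real_of_int N" by (simp only: mult_cancel_left) simp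
    then have "real_of_int (int i - int j) = real_of_int (N * int p)" using p by (simp add: divide_eq_eq)
    then have N: "int i - int j = N * int p" by (simp only: of_int_eq_iff)
    have "N = 0"
    proof (rule ccontr)
      assume "N \<noteq> 0"
      then have "1 * int p \<le> \<bar>N\<bar> * int p" by (intro mult_right_mono) auto
      also have "\<dots> = \<bar>int i - int j\<bar>" unfolding N by (simp add: abs_mult)
      also have "\<dots> < int p" using ij by linarith
      finally show False by simp
    qed
    then show False using N m by simp
  qed
  have "cis \<phi> ^ p = cis (2 * pi * (real i - real j))" using p by (simp add: Complex.DeMoivre \<phi>_def)
  also have "\<dots> = 1" by (rule cis_multiple_2pi) auto
  finally show ?thesis unfolding eq geometric_sum[OF ne] by simp
qed

text \<open>On a dilated ball \<open>q_summable_majorant\<close> allows integration term by term. The spherical pairing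
  leaves only degrees \<open>m\<close> with \<open>m - m' = 2d\<close>, \<open>|d| < p\<close>, and the sum over the rotations removes those with \<open>m \<noteq> m'\<close>.\<close>

lemma (in polyharmonic_expansion) rotations_dilation_integral:
  fixes w :: "complex ^ 'n"
  assumes p: "p > 0" and t: "0 < t" "t < 1"
  shows "(\<Sum>k<p. LINT x:ball 0 t|lborel. F (cis (real k * pi / real p)) x * cnj (zonal_poly p m' (rot p k x) w)) =
     of_nat p * (of_real t ^ (CARD('n) + 2 * m') * (ball_factor (2 * m') * q m' (vcnj w)))"
proof -
  define y where "y = vcnj w"
  define H where "H x = zonal_poly p m' (cvec x) y" for x :: "real ^ 'n"
  define \<omega> where "\<omega> k = cis (real k * pi / real p)" for k
  have \<omega>: "cmod (\<omega> k) = 1" for k by (simp add: \<omega>_def)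
  have Hc: "continuous_on UNIV H"
    unfolding H_def by (intro continuous_hom_polys'[OF zonal_poly_hom_polys] continuous_on_cvec continuous_on_id)
  have H_scale: "H (s *\<^sub>R x) = of_real s ^ m' * H x" for s x by (simp add: H_def cvec_scaleR zonal_poly_scale)
  have F_scale: "F z (s *\<^sub>R x) = F (z * of_real s) x" for z s x
    by (simp add: F_def q_scale power_mult_distrib mult_ac)
  have Zc: "cnj (zonal_poly p m' (rot p k x) w) = cnj (\<omega> k ^ m') * H x" for k x
    by (simp add: rot_def \<omega>_def zonal_poly_scale H_def y_def cnj_zonal_poly)
  obtain a where a: "summable a" "\<And>m x. x \<in> cball 0 1 \<Longrightarrow> cmod (q m (cvec x)) * t ^ m \<le> a m"
    using q_summable_majorant[of t] t p by auto
  define S where "S m = sphere_mean (\<lambda>z. q m z * zonal_poly p m' z y)" for m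
  have step: "(LINT x:ball 0 t|lborel. F (\<omega> k) x * cnj (zonal_poly p m' (rot p k x) w)) =
     of_real t ^ (CARD('n) + m') * (cnj (\<omega> k ^ m') * ball_int (\<lambda>x. F (\<omega> k * of_real t) x * H x))" for k
  proof -
    have m: "(\<lambda>x. F (\<omega> k) x * (cnj (\<omega> k ^ m') * H x)) \<in> borel_measurable borel"
      by (intro borel_measurable_times F_measurable borel_measurable_const borel_measurable_continuous_onI[OF Hc])
    have "(LINT x:ball 0 t|lborel. F (\<omega> k) x * cnj (zonal_poly p m' (rot p k x) w)) =
      of_real (t ^ CARD('n)) * ball_int (\<lambda>x. (of_real t ^ m' * cnj (\<omega> k ^ m')) * (F (\<omega> k * of_real t) x * H x))"
      unfolding Zc set_lebesgue_integral_ball_scale[OF m t(1)] F_scale H_scale by (simp only: mult_ac)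
    also have "\<dots> = of_real (t ^ CARD('n)) * ((of_real t ^ m' * cnj (\<omega> k ^ m')) * ball_int (\<lambda>x. F (\<omega> k * of_real t) x * H x))"
      by (simp only: set_integral_mult_right)
    finally show ?thesis by (simp add: power_add mult_ac)
  qed
  have s: "(\<lambda>m. (\<omega> k * of_real t) ^ m * (ball_factor (m + m') * S m)) sums ball_int (\<lambda>x. F (\<omega> k * of_real t) x * H x)" for k
  proof -
    have "(\<lambda>m. (\<omega> k * of_real t) ^ m * ball_int (\<lambda>x. q m (cvec x) * H x)) sums ball_int (\<lambda>x. F (\<omega> k * of_real t) x * H x)"
      by (rule ball_int_F_times[OF _ a(1) _ Hc]) (use a(2) t in \<open>auto simp: norm_mult \<omega>\<close>)
    moreover have "ball_int (\<lambda>x. q m (cvec x) * H x) = ball_factor (m + m') * S m" for m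
      unfolding H_def S_def using ball_int_hom_polys[OF hom_polys_mult[OF qh zonal_poly_hom_polys], of m p m' y] by (simp add: ball_factor_def)
    ultimately show ?thesis by simp
  qed
  have "(\<lambda>m. \<Sum>k<p. cnj (\<omega> k ^ m') * ((\<omega> k * of_real t) ^ m * (ball_factor (m + m') * S m))) sums
     (\<Sum>k<p. cnj (\<omega> k ^ m') * ball_int (\<lambda>x. F (\<omega> k * of_real t) x * H x))"
    by (intro sums_sum sums_mult s)
  moreover have "(\<Sum>k<p. cnj (\<omega> k ^ m') * ((\<omega> k * of_real t) ^ m * (ball_factor (m + m') * S m))) =
      (if m = m' then of_nat p * (of_real t ^ m' * (ball_factor (2 * m') * q m' y)) else 0)" for m
  proof -
    have "(\<Sum>k<p. cnj (\<omega> k ^ m') * ((\<omega> k * of_real t) ^ m * (ball_factor (m + m') * S m))) =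
      (\<Sum>k<p. \<omega> k ^ m * cnj (\<omega> k ^ m')) * (of_real t ^ m * (ball_factor (m + m') * S m))"
      unfolding sum_distrib_right by (intro sum.cong refl) (simp only: power_mult_distrib mult_ac)
    also have "\<dots> = (if m = m' then of_nat p * (of_real t ^ m' * (ball_factor (2 * m') * q m' y)) else 0)"
    proof (cases "m = m'")
      case True
      have S: "S m' = q m' y" unfolding S_def by (rule sphere_mean_polyharmonic_zonal_poly(1)[OF q])
      have "(\<Sum>k<p. \<omega> k ^ m' * cnj (\<omega> k ^ m')) = of_nat p" unfolding \<omega>_def cis_power_cnj by simp
      then show ?thesis unfolding True S by (simp only: mult_2 refl if_True)
    next
      case False
      have "(\<Sum>k<p. \<omega> k ^ m * cnj (\<omega> k ^ m')) * S m = 0"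
      proof (cases "\<exists>i j. i < p \<and> j < p \<and> m + 2 * j = m' + 2 * i")
        case True
        then obtain i j where "i < p" "j < p" "m + 2 * j = m' + 2 * i" by blast
        from sum_rotations[OF p this False] show ?thesis unfolding \<omega>_def by simp
      next
        case no: False
        have "S m = 0" unfolding S_def by (rule sphere_mean_polyharmonic_zonal_poly(2)[OF q]) (use no in blast)
        then show ?thesis by simp
      qed
      then show ?thesis using False by auto
    qed
    finally show ?thesis .
  qed
  ultimately have "(\<lambda>m. if m = m' then of_nat p * (of_real t ^ m' * (ball_factor (2 * m') * q m' y)) else 0) sums
     (\<Sum>k<p. cnj (\<omega> k ^ m') * ball_int (\<lambda>x. F (\<omega> k * of_real t) x * H x))" by simp
  from sums_unique2[OF this sums_single]
  have eq: "(\<Sum>k<p. cnj (\<omega> k ^ m') * ball_int (\<lambda>x. F (\<omega> k * of_real t) x * H x)) = of_nat p * (of_real t ^ m' * (ball_factor (2 * m') * q m' y))" .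
  have "of_real t ^ (CARD('n) + 2 * m') = (of_real t ^ (CARD('n) + m') * of_real t ^ m' :: complex)"
    by (simp only: power_add mult_2 mult.assoc)
  then show ?thesis
    unfolding \<omega>_def[symmetric] step sum_distrib_left[symmetric] eq y_def[symmetric] by (simp only: mult_ac)
qed

lemma set_integrable_mult_bounded:
  fixes f g :: "real ^ 'n \<Rightarrow> complex"
  assumes f: "set_integrable lborel A f" and m: "f \<in> borel_measurable borel" "g \<in> borel_measurable borel" "A \<in> sets borel"
    and g: "\<And>x. x \<in> A \<Longrightarrow> cmod (g x) \<le> B"
  shows "set_integrable lborel A (\<lambda>x. f x * g x)"
proof (rule set_integrable_bound)
  show "set_integrable lborel A (\<lambda>x. of_real B * f x)" using f by (intro set_integrable_mult_right)
  show "set_borel_measurable lborel A (\<lambda>x. f x * g x)"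
    unfolding set_borel_measurable_def using m by measurable
  show "AE x in lborel. x \<in> A \<longrightarrow> cmod (f x * g x) \<le> cmod (of_real B * f x)"
  proof (rule AE_I2, rule impI)
    fix x assume "x \<in> A"
    then have "cmod (g x) \<le> \<bar>B\<bar>" using g by fastforce
    then show "cmod (f x * g x) \<le> cmod (of_real B * f x)" by (simp add: norm_mult mult.commute[of "cmod (f x)"] mult_right_mono)
  qed
qed

text \<open>The limit of \<open>rotations_dilation_integral\<close> as the balls exhaust the unit ball.\<close>

lemma (in polyharmonic_expansion) rotations_integral:
  fixes w :: "complex ^ 'n"
  assumes p: "p > 0" and int: "\<And>k. k < p \<Longrightarrow> set_integrable lborel (ball 0 1) (F (cis (real k * pi / real p)))"
  shows "(\<Sum>k<p. ball_int (\<lambda>x. F (cis (real k * pi / real p)) x * cnj (zonal_poly p m' (rot p k x) w))) =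
     of_nat p * (ball_factor (2 * m') * q m' (vcnj w))"
proof -
  define t where "t i = 1 - 1 / (real i + 2)" for i
  have t: "0 < t i" "t i < 1" for i by (auto simp: t_def)
  have "(\<lambda>i. 1 - 1 / (real i + 2)) \<longlonglongrightarrow> 1" by real_asymp
  then have tl: "t \<longlonglongrightarrow> 1" unfolding t_def[abs_def] .
  have inc: "incseq t" unfolding t_def[abs_def] by (intro incseq_SucI) (simp add: frac_le)
  have un: "(\<Union>i. ball (0::real^'n) (t i)) = ball 0 1"
  proof (intro equalityI subsetI)
    fix x :: "real ^ 'n" assume "x \<in> (\<Union>i. ball 0 (t i))"
    then show "x \<in> ball 0 1" using t by (auto intro: less_trans)
  next
    fix x :: "real ^ 'n" assume "x \<in> ball 0 1"
    then have "eventually (\<lambda>i. t i > norm x) sequentially" by (intro order_tendstoD(1)[OF tl]) simp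
    then show "x \<in> (\<Union>i. ball 0 (t i))" by (auto dest: eventually_happens)
  qed
  let ?f = "\<lambda>k x. F (cis (real k * pi / real p)) x * cnj (zonal_poly p m' (rot p k x) w)"
  have zonal_coeff: "continuous_on A (\<lambda>x. cnj (zonal_poly p m' (rot p k x) w))" for k A
    by (intro continuous_on_cnj continuous_hom_polys'[OF zonal_poly_hom_polys] continuous_rot)
  have fi: "set_integrable lborel (ball 0 1) (?f k)" if k: "k < p" for k
  proof -
    have "bounded ((\<lambda>x::real^'n. cnj (zonal_poly p m' (rot p k x) w)) ` cball 0 1)"
      by (intro compact_imp_bounded compact_continuous_image zonal_coeff) auto
    then obtain B where "\<And>x::real^'n. x \<in> cball 0 1 \<Longrightarrow> cmod (cnj (zonal_poly p m' (rot p k x) w)) \<le> B" unfolding bounded_iff by blast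
    then show ?thesis by (intro set_integrable_mult_bounded[OF int[OF k] F_measurable borel_measurable_continuous_onI[OF zonal_coeff], where B=B]) auto
  qed
  have incb: "incseq (\<lambda>i. ball (0::real^'n) (t i))"
    unfolding incseq_def
  proof (intro allI impI subset_ball)
    show "t i \<le> t j" if "i \<le> j" for i j using incseqD[OF inc that] .
  qed
  have "(\<lambda>i. LINT x:ball 0 (t i)|lborel. ?f k x) \<longlonglongrightarrow> ball_int (?f k)" if k: "k < p" for k
    using set_integral_cont_up[OF _ incb, of lborel "?f k"] fi[OF k] unfolding un by simp
  then have "(\<lambda>i. \<Sum>k<p. LINT x:ball 0 (t i)|lborel. ?f k x) \<longlonglongrightarrow> (\<Sum>k<p. ball_int (?f k))"
    by (intro tendsto_sum) auto
  then have 1: "(\<lambda>i. of_nat p * (of_real (t i) ^ (CARD('n) + 2 * m') * (ball_factor (2 * m') * q m' (vcnj w)))) \<longlonglongrightarrow> (\<Sum>k<p. ball_int (?f k))"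
    unfolding rotations_dilation_integral[OF p t] .
  have "(\<lambda>i. of_nat p * (of_real (t i) ^ (CARD('n) + 2 * m') * (ball_factor (2 * m') * q m' (vcnj w)))) \<longlonglongrightarrow>
      of_nat p * (of_real 1 ^ (CARD('n) + 2 * m') * (ball_factor (2 * m') * q m' (vcnj w)))"
    by (intro tendsto_intros tl)
  from LIMSEQ_unique[OF 1 this] show ?thesis by simp
qed

section \<open>The reproducing property\<close>

text \<open>Write \<open>b = s b'\<close> with \<open>|b| < s < 1\<close>. Homogeneity in the second argument gains \<open>s\<^sup>m\<close>, and the zonal bound loses
  \<open>r\<^sup>m\<close> with \<open>r > s\<close>.\<close>

lemma kernel_term_majorant:
  fixes b :: "real ^ 'n"
  assumes \<beta>: "cmod \<beta> = 1" and b: "norm b < 1"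
  obtains A where "summable A" "\<And>m k x. norm x \<le> 1 \<Longrightarrow> cmod (kernel_term p (\<beta> *s cvec b) m (rot p k x)) \<le> A m"
proof -
  obtain s where s: "norm b < s" "s < 1" using b dense by blast
  obtain r where r: "s < r" "r < 1" using s(2) dense by blast
  have s0: "s > 0" using s norm_ge_zero[of b] by linarith
  then have r0: "r > 0" using r by simp
  let ?V = "complex_of_real (unit_ball_vol (real CARD('n)))"
  define b' where "b' = (1 / s) *\<^sub>R b"
  have b': "norm b' \<le> 1" "\<beta> *s cvec b = of_real s *s (\<beta> *s cvec b')"
    using s s0 by (auto simp: b'_def cvec_scaleR vector_smult_assoc)
  define D where "D = zonal_bound CARD('n) r / cmod (of_nat CARD('n) * ?V)"
  define A where "A m = D * (real CARD('n) * (s / r) ^ m + 2 * (real m * (s / r) ^ m))" for m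
  have sr: "norm (s / r) < 1" using s0 r0 r by simp
  have "summable (\<lambda>m. real m * (s / r) ^ m)"
  proof -
    have "summable (\<lambda>m. (s / r) * (of_nat (Suc m) * (s / r) ^ m))"
      by (intro summable_mult sums_summable[OF geometric_deriv_sums[OF sr]])
    then have "summable (\<lambda>m. real (Suc m) * (s / r) ^ Suc m)" by (simp only: power_Suc mult_ac)
    then show ?thesis by (rule summable_Suc_iff[THEN iffD1])
  qed
  then have "summable A" unfolding A_def by (intro summable_mult summable_add summable_geometric sr)
  moreover have "cmod (kernel_term p (\<beta> *s cvec b) m (rot p k x)) \<le> A m" if x: "norm x \<le> 1" for m k x
  proof -
    have "norm x * norm b' \<le> 1 * 1" using x b' by (intro mult_mono) auto
    then have "cmod (zonal_poly p m (rot p k x) (\<beta> *s cvec b')) \<le> zonal_bound CARD('n) r / r ^ m"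
      unfolding rot_def using \<beta> r0 r(2) by (intro zonal_poly_bound_real) auto
    then have "s ^ m * cmod (zonal_poly p m (rot p k x) (\<beta> *s cvec b')) \<le> s ^ m * (zonal_bound CARD('n) r / r ^ m)"
      using s0 by (intro mult_left_mono) auto
    then have z: "cmod (zonal_poly p m (rot p k x) (\<beta> *s cvec b)) \<le> zonal_bound CARD('n) r * (s / r) ^ m"
      unfolding b'(2) zonal_poly_scale_right using s0 by (simp add: norm_mult norm_power power_divide mult_ac)
    have c: "cmod (of_nat CARD('n) + 2 * of_nat m) = real CARD('n) + 2 * real m"
    proof -
      have "of_nat CARD('n) + 2 * of_nat m = complex_of_real (real CARD('n) + 2 * real m)" by simp
      then show ?thesis by (simp only: norm_of_real)
    qed
    have "cmod (kernel_term p (\<beta> *s cvec b) m (rot p k x)) =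
       (real CARD('n) + 2 * real m) / cmod (of_nat CARD('n) * ?V) * cmod (zonal_poly p m (rot p k x) (\<beta> *s cvec b))"
      unfolding kernel_term_def norm_mult[of "_ / _"] norm_divide c ..
    also have "\<dots> \<le> (real CARD('n) + 2 * real m) / cmod (of_nat CARD('n) * ?V) * (zonal_bound CARD('n) r * (s / r) ^ m)"
      by (intro mult_left_mono z) auto
    also have "\<dots> = A m" by (simp add: A_def D_def algebra_simps add_divide_distrib)
    finally show ?thesis .
  qed
  ultimately show ?thesis using that by blast
qed

text \<open>Sum the identities \<open>rotations_integral\<close> over all degrees; \<open>kernel_term_majorant\<close> justifies
  exchanging the sum with the integral against an integrable function. What remains is the expansion of
  \<open>f\<close> at \<open>y\<close>.\<close>

lemma bergman_reproducing:
  fixes y :: "complex ^ 'n"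
  assumes p: "p > 0" and y: "y \<in> Bhat p" and f: "f \<in> bergman_space p"
  shows "f y = bergman_inner p f (kernel_at p y)"
proof -
  obtain u q where u: "u \<in> polyharmonic_ball p" and qh: "\<And>m. q m \<in> hom_polys m"
    and qs: "\<And>x. x \<in> ball 0 1 \<Longrightarrow> (\<lambda>m. q m (cvec x)) sums u x"
    and fs: "\<And>\<psi> x. x \<in> ball 0 1 \<Longrightarrow> cis \<psi> *s cvec x \<in> Bhat p \<Longrightarrow> (\<lambda>m. cis (real m * \<psi>) * q m (cvec x)) sums f (cis \<psi> *s cvec x)"
    using f unfolding bergman_space_def polyharmonic_Bhat_def by blast
  have fint: "set_integrable lborel (ball 0 1) (\<lambda>x. (cmod (f (rot p k x)))\<^sup>2)" if "k < p" for k
    using f that unfolding bergman_space_def by blast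
  have an: "real_analytic_on u (ball 0 1)" using u by (simp add: polyharmonic_ball_def)
  have qp: "q m \<in> polyharmonic_polys p m" for m
  proof -
    obtain r c where r: "r > 0" and m: "power_series_at c 0 r u"
      using an[unfolded real_analytic_on_power_series_at, rule_format, of 0] by auto
    then have m': "power_series_at c 0 (min r 1) u" by (auto simp: power_series_at_def)
    have r': "min r 1 > 0" using r by simp
    have "\<forall>x\<in>ball 0 (min r 1). (real_laplacian ^^ p) u x = 0" using u by (auto simp: polyharmonic_ball_def)
    then show ?thesis using polyharmonic_expansion_iff[OF m' r' qh qs, of p] by blast
  qed
  interpret polyharmonic_expansion u q p by unfold_locales (use an qp qs in auto)
  define \<omega> where "\<omega> k = cis (real k * pi / real p)" for k
  have fF_sums: "(\<lambda>m. q m (cvec x) * \<omega> k ^ m) sums f (rot p k x)" if "k < p" "x \<in> ball 0 1" for k x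
    using fs[OF that(2), of "real k * pi / real p"] Bhat_rot[OF that(1), of x] that(2)
    by (simp add: rot_def \<omega>_def Complex.DeMoivre mult.commute)
  have fF: "f (rot p k x) = F (\<omega> k) x" if "k < p" "x \<in> ball 0 1" for k x
    using fF_sums[OF that] unfolding F_def by (rule sums_unique)
  \<comment> \<open>The ball has finite volume, and \<open>|F| \<le> 1 + |F|\<^sup>2\<close>.\<close>
  have Fint: "set_integrable lborel (ball 0 1) (F (\<omega> k))" if k: "k < p" for k
  proof (rule set_integrable_bound)
    have "set_integrable lborel (ball 0 1) (\<lambda>x::real^'n. 1 :: real)"
      unfolding set_integrable_def using emeasure_bounded_finite[of "ball 0 1 :: (real^'n) set"] by (auto intro!: integrable_real_indicator)
    then show "set_integrable lborel (ball 0 1) (\<lambda>x. 1 + (cmod (f (rot p k x)))\<^sup>2)"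
      by (intro set_integral_add fint k)
    show "set_borel_measurable lborel (ball 0 1) (F (\<omega> k))"
      unfolding set_borel_measurable_def using F_measurable[of "\<omega> k"]
      by (auto intro!: borel_measurable_scaleR borel_measurable_indicator)
    show "AE x in lborel. x \<in> ball 0 1 \<longrightarrow> cmod (F (\<omega> k) x) \<le> norm (1 + (cmod (f (rot p k x)))\<^sup>2)"
    proof (rule AE_I2, rule impI)
      fix x :: "real ^ 'n" assume x: "x \<in> ball 0 1"
      have "0 \<le> (cmod (F (\<omega> k) x) - 1)\<^sup>2 + (cmod (F (\<omega> k) x))\<^sup>2 + 1" by simp
      then have "2 * cmod (F (\<omega> k) x) \<le> 2 * (1 + (cmod (F (\<omega> k) x))\<^sup>2)" by (simp add: power2_diff)
      then show "cmod (F (\<omega> k) x) \<le> norm (1 + (cmod (f (rot p k x)))\<^sup>2)" unfolding fF[OF k x] by simp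
    qed
  qed
  obtain l b where l: "l < p" and b: "norm b < 1" and yb: "y = rot p l b" using y by (rule BhatE)
  define \<beta> where "\<beta> = cis (- (real l * pi / real p))"
  have \<beta>: "cmod \<beta> = 1" and w: "vcnj y = \<beta> *s cvec b" by (simp_all add: \<beta>_def yb vcnj_rot)
  define w where "w = vcnj y"
  obtain A where A: "summable A" "\<And>m k x. norm x \<le> 1 \<Longrightarrow> cmod (kernel_term p w m (rot p k x)) \<le> A m"
    using kernel_term_majorant[OF \<beta> b, of p] unfolding w_def w by blast
  have hom: "kernel_term p w m \<in> hom_polys m" for m
    using kernel_term_polyharmonic[of p w m] by (simp add: polyharmonic_polys_def)
  let ?V = "of_nat CARD('n) * complex_of_real (unit_ball_vol (real CARD('n)))"
  have coeff: "(\<Sum>k<p. ball_int (\<lambda>x. F (\<omega> k) x * cnj (kernel_term p w m (rot p k x)))) = of_nat p * q m y" for m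
  proof -
    define d :: complex where "d = (of_nat CARD('n) + 2 * of_nat m) / ?V"
    have n: "of_nat CARD('n) + 2 * of_nat m \<noteq> (0 :: complex)"
    proof -
      have "of_nat (CARD('n) + 2 * m) \<noteq> (0 :: complex)" unfolding of_nat_eq_0_iff by simp
      then show ?thesis by simp
    qed
    have d: "cnj d = d" "d * ball_factor (2 * m) = 1"
      using n unit_ball_vol_neq_0[of "CARD('n)"] by (auto simp: d_def ball_factor_def)
    have "ball_int (\<lambda>x. F (\<omega> k) x * cnj (kernel_term p w m (rot p k x))) = d * ball_int (\<lambda>x. F (\<omega> k) x * cnj (zonal_poly p m (rot p k x) w))" for k
    proof -
      have "F (\<omega> k) x * cnj (kernel_term p w m (rot p k x)) = d * (F (\<omega> k) x * cnj (zonal_poly p m (rot p k x) w))" for x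
        unfolding kernel_term_def d_def[symmetric] complex_cnj_mult d(1) by (simp only: mult_ac)
      then show ?thesis by (simp only: set_integral_mult_right)
    qed
    then have "(\<Sum>k<p. ball_int (\<lambda>x. F (\<omega> k) x * cnj (kernel_term p w m (rot p k x)))) =
        d * (of_nat p * (ball_factor (2 * m) * q m (vcnj w)))"
      unfolding sum_distrib_left[symmetric] using rotations_integral[OF p Fint[unfolded \<omega>_def], of m w, folded \<omega>_def]
      by (simp add: sum_distrib_left[symmetric])
    also have "\<dots> = (d * ball_factor (2 * m)) * (of_nat p * q m y)" by (simp add: w_def mult_ac)
    finally show ?thesis unfolding d(2) by simp
  qed
  have series: "(\<lambda>m. ball_int (\<lambda>x. F (\<omega> k) x * cnj (kernel_term p w m (rot p k x)))) sums ball_int (\<lambda>x. f (rot p k x) * cnj (kernel_at p y (rot p k x)))"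
    if k: "k < p" for k
  proof -
    define g where "g m x = indicat_real (ball 0 1) x *\<^sub>R (F (\<omega> k) x * cnj (kernel_term p w m (rot p k x)))" for m x
    define G where "G x = indicat_real (ball 0 1) x * cmod (F (\<omega> k) x)" for x
    have Gi: "integrable lborel G"
    proof -
      have "integrable lborel (\<lambda>x. norm (indicat_real (ball 0 1) x *\<^sub>R F (\<omega> k) x))"
        using Fint[OF k] unfolding set_integrable_def by (rule integrable_norm)
      then show ?thesis by (simp add: G_def[abs_def])
    qed
    have gi: "integrable lborel (g m)" for m
      unfolding g_def[abs_def] set_integrable_def[symmetric]
    proof (rule set_integrable_mult_bounded[OF Fint[OF k] F_measurable, where B="A m"])
      show "(\<lambda>x. cnj (kernel_term p w m (rot p k x))) \<in> borel_measurable borel"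
        by (intro borel_measurable_continuous_onI continuous_on_cnj continuous_hom_polys'[OF hom] continuous_rot)
    qed (use A(2) in auto)
    have gb: "cmod (g m x) \<le> G x * A m" for m x
      using A(2)[of x m k] by (auto simp: g_def G_def norm_mult indicator_def intro!: mult_left_mono)
    have "(\<lambda>m. integral\<^sup>L lborel (g m)) sums integral\<^sup>L lborel (\<lambda>x. \<Sum>m. g m x)"
    proof (rule sums_integral[OF gi])
      show "AE x in lborel. summable (\<lambda>m. cmod (g m x))"
      proof (rule AE_I2)
        fix x
        show "summable (\<lambda>m. cmod (g m x))"
          by (rule summable_comparison_test'[OF summable_mult[OF A(1), of "G x"], of 0]) (use gb in simp)
      qed
      show "summable (\<lambda>m. \<integral>x. cmod (g m x) \<partial>lborel)"
      proof (rule summable_comparison_test'[OF summable_mult[OF A(1), of "integral\<^sup>L lborel G"], of 0])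
        fix m
        have "(\<integral>x. cmod (g m x) \<partial>lborel) \<le> (\<integral>x. G x * A m \<partial>lborel)"
          by (rule Bochner_Integration.integral_mono[OF integrable_norm[OF gi] integrable_mult_left[OF Gi] gb])
        then show "norm (\<integral>x. cmod (g m x) \<partial>lborel) \<le> integral\<^sup>L lborel G * A m" by simp
      qed
    qed
    moreover have "(\<Sum>m. g m x) = indicat_real (ball 0 1) x *\<^sub>R (f (rot p k x) * cnj (kernel_at p y (rot p k x)))" for x
    proof (cases "x \<in> ball 0 1")
      case True
      have "norm x * norm b \<le> 1 * norm b" using True by (intro mult_right_mono) auto
      then have "norm x * norm b < 1" using b by simp
      then have "(\<lambda>m. kernel_term p w m (rot p k x)) sums kernel_fun p w (rot p k x)"
        unfolding w_def w rot_def by (intro kernel_term_sums \<beta> p) auto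
      then have "(\<lambda>m. cnj (kernel_term p w m (rot p k x))) sums cnj (kernel_fun p w (rot p k x))" by (simp add: sums_cnj)
      then have "(\<lambda>m. F (\<omega> k) x * cnj (kernel_term p w m (rot p k x))) sums (F (\<omega> k) x * cnj (kernel_fun p w (rot p k x)))" by (rule sums_mult)
      moreover have "rot p k x \<in> Bhat p" using k True by (intro Bhat_rot) auto
      ultimately show ?thesis using True fF[OF k True] by (simp add: g_def sums_iff kernel_at_def w_def)
    qed (simp add: g_def)
    ultimately show ?thesis by (simp add: g_def[abs_def] set_lebesgue_integral_def)
  qed
  have "(\<lambda>m. \<Sum>k<p. ball_int (\<lambda>x. F (\<omega> k) x * cnj (kernel_term p w m (rot p k x)))) sums
      (\<Sum>k<p. ball_int (\<lambda>x. f (rot p k x) * cnj (kernel_at p y (rot p k x))))"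
    by (rule sums_sum) (use series in auto)
  then have "(\<lambda>m. of_nat p * q m y) sums (\<Sum>k<p. ball_int (\<lambda>x. f (rot p k x) * cnj (kernel_at p y (rot p k x))))"
    unfolding coeff .
  moreover have "(\<lambda>m. of_nat p * q m y) sums (of_nat p * f y)"
    using sums_mult[OF fF_sums[OF l, of b], of "of_nat p"] b by (simp add: yb rot_def \<omega>_def hom_polys_scale[OF qh] mult_ac)
  ultimately have "(\<Sum>k<p. ball_int (\<lambda>x. f (rot p k x) * cnj (kernel_at p y (rot p k x)))) = of_nat p * f y" by (rule sums_unique2)
  then show ?thesis unfolding bergman_inner_def using p by simp
qed

lemma bergman_inner_commute: "bergman_inner p f g = cnj (bergman_inner p g f)"
proof -
  have "ball_int (\<lambda>x. f (rot p k x) * cnj (g (rot p k x))) = cnj (ball_int (\<lambda>x. g (rot p k x) * cnj (f (rot p k x))))" for k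
    unfolding set_lebesgue_integral_def Bochner_Integration.integral_cnj[symmetric]
    by (intro Bochner_Integration.integral_cong refl) (simp add: mult.commute)
  then show ?thesis by (simp add: bergman_inner_def)
qed

text \<open>Two elements of the space that both represent evaluation at \<open>y\<close> agree at \<open>z\<close>: pair each with the
  kernel at \<open>z\<close> and use Hermitian symmetry.\<close>

lemma bergman_kernel_eq:
  fixes x y :: "complex ^ 'n"
  assumes p: "p > 0" and x: "x \<in> Bhat p" and y: "y \<in> Bhat p"
  shows "bergman_kernel p x y = kernel_fun p (vcnj y) x"
proof -
  have K: "kernel_at p z \<in> bergman_space p" if "z \<in> Bhat p" for z :: "complex ^ 'n"
    using kernel_at_in_bergman_space[OF p that] .
  note rep = bergman_reproducing[OF p]
  have "(THE f. f \<in> bergman_space p \<and> (\<forall>u\<in>bergman_space p. u y = bergman_inner p u f)) = kernel_at p y"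
  proof (rule the_equality)
    show "kernel_at p y \<in> bergman_space p \<and> (\<forall>u\<in>bergman_space p. u y = bergman_inner p u (kernel_at p y))"
      using K[OF y] rep[OF y] by blast
  next
    fix f :: "complex ^ 'n \<Rightarrow> complex" assume f: "f \<in> bergman_space p \<and> (\<forall>u\<in>bergman_space p. u y = bergman_inner p u f)"
    show "f = kernel_at p y"
    proof (rule extensionalityI)
      show "f \<in> extensional (Bhat p)" "kernel_at p y \<in> extensional (Bhat p)"
        using f by (auto simp: bergman_space_def polyharmonic_Bhat_def kernel_at_def)
      fix z :: "complex ^ 'n" assume z: "z \<in> Bhat p"
      have "f z = bergman_inner p f (kernel_at p z)" using f z by (intro rep) auto
      also have "\<dots> = cnj (bergman_inner p (kernel_at p z) f)" by (rule bergman_inner_commute)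
      also have "\<dots> = cnj (kernel_at p z y)" using f K[OF z] by simp
      also have "kernel_at p z y = bergman_inner p (kernel_at p z) (kernel_at p y)" by (rule rep[OF y K[OF z]])
      also have "cnj \<dots> = bergman_inner p (kernel_at p y) (kernel_at p z)" by (rule bergman_inner_commute[symmetric])
      also have "\<dots> = kernel_at p y z" by (rule rep[OF z K[OF y], symmetric])
      finally show "f z = kernel_at p y z" .
    qed
  qed
  then show ?thesis using x by (simp add: bergman_kernel_def kernel_at_def)
qed

section \<open>The two formulas for the kernel\<close>

lemma poisson_dilation:
  fixes a b :: "real ^ 'n"
  assumes p: "p > 0" and k: "k < p" "l < p" and t: "norm (t *\<^sub>R a) < 1" "norm (t *\<^sub>R b) < 1"
  shows "poisson p (t *\<^sub>R rot p k a) (t *\<^sub>R rot p l b) = (\<Sum>m. zonal_poly p m (rot p k a) (vcnj (rot p l b)) * of_real (t\<^sup>2) ^ m)"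
proof -
  have r: "t *\<^sub>R rot p i c = rot p i (t *\<^sub>R c)" for i and c :: "real ^ 'n"
    by (simp add: rot_def scaleR_eq_smult cvec_scaleR vector_smult_assoc mult.commute)
  have "zonal p m (t *\<^sub>R rot p k a) (t *\<^sub>R rot p l b) = zonal_poly p m (rot p k a) (vcnj (rot p l b)) * of_real (t\<^sup>2) ^ m" for m
  proof -
    have "zonal p m (t *\<^sub>R rot p k a) (t *\<^sub>R rot p l b) = zonal_poly p m (t *\<^sub>R rot p k a) (vcnj (t *\<^sub>R rot p l b))"
      unfolding r by (intro zonal_eq p Bhat_rot k t)
    also have "\<dots> = of_real t ^ m * (of_real t ^ m * zonal_poly p m (rot p k a) (vcnj (rot p l b)))"
      unfolding scaleR_eq_smult vcnj_smult zonal_poly_scale zonal_poly_scale_right by simp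
    finally show ?thesis by (simp add: power_mult_distrib power2_eq_square mult_ac)
  qed
  then show ?thesis unfolding poisson_def by simp
qed

lemma cnorm_power: "cnorm z ^ (2 * k) = bdot z z ^ k"
  by (simp add: cnorm_def power_mult)

theorem theorem2:
  fixes p :: nat and x y :: "complex ^ 'n"
  assumes "p > 0" and "x \<in> Bhat p" and "y \<in> Bhat p"
  shows "bergman_kernel p x y =
           1 / (of_nat CARD('n) * of_real (unit_ball_vol (real CARD('n)))) *
           (of_nat CARD('n) * poisson p x y +
            vector_derivative (\<lambda>t::real. poisson p (t *\<^sub>R x) (t *\<^sub>R y)) (at 1)) \<and>
         bergman_kernel p x y =
           ((of_nat CARD('n) - 4 * of_nat p) * cnorm x ^ (2 * p + 2) * cnorm (vcnj y) ^ (2 * p + 2) +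
            (8 * of_nat p * bdot x (vcnj y) - of_nat CARD('n) - 4 * of_nat p) *
              cnorm x ^ (2 * p) * cnorm (vcnj y) ^ (2 * p) +
            of_nat CARD('n) * (1 - cnorm x ^ 2 * cnorm (vcnj y) ^ 2)) /
           (of_nat CARD('n) * of_real (unit_ball_vol (real CARD('n))) *
            (1 - 2 * bdot x (vcnj y) + cnorm x ^ 2 * cnorm (vcnj y) ^ 2)
              powr (of_nat CARD('n) / 2 + 1))"
proof
  let ?w = "vcnj y" and ?V = "of_nat CARD('n) * complex_of_real (unit_ball_vol (real CARD('n)))"
  have kernel: "bergman_kernel p x y = kern_closed p x ?w / ?V"
    using bergman_kernel_eq[OF assms] by (simp add: kernel_fun_def)
  obtain k a where k: "k < p" and a: "norm a < 1" and x: "x = rot p k a" using assms(2) by (rule BhatE)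
  obtain l b where l: "l < p" and b: "norm b < 1" and y: "y = rot p l b" using assms(3) by (rule BhatE)
  have "norm a * norm b \<le> 1 * norm b" using a by (intro mult_right_mono) auto
  then have ab: "norm a * norm b < 1" using b by simp
  obtain R where R: "R > 1" "zonal_gf p x ?w holomorphic_on ball 0 R"
    and s: "\<And>\<tau>. cmod \<tau> < R \<Longrightarrow> (\<lambda>m. zonal_poly p m x ?w * \<tau> ^ m) sums zonal_gf p x ?w \<tau>"
    and d: "of_nat CARD('n) * zonal_gf p x ?w 1 + 2 * deriv (zonal_gf p x ?w) 1 = kern_closed p x ?w"
    by (rule zonal_series[OF norm_cis norm_cis ab assms(1), of "real k * pi / real p" "- (real l * pi / real p)",
          folded rot_def vcnj_rot x y]) (rule that, assumption+)
  define S where "S = {t::real. norm (t *\<^sub>R a) < 1 \<and> norm (t *\<^sub>R b) < 1 \<and> t\<^sup>2 < R}"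
  have S: "open S" unfolding S_def by (intro open_Collect_conj open_Collect_less continuous_intros)
  have P: "poisson p (t *\<^sub>R x) (t *\<^sub>R y) = zonal_gf p x ?w (of_real t ^ 2)" if "t \<in> S" for t
  proof -
    have "(\<lambda>m. zonal_poly p m x ?w * of_real (t\<^sup>2) ^ m) sums zonal_gf p x ?w (of_real (t\<^sup>2))"
      using that by (intro s) (simp add: S_def norm_power)
    then show ?thesis
      unfolding x y poisson_dilation[OF assms(1) k l, of t a b, OF that[unfolded S_def, THEN CollectD, THEN conjunct1] that[unfolded S_def, THEN CollectD, THEN conjunct2, THEN conjunct1]]
      by (simp add: sums_iff)
  qed
  have S1: "1 \<in> S" using a b R by (simp add: S_def)
  have "((\<lambda>z. zonal_gf p x ?w (z ^ 2)) has_field_derivative deriv (zonal_gf p x ?w) 1 * 2) (at (of_real 1))"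
  proof (rule DERIV_chain2[where f="zonal_gf p x ?w" and g="\<lambda>z. z ^ 2"])
    show "(zonal_gf p x ?w has_field_derivative deriv (zonal_gf p x ?w) 1) (at (of_real 1 ^ 2))"
      using holomorphic_derivI[OF R(2) open_ball, of 1] R(1) by simp
    show "((\<lambda>z::complex. z ^ 2) has_field_derivative 2) (at (of_real 1))" by (auto intro!: derivative_eq_intros)
  qed
  then have "((\<lambda>t::real. zonal_gf p x ?w (of_real t ^ 2)) has_vector_derivative deriv (zonal_gf p x ?w) 1 * 2) (at 1)"
    using has_vector_derivative_real_field by blast
  then have "((\<lambda>t. poisson p (t *\<^sub>R x) (t *\<^sub>R y)) has_vector_derivative deriv (zonal_gf p x ?w) 1 * 2) (at 1)"
    by (rule has_vector_derivative_transform_within_open[OF _ S S1]) (simp add: P)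
  then have "vector_derivative (\<lambda>t. poisson p (t *\<^sub>R x) (t *\<^sub>R y)) (at 1) = deriv (zonal_gf p x ?w) 1 * 2"
    by (rule vector_derivative_at)
  moreover have "poisson p x y = zonal_gf p x ?w 1" using P[OF S1] by simp
  ultimately show "bergman_kernel p x y = 1 / ?V *
      (of_nat CARD('n) * poisson p x y + vector_derivative (\<lambda>t::real. poisson p (t *\<^sub>R x) (t *\<^sub>R y)) (at 1))"
    unfolding kernel d[symmetric] by (simp add: mult.commute)
  have c2: "cnorm z ^ 2 = bdot z z" for z :: "complex ^ 'n" using cnorm_power[of z 1] by simp
  have cp: "cnorm z ^ (2 * p + 2) = bdot z z ^ (p + 1)" for z :: "complex ^ 'n" using cnorm_power[of z "p + 1"] by simp
  have "of_nat CARD('n) * (1 - (bdot x x * bdot ?w ?w) ^ p) * (1 - bdot x x * bdot ?w ?w) -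
      4 * of_nat p * (bdot x x * bdot ?w ?w) ^ p * (1 - 2 * bdot x ?w + bdot x x * bdot ?w ?w) =
    (of_nat CARD('n) - 4 * of_nat p) * bdot x x ^ (p + 1) * bdot ?w ?w ^ (p + 1) +
    (8 * of_nat p * bdot x ?w - of_nat CARD('n) - 4 * of_nat p) * bdot x x ^ p * bdot ?w ?w ^ p +
    of_nat CARD('n) * (1 - bdot x x * bdot ?w ?w)"
    by (simp add: power_mult_distrib algebra_simps)
  then show "bergman_kernel p x y =
           ((of_nat CARD('n) - 4 * of_nat p) * cnorm x ^ (2 * p + 2) * cnorm (vcnj y) ^ (2 * p + 2) +
            (8 * of_nat p * bdot x (vcnj y) - of_nat CARD('n) - 4 * of_nat p) *
              cnorm x ^ (2 * p) * cnorm (vcnj y) ^ (2 * p) +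
            of_nat CARD('n) * (1 - cnorm x ^ 2 * cnorm (vcnj y) ^ 2)) /
           (?V * (1 - 2 * bdot x (vcnj y) + cnorm x ^ 2 * cnorm (vcnj y) ^ 2) powr (of_nat CARD('n) / 2 + 1))"
    unfolding kernel kern_closed_def cp c2 cnorm_power by (simp add: mult_ac)
qed

end
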